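(* Let $X_1,X_2,\dots$ be i.i.d. $N(\mu,\sigma^2)$ with $\mu\in\mathbb{R}$, $\sigma>0$ unknown. For $n\ge2$ let $\bar X_n=n^{-1}\sum_{i=1}^n X_i$ and $S_n^2=(n-1)^{-1}\sum_{i=1}^n(X_i-\bar X_n)^2$. Let $A>0$ be a known weight and $c>0$ a known unit sampling cost, and set $n^*=\sigma\sqrt{A/c}$. Fix an integer $k\ge1$ and $0<\rho<1$. Let the pilot size be $m=m_0k+1$ for an integer $m_0\ge1$, and define $$T=\inf\{n\ge 0:\ m+kn\ge \rho S_{m+kn}\sqrt{A/c}\},\qquad N=\lfloor \rho^{-1}(m+kT)\rfloor+1,$$ where $\lfloor u\rfloor$ denotes the largest integer strictly smaller than $u$. Define the risk $R_N=A\,E_{\mu,\sigma}[(\bar X_N-\mu)^2]+c\,E_{\mu,\sigma}[N]$, the minimum fixed-sample risk $R_{n^*}=2cn^*$, the risk efficiency $\xi(c)=R_N/R_{n^*}$ and the regret $\omega(c)=R_N-R_{n^*}$. Let $$\eta_1(k)=\frac{k-1}{2}-\frac12\sum_{n=1}^\infty n^{-1}E\big[\{\chi^2_{kn}-3kn\}^+\big],$$ where $\chi^2_{d}$ denotes a chi-square random variable with $d$ degrees of freedom and $\{u\}^+=\max\{0,u\}$. Consider the limit operations $m_0\to\infty$, $m=m_0k+1\to\infty$, $c=O(m^{-2r})$, $n^*=O(m^r)$ and $\limsup m/n^*<\rho$, where $r>1$ is a fixed constant. Then for all fixed $\mu,\sigma,A,k$ and $0<\rho<1$, under these limit operations: (i)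 $E_{\mu,\sigma}[N/n^*]\to1$; (ii) $\rho^{-1}\eta_1(k)+o(1)\le E_{\mu,\sigma}[N-n^*]\le \rho^{-1}\eta_1(k)+1+o(1)$; (iii) $\xi(c)\to 1$; (iv) $\omega(c)=\frac12\rho^{-1}c+o(c)$.
   Context: Sampling proceeds by taking $m$ pilot observations, then $k$ observations at a time until time $T$, then $N-m-kT$ further observations in one batch; $\mu$ is estimated by $\bar X_N$. $E_{\mu,\sigma}$ denotes expectation under $N(\mu,\sigma^2)$. *)

theory Defs
  imports "HOL-Probability.Probability" "HOL-Library.Landau_Symbols"
begin

text \<open>Sample space of an i.i.d. N(mu, sigma^2) sequence: the coordinates x 1, x 2, ...
  of x in the infinite product of normal distributions (coordinate 0 is unused).\<close>
definition normal_seq_space :: "real \<Rightarrow> real \<Rightarrow> (nat \<Rightarrow> real) measure" where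
  "normal_seq_space \<mu> \<sigma> = (\<Pi>\<^sub>M i\<in>(UNIV::nat set). density lborel (normal_density \<mu> \<sigma>))"

definition sample_mean :: "nat \<Rightarrow> (nat \<Rightarrow> real) \<Rightarrow> real" where
  "sample_mean n x = (\<Sum>i=1..n. x i) / real n"

definition sample_sd :: "nat \<Rightarrow> (nat \<Rightarrow> real) \<Rightarrow> real" where
  "sample_sd n x = sqrt ((\<Sum>i=1..n. (x i - sample_mean n x)^2) / (real n - 1))"

definition strict_floor :: "real \<Rightarrow> int" where
  "strict_floor u = \<lceil>u\<rceil> - 1"

definition n_star :: "real \<Rightarrow> real \<Rightarrow> real \<Rightarrow> real" where
  "n_star \<sigma> A c = \<sigma> * sqrt (A / c)"

definition stop_T :: "nat \<Rightarrow> nat \<Rightarrow> real \<Rightarrow> real \<Rightarrow> real \<Rightarrow> (nat \<Rightarrow> real) \<Rightarrow> nat" where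
  "stop_T m k \<rho> A c x =
     (LEAST n. real (m + k * n) \<ge> \<rho> * sample_sd (m + k * n) x * sqrt (A / c))"

definition final_N :: "nat \<Rightarrow> nat \<Rightarrow> real \<Rightarrow> real \<Rightarrow> real \<Rightarrow> (nat \<Rightarrow> real) \<Rightarrow> nat" where
  "final_N m k \<rho> A c x = nat (strict_floor (real (m + k * stop_T m k \<rho> A c x) / \<rho>) + 1)"

definition risk_N :: "real \<Rightarrow> real \<Rightarrow> nat \<Rightarrow> nat \<Rightarrow> real \<Rightarrow> real \<Rightarrow> real \<Rightarrow> real" where
  "risk_N \<mu> \<sigma> m k \<rho> A c =
     A * (\<integral>x. (sample_mean (final_N m k \<rho> A c x) x - \<mu>)^2 \<partial>normal_seq_space \<mu> \<sigma>)
     + c * (\<integral>x. real (final_N m k \<rho> A c x) \<partial>normal_seq_space \<mu> \<sigma>)"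

definition risk_opt :: "real \<Rightarrow> real \<Rightarrow> real \<Rightarrow> real" where
  "risk_opt \<sigma> A c = 2 * c * n_star \<sigma> A c"

definition risk_eff :: "real \<Rightarrow> real \<Rightarrow> nat \<Rightarrow> nat \<Rightarrow> real \<Rightarrow> real \<Rightarrow> real \<Rightarrow> real" where
  "risk_eff \<mu> \<sigma> m k \<rho> A c = risk_N \<mu> \<sigma> m k \<rho> A c / risk_opt \<sigma> A c"

definition regret :: "real \<Rightarrow> real \<Rightarrow> nat \<Rightarrow> nat \<Rightarrow> real \<Rightarrow> real \<Rightarrow> real \<Rightarrow> real" where
  "regret \<mu> \<sigma> m k \<rho> A c = risk_N \<mu> \<sigma> m k \<rho> A c - risk_opt \<sigma> A c"

text \<open>E[{chi^2_d - 3d}^+], with chi^2_d realised as the sum of squares of d i.i.d.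
  standard normal variables.\<close>
definition chi_sq_excess :: "nat \<Rightarrow> real" where
  "chi_sq_excess d =
     (\<integral>x. max 0 ((\<Sum>i<d. (x i)^2) - 3 * real d) \<partial>normal_seq_space 0 1)"

definition eta1 :: "nat \<Rightarrow> real" where
  "eta1 k = (real k - 1) / 2
     - 1/2 * (\<Sum>n. chi_sq_excess (k * Suc n) / real (Suc n))"

end

theory Submission imports Defs
begin

text \<open>Helmert's orthogonal transformation turns the centred observations into independent standard normals
  \<open>Z 0, Z 1, \<dots>\<close>: \<open>(n - 1) S_n^2 / \<sigma>^2\<close> becomes the sum of the first \<open>n - 1\<close> squares and the error of the
  sample mean at \<open>N\<close> becomes a later coordinate, independent of \<open>N\<close>. Hence the regret is
  \<open>c E[(N - n^*)^2 / N]\<close>, and with \<open>h = \<rho> n^*\<close> the rule stops as soon as the sum of \<open>k n\<close> squares falls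
  below \<open>g n = k n (k n + 1)^2 / h^2\<close>. Let \<open>M\<close> be the sample size at which this happens.

  Wald's second identity gives \<open>E (M - h)^2 / h \<longlonglongrightarrow> 1 / 2\<close>, hence (iv), and Wald's first identity reduces
  \<open>E (M - h)\<close> to the mean overshoot. For the latter, only the last \<open>L\<close> steps before stopping matter:
  summing over the stopping time, the mean overshoot is the sum of the densities of the partial sums on
  the boundary times half a second moment for the walk with increments \<open>\<chi>^2_k - 3 k\<close>. The sum
  of densities is found by telescoping \<open>P(S_n > g n)\<close>; the second moment is computed by time reversal,
  Lindley's recursion and Spitzer's identity.\<close>

section \<open>Sequences of independent standard normal variables\<close>

text \<open>Where the constants come from: near \<open>h\<close> the boundary rises by 3 per
  coordinate, while the sum of squares has mean slope 1 and variance 2. The net slope 2 turns its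
  fluctuations into M - h, so E (M - h)^2 is about 2 h / 2^2. In the mean, the curvature of the
  boundary adds 3 E (M - h)^2 / h, which tends to 3 / 2, so that E (M - h) tends to (e - 3 / 2) / 2,
  with e the limit of the mean overshoot. The densities sum to 1 / (2 k), and half the moment 4 k^2
  + 2 k - 4 k S yields e = k + 1 / 2 - S, where S is the series in \<open>eta1\<close>.

  Two obstacles shape the proof. M may be far from \<open>h\<close>, where only crude powers of M +
  h bound anything; since \<open>h\<close> is at most a power of the pilot size, such deviations are
  exponentially improbable in that size and contribute o(1) to every moment. And the overshoot
  depends on the whole past; forgetting all but the last L steps costs a factor geometric in L, so L
  and the width K of a window of order K sqrt h around \<open>h\<close> stay fixed while
  \<open>h\<close> grows, and are sent to infinity afterwards.\<close>

abbreviation std_normal :: "real measure" where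
  "std_normal \<equiv> density lborel (normal_density 0 1)"

abbreviation std_seq :: "(nat \<Rightarrow> real) measure" where
  "std_seq \<equiv> normal_seq_space 0 1"

interpretation std_normal: prob_space std_normal
  by (rule prob_space_normal_density) simp

interpretation std: sequence_space std_normal
  by unfold_locales

lemma prob_space_normal_seq: "\<sigma> > 0 \<Longrightarrow> prob_space (normal_seq_space \<mu> \<sigma>)"
  unfolding normal_seq_space_def by (intro prob_space_PiM prob_space_normal_density)

interpretation std_seq: prob_space std_seq
  by (rule prob_space_normal_seq) simp

lemma sets_normal_seq [measurable_cong]:
  "sets (normal_seq_space \<mu> \<sigma>) = sets (PiM UNIV (\<lambda>_. borel))"
  unfolding normal_seq_space_def by (intro sets_PiM_cong) auto

lemma space_normal_seq [simp]: "space (normal_seq_space \<mu> \<sigma>) = UNIV"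
  by (simp add: normal_seq_space_def space_PiM)

lemma std_seq_eq: "std_seq = (\<Pi>\<^sub>M i\<in>(UNIV::nat set). std_normal)"
  by (simp add: normal_seq_space_def)

lemma measurable_comb_seq_std [measurable]:
  "(\<lambda>(x, y). comb_seq d x y) \<in> std_seq \<Otimes>\<^sub>M std_seq \<rightarrow>\<^sub>M std_seq"
  unfolding std_seq_eq by (rule measurable_comb_seq)

text \<open>\<open>comb_seq d x y\<close> has the first \<open>d\<close> entries of \<open>x\<close>
  followed by all of \<open>y\<close>. That this splice of two independent copies has the same law
  is how the independence of past and future enters everywhere below.\<close>

lemma distr_comb_seq_std:
  "distr (std_seq \<Otimes>\<^sub>M std_seq) std_seq (\<lambda>(x, y). comb_seq d x y) = std_seq"
  using std.PiM_comb_seq[of d] unfolding std_seq_eq .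

interpretation std_pair: pair_prob_space std_seq std_seq
  by unfold_locales

lemma nn_integral_std_split:
  assumes f: "f \<in> borel_measurable std_seq"
  shows "(\<integral>\<^sup>+x. f x \<partial>std_seq) = (\<integral>\<^sup>+x. \<integral>\<^sup>+y. f (comb_seq d x y) \<partial>std_seq \<partial>std_seq)"
proof -
  note f[measurable]
  have "(\<integral>\<^sup>+x. f x \<partial>std_seq) = (\<integral>\<^sup>+z. f (case z of (x, y) \<Rightarrow> comb_seq d x y) \<partial>(std_seq \<Otimes>\<^sub>M std_seq))"
    by (subst distr_comb_seq_std[of d, symmetric], subst nn_integral_distr) simp_all
  also have "\<dots> = (\<integral>\<^sup>+x. \<integral>\<^sup>+y. f (comb_seq d x y) \<partial>std_seq \<partial>std_seq)"
    by (subst std_seq.nn_integral_fst[symmetric]) simp_all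
  finally show ?thesis .
qed

text \<open>Fubini in the other order: the inner integral runs over the first \<open>d\<close>
  coordinates with the later ones held fixed, as needed to condition on the future of the
  walk.\<close>

lemma nn_integral_std_split':
  assumes f: "f \<in> borel_measurable std_seq"
  shows "(\<integral>\<^sup>+x. f x \<partial>std_seq) = (\<integral>\<^sup>+y. \<integral>\<^sup>+x. f (comb_seq d x y) \<partial>std_seq \<partial>std_seq)"
proof -
  note f[measurable]
  show ?thesis
    by (subst nn_integral_std_split[OF f, of d], rule std_pair.Fubini'[symmetric]) simp
qed

lemma integrable_std_split:
  fixes f :: "(nat \<Rightarrow> real) \<Rightarrow> real"
  assumes f: "integrable std_seq f"
  shows "integrable (std_seq \<Otimes>\<^sub>M std_seq) (\<lambda>(x, y). f (comb_seq d x y))"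
proof -
  have "integrable (distr (std_seq \<Otimes>\<^sub>M std_seq) std_seq (\<lambda>(x, y). comb_seq d x y)) f"
    using f by (simp add: distr_comb_seq_std)
  then show ?thesis
    by (subst (asm) integrable_distr_eq) (use f in \<open>auto simp: split_beta'\<close>)
qed

lemma integral_std_split:
  fixes f :: "(nat \<Rightarrow> real) \<Rightarrow> real"
  assumes f: "integrable std_seq f"
  shows "(\<integral>x. f x \<partial>std_seq) = (\<integral>x. \<integral>y. f (comb_seq d x y) \<partial>std_seq \<partial>std_seq)"
proof -
  have [measurable]: "f \<in> borel_measurable std_seq" using f by auto
  have "(\<integral>x. f x \<partial>std_seq) = (\<integral>z. f (case z of (x, y) \<Rightarrow> comb_seq d x y) \<partial>(std_seq \<Otimes>\<^sub>M std_seq))"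
    by (subst distr_comb_seq_std[of d, symmetric], subst integral_distr) simp_all
  also have "\<dots> = (\<integral>x. \<integral>y. f (comb_seq d x y) \<partial>std_seq \<partial>std_seq)"
    by (subst std_pair.integral_fst'[symmetric]) (use integrable_std_split[OF f, of d] in \<open>auto simp: split_beta'\<close>)
  finally show ?thesis .
qed

text \<open>Exchangeability of an i.i.d. sequence. It is applied to shifts, to cyclic rotations of
  blocks and to time reversal.\<close>

lemma distr_std_reindex:
  assumes "inj \<pi>"
  shows "distr std_seq std_seq (\<lambda>x i. x (\<pi> i)) = std_seq"
proof -
  have "distr (PiM UNIV (\<lambda>_. std_normal)) (\<Pi>\<^sub>M i\<in>UNIV. std_normal) (\<lambda>x. \<lambda>n\<in>UNIV. x (\<pi> n))
      = (\<Pi>\<^sub>M i\<in>UNIV. std_normal)"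
    by (rule distr_PiM_reindex) (use assms std_normal.prob_space_axioms in auto)
  then show ?thesis by (simp add: std_seq_eq restrict_UNIV)
qed

lemma measurable_std_reindex [measurable]: "(\<lambda>x i. x (\<pi> i)) \<in> std_seq \<rightarrow>\<^sub>M std_seq"
  unfolding std_seq_eq by (rule measurable_PiM_single') (auto simp: space_PiM)

lemma integral_std_reindex:
  fixes f :: "(nat \<Rightarrow> real) \<Rightarrow> real"
  assumes "inj \<pi>" and [measurable]: "f \<in> borel_measurable std_seq"
  shows "(\<integral>x. f (\<lambda>i. x (\<pi> i)) \<partial>std_seq) = (\<integral>x. f x \<partial>std_seq)"
  by (subst (2) distr_std_reindex[OF assms(1), symmetric], subst integral_distr) simp_all

lemma integrable_std_reindex:
  fixes f :: "(nat \<Rightarrow> real) \<Rightarrow> real"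
  assumes "inj \<pi>" and f: "integrable std_seq f"
  shows "integrable std_seq (\<lambda>x. f (\<lambda>i. x (\<pi> i)))"
proof -
  have [measurable]: "f \<in> borel_measurable std_seq" using f by auto
  have "integrable (distr std_seq std_seq (\<lambda>x i. x (\<pi> i))) f"
    using f by (simp add: distr_std_reindex[OF assms(1)])
  then show ?thesis by (subst (asm) integrable_distr_eq) auto
qed

lemma distr_std_component: "distr std_seq borel (\<lambda>x. x i) = std_normal"
proof -
  have "distr std_seq std_normal (\<lambda>x. x i) = std_normal"
    unfolding std_seq_eq by (rule std.PiM_component) simp
  moreover have "distr std_seq std_normal (\<lambda>x. x i) = distr std_seq borel (\<lambda>x. x i)"
    by (rule distr_cong) auto
  ultimately show ?thesis by simp
qed

text \<open>The assumption \<open>fd\<close> expresses that \<open>f\<close> depends on the first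
  \<open>d\<close> coordinates only, which makes it independent of the shifted
  \<open>g\<close>.\<close>

lemma indep_std_mult:
  fixes f g :: "(nat \<Rightarrow> real) \<Rightarrow> real"
  assumes f: "integrable std_seq f" and g: "integrable std_seq g"
    and fd: "\<And>x y. f (comb_seq d x y) = f x"
  shows "integrable std_seq (\<lambda>x. f x * g (\<lambda>i. x (i + d)))"
    and "(\<integral>x. f x * g (\<lambda>i. x (i + d)) \<partial>std_seq) = (\<integral>x. f x \<partial>std_seq) * (\<integral>x. g x \<partial>std_seq)"
proof -
  have [measurable]: "f \<in> borel_measurable std_seq" "g \<in> borel_measurable std_seq"
    using f g by auto
  have *: "f (comb_seq d x y) * g (\<lambda>i. comb_seq d x y (i + d)) = f x * g y" for x y
    by (simp add: fd comb_seq_add)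
  have "integrable (std_seq \<Otimes>\<^sub>M std_seq) (\<lambda>z. f (fst z) * g (snd z))"
    by (rule std_pair.Fubini_integrable)
       (use f g in \<open>auto simp: abs_mult intro!: integrable_mult_left integrable_mult_right\<close>)
  then have "integrable (std_seq \<Otimes>\<^sub>M std_seq) (\<lambda>z. (\<lambda>x. f x * g (\<lambda>i. x (i + d))) (case z of (x, y) \<Rightarrow> comb_seq d x y))"
    by (simp add: split_beta' * case_prod_beta)
  then have "integrable (distr (std_seq \<Otimes>\<^sub>M std_seq) std_seq (\<lambda>(x, y). comb_seq d x y))
      (\<lambda>x. f x * g (\<lambda>i. x (i + d)))"
    by (subst integrable_distr_eq) (simp_all add: split_beta')
  then show i: "integrable std_seq (\<lambda>x. f x * g (\<lambda>i. x (i + d)))"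
    by (simp add: distr_comb_seq_std)
  show "(\<integral>x. f x * g (\<lambda>i. x (i + d)) \<partial>std_seq) = (\<integral>x. f x \<partial>std_seq) * (\<integral>x. g x \<partial>std_seq)"
    by (subst integral_std_split[OF i, of d]) (simp add: *)
qed

section \<open>Sums of squares and their moments\<close>

definition sumsq :: "nat \<Rightarrow> (nat \<Rightarrow> real) \<Rightarrow> real" where
  "sumsq d x = (\<Sum>i<d. (x i)\<^sup>2)"

lemma measurable_sumsq [measurable]: "sumsq d \<in> borel_measurable (normal_seq_space \<mu> \<sigma>)"
  unfolding sumsq_def by measurable

lemma sumsq_nonneg [simp]: "0 \<le> sumsq d x"
  by (simp add: sumsq_def sum_nonneg)

lemma sumsq_0 [simp]: "sumsq 0 x = 0" by (simp add: sumsq_def)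

lemma sumsq_Suc: "sumsq (Suc d) x = sumsq d x + (x d)\<^sup>2" by (simp add: sumsq_def)

lemma sumsq_mono: "d \<le> e \<Longrightarrow> sumsq d x \<le> sumsq e x"
  by (auto simp: sumsq_def intro!: sum_mono2)

lemma sumsq_add: "sumsq (d + e) x = sumsq d x + sumsq e (\<lambda>i. x (i + d))"
  by (induction e) (simp_all add: sumsq_Suc add.commute)

lemma sumsq_comb_seq_le: "e \<le> d \<Longrightarrow> sumsq e (comb_seq d x y) = sumsq e x"
  by (auto simp: sumsq_def comb_seq_def)

lemma sumsq_comb_seq_add: "sumsq (d + e) (comb_seq d x y) = sumsq d x + sumsq e y"
  by (simp add: sumsq_add sumsq_comb_seq_le comb_seq_add)

lemma integrable_std_power: "integrable std_seq (\<lambda>x. x i ^ n)"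
  and integral_std_power: "(\<integral>x. x i ^ n \<partial>std_seq) = (\<integral>x. std_normal_density x * x ^ n \<partial>lborel)"
proof -
  have "integrable (distr std_seq borel (\<lambda>x. x i)) (\<lambda>x. x ^ n)"
    unfolding distr_std_component using integrable_std_normal_moment[of n]
    by (subst integrable_density) auto
  then show "integrable std_seq (\<lambda>x. x i ^ n)"
    by (subst (asm) integrable_distr_eq) auto
  have "(\<integral>x. x i ^ n \<partial>std_seq) = (\<integral>x. x ^ n \<partial>(distr std_seq borel (\<lambda>x. x i)))"
    by (subst integral_distr) auto
  also have "\<dots> = (\<integral>x. std_normal_density x * x ^ n \<partial>lborel)"
    unfolding distr_std_component by (subst integral_density) auto
  finally show "(\<integral>x. x i ^ n \<partial>std_seq) = (\<integral>x. std_normal_density x * x ^ n \<partial>lborel)" .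
qed

lemma integral_std_square: "(\<integral>x. (x i)\<^sup>2 \<partial>std_seq) = 1"
  using integral_std_normal_moment_even[of 1] by (simp add: integral_std_power)

lemma integral_std_fourth: "(\<integral>x. x i ^ 4 \<partial>std_seq) = 3"
  using integral_std_normal_moment_even[of 2] by (simp add: integral_std_power fact_numeral)

lemma integrable_sumsq [simp]: "integrable std_seq (sumsq d)"
  and integral_sumsq: "(\<integral>x. sumsq d x \<partial>std_seq) = d"
  unfolding sumsq_def[abs_def] by (simp_all add: integrable_std_power integral_std_square)

text \<open>Induction over independent increments: the cross term has mean zero, and each coordinate
  adds 3 - 2 + 1 = 2 because the fourth moment is 3.\<close>

lemma sumsq_centered:
  "integrable std_seq (\<lambda>x. (sumsq d x - d)\<^sup>2) \<and> (\<integral>x. (sumsq d x - d)\<^sup>2 \<partial>std_seq) = 2 * d"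
proof (induction d)
  case (Suc d)
  let ?f = "\<lambda>x. sumsq d x - real d" and ?g = "\<lambda>x. (x 0)\<^sup>2 - 1 :: real"
  have f: "integrable std_seq ?f" and g: "integrable std_seq ?g"
    by (auto simp: integrable_std_power)
  have fd: "?f (comb_seq d x y) = ?f x" for x y by (simp add: sumsq_comb_seq_le)
  note fg = indep_std_mult[OF f g fd]
  have gg: "integrable std_seq (\<lambda>x. ((x d)\<^sup>2 - 1)\<^sup>2)"
    by (simp add: power2_diff integrable_std_power flip: power_mult)
  have gg2: "(\<integral>x. ((x d)\<^sup>2 - 1)\<^sup>2 \<partial>std_seq) = 2"
    by (simp add: power2_diff integrable_std_power integral_std_square integral_std_fourth std_seq.prob_space[simplified] flip: power_mult)
  have eq: "(sumsq (Suc d) x - real (Suc d))\<^sup>2 = (?f x)\<^sup>2 + 2 * (?f x * ?g (\<lambda>i. x (i + d))) + ((x d)\<^sup>2 - 1)\<^sup>2" for x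
    by (simp add: sumsq_Suc power2_eq_square algebra_simps)
  have g0: "(\<integral>x. ?g x \<partial>std_seq) = 0"
    by (simp add: integrable_std_power integral_std_square std_seq.prob_space[simplified])
  show ?case unfolding eq
    using Suc fg gg gg2 g0 by (simp add: integrable_std_power)
qed simp

section \<open>Chernoff bounds for chi-square variables\<close>

text \<open>The tilted density \<open>exp (s * x\<^sup>2) * normal_density 0 1 x\<close> is a
  multiple of the normal density with variance 1 / (1 - 2 s), so only the factor has to be read
  off.\<close>

lemma nn_integral_exp_square:
  assumes "s < 1 / 2"
  shows "(\<integral>\<^sup>+x. ennreal (exp (s * x\<^sup>2)) \<partial>std_normal) = ennreal (1 / sqrt (1 - 2 * s))"
proof -
  let ?t = "1 / sqrt (1 - 2 * s)"
  have t: "0 < ?t" "?t\<^sup>2 = 1 / (1 - 2 * s)" using assms by (auto simp: power_divide)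
  have *: "exp (s * x\<^sup>2) * normal_density 0 1 x = ?t * normal_density 0 ?t x" for x
    using assms
    by (simp add: normal_density_def power_divide real_sqrt_mult real_sqrt_divide divide_simps
        flip: exp_add) (simp add: field_simps)
  have "(\<integral>\<^sup>+x. ennreal (exp (s * x\<^sup>2)) \<partial>std_normal)
      = (\<integral>\<^sup>+x. ennreal ?t * ennreal (normal_density 0 ?t x) \<partial>lborel)"
    using t * by (subst nn_integral_density)
      (auto simp: mult.commute simp flip: ennreal_mult'' intro!: nn_integral_cong)
  also have "\<dots> = ennreal ?t * ennreal (\<integral>x. normal_density 0 ?t x \<partial>lborel)"
    using t by (subst nn_integral_cmult) (auto simp: nn_integral_eq_integral)
  finally show ?thesis using t by simp
qed

lemma nn_integral_exp_sumsq:
  assumes "s < 1 / 2"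
  shows "(\<integral>\<^sup>+x. ennreal (exp (s * sumsq d x)) \<partial>std_seq) = ennreal ((1 / sqrt (1 - 2 * s)) ^ d)"
proof (induction d)
  case 0
  then show ?case by (simp add: std_seq.emeasure_space_1[simplified])
next
  case (Suc d)
  have z: "(\<integral>\<^sup>+x. ennreal (exp (s * (x 0)\<^sup>2)) \<partial>std_seq) = ennreal (1 / sqrt (1 - 2 * s))"
    unfolding nn_integral_exp_square[OF assms, symmetric]
    by (subst distr_std_component[of 0, symmetric], subst nn_integral_distr) auto
  have "(\<integral>\<^sup>+x. ennreal (exp (s * sumsq (Suc d) x)) \<partial>std_seq)
      = (\<integral>\<^sup>+x. \<integral>\<^sup>+y. ennreal (exp (s * sumsq d x)) * ennreal (exp (s * (y 0)\<^sup>2)) \<partial>std_seq \<partial>std_seq)"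
    using sumsq_comb_seq_add[of d 1]
    by (subst nn_integral_std_split[of _ d])
       (auto simp: sumsq_Suc distrib_left exp_add ennreal_mult intro!: nn_integral_cong)
  also have "\<dots> = ennreal ((1 / sqrt (1 - 2 * s)) ^ d) * ennreal (1 / sqrt (1 - 2 * s))"
    using Suc z by (simp add: nn_integral_cmult nn_integral_multc)
  finally show ?case using assms by (simp add: mult.commute flip: ennreal_mult'')
qed

lemma sumsq_upper_tail:
  assumes "0 < s" "s < 1 / 2"
  shows "measure std_seq {x. a \<le> sumsq d x} \<le> exp (- s * a) * (1 / sqrt (1 - 2 * s)) ^ d"
proof -
  have "emeasure std_seq {x\<in>space std_seq. 1 \<le> ennreal (exp (- s * a)) * ennreal (exp (s * sumsq d x))}
     \<le> ennreal (exp (- s * a)) * (\<integral>\<^sup>+x. ennreal (exp (s * sumsq d x)) * indicator (space std_seq) x \<partial>std_seq)"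
    by (rule nn_integral_Markov_inequality) (auto simp: sets.top[of std_seq, simplified])
  also have "{x\<in>space std_seq. 1 \<le> ennreal (exp (- s * a)) * ennreal (exp (s * sumsq d x))} = {x. a \<le> sumsq d x}"
  proof -
    have "ennreal (exp (- s * a)) * ennreal (exp (s * sumsq d x)) = ennreal (exp (s * (sumsq d x - a)))" for x
      by (subst ennreal_mult''[symmetric]) (simp_all add: algebra_simps flip: exp_add)
    then show ?thesis using assms by (simp add: zero_le_mult_iff)
  qed
  finally show ?thesis using assms
    by (simp add: nn_integral_exp_sumsq std_seq.emeasure_eq_measure flip: ennreal_mult'')
qed

lemma sumsq_lower_tail:
  assumes "0 < s"
  shows "measure std_seq {x. sumsq d x \<le> a} \<le> exp (s * a) * (1 / sqrt (1 + 2 * s)) ^ d"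
proof -
  have "emeasure std_seq {x\<in>space std_seq. 1 \<le> ennreal (exp (s * a)) * ennreal (exp ((- s) * sumsq d x))}
     \<le> ennreal (exp (s * a)) * (\<integral>\<^sup>+x. ennreal (exp ((- s) * sumsq d x)) * indicator (space std_seq) x \<partial>std_seq)"
    by (rule nn_integral_Markov_inequality) (auto simp: sets.top[of std_seq, simplified])
  also have "{x\<in>space std_seq. 1 \<le> ennreal (exp (s * a)) * ennreal (exp ((- s) * sumsq d x))} = {x. sumsq d x \<le> a}"
  proof -
    have "ennreal (exp (s * a)) * ennreal (exp ((- s) * sumsq d x)) = ennreal (exp (s * (a - sumsq d x)))" for x
      by (subst ennreal_mult''[symmetric]) (simp_all add: algebra_simps flip: exp_add)
    then show ?thesis using assms by (simp only: ennreal_ge_1 one_le_exp_iff zero_le_mult_iff) auto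
  qed
  finally show ?thesis using assms nn_integral_exp_sumsq[of "-s" d]
    by (simp add: std_seq.emeasure_eq_measure flip: ennreal_mult'')
qed

lemma sumsq_chernoff:
  fixes \<delta> :: real
  assumes "0 < \<delta>" "\<delta> < 1"
  obtains b :: real where "0 < b" "b < 1"
    "\<And>d. measure std_seq {x. (1 + \<delta>) * real d \<le> sumsq d x} \<le> b ^ d"
    "\<And>d. measure std_seq {x. sumsq d x \<le> (1 - \<delta>) * real d} \<le> b ^ d"
proof -
  \<comment> \<open>With \<delta> = 8 s the linear terms in s cancel, and the gain 8 s^2 from
    \<delta> exceeds the second-order errors of the logarithms, 4 s^2 in \<open>b1\<close> and 2 s^2
    in \<open>b2\<close>.\<close>
  define s where "s = \<delta> / 8"
  have s: "0 < s" "s < 1 / 8" "\<delta> = 8 * s" using assms by (auto simp: s_def)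
  define b1 b2 where "b1 = exp (- s * (1 + \<delta>)) * (1 / sqrt (1 - 2 * s))"
    and "b2 = exp (s * (1 - \<delta>)) * (1 / sqrt (1 + 2 * s))"
  have ln1: "- 2 * s - 2 * (2 * s)\<^sup>2 \<le> ln (1 - 2 * s)"
    using ln_one_minus_pos_lower_bound[of "2 * s"] s by simp
  have ln2: "2 * s - (2 * s)\<^sup>2 \<le> ln (1 + 2 * s)"
    using ln_one_plus_pos_lower_bound[of "2 * s"] s by simp
  have b: "0 < b1" "0 < b2" using s by (auto simp: b1_def b2_def)
  have "ln b1 = - s * (1 + \<delta>) - ln (1 - 2 * s) / 2"
    using s by (simp add: b1_def ln_mult ln_div ln_sqrt)
  also have "\<dots> \<le> - s * (1 + \<delta>) + (2 * s + 2 * (2 * s)\<^sup>2) / 2" using ln1 by (simp add: field_simps)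
  also have "\<dots> < 0" using s by (simp add: power2_eq_square algebra_simps)
  finally have b1: "b1 < 1" using b by (simp add: ln_less_zero_iff)
  have "ln b2 = s * (1 - \<delta>) - ln (1 + 2 * s) / 2"
    using s by (simp add: b2_def ln_mult ln_div ln_sqrt)
  also have "\<dots> \<le> s * (1 - \<delta>) - (2 * s - (2 * s)\<^sup>2) / 2" using ln2 by (simp add: field_simps)
  also have "\<dots> = - 6 * s * s" using s by (simp add: power2_eq_square algebra_simps diff_divide_distrib)
  also have "\<dots> < 0" using s by simp
  finally have b2: "b2 < 1" using b by (simp add: ln_less_zero_iff)
  have p1: "measure std_seq {x. (1 + \<delta>) * real d \<le> sumsq d x} \<le> (max b1 b2) ^ d" for d
  proof -
    have "measure std_seq {x. (1 + \<delta>) * real d \<le> sumsq d x}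
        \<le> exp (- s * ((1 + \<delta>) * real d)) * (1 / sqrt (1 - 2 * s)) ^ d"
      by (rule sumsq_upper_tail) (use s in auto)
    also have "exp (- s * ((1 + \<delta>) * real d)) = exp (- s * (1 + \<delta>)) ^ d"
      by (simp add: exp_of_nat_mult[symmetric] algebra_simps)
    also have "\<dots> * (1 / sqrt (1 - 2 * s)) ^ d = b1 ^ d" unfolding b1_def by (simp only: power_mult_distrib)
    also have "\<dots> \<le> (max b1 b2) ^ d" using b by (intro power_mono) auto
    finally show ?thesis .
  qed
  have p2: "measure std_seq {x. sumsq d x \<le> (1 - \<delta>) * real d} \<le> (max b1 b2) ^ d" for d
  proof -
    have "measure std_seq {x. sumsq d x \<le> (1 - \<delta>) * real d}
        \<le> exp (s * ((1 - \<delta>) * real d)) * (1 / sqrt (1 + 2 * s)) ^ d"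
      by (rule sumsq_lower_tail) (use s in auto)
    also have "exp (s * ((1 - \<delta>) * real d)) = exp (s * (1 - \<delta>)) ^ d"
      by (simp add: exp_of_nat_mult[symmetric] algebra_simps)
    also have "\<dots> * (1 / sqrt (1 + 2 * s)) ^ d = b2 ^ d" unfolding b2_def by (simp only: power_mult_distrib)
    also have "\<dots> \<le> (max b1 b2) ^ d" using b by (intro power_mono) auto
    finally show ?thesis .
  qed
  show thesis by (rule that[of "max b1 b2"]) (use b b1 b2 p1 p2 in auto)
qed

section \<open>Chi-square densities\<close>

text \<open>The gamma density of shape \<open>a\<close> and scale 2 without its normalising
  constant. The constant is never evaluated; what is needed of it follows from total mass
  one.\<close>

definition gamma_shape :: "real \<Rightarrow> real \<Rightarrow> real" where
  "gamma_shape a y = (if y > 0 then y powr (a - 1) * exp (- y / 2) else 0)"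

lemma gamma_shape_nonneg [simp]: "0 \<le> gamma_shape a y" by (simp add: gamma_shape_def)

lemma measurable_gamma_shape [measurable]: "gamma_shape a \<in> borel_measurable borel"
  unfolding gamma_shape_def[abs_def] by measurable

text \<open>Substitution y = z^2 on the positive half line, with the negative half supplied by
  symmetry. The substitution rule is applied on the compact intervals from 0 to n, and monotone
  convergence removes the truncation.\<close>

lemma nn_integral_std_square:
  assumes [measurable]: "f \<in> borel_measurable borel"
  shows "(\<integral>\<^sup>+x. f ((x 0)\<^sup>2) \<partial>std_seq)
       = (\<integral>\<^sup>+y. f y * (ennreal (1 / sqrt (2 * pi)) * ennreal (gamma_shape (1 / 2) y)) \<partial>lborel)"
proof -
  define F where "F y = f y * ennreal (gamma_shape (1 / 2) y)" for y
  define H where "H z = f (z\<^sup>2) * ennreal (exp (- z\<^sup>2 / 2))" for z :: real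
  have [measurable]: "F \<in> borel_measurable borel" "H \<in> borel_measurable borel"
    by (auto simp: F_def[abs_def] H_def[abs_def])
  have sub: "(\<integral>\<^sup>+y. F y * indicator {0..(real n)\<^sup>2} y \<partial>lborel)
      = (\<integral>\<^sup>+z. (2 * H z) * indicator {0<..real n} z \<partial>lborel)" for n
  proof (cases "n = 0")
    case True
    have "(\<integral>\<^sup>+y. F y * indicator {0..(real n)\<^sup>2} y \<partial>lborel) = integral\<^sup>N lborel (\<lambda>y::real. 0)"
      by (intro nn_integral_cong_AE AE_I[where N = "{0}"]) (auto simp: True indicator_def split: if_splits)
    then show ?thesis using True by simp
  next
    case False
    have "(\<integral>\<^sup>+y. F y * indicator {0\<^sup>2..(real n)\<^sup>2} y \<partial>lborel)
        = (\<integral>\<^sup>+z. F (z\<^sup>2) * ennreal (2 * z) * indicator {0..real n} z \<partial>lborel)"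
      by (rule nn_integral_substitution_aux[where g = "\<lambda>z. z\<^sup>2"])
         (use False in \<open>auto intro!: derivative_eq_intros continuous_intros\<close>)
    also have "\<dots> = (\<integral>\<^sup>+z. (2 * H z) * indicator {0<..real n} z \<partial>lborel)"
    proof (intro nn_integral_cong)
      fix z :: real
      show "F (z\<^sup>2) * ennreal (2 * z) * indicator {0..real n} z = (2 * H z) * indicator {0<..real n} z"
      proof (cases "0 < z")
        case True
        have "(z\<^sup>2) powr (1 / 2 - 1) = 1 / z"
        proof -
          have "(z\<^sup>2) powr (1 / 2 - 1) = (z powr 2) powr (- (1 / 2))" using True by (simp add: powr_numeral)
          also have "\<dots> = z powr (- 1)" by (subst powr_powr) simp
          finally show ?thesis using True by (simp add: powr_minus_divide)
        qed
        then have "gamma_shape (1 / 2) (z\<^sup>2) * (2 * z) = 2 * exp (- z\<^sup>2 / 2)"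
          using True by (simp add: gamma_shape_def)
        then have "ennreal (gamma_shape (1 / 2) (z\<^sup>2) * (2 * z)) = ennreal (2 * exp (- z\<^sup>2 / 2))"
          by (simp only:)
        then have "ennreal (gamma_shape (1 / 2) (z\<^sup>2)) * ennreal (2 * z) = 2 * ennreal (exp (- z\<^sup>2 / 2))"
          using True by (subst (asm) ennreal_mult, simp, simp, subst (asm) ennreal_mult) simp_all
        then show ?thesis using True
          by (simp add: F_def H_def indicator_def mult.assoc mult.left_commute)
      qed (auto simp: indicator_def F_def gamma_shape_def)
    qed
    finally show ?thesis by simp
  qed
  have supF: "(\<integral>\<^sup>+y. F y \<partial>lborel) = (SUP n. \<integral>\<^sup>+y. F y * indicator {0..(real n)\<^sup>2} y \<partial>lborel)"
  proof -
    have pt: "F y = (SUP n. F y * indicator {0..(real n)\<^sup>2} y)" for y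
    proof (cases "y > 0")
      case True
      obtain n where n: "y < real n" using reals_Archimedean2 by blast
      have "real n \<ge> 1" using n True by (cases n) auto
      have "real n * 1 \<le> real n * real n" using \<open>real n \<ge> 1\<close> by (intro mult_left_mono) auto
      then have "y \<le> (real n)\<^sup>2" using n by (simp add: power2_eq_square)
      then have "F y \<le> F y * indicator {0..(real n)\<^sup>2} y" using True by simp
      then show ?thesis
        by (intro antisym SUP_upper2[of n] SUP_least) (auto simp: indicator_def)
    qed (simp add: F_def gamma_shape_def)
    have "(\<integral>\<^sup>+y. F y \<partial>lborel) = (\<integral>\<^sup>+y. (SUP n. F y * indicator {0..(real n)\<^sup>2} y) \<partial>lborel)"
      using pt by simp
    also have "\<dots> = (SUP n. \<integral>\<^sup>+y. F y * indicator {0..(real n)\<^sup>2} y \<partial>lborel)"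
    proof (rule nn_integral_monotone_convergence_SUP)
      show "incseq (\<lambda>n y. F y * indicator {0..(real n)\<^sup>2} y)"
      proof (intro incseq_SucI le_funI)
        fix n y
        have le: "(real n)\<^sup>2 \<le> (real (Suc n))\<^sup>2" by (intro power_mono) auto
        show "F y * indicator {0..(real n)\<^sup>2} y \<le> F y * indicator {0..(real (Suc n))\<^sup>2} y"
          using order.trans[OF _ le, of y] by (auto simp: indicator_def simp del: of_nat_Suc)
      qed
    qed simp
    finally show ?thesis .
  qed
  have supH: "(\<integral>\<^sup>+z. 2 * H z * indicator {0<..} z \<partial>lborel) = (SUP n. \<integral>\<^sup>+z. (2 * H z) * indicator {0<..real n} z \<partial>lborel)"
  proof -
    have pt: "2 * H z * indicator {0<..} z = (SUP n. (2 * H z) * indicator {0<..real n} z)" for z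
    proof -
      obtain n where n: "z < real n" using reals_Archimedean2 by blast
      then have "2 * H z * indicator {0<..} z \<le> (2 * H z) * indicator {0<..real n} z"
        by (auto simp: indicator_def)
      then show ?thesis
        by (intro antisym SUP_upper2[of n] SUP_least) (auto simp: indicator_def)
    qed
    have "(\<integral>\<^sup>+z. 2 * H z * indicator {0<..} z \<partial>lborel) = (\<integral>\<^sup>+z. (SUP n. (2 * H z) * indicator {0<..real n} z) \<partial>lborel)"
      using pt by simp
    also have "\<dots> = (SUP n. \<integral>\<^sup>+z. (2 * H z) * indicator {0<..real n} z \<partial>lborel)"
      by (rule nn_integral_monotone_convergence_SUP) (auto simp: incseq_def le_fun_def indicator_def)
    finally show ?thesis .
  qed
  have FH: "(\<integral>\<^sup>+y. F y \<partial>lborel) = (\<integral>\<^sup>+z. 2 * H z * indicator {0<..} z \<partial>lborel)"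
    unfolding supF supH sub ..
  have even: "(\<integral>\<^sup>+z. H z * indicator {..<0} z \<partial>lborel) = (\<integral>\<^sup>+z. H z * indicator {0<..} z \<partial>lborel)"
    by (subst nn_integral_real_affine[where c = "-1" and t = 0])
       (auto simp: H_def indicator_def intro!: nn_integral_cong)
  have "(\<integral>\<^sup>+z. H z \<partial>lborel) = (\<integral>\<^sup>+z. H z * indicator {0<..} z + H z * indicator {..<0} z \<partial>lborel)"
    by (intro nn_integral_cong_AE AE_I[where N = "{0}"]) (auto simp: indicator_def split: if_splits)
  also have "\<dots> = 2 * (\<integral>\<^sup>+z. H z * indicator {0<..} z \<partial>lborel)"
    by (subst nn_integral_add) (auto simp: even mult_2)
  also have "\<dots> = (\<integral>\<^sup>+y. F y \<partial>lborel)"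
    unfolding FH by (subst nn_integral_cmult[symmetric]) (auto simp: mult.assoc)
  finally have HF: "(\<integral>\<^sup>+z. H z \<partial>lborel) = (\<integral>\<^sup>+y. F y \<partial>lborel)" .
  have H_eq: "ennreal (std_normal_density z) = ennreal (1 / sqrt (2 * pi)) * ennreal (exp (- z\<^sup>2 / 2))" for z
    unfolding std_normal_density_def by (rule ennreal_mult) auto
  have "(\<integral>\<^sup>+x. f ((x 0)\<^sup>2) \<partial>std_seq) = (\<integral>\<^sup>+z. f (z\<^sup>2) \<partial>(distr std_seq borel (\<lambda>x. x 0)))"
    by (subst nn_integral_distr) auto
  also have "\<dots> = (\<integral>\<^sup>+z. ennreal (1 / sqrt (2 * pi)) * H z \<partial>lborel)"
    unfolding distr_std_component
    by (subst nn_integral_density)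
       (auto simp: H_def H_eq mult.commute mult.left_commute intro!: nn_integral_cong)
  also have "\<dots> = ennreal (1 / sqrt (2 * pi)) * (\<integral>\<^sup>+y. F y \<partial>lborel)"
    by (simp add: nn_integral_cmult HF)
  also have "\<dots> = (\<integral>\<^sup>+y. f y * (ennreal (1 / sqrt (2 * pi)) * ennreal (gamma_shape (1 / 2) y)) \<partial>lborel)"
    by (subst nn_integral_cmult[symmetric]) (auto simp: F_def mult_ac)
  finally show ?thesis .
qed

text \<open>Scaling u = v w pulls all powers of \<open>v\<close> out of the convolution; what
  remains is a beta integral, kept as an unevaluated and possibly infinite \<open>B\<close>.\<close>

lemma nn_integral_gamma_shape_conv:
  obtains B :: ennreal where
    "\<And>v. (\<integral>\<^sup>+u. ennreal (gamma_shape a (v - u)) * ennreal (gamma_shape b u) \<partial>lborel)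
        = B * ennreal (gamma_shape (a + b) v)"
proof -
  define J where "J w = (if 0 < w \<and> w < 1 then (1 - w) powr (a - 1) * w powr (b - 1) else 0 :: real)" for w
  have [measurable]: "J \<in> borel_measurable borel" by (simp add: J_def[abs_def])
  have "(\<integral>\<^sup>+u. ennreal (gamma_shape a (v - u)) * ennreal (gamma_shape b u) \<partial>lborel)
      = (\<integral>\<^sup>+w. ennreal (J w) \<partial>lborel) * ennreal (gamma_shape (a + b) v)" for v
  proof (cases "v > 0")
    case True
    have eq: "v * (gamma_shape a (v - v * w) * gamma_shape b (v * w)) = gamma_shape (a + b) v * J w" for w
    proof (cases "0 < w \<and> w < 1")
      case w: True
      have h1: "v - v * w = v * (1 - w)" by (simp add: algebra_simps)
      have h2: "v * (v powr (a - 1) * v powr (b - 1)) = v powr (a + b - 1)"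
      proof -
        have "v * (v powr (a - 1) * v powr (b - 1)) = v powr 1 * (v powr (a - 1) * v powr (b - 1))"
          using True by simp
        also have "\<dots> = v powr (1 + ((a - 1) + (b - 1)))" by (simp only: powr_add)
        finally show ?thesis by (simp add: algebra_simps)
      qed
      have h3: "exp (- (v * (1 - w)) / 2) * exp (- (v * w) / 2) = exp (- v / 2)"
        by (simp add: algebra_simps flip: exp_add) (simp add: field_simps)
      have h4: "gamma_shape a (v * (1 - w)) = v powr (a - 1) * (1 - w) powr (a - 1) * exp (- (v * (1 - w)) / 2)"
        using True w by (simp add: gamma_shape_def powr_mult)
      have h5: "gamma_shape b (v * w) = v powr (b - 1) * w powr (b - 1) * exp (- (v * w) / 2)"
        using True w by (simp add: gamma_shape_def powr_mult)
      have h6: "gamma_shape (a + b) v = v powr (a + b - 1) * exp (- v / 2)"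
        using True by (simp add: gamma_shape_def)
      have h7: "J w = (1 - w) powr (a - 1) * w powr (b - 1)" using w by (simp add: J_def)
      have "v * (gamma_shape a (v * (1 - w)) * gamma_shape b (v * w))
          = (v * (v powr (a - 1) * v powr (b - 1))) * (exp (- (v * (1 - w)) / 2) * exp (- (v * w) / 2))
            * ((1 - w) powr (a - 1) * w powr (b - 1))"
        unfolding h4 h5 by (simp only: mult_ac)
      then show ?thesis unfolding h1 h2 h3 h6 h7 .
    next
      case False
      then have "v * w \<le> 0 \<or> v - v * w \<le> 0"
        using True by (auto simp: not_less mult_nonneg_nonpos)
      then show ?thesis using False by (auto simp: gamma_shape_def J_def)
    qed
    have "(\<integral>\<^sup>+u. ennreal (gamma_shape a (v - u)) * ennreal (gamma_shape b u) \<partial>lborel)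
        = ennreal v * (\<integral>\<^sup>+w. ennreal (gamma_shape a (v - v * w)) * ennreal (gamma_shape b (v * w)) \<partial>lborel)"
      using True by (subst nn_integral_real_affine[where c = v and t = 0]) auto
    also have "\<dots> = (\<integral>\<^sup>+w. ennreal (v * (gamma_shape a (v - v * w) * gamma_shape b (v * w))) \<partial>lborel)"
      using True by (subst nn_integral_cmult[symmetric]) (auto simp: ennreal_mult)
    also have "\<dots> = (\<integral>\<^sup>+w. ennreal (gamma_shape (a + b) v) * ennreal (J w) \<partial>lborel)"
      unfolding eq by (intro nn_integral_cong ennreal_mult) (auto simp: J_def)
    also have "\<dots> = (\<integral>\<^sup>+w. ennreal (J w) \<partial>lborel) * ennreal (gamma_shape (a + b) v)"
      by (subst nn_integral_cmult) (auto simp: mult.commute)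
    finally show ?thesis .
  next
    case False
    have "(\<integral>\<^sup>+u. ennreal (gamma_shape a (v - u)) * ennreal (gamma_shape b u) \<partial>lborel) = (\<integral>\<^sup>+u. 0 \<partial>(lborel :: real measure))"
      using False by (intro nn_integral_cong) (auto simp: gamma_shape_def)
    then show ?thesis using False by (simp add: gamma_shape_def)
  qed
  then show thesis by (rule that)
qed

text \<open>Adding one coordinate convolves with the one-dimensional case. The constant lives in
  \<open>ennreal\<close> because the beta integral of the convolution is not yet known to be
  finite.\<close>

lemma nn_integral_sumsq_ennreal:
  assumes "0 < d"
  shows "\<exists>C::ennreal. \<forall>f\<in>borel_measurable borel. (\<integral>\<^sup>+x. f (sumsq d x) \<partial>std_seq)
    = (\<integral>\<^sup>+y. f y * (C * ennreal (gamma_shape (real d / 2) y)) \<partial>lborel)"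
  using assms
proof (induction d rule: nat_induct_non_zero)
  case 1
  then show ?case using nn_integral_std_square
    by (intro exI[of _ "ennreal (1 / sqrt (2 * pi))"]) (auto simp: sumsq_Suc)
next
  case (Suc d)
  then obtain C where C: "\<And>f. f \<in> borel_measurable borel \<Longrightarrow> (\<integral>\<^sup>+x. f (sumsq d x) \<partial>std_seq)
    = (\<integral>\<^sup>+y. f y * (C * ennreal (gamma_shape (real d / 2) y)) \<partial>lborel)" by blast
  obtain B where B: "\<And>v. (\<integral>\<^sup>+u. ennreal (gamma_shape (real d / 2) (v - u)) * ennreal (gamma_shape (1 / 2) u) \<partial>lborel)
        = B * ennreal (gamma_shape (real d / 2 + 1 / 2) v)"
    using nn_integral_gamma_shape_conv[of "real d / 2" "1 / 2"] by blast
  let ?c = "ennreal (1 / sqrt (2 * pi))"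
  have "(\<integral>\<^sup>+x. f (sumsq (Suc d) x) \<partial>std_seq)
    = (\<integral>\<^sup>+y. f y * (C * ?c * B * ennreal (gamma_shape (real (Suc d) / 2) y)) \<partial>lborel)"
    if [measurable]: "f \<in> borel_measurable borel" for f
  proof -
    have "(\<integral>\<^sup>+x. f (sumsq (Suc d) x) \<partial>std_seq)
        = (\<integral>\<^sup>+y. \<integral>\<^sup>+x. f (sumsq d x + (y 0)\<^sup>2) \<partial>std_seq \<partial>std_seq)"
      using sumsq_comb_seq_add[of d 1]
      by (subst nn_integral_std_split'[of _ d]) (auto simp: sumsq_Suc)
    also have "\<dots> = (\<integral>\<^sup>+y. (\<lambda>u. \<integral>\<^sup>+s. f (s + u) * (C * ennreal (gamma_shape (real d / 2) s)) \<partial>lborel) ((y 0)\<^sup>2) \<partial>std_seq)"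
      using C[of "\<lambda>s. f (s + u)" for u] by (intro nn_integral_cong) simp
    also have "\<dots> = (\<integral>\<^sup>+u. (\<integral>\<^sup>+s. f (s + u) * (C * ennreal (gamma_shape (real d / 2) s)) \<partial>lborel) * (?c * ennreal (gamma_shape (1 / 2) u)) \<partial>lborel)"
      by (rule nn_integral_std_square) measurable
    also have "\<dots> = (\<integral>\<^sup>+u. (\<integral>\<^sup>+v. f v * (C * ennreal (gamma_shape (real d / 2) (v - u))) \<partial>lborel) * (?c * ennreal (gamma_shape (1 / 2) u)) \<partial>lborel)"
    proof (rule nn_integral_cong)
      fix u :: real
      have "(\<integral>\<^sup>+s. f (s + u) * (C * ennreal (gamma_shape (real d / 2) s)) \<partial>lborel) =
          (\<integral>\<^sup>+v. f v * (C * ennreal (gamma_shape (real d / 2) (v - u))) \<partial>lborel)"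
        by (subst (2) nn_integral_real_affine[where c = 1 and t = u]) (simp_all add: add.commute)
      then show "(\<integral>\<^sup>+s. f (s + u) * (C * ennreal (gamma_shape (real d / 2) s)) \<partial>lborel) * (?c * ennreal (gamma_shape (1 / 2) u))
        = (\<integral>\<^sup>+v. f v * (C * ennreal (gamma_shape (real d / 2) (v - u))) \<partial>lborel) * (?c * ennreal (gamma_shape (1 / 2) u))"
        by simp
    qed
    also have "\<dots> = (\<integral>\<^sup>+u. \<integral>\<^sup>+v. f v * (C * ?c) * (ennreal (gamma_shape (real d / 2) (v - u)) * ennreal (gamma_shape (1 / 2) u)) \<partial>lborel \<partial>lborel)"
      by (subst nn_integral_multc[symmetric]) (auto simp: mult_ac)
    also have "\<dots> = (\<integral>\<^sup>+v. \<integral>\<^sup>+u. f v * (C * ?c) * (ennreal (gamma_shape (real d / 2) (v - u)) * ennreal (gamma_shape (1 / 2) u)) \<partial>lborel \<partial>lborel)"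
      by (rule lborel_pair.Fubini') measurable
    also have "\<dots> = (\<integral>\<^sup>+v. f v * (C * ?c) * (B * ennreal (gamma_shape (real d / 2 + 1 / 2) v)) \<partial>lborel)"
      by (subst nn_integral_cmult) (simp_all add: B)
    finally show ?thesis by (simp add: mult_ac add_divide_distrib add.commute)
  qed
  then show ?case by blast
qed

lemma nn_integral_sumsq:
  assumes "0 < d"
  obtains C :: real where "0 \<le> C"
    "\<And>f. f \<in> borel_measurable borel \<Longrightarrow> (\<integral>\<^sup>+x. f (sumsq d x) \<partial>std_seq)
       = (\<integral>\<^sup>+y. f y * ennreal (C * gamma_shape (real d / 2) y) \<partial>lborel)"
proof -
  obtain C where C: "\<And>f. f \<in> borel_measurable borel \<Longrightarrow> (\<integral>\<^sup>+x. f (sumsq d x) \<partial>std_seq)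
    = (\<integral>\<^sup>+y. f y * (C * ennreal (gamma_shape (real d / 2) y)) \<partial>lborel)"
    using nn_integral_sumsq_ennreal[OF assms] by blast
  \<comment> \<open>Total mass one excludes an infinite constant: a product with \<infinity> would
    be 0 or \<infinity>.\<close>
  have "1 = C * (\<integral>\<^sup>+y. ennreal (gamma_shape (real d / 2) y) \<partial>lborel)"
    using C[of "\<lambda>_. 1"] by (simp add: std_seq.emeasure_space_1[simplified] nn_integral_cmult)
  then have "C \<noteq> \<top>" by (auto simp: ennreal_top_mult split: if_splits)
  then obtain c where c: "C = ennreal c" "0 \<le> c" by (cases C) auto
  show thesis by (rule that[of c]) (use C c in \<open>auto simp: ennreal_mult'\<close>)
qed

section \<open>Height and slope of the gamma density\<close>

lemma mult_exp_neg_square_le: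
  fixes t :: real assumes "0 \<le> t" shows "t * exp (- t\<^sup>2 / 2) \<le> 1"
proof -
  have "t \<le> 1 + t\<^sup>2 / 2" using sum_squares_bound[of t 1] by (simp add: power2_eq_square)
  also have "\<dots> \<le> exp (t\<^sup>2 / 2)" by (rule exp_ge_add_one_self)
  finally show ?thesis by (simp add: exp_minus field_simps)
qed

lemma ln_le_below_1:
  fixes z :: real assumes "0 < z" "z \<le> 1"
  shows "ln z \<le> (z - 1) - (1 - z)\<^sup>2 / 2"
proof -
  let ?f = "\<lambda>z::real. ln z - (z - 1) + (1 - z)\<^sup>2 / 2"
  have "?f z \<le> ?f 1"
  proof (rule DERIV_nonneg_imp_nondecreasing[OF assms(2)])
    fix x assume x: "z \<le> x" "x \<le> 1"
    have "(?f has_real_derivative (1 / x - 1 - (1 - x))) (at x)"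
      using assms x by (auto intro!: derivative_eq_intros simp: diff_divide_distrib)
    moreover have "1 / x - 1 - (1 - x) = (1 - x)\<^sup>2 / x"
      using assms x by (simp add: field_simps power2_eq_square)
    then have "0 \<le> 1 / x - 1 - (1 - x)" using assms x by simp
    ultimately show "\<exists>y. (?f has_real_derivative y) (at x) \<and> 0 \<le> y" by blast
  qed
  then show ?thesis by simp
qed

text \<open>Above 1 the purely quadratic correction that works below 1 is too strong; the factor 1 /
  z repairs it. It makes the right-hand side equal to (z - 1 / z) / 2.\<close>

lemma ln_le_above_1:
  fixes z :: real assumes "1 \<le> z"
  shows "ln z \<le> (z - 1) - (z - 1)\<^sup>2 / (2 * z)"
proof -
  let ?f = "\<lambda>z::real. (z - 1 / z) / 2 - ln z"
  have "?f 1 \<le> ?f z"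
  proof (rule DERIV_nonneg_imp_nondecreasing[OF assms(1)])
    fix x assume x: "1 \<le> x" "x \<le> z"
    have "(?f has_real_derivative ((1 + 1 / x\<^sup>2) / 2 - 1 / x)) (at x)"
      using assms x by (auto intro!: derivative_eq_intros simp: power2_eq_square)
    moreover have eq: "(1 + 1 / x\<^sup>2) / 2 - 1 / x = (1 - 1 / x)\<^sup>2 / 2"
      using assms x by (simp add: field_simps power2_eq_square)
    have "0 \<le> (1 + 1 / x\<^sup>2) / 2 - 1 / x" unfolding eq by simp
    ultimately show "\<exists>y. (?f has_real_derivative y) (at x) \<and> 0 \<le> y" by blast
  qed
  moreover have "(z - 1) - (z - 1)\<^sup>2 / (2 * z) = (z - 1 / z) / 2"
    using assms by (simp add: field_simps power2_eq_square)
  ultimately show ?thesis by simp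
qed

text \<open>The density of shape q + 1 has its mode at 2 q. In terms of the ratio z to the mode it
  is governed by \<open>ln z - (z - 1)\<close>, which is at most 0 and vanishes at z = 1.\<close>

lemma gamma_shape_mode:
  assumes "0 < q" "0 < z"
  shows "gamma_shape (q + 1) (2 * q * z) = gamma_shape (q + 1) (2 * q) * exp (q * (ln z - (z - 1)))"
  using assms
  by (simp add: gamma_shape_def powr_mult powr_def[of z] mult_ac algebra_simps flip: exp_add)

lemma gamma_shape_le_mode:
  assumes "0 < q" shows "gamma_shape (q + 1) y \<le> gamma_shape (q + 1) (2 * q)"
proof (cases "0 < y")
  case True
  define z where "z = y / (2 * q)"
  have z: "0 < z" "y = 2 * q * z" using assms True by (auto simp: z_def)
  have "exp (q * (ln z - (z - 1))) \<le> 1"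
    using ln_le_minus_one[OF z(1)] assms by (simp add: mult_nonneg_nonpos)
  then show ?thesis
    unfolding z(2) gamma_shape_mode[OF assms z(1)] by (intro mult_left_le) auto
qed (simp add: gamma_shape_def)

text \<open>Within about one standard deviation to the right of the mode the density stays above
  exp(-1) times its maximum; total mass at most 1 then caps the maximum.\<close>

lemma gamma_shape_mode_bound:
  assumes q: "1 \<le> q" and C: "0 \<le> C"
    and "(\<integral>\<^sup>+y. ennreal (C * gamma_shape (q + 1) y) \<partial>lborel) \<le> 1"
  shows "C * gamma_shape (q + 1) (2 * q) \<le> exp 1 / (2 * sqrt q)"
proof -
  let ?m = "C * gamma_shape (q + 1) (2 * q)"
  have low: "?m * exp (- 1) \<le> C * gamma_shape (q + 1) y" if y: "2 * q \<le> y" "y \<le> 2 * q + 2 * sqrt q" for y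
  proof -
    define x where "x = y / (2 * q) - 1"
    have q0: "0 < q" using q by simp
    have sq: "sqrt q * sqrt q = q" using q by simp
    have "y / (2 * q) \<le> (2 * q + 2 * sqrt q) / (2 * q)" using y q0 by (intro divide_right_mono) auto
    also have "\<dots> = 1 + 1 / sqrt q" using q0 sq by (simp add: field_simps)
    finally have "y / (2 * q) \<le> 1 + 1 / sqrt q" .
    then have x: "0 \<le> x" "x \<le> 1 / sqrt q" "y = 2 * q * (1 + x)" using y q0 by (auto simp: x_def field_simps)
    have "1 / sqrt q \<le> 1" using q by simp
    then have "x \<le> 1" using x by linarith
    have "q * x\<^sup>2 \<le> q * (1 / sqrt q)\<^sup>2" using x q0 by (intro mult_left_mono power_mono) auto
    also have "\<dots> = 1" using q0 by (simp add: power_divide)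
    finally have "q * x\<^sup>2 \<le> 1" .
    moreover have "q * (x - x\<^sup>2) \<le> q * ln (1 + x)"
      using ln_one_plus_pos_lower_bound[OF x(1) \<open>x \<le> 1\<close>] q0 by (intro mult_left_mono) auto
    ultimately have "exp (- 1) \<le> exp (q * (ln (1 + x) - (1 + x - 1)))"
      by (simp add: algebra_simps)
    moreover have "0 < 1 + x" using x by simp
    ultimately show ?thesis
      unfolding x(3) gamma_shape_mode[OF q0 \<open>0 < 1 + x\<close>] using C
      by (simp add: mult.assoc mult_left_mono)
  qed
  have "ennreal (?m * exp (- 1)) * ennreal (2 * sqrt q)
      = (\<integral>\<^sup>+y. ennreal (?m * exp (- 1)) * indicator {2 * q .. 2 * q + 2 * sqrt q} y \<partial>lborel)"
    using q by (subst nn_integral_cmult_indicator) auto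
  also have "\<dots> \<le> (\<integral>\<^sup>+y. ennreal (C * gamma_shape (q + 1) y) \<partial>lborel)"
    using low by (intro nn_integral_mono) (auto simp: indicator_def ennreal_leI)
  also have "\<dots> \<le> 1" by fact
  finally have "ennreal (?m * exp (- 1) * (2 * sqrt q)) \<le> 1"
    using C q by (subst ennreal_mult) auto
  then have "?m * exp (- 1) * (2 * sqrt q) \<le> 1" by (simp add: ennreal_le_1)
  then show ?thesis using q by (simp add: exp_minus field_simps)
qed

text \<open>Up to constants this is the derivative of the density relative to its maximum. With
  \<open>t\<close> a rescaled distance from the mode, both cases reduce to t exp(-t^2 / 2) \<le> 1.
  Below the mode the factor 1 / z is absorbed by giving up one unit of \<open>q\<close>, whence
  \<open>sqrt (q - 1)\<close>.\<close>

lemma gamma_shape_slope: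
  assumes q: "1 < q" and z: "0 < z"
  shows "exp (q * (ln z - (z - 1))) * \<bar>1 / z - 1\<bar> \<le> exp 1 / sqrt (q - 1)"
proof (cases "z \<le> 1")
  case True
  define t where "t = (1 - z) * sqrt (q - 1)"
  have t: "0 \<le> t" "t\<^sup>2 = (q - 1) * (1 - z)\<^sup>2" using q True by (auto simp: t_def power_mult_distrib)
  have "exp (q * (ln z - (z - 1))) / z = exp (q * (ln z - (z - 1)) - ln z)"
    using z by (simp add: exp_diff)
  also have "q * (ln z - (z - 1)) - ln z = (q - 1) * (ln z - (z - 1)) + (1 - z)"
    by (simp add: algebra_simps)
  also have "\<dots> \<le> (q - 1) * (- (1 - z)\<^sup>2 / 2) + 1"
    using ln_le_below_1[OF z True] q z by (intro add_mono mult_left_mono) auto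
  also have "\<dots> = - t\<^sup>2 / 2 + 1" by (simp add: t)
  finally have "exp (q * (ln z - (z - 1))) / z * (1 - z) \<le> exp (- t\<^sup>2 / 2 + 1) * (1 - z)"
    using True by (intro mult_right_mono) auto
  also have "\<dots> = exp 1 * (t * exp (- t\<^sup>2 / 2)) / sqrt (q - 1)"
  proof -
    have tz: "1 - z = t / sqrt (q - 1)" using q by (simp add: t_def)
    have "exp (- t\<^sup>2 / 2 + 1) = exp 1 * exp (- t\<^sup>2 / 2)" by (simp only: exp_add mult.commute)
    then show ?thesis unfolding tz by simp
  qed
  also have "\<dots> \<le> exp 1 * 1 / sqrt (q - 1)"
    using q mult_exp_neg_square_le[OF t(1)] by (intro divide_right_mono mult_left_mono) auto
  finally show ?thesis using True z by (simp add: abs_if field_simps)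
next
  case False
  define t where "t = (z - 1) * sqrt (q / z)"
  have t: "0 \<le> t" "t\<^sup>2 = q * (z - 1)\<^sup>2 / z" using q False by (auto simp: t_def power_mult_distrib)
  have "q * (ln z - (z - 1)) \<le> q * (- (z - 1)\<^sup>2 / (2 * z))"
    using ln_le_above_1[of z] False q by (intro mult_left_mono) auto
  also have "\<dots> = - t\<^sup>2 / 2" by (simp add: t)
  finally have "exp (q * (ln z - (z - 1))) * ((z - 1) / z) \<le> exp (- t\<^sup>2 / 2) * ((z - 1) / z)"
    using False by (intro mult_right_mono) auto
  moreover have "(z - 1) / z = t / sqrt q * (1 / sqrt z)"
    using q False z by (simp add: t_def real_sqrt_divide field_simps)
  ultimately have "exp (q * (ln z - (z - 1))) * ((z - 1) / z) \<le> exp (- t\<^sup>2 / 2) * (t / sqrt q * (1 / sqrt z))"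
    by simp
  also have "exp (- t\<^sup>2 / 2) * (t / sqrt q * (1 / sqrt z)) = (t * exp (- t\<^sup>2 / 2)) / sqrt q * (1 / sqrt z)"
    by simp
  also have "\<dots> \<le> 1 / sqrt q * 1"
    using q False t mult_exp_neg_square_le[OF t(1)] by (intro mult_mono divide_right_mono) auto
  also have "\<dots> \<le> exp 1 / sqrt (q - 1)"
    using q by (simp, intro frac_le) auto
  finally have "exp (q * (ln z - (z - 1))) * ((z - 1) / z) \<le> exp 1 / sqrt (q - 1)" .
  moreover have "\<bar>1 / z - 1\<bar> = (z - 1) / z" using False by (simp add: abs_if field_simps)
  ultimately show ?thesis by simp
qed

text \<open>Mean value theorem, with the derivative bounded by \<open>gamma_shape_slope\<close> at
  the ratio z = y / (2 q). Negative arguments are replaced by 0, where the function has the same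
  value 0.\<close>

lemma gamma_shape_lipschitz:
  assumes q: "1 < q"
  shows "\<bar>gamma_shape (q + 1) y - gamma_shape (q + 1) y'\<bar>
      \<le> gamma_shape (q + 1) (2 * q) * (exp 1 / (2 * sqrt (q - 1))) * \<bar>y - y'\<bar>"
proof -
  let ?w = "gamma_shape (q + 1)"
  let ?L = "?w (2 * q) * (exp 1 / (2 * sqrt (q - 1)))"
  let ?w' = "\<lambda>y. ?w y * (q / y - 1 / 2)"
  have eq: "?w y = y powr q * exp (- y / 2)" if "0 \<le> y" for y
    using that by (auto simp: gamma_shape_def)
  have der: "(?w has_real_derivative ?w' y) (at y)" if y: "0 < y" for y
  proof -
    have "((\<lambda>y. y powr q * exp (- y / 2)) has_real_derivative ?w' y) (at y)"
      using y by (auto intro!: derivative_eq_intros simp: gamma_shape_def powr_diff field_simps)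
    moreover have "eventually (\<lambda>y. ?w y = y powr q * exp (- y / 2)) (nhds y)"
      using eventually_nhds_in_open[of "{0<..}" y] y by (auto elim!: eventually_mono simp: gamma_shape_def)
    ultimately show ?thesis by (subst DERIV_cong_ev) auto
  qed
  have bd: "\<bar>?w' y\<bar> \<le> ?L" if y: "0 < y" for y
  proof -
    define z where "z = y / (2 * q)"
    have z: "0 < z" "y = 2 * q * z" using q y by (auto simp: z_def)
    have q0: "0 < q" using q by simp
    have "\<bar>?w' y\<bar> = ?w (2 * q) * (exp (q * (ln z - (z - 1))) * \<bar>1 / z - 1\<bar>) / 2"
    proof -
      have "q / (2 * q * z) - 1 / 2 = (1 / z - 1) / 2" using q0 z(1) by (simp add: field_simps)
      then show ?thesis unfolding z(2) gamma_shape_mode[OF q0 z(1)] by (simp only:) (simp add: abs_mult)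
    qed
    also have "\<dots> \<le> ?w (2 * q) * (exp 1 / sqrt (q - 1)) / 2"
      using gamma_shape_slope[OF q z(1)] by (intro divide_right_mono mult_left_mono) auto
    finally show ?thesis by simp
  qed
  have main: "\<bar>?w b - ?w a\<bar> \<le> ?L * (b - a)" if ab: "0 \<le> a" "a < b" for a b
  proof -
    have cont: "continuous_on {a..b} ?w"
    proof (subst continuous_on_cong[OF refl eq])
      show "continuous_on {a..b} (\<lambda>y. y powr q * exp (- y / 2))"
      proof (rule continuous_on_mult)
        show "continuous_on {a..b} (\<lambda>y. y powr q)"
          by (rule continuous_on_powr') (use ab q in \<open>auto intro: continuous_on_id continuous_on_const\<close>)
        show "continuous_on {a..b} (\<lambda>y. exp (- y / 2))" by (intro continuous_intros) auto
      qed
    qed (use ab in auto)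
    obtain \<xi> where \<xi>: "a < \<xi>" "\<xi> < b" "?w b - ?w a = (b - a) * ?w' \<xi>"
    proof (rule mvt[OF ab(2) cont])
      fix x assume "a < x" "x < b"
      then show "(?w has_derivative (\<lambda>h. ?w' x * h)) (at x)"
        using der[of x] ab by (simp only: has_field_derivative_def)
    next
      fix x assume "a < x" "x < b" "?w b - ?w a = ?w' x * (b - a)"
      then show thesis using that[of x] by (simp only: mult.commute)
    qed
    have "\<bar>?w b - ?w a\<bar> = (b - a) * \<bar>?w' \<xi>\<bar>" using \<xi>(3) ab by (simp only: abs_mult)
    also have "\<dots> \<le> (b - a) * ?L" using bd[of \<xi>] \<xi> ab by (intro mult_left_mono) auto
    finally show ?thesis by (simp add: mult.commute)
  qed
  have L: "0 \<le> ?L" using q by simp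
  have pos: "?w y = ?w (max 0 y)" for y by (auto simp: gamma_shape_def max_def)
  have "\<bar>?w (max 0 y) - ?w (max 0 y')\<bar> \<le> ?L * \<bar>max 0 y - max 0 y'\<bar>"
    using main[of "max 0 y" "max 0 y'"] main[of "max 0 y'" "max 0 y"]
    by (cases "max 0 y" "max 0 y'" rule: linorder_cases) (auto simp: abs_minus_commute)
  also have "\<dots> \<le> ?L * \<bar>y - y'\<bar>" using L by (intro mult_left_mono) auto
  finally show ?thesis using pos[of y] pos[of y'] by simp
qed

text \<open>Height of order d^(-1/2) and slope of order 1 / d are what a normal density of variance
  2 d would have. Together they control the law of the sum on bounded intervals, uniformly in their
  location.\<close>

lemma sumsq_density:
  obtains C :: real where "0 < C"
    "\<And>d. 6 \<le> d \<Longrightarrow> \<exists>p. p \<in> borel_measurable borel \<and> (\<forall>y. 0 \<le> p y \<and> p y \<le> C / sqrt d)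
      \<and> (\<forall>y z. \<bar>p y - p z\<bar> \<le> C / d * \<bar>y - z\<bar>)
      \<and> (\<forall>f\<in>borel_measurable borel. (\<integral>\<^sup>+x. f (sumsq d x) \<partial>std_seq) = (\<integral>\<^sup>+y. f y * ennreal (p y) \<partial>lborel))"
proof (rule that[of "exp 2 * 3"])
  show "(0::real) < exp 2 * 3" by simp
  fix d :: nat assume d: "6 \<le> d"
  define q where "q = real d / 2 - 1"
  have q: "1 < q" "real d / 2 = q + 1" "2 \<le> q" "real d \<le> 3 * q" "real d \<le> 6 * (q - 1)" using d by (auto simp: q_def)
  obtain c where c: "0 \<le> c" "\<And>f. f \<in> borel_measurable borel \<Longrightarrow> (\<integral>\<^sup>+x. f (sumsq d x) \<partial>std_seq)
       = (\<integral>\<^sup>+y. f y * ennreal (c * gamma_shape (real d / 2) y) \<partial>lborel)"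
    using nn_integral_sumsq[of d] d by auto
  let ?p = "\<lambda>y. c * gamma_shape (q + 1) y"
  have "(\<integral>\<^sup>+y. ennreal (c * gamma_shape (q + 1) y) \<partial>lborel) = 1"
    using c(2)[of "\<lambda>_. 1"] q by (simp add: std_seq.emeasure_space_1[simplified])
  then have m: "?p (2 * q) \<le> exp 1 / (2 * sqrt q)" using gamma_shape_mode_bound[of q c] q c by simp
  have "exp 1 \<le> exp (2::real)" by simp
  then have e: "exp 1 \<le> exp 2 * (3::real)" using exp_ge_zero[of "2::real"] by linarith
  have sup: "?p y \<le> exp 2 * 3 / sqrt d" for y
  proof -
    have "?p y \<le> ?p (2 * q)" using gamma_shape_le_mode[of q y] q c by (intro mult_left_mono) auto
    also have "\<dots> \<le> exp 1 / (2 * sqrt q)" by fact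
    also have "\<dots> \<le> exp 2 * 3 / sqrt d"
    proof -
      have "sqrt d \<le> sqrt (4 * q)" using q by simp
      also have "\<dots> = 2 * sqrt q" by (simp add: real_sqrt_mult)
      finally show ?thesis using d e by (intro frac_le) auto
    qed
    finally show ?thesis .
  qed
  have lip: "\<bar>?p y - ?p z\<bar> \<le> exp 2 * 3 / d * \<bar>y - z\<bar>" for y z
  proof -
    have "\<bar>?p y - ?p z\<bar> = c * \<bar>gamma_shape (q + 1) y - gamma_shape (q + 1) z\<bar>"
      using c by (simp add: abs_mult flip: right_diff_distrib)
    also have "\<dots> \<le> c * (gamma_shape (q + 1) (2 * q) * (exp 1 / (2 * sqrt (q - 1))) * \<bar>y - z\<bar>)"
      using gamma_shape_lipschitz[OF q(1)] c by (intro mult_left_mono) auto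
    also have "\<dots> = ?p (2 * q) * (exp 1 / (2 * sqrt (q - 1))) * \<bar>y - z\<bar>" by simp
    also have "\<dots> \<le> exp 1 / (2 * sqrt q) * (exp 1 / (2 * sqrt (q - 1))) * \<bar>y - z\<bar>"
      using m q by (intro mult_right_mono) auto
    also have "\<dots> \<le> exp 2 * 3 / d * \<bar>y - z\<bar>"
    proof (intro mult_right_mono)
      have "exp 1 / (2 * sqrt q) * (exp 1 / (2 * sqrt (q - 1))) = exp 2 / (4 * sqrt q * sqrt (q - 1))"
        by (simp flip: exp_add)
      also have "\<dots> \<le> exp 2 / (4 * sqrt (q - 1) * sqrt (q - 1))"
        using q by (intro divide_left_mono mult_mono mult_pos_pos) auto
      also have "\<dots> = exp 2 / (4 * (q - 1))" using q by (simp add: mult.assoc)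
      also have "\<dots> \<le> exp 2 * 3 / d"
        using q d by (simp add: field_simps)
      finally show "exp 1 / (2 * sqrt q) * (exp 1 / (2 * sqrt (q - 1))) \<le> exp 2 * 3 / d" .
    qed auto
    finally show ?thesis .
  qed
  show "\<exists>p. p \<in> borel_measurable borel \<and> (\<forall>y. 0 \<le> p y \<and> p y \<le> exp 2 * 3 / sqrt d)
      \<and> (\<forall>y z. \<bar>p y - p z\<bar> \<le> exp 2 * 3 / d * \<bar>y - z\<bar>)
      \<and> (\<forall>f\<in>borel_measurable borel. (\<integral>\<^sup>+x. f (sumsq d x) \<partial>std_seq) = (\<integral>\<^sup>+y. f y * ennreal (p y) \<partial>lborel))"
    by (rule exI[of _ ?p]) (use c sup lip q in auto)
qed

section \<open>The Helmert transformation\<close>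

lemma measurable_comb_seq_std':
  assumes "f \<in> N \<rightarrow>\<^sub>M std_seq" "g \<in> N \<rightarrow>\<^sub>M std_seq"
  shows "(\<lambda>x. comb_seq i (f x) (g x)) \<in> N \<rightarrow>\<^sub>M std_seq"
  using assms unfolding std_seq_eq by (rule measurable_comb_seq')

lemma measurable_std_const:
  assumes "f \<in> borel_measurable N"
  shows "(\<lambda>x _. f x) \<in> N \<rightarrow>\<^sub>M std_seq"
  using assms unfolding std_seq_eq by (intro measurable_PiM_single') (auto simp: space_PiM)

lemma measurable_case_nat_std:
  assumes "f \<in> borel_measurable N" "g \<in> N \<rightarrow>\<^sub>M std_seq"
  shows "(\<lambda>x. case_nat (f x) (g x)) \<in> N \<rightarrow>\<^sub>M std_seq"
  using measurable_comb_seq_std'[OF measurable_std_const[OF assms(1)] assms(2), of "Suc 0"]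
  by (simp only: comb_seq_Suc_0)

lemma nn_integral_std_cons:
  assumes f: "f \<in> borel_measurable std_seq"
  shows "(\<integral>\<^sup>+x. f x \<partial>std_seq) = (\<integral>\<^sup>+a. \<integral>\<^sup>+x. f (case_nat a x) \<partial>std_seq \<partial>std_normal)"
proof -
  have m: "(\<lambda>z. case_nat (fst z) (snd z)) \<in> std_normal \<Otimes>\<^sub>M std_seq \<rightarrow>\<^sub>M std_seq"
  proof (rule measurable_case_nat_std)
    have "fst \<in> std_normal \<Otimes>\<^sub>M std_seq \<rightarrow>\<^sub>M std_normal" by (rule measurable_fst)
    then show "fst \<in> borel_measurable (std_normal \<Otimes>\<^sub>M std_seq)"
      using measurable_cong_sets[of "std_normal \<Otimes>\<^sub>M std_seq" _ std_normal borel] by simp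
  qed (rule measurable_snd)
  have "distr (std_normal \<Otimes>\<^sub>M std_seq) std_seq (\<lambda>z. case_nat (fst z) (snd z)) = std_seq"
    using std.PiM_iter unfolding std_seq_eq split_beta' .
  then have "(\<integral>\<^sup>+x. f x \<partial>std_seq) = (\<integral>\<^sup>+z. f (case_nat (fst z) (snd z)) \<partial>(std_normal \<Otimes>\<^sub>M std_seq))"
    using nn_integral_distr[OF m, of f] f by simp
  also have "\<dots> = (\<integral>\<^sup>+a. \<integral>\<^sup>+x. f (case_nat a x) \<partial>std_seq \<partial>std_normal)"
    using std_seq.nn_integral_fst[of "\<lambda>z. f (case_nat (fst z) (snd z))" std_normal]
      measurable_compose[OF m f] by simp
  finally show ?thesis .
qed

text \<open>The map is orthogonal, a reflection of the plane, and so preserves the product density.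
  The change of variables is carried out one coordinate at a time, with the Jacobians
  \<open>1 / \<alpha>\<close> and \<open>\<alpha>\<close>, hence the condition on \<alpha>.\<close>

lemma nn_integral_rotate_normal:
  fixes f :: "real \<Rightarrow> real \<Rightarrow> ennreal" and \<alpha> \<beta> :: real
  assumes [measurable]: "case_prod f \<in> borel_measurable (borel \<Otimes>\<^sub>M borel)"
    and \<alpha>: "\<alpha> \<noteq> 0" and 1: "\<alpha>\<^sup>2 + \<beta>\<^sup>2 = 1"
  shows "(\<integral>\<^sup>+a. \<integral>\<^sup>+b. f (\<alpha> * b - \<beta> * a) (\<alpha> * a + \<beta> * b) \<partial>std_normal \<partial>std_normal)
       = (\<integral>\<^sup>+a. \<integral>\<^sup>+b. f a b \<partial>std_normal \<partial>std_normal)"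
proof -
  define H where "H u v = f u v * ennreal (std_normal_density u * std_normal_density v)" for u v
  have [measurable]: "case_prod H \<in> borel_measurable (borel \<Otimes>\<^sub>M borel)"
    unfolding H_def[abs_def] by measurable
  have dens: "(\<integral>\<^sup>+a. \<integral>\<^sup>+b. F a b \<partial>std_normal \<partial>std_normal)
      = (\<integral>\<^sup>+a. \<integral>\<^sup>+b. F a b * ennreal (std_normal_density a * std_normal_density b) \<partial>lborel \<partial>lborel)"
    if [measurable]: "case_prod F \<in> borel_measurable (borel \<Otimes>\<^sub>M borel)" for F :: "real \<Rightarrow> real \<Rightarrow> ennreal"
    by (simp add: nn_integral_density nn_integral_cmult[symmetric] ennreal_mult mult_ac)
  have norm: "std_normal_density (\<alpha> * b - \<beta> * a) * std_normal_density (\<alpha> * a + \<beta> * b)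
      = std_normal_density a * std_normal_density b" for a b
  proof -
    have "(\<alpha> * b - \<beta> * a)\<^sup>2 + (\<alpha> * a + \<beta> * b)\<^sup>2 = (\<alpha>\<^sup>2 + \<beta>\<^sup>2) * (a\<^sup>2 + b\<^sup>2)"
      by (simp add: power2_eq_square algebra_simps)
    then have "(\<alpha> * b - \<beta> * a)\<^sup>2 + (\<alpha> * a + \<beta> * b)\<^sup>2 = a\<^sup>2 + b\<^sup>2" by (simp add: 1)
    then have "exp (- (\<alpha> * b - \<beta> * a)\<^sup>2 / 2) * exp (- (\<alpha> * a + \<beta> * b)\<^sup>2 / 2) = exp (- a\<^sup>2 / 2) * exp (- b\<^sup>2 / 2)"
      by (simp add: field_simps flip: exp_add)
    then show ?thesis by (simp add: std_normal_density_def mult_ac)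
  qed
  have v: "\<alpha> * a + \<beta> * (\<beta> * a / \<alpha> + 1 / \<alpha> * u) = (a + \<beta> * u) / \<alpha>" for a u
  proof -
    have "\<alpha> * a + \<beta> * (\<beta> * a / \<alpha> + 1 / \<alpha> * u) = ((\<alpha>\<^sup>2 + \<beta>\<^sup>2) * a + \<beta> * u) / \<alpha>"
      using \<alpha> by (simp add: field_simps power2_eq_square)
    then show ?thesis by (simp add: 1)
  qed
  have "(\<integral>\<^sup>+a. \<integral>\<^sup>+b. f (\<alpha> * b - \<beta> * a) (\<alpha> * a + \<beta> * b) \<partial>std_normal \<partial>std_normal)
      = (\<integral>\<^sup>+a. \<integral>\<^sup>+b. H (\<alpha> * b - \<beta> * a) (\<alpha> * a + \<beta> * b) \<partial>lborel \<partial>lborel)"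
    by (subst dens) (simp_all add: H_def norm)
  also have "\<dots> = (\<integral>\<^sup>+a. \<bar>1 / \<alpha>\<bar> * (\<integral>\<^sup>+u. H u ((a + \<beta> * u) / \<alpha>) \<partial>lborel) \<partial>lborel)"
  proof (rule nn_integral_cong)
    fix a :: real
    have "\<alpha> * (\<beta> * a / \<alpha> + 1 / \<alpha> * u) - \<beta> * a = u" for u using \<alpha> by (simp add: field_simps)
    then show "(\<integral>\<^sup>+b. H (\<alpha> * b - \<beta> * a) (\<alpha> * a + \<beta> * b) \<partial>lborel) = \<bar>1 / \<alpha>\<bar> * (\<integral>\<^sup>+u. H u ((a + \<beta> * u) / \<alpha>) \<partial>lborel)"
      using \<alpha> by (subst nn_integral_real_affine[where c = "1 / \<alpha>" and t = "\<beta> * a / \<alpha>"]) (simp_all only: v, simp_all)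
  qed
  also have "\<dots> = \<bar>1 / \<alpha>\<bar> * (\<integral>\<^sup>+u. \<integral>\<^sup>+a. H u ((a + \<beta> * u) / \<alpha>) \<partial>lborel \<partial>lborel)"
    by (subst nn_integral_cmult, measurable) (subst lborel_pair.Fubini', simp_all)
  also have "\<dots> = \<bar>1 / \<alpha>\<bar> * (\<integral>\<^sup>+u. \<bar>\<alpha>\<bar> * (\<integral>\<^sup>+v. H u v \<partial>lborel) \<partial>lborel)"
  proof -
    have "(\<integral>\<^sup>+a. H u ((a + \<beta> * u) / \<alpha>) \<partial>lborel) = \<bar>\<alpha>\<bar> * (\<integral>\<^sup>+v. H u v \<partial>lborel)" for u
      using \<alpha> by (subst nn_integral_real_affine[where c = \<alpha> and t = "- \<beta> * u"]) simp_all
    then show ?thesis by simp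
  qed
  also have "\<dots> = \<bar>1 / \<alpha>\<bar> * (\<bar>\<alpha>\<bar> * (\<integral>\<^sup>+u. \<integral>\<^sup>+v. H u v \<partial>lborel \<partial>lborel))"
    by (subst nn_integral_cmult) (simp_all del: nn_integral_cmult)
  also have "\<dots> = (\<integral>\<^sup>+u. \<integral>\<^sup>+v. H u v \<partial>lborel \<partial>lborel)"
  proof -
    have "ennreal \<bar>1 / \<alpha>\<bar> * ennreal \<bar>\<alpha>\<bar> = 1"
      using \<alpha> by (simp add: field_simps flip: ennreal_mult'' abs_mult)
    then show ?thesis by (simp add: mult.assoc[symmetric])
  qed
  also have "\<dots> = (\<integral>\<^sup>+a. \<integral>\<^sup>+b. f a b \<partial>std_normal \<partial>std_normal)"
    by (subst dens) (simp_all add: H_def[abs_def])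
  finally show ?thesis .
qed

definition rotate_coords :: "real \<Rightarrow> real \<Rightarrow> nat \<Rightarrow> (nat \<Rightarrow> real) \<Rightarrow> nat \<Rightarrow> real" where
  "rotate_coords \<alpha> \<beta> n x = x(n := \<alpha> * x (Suc n) - \<beta> * x n, Suc n := \<alpha> * x n + \<beta> * x (Suc n))"

lemma measurable_rotate_coords [measurable]: "rotate_coords \<alpha> \<beta> n \<in> std_seq \<rightarrow>\<^sub>M std_seq"
  unfolding std_seq_eq rotate_coords_def[abs_def] fun_upd_def
  by (rule measurable_PiM_single') (auto simp: space_PiM)

lemma rotate_coords_comb_seq:
  "rotate_coords \<alpha> \<beta> n (comb_seq n x (case_nat a (case_nat b y)))
     = comb_seq n x (case_nat (\<alpha> * b - \<beta> * a) (case_nat (\<alpha> * a + \<beta> * b) y))"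
proof
  fix i
  consider "i < n" | "i = n" | "i = Suc n" | k where "i = Suc (Suc (k + n))"
    by (metis less_antisym linorder_neqE_nat less_natE add.commute)
  then show "rotate_coords \<alpha> \<beta> n (comb_seq n x (case_nat a (case_nat b y))) i
     = comb_seq n x (case_nat (\<alpha> * b - \<beta> * a) (case_nat (\<alpha> * a + \<beta> * b) y)) i"
    by cases (auto simp: rotate_coords_def comb_seq_def Suc_diff_le)
qed

text \<open>The two coordinates concerned are split off between an untouched initial segment and an
  untouched tail, which reduces the claim to the plane.\<close>

lemma nn_integral_rotate_coords:
  assumes f: "f \<in> borel_measurable std_seq" and \<alpha>: "\<alpha> \<noteq> 0" and 1: "\<alpha>\<^sup>2 + \<beta>\<^sup>2 = 1"
  shows "(\<integral>\<^sup>+x. f (rotate_coords \<alpha> \<beta> n x) \<partial>std_seq) = (\<integral>\<^sup>+x. f x \<partial>std_seq)"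
proof -
  have split: "(\<integral>\<^sup>+x. F x \<partial>std_seq) = (\<integral>\<^sup>+x. \<integral>\<^sup>+a. \<integral>\<^sup>+b. \<integral>\<^sup>+y. F (comb_seq n x (case_nat a (case_nat b y))) \<partial>std_seq \<partial>std_normal \<partial>std_normal \<partial>std_seq)"
    if F: "F \<in> borel_measurable std_seq" for F
  proof -
    have "(\<integral>\<^sup>+y. F (comb_seq n x y) \<partial>std_seq)
        = (\<integral>\<^sup>+a. \<integral>\<^sup>+b. \<integral>\<^sup>+y. F (comb_seq n x (case_nat a (case_nat b y))) \<partial>std_seq \<partial>std_normal \<partial>std_normal)" for x
    proof -
      have G: "(\<lambda>y. F (comb_seq n x y)) \<in> borel_measurable std_seq"
        by (rule measurable_compose[OF measurable_comb_seq_std' F]) simp_all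
      have "(\<lambda>y. F (comb_seq n x (case_nat a y))) \<in> borel_measurable std_seq" for a
        by (rule measurable_compose[OF measurable_case_nat_std G]) simp_all
      then have "(\<integral>\<^sup>+y. F (comb_seq n x (case_nat a y)) \<partial>std_seq) = (\<integral>\<^sup>+b. \<integral>\<^sup>+y. F (comb_seq n x (case_nat a (case_nat b y))) \<partial>std_seq \<partial>std_normal)" for a
        by (rule nn_integral_std_cons)
      then show ?thesis by (subst nn_integral_std_cons[OF G]) simp
    qed
    then show ?thesis by (subst nn_integral_std_split[OF F, of n]) simp
  qed
  have "(\<integral>\<^sup>+x. f (rotate_coords \<alpha> \<beta> n x) \<partial>std_seq)
      = (\<integral>\<^sup>+x. \<integral>\<^sup>+a. \<integral>\<^sup>+b. \<integral>\<^sup>+y. f (comb_seq n x (case_nat (\<alpha> * b - \<beta> * a) (case_nat (\<alpha> * a + \<beta> * b) y))) \<partial>std_seq \<partial>std_normal \<partial>std_normal \<partial>std_seq)"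
    by (subst split[OF measurable_compose[OF measurable_rotate_coords f]]) (simp only: rotate_coords_comb_seq)
  also have "\<dots> = (\<integral>\<^sup>+x. \<integral>\<^sup>+a. \<integral>\<^sup>+b. \<integral>\<^sup>+y. f (comb_seq n x (case_nat a (case_nat b y))) \<partial>std_seq \<partial>std_normal \<partial>std_normal \<partial>std_seq)"
  proof (rule nn_integral_cong)
    fix x
    have "(\<lambda>z. f (comb_seq n x (case_nat (fst (fst z)) (case_nat (snd (fst z)) (snd z)))))
        \<in> borel_measurable ((borel \<Otimes>\<^sub>M borel) \<Otimes>\<^sub>M std_seq)"
      by (intro measurable_compose[OF _ f] measurable_comb_seq_std' measurable_case_nat_std) simp_all
    then have "(\<lambda>z. \<integral>\<^sup>+y. f (comb_seq n x (case_nat (fst z) (case_nat (snd z) y))) \<partial>std_seq)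
        \<in> borel_measurable (borel \<Otimes>\<^sub>M borel)"
      using std_seq.borel_measurable_nn_integral[of "\<lambda>z y. f (comb_seq n x (case_nat (fst z) (case_nat (snd z) y)))"]
      by (simp add: split_beta')
    then show "(\<integral>\<^sup>+a. \<integral>\<^sup>+b. \<integral>\<^sup>+y. f (comb_seq n x (case_nat (\<alpha> * b - \<beta> * a) (case_nat (\<alpha> * a + \<beta> * b) y))) \<partial>std_seq \<partial>std_normal \<partial>std_normal)
        = (\<integral>\<^sup>+a. \<integral>\<^sup>+b. \<integral>\<^sup>+y. f (comb_seq n x (case_nat a (case_nat b y))) \<partial>std_seq \<partial>std_normal \<partial>std_normal)"
      using nn_integral_rotate_normal[of "\<lambda>a b. \<integral>\<^sup>+y. f (comb_seq n x (case_nat a (case_nat b y))) \<partial>std_seq", OF _ \<alpha> 1]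
      by (simp add: split_beta')
  qed
  also have "\<dots> = (\<integral>\<^sup>+x. f x \<partial>std_seq)" by (rule split[OF f, symmetric])
  finally show ?thesis .
qed

text \<open>After \<open>n\<close> steps, coordinate \<open>n\<close> carries the normalised sum of \<open>x 0, \<dots>, x n\<close> and the coordinates
  below \<open>n\<close> carry the Helmert contrasts, which no longer change.\<close>

primrec helmert :: "nat \<Rightarrow> (nat \<Rightarrow> real) \<Rightarrow> nat \<Rightarrow> real" where
  "helmert 0 x = x"
| "helmert (Suc n) x = rotate_coords (sqrt (real (Suc n) / real (Suc (Suc n)))) (sqrt (1 / real (Suc (Suc n)))) n (helmert n x)"

lemma measurable_helmert [measurable]: "helmert n \<in> std_seq \<rightarrow>\<^sub>M std_seq"
proof (induction n)
  case 0
  show ?case unfolding helmert.simps by (rule measurable_ident_sets[OF refl])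
next
  case (Suc n)
  show ?case unfolding helmert.simps by (rule measurable_compose[OF Suc measurable_rotate_coords])
qed

lemma nn_integral_helmert:
  assumes "f \<in> borel_measurable std_seq"
  shows "(\<integral>\<^sup>+x. f (helmert n x) \<partial>std_seq) = (\<integral>\<^sup>+x. f x \<partial>std_seq)"
  using assms
proof (induction n arbitrary: f)
  case (Suc n)
  let ?a = "sqrt (real (Suc n) / real (Suc (Suc n)))" and ?b = "sqrt (1 / real (Suc (Suc n)))"
  have "(\<integral>\<^sup>+x. f (helmert (Suc n) x) \<partial>std_seq) = (\<integral>\<^sup>+x. f (rotate_coords ?a ?b n x) \<partial>std_seq)"
    unfolding helmert.simps by (rule Suc.IH[OF measurable_compose[OF measurable_rotate_coords Suc.prems]])
  also have "\<dots> = (\<integral>\<^sup>+x. f x \<partial>std_seq)"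
    by (rule nn_integral_rotate_coords[OF Suc.prems]) (simp_all add: field_simps)
  finally show ?case .
qed simp

lemma helmert_above: "n < i \<Longrightarrow> helmert n x i = x i"
  by (induction n) (auto simp: rotate_coords_def)

lemma helmert_diag: "helmert n x n = (\<Sum>i\<le>n. x i) / sqrt (real (Suc n))"
proof (induction n)
  case (Suc n)
  have "helmert (Suc n) x (Suc n) = sqrt (real (Suc n) / real (Suc (Suc n))) * helmert n x n
      + sqrt (1 / real (Suc (Suc n))) * x (Suc n)"
    by (simp add: rotate_coords_def helmert_above)
  also have "\<dots> = (\<Sum>i\<le>Suc n. x i) / sqrt (real (Suc (Suc n)))"
    unfolding Suc real_sqrt_divide by (simp add: add_divide_distrib)
  finally show ?case .
qed simp

lemma helmert_stable: "i < n \<Longrightarrow> n \<le> n' \<Longrightarrow> helmert n' x i = helmert n x i"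
proof (induction "n' - n" arbitrary: n')
  case (Suc d)
  then obtain l where l: "n' = Suc l" "d = l - n" "n \<le> l" by (cases n') auto
  have "helmert n' x i = helmert l x i" using Suc.prems l by (simp add: rotate_coords_def)
  with Suc.hyps(1)[of l] Suc.prems l show ?case by simp
qed simp

lemma sumsq_helmert: "sumsq (Suc n) (helmert n x) = sumsq (Suc n) x"
proof (induction n)
  case (Suc n)
  define a b where "a = sqrt (real (Suc n) / real (Suc (Suc n)))" and "b = sqrt (1 / real (Suc (Suc n)))"
  have ab: "a\<^sup>2 + b\<^sup>2 = 1" by (simp add: a_def b_def field_simps)
  let ?y = "helmert n x"
  have eq: "sumsq n (rotate_coords a b n ?y) = sumsq n ?y"
    by (auto simp: sumsq_def rotate_coords_def)
  have "(a * ?y (Suc n) - b * ?y n)\<^sup>2 + (a * ?y n + b * ?y (Suc n))\<^sup>2 = (a\<^sup>2 + b\<^sup>2) * ((?y n)\<^sup>2 + (?y (Suc n))\<^sup>2)"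
    by (simp add: power2_eq_square algebra_simps)
  then have "sumsq (Suc (Suc n)) (rotate_coords a b n ?y) = sumsq (Suc (Suc n)) ?y"
    unfolding sumsq_Suc eq by (simp add: rotate_coords_def ab)
  also have "\<dots> = sumsq (Suc (Suc n)) x"
    using Suc by (simp add: sumsq_Suc[of "Suc n"] helmert_above)
  finally show ?case by (simp add: a_def b_def)
qed simp

text \<open>Orthogonality preserves the total sum of squares, and coordinate \<open>n\<close> holds
  exactly the part due to the mean; the contrasts keep the centred sum of squares.\<close>

lemma sumsq_helmert_eq:
  "sumsq n (helmert n x) = sumsq (Suc n) x - (\<Sum>i\<le>n. x i)\<^sup>2 / real (Suc n)"
  using sumsq_helmert[of n x] by (simp add: sumsq_Suc[of n "helmert n x"] helmert_diag power_divide)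

lemma sumsq_helmert_stable: "d \<le> n \<Longrightarrow> n \<le> n' \<Longrightarrow> sumsq d (helmert n' x) = sumsq d (helmert n x)"
  unfolding sumsq_def by (intro sum.cong refl) (simp add: helmert_stable[of _ n n'])

text \<open>The shift by one discards coordinate 0, which the sample never uses, and aligns the
  observations with coordinates counted from 0.\<close>

definition standardize :: "real \<Rightarrow> real \<Rightarrow> (nat \<Rightarrow> real) \<Rightarrow> nat \<Rightarrow> real" where
  "standardize \<mu> \<sigma> x i = (x (Suc i) - \<mu>) / \<sigma>"

lemma measurable_standardize [measurable]: "standardize \<mu> \<sigma> \<in> normal_seq_space \<mu> \<sigma> \<rightarrow>\<^sub>M std_seq"
  unfolding standardize_def[abs_def] normal_seq_space_def
  by (rule measurable_PiM_single') (auto simp: space_PiM)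

text \<open>Checked on finite-dimensional rectangles: the preimage of a rectangle over
  \<open>J\<close> is one over the shifted index set.\<close>

lemma distr_standardize:
  assumes "0 < \<sigma>"
  shows "distr (normal_seq_space \<mu> \<sigma>) std_seq (standardize \<mu> \<sigma>) = std_seq"
proof -
  let ?M = "\<lambda>_::nat. density lborel (normal_density \<mu> \<sigma>)"
  interpret N: prob_space "density lborel (normal_density \<mu> \<sigma>)"
    by (rule prob_space_normal_density) fact
  interpret P: product_prob_space ?M UNIV by unfold_locales
  have "distributed (density lborel (normal_density \<mu> \<sigma>)) lborel (\<lambda>x. x) (normal_density \<mu> \<sigma>)"
    by (simp add: distributed_def distr_id2)
  then have "distributed (density lborel (normal_density \<mu> \<sigma>)) lborel (\<lambda>x. (x - \<mu>) / \<sigma>) std_normal_density"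
    using N.normal_standard_normal_convert[of \<sigma> "\<lambda>x. x" \<mu>] assms by simp
  then have one: "emeasure (density lborel (normal_density \<mu> \<sigma>)) ((\<lambda>x. (x - \<mu>) / \<sigma>) -` E) = emeasure std_normal E"
    if "E \<in> sets borel" for E
    using that emeasure_distr[of "\<lambda>x. (x - \<mu>) / \<sigma>" "density lborel (normal_density \<mu> \<sigma>)" lborel E]
    by (simp add: distributed_def)
  have "distr (normal_seq_space \<mu> \<sigma>) (PiM UNIV (\<lambda>_. std_normal)) (standardize \<mu> \<sigma>) = PiM UNIV (\<lambda>_. std_normal)" (is "?D = _")
  proof (rule std.PiM_eq)
    fix J :: "nat set" and E :: "nat \<Rightarrow> real set"
    assume J: "finite J" "J \<subseteq> UNIV" "\<And>j. j \<in> J \<Longrightarrow> E j \<in> sets std_normal"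
    have E[measurable]: "j \<in> J \<Longrightarrow> E j \<in> sets borel" for j using J(3) by simp
    let ?X = "prod_emb UNIV (\<lambda>_. std_normal) J (\<Pi>\<^sub>E j\<in>J. E j)"
    let ?F = "\<lambda>j. (\<lambda>x. (x - \<mu>) / \<sigma>) -` E (j - 1)"
    have pre: "standardize \<mu> \<sigma> -` ?X \<inter> space (normal_seq_space \<mu> \<sigma>) = prod_emb UNIV ?M (Suc ` J) (\<Pi>\<^sub>E j\<in>Suc ` J. ?F j)"
      by (auto simp: prod_emb_def standardize_def PiE_iff space_PiM)
    have F: "?F j \<in> sets (?M j)" if "j \<in> Suc ` J" for j
      using that by (auto intro!: measurable_sets_borel[of _ borel])
    have "emeasure ?D ?X = emeasure (normal_seq_space \<mu> \<sigma>) (standardize \<mu> \<sigma> -` ?X \<inter> space (normal_seq_space \<mu> \<sigma>))"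
      by (rule emeasure_distr) (use J measurable_standardize in \<open>auto simp: std_seq_eq intro!: sets_PiM_I\<close>)
    also have "\<dots> = (\<Prod>j\<in>Suc ` J. emeasure (?M j) (?F j))"
      unfolding pre unfolding normal_seq_space_def using J F by (intro P.emeasure_PiM_emb) auto
    also have "\<dots> = (\<Prod>j\<in>J. emeasure std_normal (E j))"
      by (subst prod.reindex) (auto simp: one E)
    finally show "emeasure ?D ?X = (\<Prod>j\<in>J. emeasure std_normal (E j))" .
  qed simp
  then show ?thesis by (simp add: std_seq_eq)
qed

lemma nn_integral_helmert_standardize:
  assumes "0 < \<sigma>" and "f \<in> borel_measurable std_seq"
  shows "(\<integral>\<^sup>+x. f (helmert n (standardize \<mu> \<sigma> x)) \<partial>normal_seq_space \<mu> \<sigma>) = (\<integral>\<^sup>+x. f x \<partial>std_seq)"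
proof -
  have "(\<integral>\<^sup>+x. f (helmert n (standardize \<mu> \<sigma> x)) \<partial>normal_seq_space \<mu> \<sigma>)
      = (\<integral>\<^sup>+x. f (helmert n x) \<partial>(distr (normal_seq_space \<mu> \<sigma>) std_seq (standardize \<mu> \<sigma>)))"
    by (subst nn_integral_distr[OF measurable_standardize])
       (use measurable_compose[OF measurable_helmert assms(2)] in simp_all)
  also have "\<dots> = (\<integral>\<^sup>+x. f x \<partial>std_seq)"
    unfolding distr_standardize[OF assms(1)] by (rule nn_integral_helmert[OF assms(2)])
  finally show ?thesis .
qed

lemma sample_mean_standardize:
  assumes "0 < \<sigma>"
  shows "sample_mean (Suc n) x - \<mu> = \<sigma> * helmert n (standardize \<mu> \<sigma> x) n / sqrt (real (Suc n))"
proof -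
  have "(\<Sum>i\<le>n. standardize \<mu> \<sigma> x i) = ((\<Sum>i=1..Suc n. x i) - real (Suc n) * \<mu>) / \<sigma>"
    unfolding standardize_def sum_divide_distrib[symmetric]
    by (simp add: sum_subtractf sum.atLeast1_atMost_eq flip: lessThan_Suc_atMost)
  then show ?thesis using assms
    by (simp add: sample_mean_def helmert_diag field_simps)
qed

lemma sample_sd_standardize:
  assumes "0 < \<sigma>"
  shows "sample_sd (Suc n) x = \<sigma> * sqrt (sumsq n (helmert n (standardize \<mu> \<sigma> x)) / real n)"
proof -
  let ?\<xi> = "standardize \<mu> \<sigma> x" and ?m = "sample_mean (Suc n) x"
  \<comment> \<open>\<open>c\<close> is the mean of the standardised observations; expanding the
    squares around it produces the expression in \<open>sumsq_helmert_eq\<close>.\<close>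
  define c where "c = (?m - \<mu>) / \<sigma>"
  have m: "(\<Sum>i\<le>n. ?\<xi> i) = real (Suc n) * c"
    using assms sample_mean_standardize[OF assms, of n x \<mu>] by (simp add: c_def helmert_diag field_simps)
  have "(\<Sum>i=1..Suc n. (x i - ?m)\<^sup>2) = (\<Sum>i\<le>n. (x (Suc i) - ?m)\<^sup>2)"
    by (simp add: sum.atLeast1_atMost_eq flip: lessThan_Suc_atMost)
  also have "\<dots> = (\<Sum>i\<le>n. \<sigma>\<^sup>2 * ((?\<xi> i)\<^sup>2 - (2 * c) * ?\<xi> i + c\<^sup>2))"
    using assms by (intro sum.cong refl) (simp add: c_def standardize_def power2_eq_square field_simps)
  also have "\<dots> = \<sigma>\<^sup>2 * ((\<Sum>i\<le>n. (?\<xi> i)\<^sup>2) - (2 * c) * (\<Sum>i\<le>n. ?\<xi> i) + real (Suc n) * c\<^sup>2)"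
    by (simp add: sum_distrib_left[symmetric] sum.distrib sum_subtractf)
  also have "\<dots> = \<sigma>\<^sup>2 * sumsq n (helmert n ?\<xi>)"
    unfolding sumsq_helmert_eq m by (simp add: sumsq_def lessThan_Suc_atMost power2_eq_square field_simps)
  finally show ?thesis using assms
    by (simp add: sample_sd_def real_sqrt_mult real_sqrt_divide)
qed

section \<open>Spitzer's identity and overshoots of a random walk\<close>

text \<open>Being the identity beyond \<open>N\<close> makes it injective on all of
  \<open>nat\<close>, as \<open>distr_std_reindex\<close> requires.\<close>

definition cycle_map :: "nat \<Rightarrow> nat \<Rightarrow> nat \<Rightarrow> nat" where
  "cycle_map N c i = (if i + c < N then i + c else if i < N then i + c - N else i)"

lemma inj_cycle_map: "c \<le> N \<Longrightarrow> inj (cycle_map N c)"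
  unfolding inj_def cycle_map_def by (auto split: if_splits)

lemma sumsq_permute:
  assumes "inj \<pi>" "\<And>i. i < N \<Longrightarrow> \<pi> i < N"
  shows "sumsq N (\<lambda>i. x (\<pi> i)) = sumsq N x"
proof -
  have "\<pi> ` {..<N} = {..<N}"
    by (intro endo_inj_surj) (use assms in \<open>auto intro: inj_on_subset\<close>)
  then have "bij_betw \<pi> {..<N} {..<N}"
    using assms by (auto simp: bij_betw_def intro: inj_on_subset)
  then show ?thesis
    unfolding sumsq_def by (rule sum.reindex_bij_betw)
qed

lemma sumsq_cycle:
  "c \<le> N \<Longrightarrow> sumsq N (\<lambda>i. x (cycle_map N c i)) = sumsq N x"
  by (intro sumsq_permute inj_cycle_map) (auto simp: cycle_map_def)

lemma sumsq_cycle_less: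
  "e + c \<le> N \<Longrightarrow> sumsq e (\<lambda>i. x (cycle_map N c i)) = sumsq e (\<lambda>i. x (i + c))"
  by (simp add: sumsq_def cycle_map_def)

text \<open>The drift \<open>3 k\<close> is the slope of the stopping boundary, per block of \<open>k\<close> coordinates, where it meets the
  mean of the sum of squares.\<close>

definition walk :: "nat \<Rightarrow> nat \<Rightarrow> (nat \<Rightarrow> real) \<Rightarrow> real" where
  "walk k i x = sumsq (k * i) x - 3 * real (k * i)"

definition walk_max :: "nat \<Rightarrow> nat \<Rightarrow> (nat \<Rightarrow> real) \<Rightarrow> real" where
  "walk_max k n x = Max ((\<lambda>i. walk k i x) ` {..n})"

lemma measurable_walk [measurable]: "walk k i \<in> borel_measurable std_seq"
  unfolding walk_def[abs_def] by measurable

lemma walk_0 [simp]: "walk k 0 x = 0" by (simp add: walk_def)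

lemma walk_shift: "walk k i (\<lambda>j. x (j + k * b)) = walk k (b + i) x - walk k b x"
  using sumsq_add[of "k * b" "k * i" x] by (simp add: walk_def algebra_simps)

lemma walk_max_0 [simp]: "walk_max k 0 x = 0" by (simp add: walk_max_def)

lemma walk_max_Suc: "walk_max k (Suc n) x = max (walk k (Suc n) x) (walk_max k n x)"
  unfolding walk_max_def by (simp add: atMost_Suc)

text \<open>Pathwise form of Lindley's recursion: either the maximum is attained at time 0, or the
  first step is taken and the walk restarts from there.\<close>

lemma walk_max_Suc': "walk_max k (Suc n) x = max 0 (walk k 1 x + walk_max k n (\<lambda>j. x (j + k)))"
proof (induction n)
  case (Suc n)
  have "walk k 1 x + walk k (Suc n) (\<lambda>j. x (j + k)) = walk k (Suc (Suc n)) x"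
    using walk_shift[of k "Suc n" x 1] by simp
  then show ?case
    unfolding walk_max_Suc[of k "Suc n" x] Suc walk_max_Suc[of k n "\<lambda>j. x (j + k)"] by (auto simp: max_def)
qed (simp add: walk_max_Suc max.commute)

lemma measurable_walk_max [measurable]: "walk_max k n \<in> borel_measurable std_seq"
  by (induction n) (simp_all add: walk_max_Suc[abs_def])

lemma walk_max_nonneg: "0 \<le> walk_max k n x"
  by (induction n) (simp_all add: walk_max_Suc)

lemma walk_max_mono: "walk_max k n x \<le> walk_max k (Suc n) x"
  by (simp add: walk_max_Suc)

lemma walk_max_le: "walk_max k n x \<le> sumsq (k * n) x"
proof (induction n)
  case (Suc n)
  have "sumsq (k * n) x \<le> sumsq (k * Suc n) x" by (intro sumsq_mono) simp
  moreover have "walk k (Suc n) x \<le> sumsq (k * Suc n) x"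
    using of_nat_0_le_iff[of "k * Suc n", where 'a = real] unfolding walk_def by linarith
  ultimately show ?case using Suc by (simp add: walk_max_Suc)
qed simp

lemma integrable_walk [simp]: "integrable std_seq (walk k i)"
  unfolding walk_def[abs_def] by simp

lemma integrable_walk_max [simp]: "integrable std_seq (walk_max k n)"
  by (rule Bochner_Integration.integrable_bound[OF integrable_sumsq[of "k * n"]])
     (auto simp: walk_max_nonneg walk_max_le)

lemma walk_max_cong: "(\<And>i. i \<le> n \<Longrightarrow> walk k i x = walk k i y) \<Longrightarrow> walk_max k n x = walk_max k n y"
  unfolding walk_max_def by (intro arg_cong[where f = Max] image_cong) auto

text \<open>Rotating by \<open>b\<close> blocks moves block \<open>b\<close> to the front and leaves
  the total after \<open>n\<close> blocks, hence the event, unchanged.\<close>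

lemma integral_walk_cycle:
  assumes "b < n"
  shows "(\<integral>x. (walk k (Suc b) x - walk k b x) * (if 0 < walk k n x then 1 else 0) \<partial>std_seq)
      = (\<integral>x. walk k 1 x * (if 0 < walk k n x then 1 else 0) \<partial>std_seq)"
proof -
  let ?\<pi> = "cycle_map (k * n) (k * b)"
  have le: "k * b \<le> k * n" "k * Suc b \<le> k * n" using assms by (simp_all del: mult_Suc_right add: Suc_leI)
  have 1: "walk k n (\<lambda>i. x (?\<pi> i)) = walk k n x" for x
    using sumsq_cycle[OF le(1)] by (simp add: walk_def)
  have 2: "walk k 1 (\<lambda>i. x (?\<pi> i)) = walk k (Suc b) x - walk k b x" for x
    using walk_shift[of k 1 x b] sumsq_cycle_less[of k "k * b" "k * n" x] le by (simp add: walk_def)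
  have "(\<integral>x. (\<lambda>x. walk k 1 x * (if 0 < walk k n x then 1 else 0)) (\<lambda>i. x (?\<pi> i)) \<partial>std_seq)
      = (\<integral>x. walk k 1 x * (if 0 < walk k n x then 1 else 0) \<partial>std_seq)"
    by (rule integral_std_reindex[OF inj_cycle_map[OF le(1)]]) measurable
  then show ?thesis by (simp only: 1 2)
qed

text \<open>The cyclic-shift proof of Spitzer's identity: on \<open>walk k n > 0\<close> the maximum over \<open>{1..n}\<close>
  splits off the first step, and rotating the \<open>n\<close> blocks replaces the shifted maximum by the unshifted one.\<close>

lemma integral_walk_max_Suc:
  "(\<integral>x. walk_max k (Suc m) x \<partial>std_seq)
    = (\<integral>x. walk_max k m x \<partial>std_seq) + (\<integral>x. max 0 (walk k (Suc m) x) \<partial>std_seq) / real (Suc m)"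
proof -
  let ?n = "Suc m" and ?\<theta> = "\<lambda>x::nat \<Rightarrow> real. \<lambda>j. x (j + k)"
  let ?I = "\<lambda>x. if 0 < walk k (Suc m) x then 1 else 0 :: real"
  have int: "integrable std_seq (\<lambda>x. f x * ?I x)" if "integrable std_seq f" for f :: "_ \<Rightarrow> real"
    by (rule Bochner_Integration.integrable_bound[OF that]) (use that in auto)
  \<comment> \<open>On the event that the last partial sum is positive, the truncation at 0 in
    Lindley's recursion is inactive; off the event the last partial sum cannot raise the
    maximum.\<close>
  have pw: "walk_max k ?n x = walk k 1 x * ?I x + walk_max k m (?\<theta> x) * ?I x + (walk_max k m x - walk_max k m x * ?I x)" for x
  proof (cases "0 < walk k ?n x")
    case True
    have "0 < walk_max k ?n x" using True by (simp add: walk_max_Suc)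
    then show ?thesis using True by (simp add: walk_max_Suc')
  next
    case False
    then show ?thesis using walk_max_nonneg[of k m x] by (simp add: walk_max_Suc)
  qed
  have le: "k \<le> k * ?n" by simp
  let ?\<pi> = "cycle_map (k * ?n) k"
  have 1: "walk k ?n (\<lambda>i. x (?\<pi> i)) = walk k ?n x" for x
    using sumsq_cycle[OF le] by (simp add: walk_def)
  have 2: "walk_max k m (\<lambda>i. x (?\<pi> i)) = walk_max k m (?\<theta> x)" for x
  proof (rule walk_max_cong)
    fix i assume "i \<le> m"
    then have "k * i + k \<le> k * ?n" by (simp add: add.commute)
    then show "walk k i (\<lambda>i. x (?\<pi> i)) = walk k i (?\<theta> x)"
      using sumsq_cycle_less[of "k * i" k "k * ?n" x] by (simp add: walk_def)
  qed
  have i\<theta>: "integrable std_seq (\<lambda>x. walk_max k m (?\<theta> x))"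
    by (rule integrable_std_reindex[of "\<lambda>j. j + k"]) (auto simp: inj_def)
  have rot: "(\<integral>x. walk_max k m (?\<theta> x) * ?I x \<partial>std_seq) = (\<integral>x. walk_max k m x * ?I x \<partial>std_seq)"
  proof -
    have "(\<integral>x. (\<lambda>x. walk_max k m x * ?I x) (\<lambda>i. x (?\<pi> i)) \<partial>std_seq) = (\<integral>x. walk_max k m x * ?I x \<partial>std_seq)"
      by (rule integral_std_reindex[OF inj_cycle_map[OF le]]) measurable
    then show ?thesis by (simp only: 1 2)
  qed
  \<comment> \<open>The positive part is the sum of the increments on the event; by rotation all
    \<open>?n\<close> increments contribute equally, which produces the division by
    \<open>Suc m\<close>.\<close>
  have "max 0 (walk k ?n x) = (\<Sum>b<?n. (walk k (Suc b) x - walk k b x) * ?I x)" for x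
    using sum_lessThan_telescope[of "\<lambda>b. walk k b x" "Suc m"]
    unfolding sum_distrib_right[symmetric] by (simp del: sum.lessThan_Suc)
  then have "(\<integral>x. max 0 (walk k ?n x) \<partial>std_seq) = (\<Sum>b<?n. (\<integral>x. (walk k (Suc b) x - walk k b x) * ?I x \<partial>std_seq))"
    by (simp only:) (rule Bochner_Integration.integral_sum, rule int, simp)
  also have "\<dots> = real ?n * (\<integral>x. walk k 1 x * ?I x \<partial>std_seq)"
  proof -
    have "(\<Sum>b<?n. (\<integral>x. (walk k (Suc b) x - walk k b x) * ?I x \<partial>std_seq)) = (\<Sum>b<?n. \<integral>x. walk k 1 x * ?I x \<partial>std_seq)"
    proof (rule sum.cong[OF refl])
      fix b assume "b \<in> {..<?n}"
      then show "(\<integral>x. (walk k (Suc b) x - walk k b x) * ?I x \<partial>std_seq) = (\<integral>x. walk k 1 x * ?I x \<partial>std_seq)"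
        using integral_walk_cycle[of b ?n k] by (simp only: lessThan_iff)
    qed
    then show ?thesis by (simp only: sum_constant card_lessThan)
  qed
  finally have first: "(\<integral>x. walk k 1 x * ?I x \<partial>std_seq) = (\<integral>x. max 0 (walk k ?n x) \<partial>std_seq) / real ?n"
    by (simp del: of_nat_Suc)
  show ?thesis
    unfolding pw using rot first int[OF i\<theta>] int[OF integrable_walk[of k 1]] int[OF integrable_walk_max[of k m]]
    by (simp del: of_nat_Suc)
qed

text \<open>Summing the recursion gives Spitzer's identity; its terms are those of the series in
  \<open>eta1\<close>.\<close>

lemma integral_walk_max:
  "(\<integral>x. walk_max k n x \<partial>std_seq) = (\<Sum>i<n. chi_sq_excess (k * Suc i) / real (Suc i))"
proof (induction n)
  case (Suc n)
  have "(\<integral>x. max 0 (walk k (Suc n) x) \<partial>std_seq) = chi_sq_excess (k * Suc n)"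
    unfolding chi_sq_excess_def walk_def sumsq_def ..
  then show ?case unfolding integral_walk_max_Suc by (simp add: Suc)
qed simp

text \<open>The squared maximum is at most a sum of exponentials of the walk at rate 1/4. Each
  coordinate multiplies their means by a factor below 1, so the bound is uniform in
  \<open>n\<close>.\<close>

lemma walk_max_square_bound:
  assumes "1 \<le> k"
  obtains B :: real where "\<And>n. integrable std_seq (\<lambda>x. (walk_max k n x)\<^sup>2)"
    "\<And>n. (\<integral>x. (walk_max k n x)\<^sup>2 \<partial>std_seq) \<le> B"
proof -
  \<comment> \<open>\<beta> is the expectation of exp ((x^2 - 3) / 4) for one standard normal x; its
    square 2 exp (- 3 / 2) is below 1.\<close>
  define \<beta> where "\<beta> = exp (- 3 / 4) * (1 / sqrt (1 - 2 * (1 / 4)) :: real)"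
  have \<beta>: "0 < \<beta>" "\<beta> < 1"
  proof -
    show "0 < \<beta>" by (simp add: \<beta>_def)
    have "\<beta>\<^sup>2 = exp (- 3 / 2) * 2" by (simp add: \<beta>_def power_mult_distrib power_divide flip: exp_double)
    moreover have "2 < exp (3 / 2 :: real)" using exp_ge_add_one_self[of "3/2::real"] by linarith
    then have "exp (- 3 / 2) * 2 < (1::real)" by (simp add: exp_minus field_simps)
    ultimately show "\<beta> < 1" using \<open>0 < \<beta>\<close> by (metis less_eq_real_def linorder_not_less one_le_power)
  qed
  have mgf: "(\<integral>\<^sup>+x. ennreal (32 * exp (walk k i x / 4)) \<partial>std_seq) = ennreal (32 * \<beta> ^ (k * i))" for i
  proof -
    have "exp (walk k i x / 4) = exp (- 3 / 4) ^ (k * i) * exp (1 / 4 * sumsq (k * i) x)" for x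
      by (simp add: walk_def exp_of_nat_mult[symmetric] flip: exp_add)
    then have "(\<integral>\<^sup>+x. ennreal (32 * exp (walk k i x / 4)) \<partial>std_seq)
        = (\<integral>\<^sup>+x. ennreal (32 * exp (- 3 / 4) ^ (k * i)) * ennreal (exp (1 / 4 * sumsq (k * i) x)) \<partial>std_seq)"
      by (simp add: ennreal_mult' mult.assoc)
    also have "\<dots> = ennreal (32 * exp (- 3 / 4) ^ (k * i)) * ennreal ((1 / sqrt (1 - 2 * (1 / 4))) ^ (k * i))"
    proof -
      have e: "(\<integral>\<^sup>+x. ennreal (exp (1 / 4 * sumsq (k * i) x)) \<partial>std_seq) = ennreal ((1 / sqrt (1 - 2 * (1 / 4))) ^ (k * i))"
        by (rule nn_integral_exp_sumsq) simp
      have m: "(\<lambda>x. ennreal (exp (1 / 4 * sumsq (k * i) x))) \<in> borel_measurable std_seq" by measurable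
      show ?thesis unfolding nn_integral_cmult[OF m] e ..
    qed
    also have "\<dots> = ennreal (32 * \<beta> ^ (k * i))"
      unfolding \<beta>_def power_mult_distrib by (subst ennreal_mult[symmetric]) (simp_all add: mult.assoc)
    finally show ?thesis .
  qed
  \<comment> \<open>The constant 32 comes from the quadratic term (w / 4)^2 / 2 of the exponential
    series.\<close>
  have sq: "(max 0 w)\<^sup>2 \<le> 32 * exp (w / 4)" for w :: real
  proof (cases "0 \<le> w")
    case True
    have "(w / 4)\<^sup>2 / 2 \<le> exp (w / 4)"
      using exp_lower_Taylor_quadratic[of "w / 4"] True by simp
    then show ?thesis using True by (simp add: power_divide)
  qed simp
  have pw: "(walk_max k n x)\<^sup>2 \<le> (\<Sum>i\<le>n. 32 * exp (walk k i x / 4))" for n x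
  proof (induction n)
    case (Suc n)
    have "(walk_max k (Suc n) x)\<^sup>2 \<le> (walk_max k n x)\<^sup>2 + (max 0 (walk k (Suc n) x))\<^sup>2"
      using walk_max_nonneg[of k n x] by (auto simp: walk_max_Suc max_def)
    also have "\<dots> \<le> (\<Sum>i\<le>n. 32 * exp (walk k i x / 4)) + 32 * exp (walk k (Suc n) x / 4)"
      by (intro add_mono Suc sq)
    finally show ?case by simp
  qed simp
  define B where "B = 32 * (1 / (1 - \<beta>))"
  have nn: "(\<integral>\<^sup>+x. ennreal ((walk_max k n x)\<^sup>2) \<partial>std_seq) \<le> ennreal B" for n
  proof -
    have "(\<integral>\<^sup>+x. ennreal ((walk_max k n x)\<^sup>2) \<partial>std_seq) \<le> (\<integral>\<^sup>+x. (\<Sum>i\<le>n. ennreal (32 * exp (walk k i x / 4))) \<partial>std_seq)"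
      using pw by (intro nn_integral_mono) (simp add: sum_ennreal ennreal_leI)
    also have "\<dots> = (\<Sum>i\<le>n. ennreal (32 * \<beta> ^ (k * i)))"
      by (subst nn_integral_sum) (simp_all add: mgf)
    also have "\<dots> = ennreal (\<Sum>i\<le>n. 32 * \<beta> ^ (k * i))" using \<beta> by (simp add: sum_ennreal)
    also have "\<dots> \<le> ennreal B"
    proof (rule ennreal_leI)
      have "(\<Sum>i\<le>n. 32 * \<beta> ^ (k * i)) \<le> (\<Sum>i\<le>n. 32 * \<beta> ^ i)"
        using \<beta> assms by (intro sum_mono mult_left_mono power_decreasing) auto
      also have "\<dots> = 32 * (\<Sum>i\<le>n. \<beta> ^ i)" by (simp add: sum_distrib_left)
      also have "\<dots> \<le> B" unfolding B_def
      proof (intro mult_left_mono)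
        have "(\<Sum>i\<le>n. \<beta> ^ i) \<le> (\<Sum>i. \<beta> ^ i)"
          using \<beta> by (intro sum_le_suminf) (auto intro: summable_geometric)
        then show "(\<Sum>i\<le>n. \<beta> ^ i) \<le> 1 / (1 - \<beta>)" using \<beta> suminf_geometric[of \<beta>] by simp
      qed auto
      finally show "(\<Sum>i\<le>n. 32 * \<beta> ^ (k * i)) \<le> B" .
    qed
    finally show ?thesis .
  qed
  have int: "integrable std_seq (\<lambda>x. (walk_max k n x)\<^sup>2)" for n
    by (rule integrableI_bounded) (use nn[of n] in \<open>auto simp: le_less_trans\<close>)
  have "0 \<le> B" using \<beta> by (simp add: B_def)
  then have "(\<integral>x. (walk_max k n x)\<^sup>2 \<partial>std_seq) \<le> B" for n
    using nn[of n] by (simp add: nn_integral_eq_integral[OF int])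
  then show thesis using int that by blast
qed

section \<open>Time reversal and the second moment of the overshoot\<close>

definition reverse_map :: "nat \<Rightarrow> nat \<Rightarrow> nat" where
  "reverse_map N i = (if i < N then N - Suc i else i)"

lemma inj_reverse_map: "inj (reverse_map N)"
  unfolding inj_def reverse_map_def by (auto split: if_splits)

lemma sumsq_reverse:
  assumes "e \<le> N"
  shows "sumsq e (\<lambda>i. x (reverse_map N i)) = sumsq N x - sumsq (N - e) x"
proof -
  have "sumsq N x = sumsq (N - e) x + (\<Sum>i<e. (x (i + (N - e)))\<^sup>2)"
    using sumsq_add[of "N - e" e x] assms by (simp add: sumsq_def)
  also have "(\<Sum>i<e. (x (i + (N - e)))\<^sup>2) = (\<Sum>i<e. (x (e - Suc i + (N - e)))\<^sup>2)"
    by (rule sum.nat_diff_reindex[symmetric])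
  also have "\<dots> = sumsq e (\<lambda>i. x (reverse_map N i))"
    unfolding sumsq_def using assms by (intro sum.cong refl) (auto simp: reverse_map_def)
  finally show ?thesis by simp
qed

lemma walk_reverse:
  assumes "i \<le> n"
  shows "walk k i (\<lambda>j. x (reverse_map (k * n) j)) = walk k n x - walk k (n - i) x"
  using sumsq_reverse[of "k * i" "k * n" x] assms
  by (simp add: walk_def diff_mult_distrib2 of_nat_diff algebra_simps)

text \<open>Partial sums of the reversed walk are the final value minus earlier partial sums of the
  original. A running minimum thus becomes a maximum over the times 1 to n + 1, that is the first
  block plus the maximum of the walk after it.\<close>

lemma walk_minimum_reverse:
  "Max ((\<lambda>i. - walk k i (\<lambda>j. x (reverse_map (k * Suc n) j))) ` {..n})
     = walk k 1 x + walk_max k n (\<lambda>j. x (j + k)) - walk k (Suc n) x"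
proof -
  have "(\<lambda>i. - walk k i (\<lambda>j. x (reverse_map (k * Suc n) j))) ` {..n}
      = (\<lambda>i. walk k (Suc i) x - walk k (Suc n) x) ` {..n}"
  proof -
    have "(\<lambda>i. - walk k i (\<lambda>j. x (reverse_map (k * Suc n) j))) ` {..n}
        = (\<lambda>i. walk k (Suc n - i) x - walk k (Suc n) x) ` {..n}"
      by (intro image_cong refl) (simp add: walk_reverse del: mult_Suc_right)
    also have "\<dots> = (\<lambda>i. walk k (Suc i) x - walk k (Suc n) x) ` (\<lambda>i. n - i) ` {..n}"
      unfolding image_image by (intro image_cong refl) (auto simp: Suc_diff_le)
    also have "(\<lambda>i. n - i) ` {..n} = {..n}"
    proof (intro equalityI subsetI)
      fix i assume "i \<in> {..n}"
      then show "i \<in> (\<lambda>i. n - i) ` {..n}" by (intro image_eqI[of _ _ "n - i"]) auto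
    qed auto
    finally show ?thesis .
  qed
  also have "\<dots> = (\<lambda>v. v + (walk k 1 x - walk k (Suc n) x)) ` (\<lambda>i. walk k i (\<lambda>j. x (j + k))) ` {..n}"
    unfolding image_image using walk_shift[of k _ x 1] by (intro image_cong refl) simp
  finally show ?thesis
    unfolding walk_max_def
    by (simp add: mono_Max_commute[symmetric] mono_def)
qed

text \<open>The second moment of the overshoot of a stationary ladder step. Reversing time turns the overshoot into
  \<open>D - M\<close> with \<open>D = - walk k 1\<close> and \<open>M\<close> the maximum of an independent walk; the negative part of \<open>D - M\<close> is the
  next maximum by Lindley's recursion.\<close>

definition overshoot_moment :: "nat \<Rightarrow> nat \<Rightarrow> real" where
  "overshoot_moment k n = (\<integral>x. (max 0 (- walk k (Suc n) x - Max ((\<lambda>i. - walk k i x) ` {..n})))\<^sup>2 \<partial>std_seq)"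

lemma overshoot_moment_eq:
  assumes k: "1 \<le> k"
  shows "overshoot_moment k n = 4 * (real k)\<^sup>2 + 2 * real k - 4 * real k * (\<integral>x. walk_max k n x \<partial>std_seq)
    + (\<integral>x. (walk_max k n x)\<^sup>2 \<partial>std_seq) - (\<integral>x. (walk_max k (Suc n) x)\<^sup>2 \<partial>std_seq)"
proof -
  have int: "integrable std_seq (\<lambda>x. (walk_max k n x)\<^sup>2)" for n
    using walk_max_square_bound[OF k] by metis
  let ?\<theta> = "\<lambda>x::nat \<Rightarrow> real. \<lambda>j. x (j + k)"
  \<comment> \<open>In this form \<open>- walk k 1\<close> visibly has mean 2 k and, by
    \<open>sumsq_centered\<close>, variance 2 k.\<close>
  have w1: "- walk k 1 x = 2 * real k - (sumsq k x - real k)" for x by (simp add: walk_def)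
  have D2: "integrable std_seq (\<lambda>x. (- walk k 1 x)\<^sup>2)" "(\<integral>x. (- walk k 1 x)\<^sup>2 \<partial>std_seq) = 4 * (real k)\<^sup>2 + 2 * real k"
  proof -
    have eq: "(- walk k 1 x)\<^sup>2 = 4 * (real k)\<^sup>2 - 4 * real k * (sumsq k x - real k) + (sumsq k x - real k)\<^sup>2" for x
      unfolding w1 by (simp add: power2_eq_square algebra_simps)
    show "integrable std_seq (\<lambda>x. (- walk k 1 x)\<^sup>2)" unfolding eq using sumsq_centered[of k] by simp
    show "(\<integral>x. (- walk k 1 x)\<^sup>2 \<partial>std_seq) = 4 * (real k)\<^sup>2 + 2 * real k"
      unfolding eq using sumsq_centered[of k] by (simp add: integral_sumsq std_seq.prob_space[simplified])
  qed
  have D1: "(\<integral>x. - walk k 1 x \<partial>std_seq) = 2 * real k" "integrable std_seq (\<lambda>x. - walk k 1 x)"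
    unfolding w1 by (simp_all add: integral_sumsq std_seq.prob_space[simplified])
  have fd: "- walk k 1 (comb_seq k x y) = - walk k 1 x" for x y by (simp add: walk_def sumsq_comb_seq_le)
  note DM = indep_std_mult[OF D1(2) integrable_walk_max[of k n] fd]
  have M2: "integrable std_seq (\<lambda>x. (walk_max k n (?\<theta> x))\<^sup>2)"
    by (rule integrable_std_reindex[of "\<lambda>j. j + k", OF _ int]) (auto simp: inj_def)
  have M2': "(\<integral>x. (walk_max k n (?\<theta> x))\<^sup>2 \<partial>std_seq) = (\<integral>x. (walk_max k n x)\<^sup>2 \<partial>std_seq)"
    by (rule integral_std_reindex[of "\<lambda>j. j + k" "\<lambda>x. (walk_max k n x)\<^sup>2"]) (auto simp: inj_def)
  have "overshoot_moment k n = (\<integral>x. (\<lambda>x. (max 0 (- walk k (Suc n) x - Max ((\<lambda>i. - walk k i x) ` {..n})))\<^sup>2)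
      (\<lambda>i. x (reverse_map (k * Suc n) i)) \<partial>std_seq)"
    unfolding overshoot_moment_def
    by (rule integral_std_reindex[OF inj_reverse_map, symmetric]) measurable
  also have "\<dots> = (\<integral>x. (max 0 (- walk k 1 x - walk_max k n (?\<theta> x)))\<^sup>2 \<partial>std_seq)"
    unfolding walk_minimum_reverse by (simp add: walk_reverse del: mult_Suc_right)
  \<comment> \<open>The square of a positive part is the full square minus the square of the
    negative part. The full square expands into products of independent factors, which the positive
    part would couple.\<close>
  also have "\<dots> = (\<integral>x. (- walk k 1 x)\<^sup>2 - 2 * (- walk k 1 x * walk_max k n (?\<theta> x)) + (walk_max k n (?\<theta> x))\<^sup>2
      - (walk_max k (Suc n) x)\<^sup>2 \<partial>std_seq)"
    unfolding walk_max_Suc' by (intro Bochner_Integration.integral_cong refl) (auto simp: max_def power2_eq_square algebra_simps)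
  also have "\<dots> = 4 * (real k)\<^sup>2 + 2 * real k - 2 * (2 * real k * (\<integral>x. walk_max k n x \<partial>std_seq))
    + (\<integral>x. (walk_max k n x)\<^sup>2 \<partial>std_seq) - (\<integral>x. (walk_max k (Suc n) x)\<^sup>2 \<partial>std_seq)"
    using D2 D1 DM M2 M2' int by simp
  finally show ?thesis by simp
qed

text \<open>The second moments of the maxima increase and are bounded, so their consecutive
  differences vanish in the limit; the first moments converge to Spitzer's series.\<close>

lemma overshoot_moment_limit:
  assumes k: "1 \<le> k"
  shows "(\<lambda>n. overshoot_moment k n) \<longlonglongrightarrow>
    4 * (real k)\<^sup>2 + 2 * real k - 4 * real k * (\<Sum>n. chi_sq_excess (k * Suc n) / real (Suc n))"
proof -
  obtain B where int: "\<And>n. integrable std_seq (\<lambda>x. (walk_max k n x)\<^sup>2)"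
    and B: "\<And>n. (\<integral>x. (walk_max k n x)\<^sup>2 \<partial>std_seq) \<le> B" using walk_max_square_bound[OF k] by metis
  let ?E = "\<lambda>n. \<integral>x. (walk_max k n x)\<^sup>2 \<partial>std_seq"
  have "incseq ?E"
  proof (rule incseq_SucI)
    fix n show "?E n \<le> ?E (Suc n)"
      by (intro integral_mono int power_mono walk_max_mono walk_max_nonneg)
  qed
  then obtain l where l: "?E \<longlonglongrightarrow> l" using incseq_convergent[of ?E B] B by blast
  have pos: "0 \<le> chi_sq_excess d" for d unfolding chi_sq_excess_def by (intro integral_nonneg_AE) simp
  have "summable (\<lambda>n. chi_sq_excess (k * Suc n) / real (Suc n))"
  proof (rule summableI_nonneg_bounded)
    fix n
    have "(\<Sum>i<n. chi_sq_excess (k * Suc i) / real (Suc i)) = (\<integral>x. walk_max k n x \<partial>std_seq)"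
      by (rule integral_walk_max[symmetric])
    also have "\<dots> \<le> (\<integral>x. 1 + (walk_max k n x)\<^sup>2 \<partial>std_seq)"
    proof (rule integral_mono)
      fix x show "walk_max k n x \<le> 1 + (walk_max k n x)\<^sup>2"
        using sum_squares_bound[of "walk_max k n x" 1] walk_max_nonneg[of k n x] by (simp add: power2_eq_square)
    qed (simp_all add: int)
    also have "\<dots> \<le> 1 + B" using B[of n] int by (simp add: std_seq.prob_space[simplified])
    finally show "(\<Sum>i<n. chi_sq_excess (k * Suc i) / real (Suc i)) \<le> 1 + B" .
  qed (simp add: pos)
  then have s: "(\<lambda>n. \<integral>x. walk_max k n x \<partial>std_seq) \<longlonglongrightarrow> (\<Sum>n. chi_sq_excess (k * Suc n) / real (Suc n))"
    unfolding integral_walk_max by (rule summable_LIMSEQ)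
  have "(\<lambda>n. 4 * (real k)\<^sup>2 + 2 * real k - 4 * real k * (\<integral>x. walk_max k n x \<partial>std_seq) + ?E n - ?E (Suc n))
    \<longlonglongrightarrow> 4 * (real k)\<^sup>2 + 2 * real k - 4 * real k * (\<Sum>n. chi_sq_excess (k * Suc n) / real (Suc n)) + l - l"
    by (intro tendsto_intros s l LIMSEQ_Suc[OF l])
  then show ?thesis unfolding overshoot_moment_eq[OF k] by simp
qed

section \<open>The stopping time and Wald's identities\<close>

lemma sets_std_Collect: "Measurable.pred std_seq P \<Longrightarrow> {x. P x} \<in> sets std_seq"
  using measurable_sets[of P std_seq "count_space UNIV" "{True}"] by (simp add: vimage_def)

text \<open>Time is counted in blocks of \<open>k\<close> Helmert coordinates, so that \<open>tau k h m\<close> stands for \<open>m_0 + T\<close>; with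
  \<open>h = \<rho> n^*\<close> the stopping rule compares the sum of squares with \<open>boundary\<close>. If the boundary is never
  reached, \<open>tau\<close> is unspecified.\<close>

definition boundary :: "nat \<Rightarrow> real \<Rightarrow> nat \<Rightarrow> real" where
  "boundary k h n = real (k * n) * (real (k * n) + 1)\<^sup>2 / h\<^sup>2"

definition tau :: "nat \<Rightarrow> real \<Rightarrow> nat \<Rightarrow> (nat \<Rightarrow> real) \<Rightarrow> nat" where
  "tau k h m x = (LEAST n. m \<le> n \<and> sumsq (k * n) x \<le> boundary k h n)"

text \<open>For \<open>n < m\<close> this is vacuously true: no check is made before the pilot
  sample is complete.\<close>

definition alive :: "nat \<Rightarrow> real \<Rightarrow> nat \<Rightarrow> nat \<Rightarrow> (nat \<Rightarrow> real) \<Rightarrow> bool" where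
  "alive k h m n x \<longleftrightarrow> (\<forall>j\<in>{m..n}. boundary k h j < sumsq (k * j) x)"

lemma measurable_tau [measurable]: "tau k h m \<in> std_seq \<rightarrow>\<^sub>M count_space UNIV"
  unfolding tau_def[abs_def] by (rule measurable_Least) measurable

lemma measurable_alive [measurable]: "Measurable.pred std_seq (alive k h m n)"
  unfolding alive_def[abs_def] by measurable

lemma boundary_nonneg: "0 \<le> boundary k h n" by (simp add: boundary_def)

lemma alive_comb_seq: "alive k h m n (comb_seq (k * n) x y) \<longleftrightarrow> alive k h m n x"
  unfolding alive_def by (intro ball_cong refl) (simp add: sumsq_comb_seq_le)

locale stopping =
  fixes k m :: nat and h :: real
  assumes k_pos: "1 \<le> k" and h_pos: "0 < h"
begin

definition stops :: "(nat \<Rightarrow> real) \<Rightarrow> bool" where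
  "stops x \<longleftrightarrow> (\<exists>n\<ge>m. sumsq (k * n) x \<le> boundary k h n)"

abbreviation T where "T \<equiv> tau k h m"

text \<open>A sample of size n has n - 1 Helmert contrasts, so stopping after \<open>T\<close>
  blocks corresponds to k T + 1 observations.\<close>

abbreviation M :: "(nat \<Rightarrow> real) \<Rightarrow> real" where "M x \<equiv> real (k * T x) + 1"

lemma tau_stops:
  assumes "stops x" shows "m \<le> T x" "sumsq (k * T x) x \<le> boundary k h (T x)"
proof -
  have "m \<le> T x \<and> sumsq (k * T x) x \<le> boundary k h (T x)"
    unfolding tau_def by (rule LeastI_ex) (use assms in \<open>auto simp: stops_def\<close>)
  then show "m \<le> T x" "sumsq (k * T x) x \<le> boundary k h (T x)" by auto
qed

lemma alive_iff: "stops x \<Longrightarrow> alive k h m n x \<longleftrightarrow> n < T x"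
proof
  assume "stops x" "alive k h m n x"
  then show "n < T x"
    using tau_stops[of x] by (force simp: alive_def not_le[symmetric])
next
  assume "n < T x"
  then show "alive k h m n x"
    unfolding alive_def tau_def using not_less_Least[of _ "\<lambda>n. m \<le> n \<and> sumsq (k * n) x \<le> boundary k h n"]
    by (force simp: not_le[symmetric])
qed

text \<open>The boundary divided by k n is ((k n + 1) / h)^2, here at most (1 - \<delta>)^2, while
  the Chernoff bound asks only for 1 - \<delta>.\<close>

lemma prob_stop_early:
  assumes b: "\<And>d. measure std_seq {x. sumsq d x \<le> (1 - \<delta>) * real d} \<le> b ^ d" "0 < b" "b < 1"
    and \<delta>: "0 < \<delta>" "\<delta> < 1" and n: "real (k * n) + 1 \<le> (1 - \<delta>) * h"
  shows "measure std_seq {x. sumsq (k * n) x \<le> boundary k h n} \<le> b ^ n"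
proof -
  have "(real (k * n) + 1)\<^sup>2 \<le> ((1 - \<delta>) * h)\<^sup>2" using n by (intro power_mono) auto
  also have "\<dots> = (1 - \<delta>) * ((1 - \<delta>) * h\<^sup>2)" by (simp add: power2_eq_square)
  also have "\<dots> \<le> 1 * ((1 - \<delta>) * h\<^sup>2)" using \<delta> by (intro mult_right_mono) auto
  finally have "(real (k * n) + 1)\<^sup>2 / h\<^sup>2 \<le> 1 - \<delta>" using h_pos by (simp add: divide_simps)
  then have "real (k * n) * ((real (k * n) + 1)\<^sup>2 / h\<^sup>2) \<le> real (k * n) * (1 - \<delta>)"
    by (intro mult_left_mono) auto
  then have "boundary k h n \<le> (1 - \<delta>) * real (k * n)" by (simp add: boundary_def mult.commute)
  then have "measure std_seq {x. sumsq (k * n) x \<le> boundary k h n} \<le> measure std_seq {x. sumsq (k * n) x \<le> (1 - \<delta>) * real (k * n)}"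
    by (intro std_seq.finite_measure_mono sets_std_Collect) auto
  also have "\<dots> \<le> b ^ (k * n)" by (rule b)
  also have "\<dots> \<le> b ^ n" using b k_pos by (intro power_decreasing) auto
  finally show ?thesis .
qed

lemma prob_above_late:
  assumes b: "\<And>d. measure std_seq {x. (1 + \<delta>) * real d \<le> sumsq d x} \<le> b ^ d" "0 < b" "b < 1"
    and \<delta>: "0 < \<delta>" and n: "(1 + \<delta>) * h \<le> real (k * n) + 1"
  shows "measure std_seq {x. boundary k h n < sumsq (k * n) x} \<le> b ^ n"
proof -
  have "1 * ((1 + \<delta>) * h\<^sup>2) \<le> (1 + \<delta>) * ((1 + \<delta>) * h\<^sup>2)" using \<delta> by (intro mult_right_mono) auto
  also have "\<dots> = ((1 + \<delta>) * h)\<^sup>2" by (simp add: power2_eq_square)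
  also have "\<dots> \<le> (real (k * n) + 1)\<^sup>2" using n \<delta> h_pos by (intro power_mono) auto
  finally have "1 + \<delta> \<le> (real (k * n) + 1)\<^sup>2 / h\<^sup>2" using h_pos by (simp add: divide_simps)
  then have "real (k * n) * (1 + \<delta>) \<le> real (k * n) * ((real (k * n) + 1)\<^sup>2 / h\<^sup>2)"
    by (intro mult_left_mono) auto
  then have "(1 + \<delta>) * real (k * n) \<le> boundary k h n" by (simp add: boundary_def mult.commute)
  then have "measure std_seq {x. boundary k h n < sumsq (k * n) x} \<le> measure std_seq {x. (1 + \<delta>) * real (k * n) \<le> sumsq (k * n) x}"
    by (intro std_seq.finite_measure_mono sets_std_Collect) auto
  also have "\<dots> \<le> b ^ (k * n)" by (rule b)
  also have "\<dots> \<le> b ^ n" using b k_pos by (intro power_decreasing) auto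
  finally show ?thesis .
qed

text \<open>Never stopping means being above the boundary at every late \<open>n\<close>, and each
  of these events has exponentially small probability.\<close>

lemma AE_stops: "AE x in std_seq. stops x"
proof -
  obtain b :: real where b: "0 < b" "b < 1"
    "\<And>d. measure std_seq {x. (1 + 1 / 2) * real d \<le> sumsq d x} \<le> b ^ d"
    by (rule sumsq_chernoff[of "1 / 2"]) auto
  have sets: "{x. \<not> stops x} \<in> sets std_seq"
    unfolding stops_def by (rule sets_std_Collect) measurable
  have "\<forall>\<^sub>F n in sequentially. measure std_seq {x. \<not> stops x} \<le> b ^ n"
  proof -
    have "filterlim (\<lambda>n. real n) at_top sequentially" by (rule filterlim_real_sequentially)
    then have "\<forall>\<^sub>F n in sequentially. (1 + 1 / 2) * h \<le> real n"
      unfolding filterlim_at_top by (rule spec)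
    then show ?thesis using eventually_ge_at_top[of m]
    proof eventually_elim
      case (elim n)
      have "real n \<le> real (k * n)" unfolding of_nat_le_iff using k_pos by simp
      then have *: "(1 + 1 / 2) * h \<le> real (k * n) + 1" using elim by linarith
      have "boundary k h n < sumsq (k * n) x" if "\<not> stops x" for x
        using that elim(2) unfolding stops_def by (meson not_le)
      then have "measure std_seq {x. \<not> stops x} \<le> measure std_seq {x. boundary k h n < sumsq (k * n) x}"
        by (intro std_seq.finite_measure_mono sets_std_Collect) auto
      also have "\<dots> \<le> b ^ n" by (rule prob_above_late[OF b(3,1,2) _ *]) simp
      finally show ?case .
    qed
  qed
  then have "measure std_seq {x. \<not> stops x} \<le> 0"
    using b by (intro tendsto_lowerbound[OF LIMSEQ_power_zero]) auto
  then have "emeasure std_seq {x. \<not> stops x} = 0"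
    by (simp add: std_seq.emeasure_eq_measure measure_le_0_iff)
  then show ?thesis using sets by (intro AE_I'[of "{x. \<not> stops x}"]) (auto simp: null_sets_def)
qed

lemma nn_integral_tau:
  "(\<integral>\<^sup>+x. f (T x) \<partial>std_seq) = (\<Sum>n. f n * emeasure std_seq {x. T x = n})" for f :: "nat \<Rightarrow> ennreal"
proof -
  have "f (T x) = (\<Sum>n. f n * indicator {x. T x = n} x)" for x
    by (subst suminf_finite[of "{T x}"]) (auto split: split_indicator)
  then have "(\<integral>\<^sup>+x. f (T x) \<partial>std_seq) = (\<integral>\<^sup>+x. (\<Sum>n. f n * indicator {x. T x = n} x) \<partial>std_seq)" by simp
  also have "\<dots> = (\<Sum>n. \<integral>\<^sup>+x. f n * indicator {x. T x = n} x \<partial>std_seq)"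
    by (rule nn_integral_suminf) measurable
  also have "\<dots> = (\<Sum>n. f n * emeasure std_seq {x. T x = n})"
    by (subst nn_integral_cmult_indicator) (auto intro!: sets_std_Collect)
  finally show ?thesis .
qed

text \<open>Stopping late, at block n = i + 1, means being above the boundary at block i. The block
  lost is paid for by \<open>hk\<close>, which shrinks \<delta> to \<delta> / 2, and the bound
  becomes b^(n - 1). Stopping early is bounded at block n itself.\<close>

lemma prob_tau_off:
  assumes b: "\<And>d. measure std_seq {x. (1 + \<delta> / 2) * real d \<le> sumsq d x} \<le> b ^ d"
    "\<And>d. measure std_seq {x. sumsq d x \<le> (1 - \<delta> / 2) * real d} \<le> b ^ d" "0 < b" "b < 1"
    and \<delta>: "0 < \<delta>" "\<delta> < 1" and hk: "2 * real k \<le> \<delta> * h" and m: "real (k * m) + 1 < h"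
    and n: "\<delta> * h < \<bar>real (k * n) + 1 - h\<bar>"
  shows "measure std_seq {x. T x = n} \<le> (if m \<le> n then b ^ n / b else 0)"
proof -
  have AE_le: "measure std_seq {x. T x = n} \<le> measure std_seq {x. P x}" if "\<And>x. stops x \<Longrightarrow> T x = n \<Longrightarrow> P x"
    and [measurable]: "Measurable.pred std_seq P" for P
    by (rule std_seq.finite_measure_mono_AE) (use that AE_stops in \<open>auto intro!: sets_std_Collect\<close>)
  consider "n < m" | "m \<le> n" "real (k * n) + 1 < h" | "m \<le> n" "h \<le> real (k * n) + 1" by linarith
  then show ?thesis
  proof cases
    case 1
    have "measure std_seq {x. T x = n} \<le> measure std_seq {x. False}"
      by (rule AE_le) (use 1 tau_stops in force)+
    then show ?thesis using 1 by simp
  next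
    case 2
    have le: "real (k * n) + 1 \<le> (1 - \<delta> / 2) * h"
      using n 2 \<delta> h_pos mult_pos_pos[OF \<delta>(1) h_pos] by (simp add: algebra_simps)
    have "measure std_seq {x. T x = n} \<le> measure std_seq {x. sumsq (k * n) x \<le> boundary k h n}"
      by (rule AE_le) (use tau_stops in auto)
    also have "\<dots> \<le> b ^ n" by (rule prob_stop_early[OF b(2-4) _ _ le]) (use \<delta> in auto)
    also have "\<dots> \<le> b ^ n / b" using b by (simp add: divide_simps mult_left_le)
    finally show ?thesis using 2 by simp
  next
    case 3
    have "n \<noteq> m" using m 3 by auto
    then obtain i where i: "n = Suc i" "m \<le> i" using 3(1) by (cases n) auto
    have "(1 + \<delta>) * h < real (k * n) + 1" using n 3 by (simp add: algebra_simps)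
    also have "real (k * n) + 1 = real (k * i) + 1 + real k" by (simp add: i)
    finally have le: "(1 + \<delta> / 2) * h \<le> real (k * i) + 1" using hk by (simp add: algebra_simps)
    have "measure std_seq {x. T x = n} \<le> measure std_seq {x. boundary k h i < sumsq (k * i) x}"
    proof (rule AE_le)
      fix x assume "stops x" "T x = n"
      then have "alive k h m i x" using alive_iff[of x i] i by simp
      then show "boundary k h i < sumsq (k * i) x" using i by (simp add: alive_def)
    qed measurable
    also have "\<dots> \<le> b ^ i" by (rule prob_above_late[OF b(1,3,4) _ le]) (use \<delta> in auto)
    finally show ?thesis using i b by simp
  qed
qed

section \<open>The stopped martingale\<close>

definition incr :: "nat \<Rightarrow> (nat \<Rightarrow> real) \<Rightarrow> real" where
  "incr n x = sumsq (k * Suc n) x - sumsq (k * n) x - real k"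

definition alive_ind :: "nat \<Rightarrow> (nat \<Rightarrow> real) \<Rightarrow> real" where
  "alive_ind n x = (if alive k h m n x then 1 else 0)"

text \<open>A martingale transform: \<open>alive_ind i\<close> depends on the first
  \<open>k * i\<close> coordinates and multiplies the next centred block. If the boundary is ever
  reached, the value is the centred sum of squares at the smaller of \<open>n\<close> and the
  stopping time.\<close>

definition stopped_sum :: "nat \<Rightarrow> (nat \<Rightarrow> real) \<Rightarrow> real" where
  "stopped_sum n x = (\<Sum>i<n. alive_ind i x * incr i x)"

lemma incr_shift: "incr n x = sumsq k (\<lambda>i. x (i + k * n)) - real k"
  using sumsq_add[of "k * n" k x] by (simp add: incr_def add.commute)

lemma measurable_alive_ind [measurable]: "alive_ind n \<in> borel_measurable std_seq"
  unfolding alive_ind_def[abs_def] by measurable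

lemma measurable_incr [measurable]: "incr n \<in> borel_measurable std_seq"
  unfolding incr_def[abs_def] by measurable

lemma measurable_stopped_sum [measurable]: "stopped_sum n \<in> borel_measurable std_seq"
  unfolding stopped_sum_def[abs_def] by measurable

lemma integrable_alive_ind [simp]: "integrable std_seq (alive_ind n)"
  by (rule std_seq.integrable_const_bound[of _ 1]) (auto simp: alive_ind_def)

lemma alive_ind_comb: "alive_ind n (comb_seq (k * n) x y) = alive_ind n x"
  by (simp add: alive_ind_def alive_comb_seq)

lemma stopped_sum_comb: "stopped_sum n (comb_seq (k * n) x y) = stopped_sum n x"
proof -
  have "alive_ind i (comb_seq (k * n) x y) * incr i (comb_seq (k * n) x y) = alive_ind i x * incr i x" if "i < n" for i
  proof -
    have "alive k h m i (comb_seq (k * n) x y) = alive k h m i x"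
      unfolding alive_def using that by (intro ball_cong refl) (simp add: sumsq_comb_seq_le)
    moreover have "k * Suc i \<le> k * n" using that by (intro mult_le_mono) auto
    moreover have "k * i \<le> k * n" using that by simp
    ultimately show ?thesis by (simp add: alive_ind_def incr_def sumsq_comb_seq_le del: mult_Suc_right)
  qed
  then show ?thesis unfolding stopped_sum_def by (intro sum.cong) auto
qed

text \<open>Orthogonality of martingale differences: block \<open>n\<close> is independent of
  everything before it, so only its variance 2 k on the surviving event is added.\<close>

lemma stopped_sum_moments:
  "integrable std_seq (stopped_sum n) \<and> integrable std_seq (\<lambda>x. (stopped_sum n x)\<^sup>2)
    \<and> (\<integral>x. stopped_sum n x \<partial>std_seq) = 0
    \<and> (\<integral>x. (stopped_sum n x)\<^sup>2 \<partial>std_seq) = 2 * real k * (\<Sum>i<n. \<integral>x. alive_ind i x \<partial>std_seq)"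
proof (induction n)
  case (Suc n)
  let ?g = "\<lambda>x. sumsq k x - real k"
  have g: "integrable std_seq ?g" "(\<integral>x. ?g x \<partial>std_seq) = 0"
    by (simp_all add: integral_sumsq std_seq.prob_space[simplified])
  have g2: "integrable std_seq (\<lambda>x. (?g x)\<^sup>2)" "(\<integral>x. (?g x)\<^sup>2 \<partial>std_seq) = 2 * real k"
    using sumsq_centered[of k] by auto
  have f: "integrable std_seq (\<lambda>x. stopped_sum n x * alive_ind n x)"
    by (rule Bochner_Integration.integrable_bound[of _ "stopped_sum n"]) (use Suc in \<open>auto simp: alive_ind_def\<close>)
  have fd: "stopped_sum n (comb_seq (k * n) x y) * alive_ind n (comb_seq (k * n) x y) = stopped_sum n x * alive_ind n x" for x y
    by (simp add: stopped_sum_comb alive_ind_comb)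
  define X where "X x = stopped_sum n x * alive_ind n x * ?g (\<lambda>i. x (i + k * n))" for x
  define Y where "Y x = alive_ind n x * ?g (\<lambda>i. x (i + k * n))" for x
  define Z where "Z x = alive_ind n x * (?g (\<lambda>i. x (i + k * n)))\<^sup>2" for x
  have X: "integrable std_seq X" "(\<integral>x. X x \<partial>std_seq) = 0"
    unfolding X_def using indep_std_mult[OF f g(1) fd] g by auto
  have Y: "integrable std_seq Y" "(\<integral>x. Y x \<partial>std_seq) = 0"
    unfolding Y_def using indep_std_mult[OF integrable_alive_ind[of n] g(1), of "k * n", OF alive_ind_comb] g by auto
  have Z: "integrable std_seq Z" "(\<integral>x. Z x \<partial>std_seq) = (\<integral>x. alive_ind n x \<partial>std_seq) * (2 * real k)"
    unfolding Z_def using indep_std_mult[OF integrable_alive_ind[of n] g2(1), of "k * n", OF alive_ind_comb] g2 by auto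
  have e1: "stopped_sum (Suc n) = (\<lambda>x. stopped_sum n x + Y x)"
    by (rule ext) (simp add: stopped_sum_def incr_shift Y_def)
  have e2: "(stopped_sum (Suc n) x)\<^sup>2 = (stopped_sum n x)\<^sup>2 + 2 * X x + Z x" for x
    unfolding e1 X_def Y_def Z_def by (simp add: alive_ind_def power2_eq_square algebra_simps)
  show ?case
    unfolding e2 unfolding e1 using Suc X Y Z by (simp add: distrib_left)
qed (simp add: stopped_sum_def)

lemma stopped_sum_eq:
  assumes "stops x"
  shows "stopped_sum n x = sumsq (k * min n (T x)) x - real (k * min n (T x))"
proof -
  have "stopped_sum n x = (\<Sum>i<min n (T x). incr i x)"
    unfolding stopped_sum_def alive_ind_def alive_iff[OF assms]
    by (rule sum.mono_neutral_cong_right) auto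
  also have "\<dots> = (\<Sum>i<min n (T x). (\<lambda>i. sumsq (k * i) x - real (k * i)) (Suc i) - (\<lambda>i. sumsq (k * i) x - real (k * i)) i)"
    by (intro sum.cong refl) (simp add: incr_def)
  also have "\<dots> = sumsq (k * min n (T x)) x - real (k * min n (T x))"
    by (subst sum_lessThan_telescope) simp
  finally show ?thesis .
qed

definition final_dev :: "(nat \<Rightarrow> real) \<Rightarrow> real" where
  "final_dev x = sumsq (k * T x) x - real (k * T x)"

lemma measurable_sumsq_tau [measurable]: "(\<lambda>x. sumsq (k * T x) x) \<in> borel_measurable std_seq"
proof -
  have "(\<lambda>x. (\<lambda>n x. sumsq (k * n) x) (T x) x) \<in> borel_measurable std_seq"
    by (rule measurable_compose_countable) measurable
  then show ?thesis by simp
qed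

lemma measurable_final_dev [measurable]: "final_dev \<in> borel_measurable std_seq"
  unfolding final_dev_def[abs_def] by measurable

lemma boundary_tau_le: "boundary k h (T x) \<le> M x ^ 3 / h\<^sup>2"
proof -
  have "real (k * T x) * (M x)\<^sup>2 \<le> M x * (M x)\<^sup>2" by (intro mult_right_mono) auto
  then show ?thesis using h_pos by (simp add: boundary_def divide_right_mono power3_eq_cube power2_eq_square mult.assoc)
qed

text \<open>Dominated convergence from bounded times. Sums of squares increase, so up to stopping
  they are at most the boundary at stopping, which is cubic in M; the squares are therefore
  dominated by the sixth power of M.\<close>

lemma wald:
  assumes int: "integrable std_seq (\<lambda>x. M x ^ 6)"
  shows "integrable std_seq final_dev" "integrable std_seq (\<lambda>x. (final_dev x)\<^sup>2)"
    "(\<integral>x. final_dev x \<partial>std_seq) = 0"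
    "(\<integral>x. (final_dev x)\<^sup>2 \<partial>std_seq) = 2 * real k * (\<integral>x. real (T x) \<partial>std_seq)"
proof -
  define c where "c = 1 / h\<^sup>2 + 1"
  have c: "1 \<le> c" by (simp add: c_def)
  have M1: "1 \<le> M x" for x by simp
  have D: "sumsq (k * min n (T x)) x + real (k * min n (T x)) \<le> c * M x ^ 3" if "stops x" for n x
  proof -
    have "sumsq (k * min n (T x)) x \<le> sumsq (k * T x) x" by (intro sumsq_mono) auto
    also have "\<dots> \<le> M x ^ 3 / h\<^sup>2" using tau_stops[OF that] boundary_tau_le[of x] by linarith
    finally have "sumsq (k * min n (T x)) x \<le> M x ^ 3 / h\<^sup>2" .
    moreover have "real (k * min n (T x)) \<le> real (k * T x)" unfolding of_nat_le_iff by (intro mult_le_mono) auto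
    then have "real (k * min n (T x)) \<le> M x" by linarith
    then have "real (k * min n (T x)) \<le> M x ^ 3" using power_increasing[of 1 3 "M x"] M1[of x] by simp
    ultimately show ?thesis by (simp add: c_def algebra_simps)
  qed
  have W: "\<bar>stopped_sum n x\<bar> \<le> c * M x ^ 3" if "stops x" for n x
    unfolding stopped_sum_eq[OF that] using D[OF that, of n] sumsq_nonneg[of "k * min n (T x)" x]
      of_nat_0_le_iff[of "k * min n (T x)", where 'a = real] by linarith
  have W2: "(stopped_sum n x)\<^sup>2 \<le> c\<^sup>2 * M x ^ 6" if "stops x" for n x
  proof -
    have "(stopped_sum n x)\<^sup>2 \<le> (c * M x ^ 3)\<^sup>2" using W[OF that, of n] by (metis abs_ge_zero power2_abs power_mono)
    then show ?thesis by (simp add: power_mult_distrib flip: power_mult)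
  qed
  have le36: "M x ^ 3 \<le> M x ^ 6" for x by (rule power_increasing) simp_all
  have le16: "M x \<le> M x ^ 6" for x using power_increasing[of 1 6 "M x"] by simp
  have i3: "integrable std_seq (\<lambda>x. M x ^ 3)"
    by (rule Bochner_Integration.integrable_bound[OF int]) (use le36 in auto)
  have i1: "integrable std_seq M"
    by (rule Bochner_Integration.integrable_bound[OF int]) (use le16 in auto)
  have lim: "(\<lambda>n. stopped_sum n x) \<longlonglongrightarrow> final_dev x" if "stops x" for x
  proof (rule tendsto_eventually)
    show "\<forall>\<^sub>F n in sequentially. stopped_sum n x = final_dev x"
      using eventually_ge_at_top[of "T x"]
      by eventually_elim (simp add: stopped_sum_eq[OF that] final_dev_def min_absorb2)
  qed
  have lim1: "AE x in std_seq. (\<lambda>n. stopped_sum n x) \<longlonglongrightarrow> final_dev x"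
    using AE_stops by (rule eventually_mono) (rule lim)
  have lim2: "AE x in std_seq. (\<lambda>n. (stopped_sum n x)\<^sup>2) \<longlonglongrightarrow> (final_dev x)\<^sup>2"
    using lim1 by (rule eventually_mono) (rule tendsto_power)
  have bd1: "AE x in std_seq. norm (stopped_sum n x) \<le> c * M x ^ 3" for n
    using AE_stops by (rule eventually_mono) (simp only: real_norm_def W)
  have bd2: "AE x in std_seq. norm ((stopped_sum n x)\<^sup>2) \<le> c\<^sup>2 * M x ^ 6" for n
    using AE_stops by (rule eventually_mono) (simp only: real_norm_def abs_power2 W2)
  have w1: "integrable std_seq (\<lambda>x. c * M x ^ 3)" "integrable std_seq (\<lambda>x. c\<^sup>2 * M x ^ 6)"
    using i3 int by auto
  have m2: "(\<lambda>x. (final_dev x)\<^sup>2) \<in> borel_measurable std_seq" "\<And>n. (\<lambda>x. (stopped_sum n x)\<^sup>2) \<in> borel_measurable std_seq"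
    by auto
  note dc1 = integrable_dominated_convergence[OF measurable_final_dev measurable_stopped_sum w1(1) lim1 bd1]
    integral_dominated_convergence[OF measurable_final_dev measurable_stopped_sum w1(1) lim1 bd1]
  note dc2 = integrable_dominated_convergence[OF m2 w1(2) lim2 bd2]
    integral_dominated_convergence[OF m2 w1(2) lim2 bd2]
  have al: "(\<Sum>i<n. alive_ind i x) = real (min n (T x))" if "stops x" for n x
  proof -
    have "(\<Sum>i<n. alive_ind i x) = (\<Sum>i<min n (T x). 1)"
      unfolding alive_ind_def alive_iff[OF that] by (rule sum.mono_neutral_cong_right) auto
    then show ?thesis by simp
  qed
  have "(\<lambda>n. \<integral>x. (\<Sum>i<n. alive_ind i x) \<partial>std_seq) \<longlonglongrightarrow> (\<integral>x. real (T x) \<partial>std_seq)"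
  proof (rule integral_dominated_convergence[where w = M])
    have "(\<lambda>n. \<Sum>i<n. alive_ind i x) \<longlonglongrightarrow> real (T x)" if "stops x" for x
      unfolding al[OF that] by (rule tendsto_eventually, rule eventually_mono[OF eventually_ge_at_top[of "T x"]]) (simp add: min_absorb2)
    then show "AE x in std_seq. (\<lambda>n. \<Sum>i<n. alive_ind i x) \<longlonglongrightarrow> real (T x)"
      using AE_stops by (auto elim!: eventually_mono)
    show "AE x in std_seq. norm (\<Sum>i<n. alive_ind i x) \<le> M x" for n
      using AE_stops
    proof (rule eventually_mono)
      fix x assume x: "stops x"
      have "real (min n (T x)) \<le> real (T x)" by simp
      also have "\<dots> \<le> real (k * T x)" unfolding of_nat_le_iff using k_pos by simp
      finally show "norm (\<Sum>i<n. alive_ind i x) \<le> M x" unfolding al[OF x] by simp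
    qed
  qed (use i1 in auto)
  then have "(\<lambda>n. 2 * real k * (\<Sum>i<n. \<integral>x. alive_ind i x \<partial>std_seq)) \<longlonglongrightarrow> 2 * real k * (\<integral>x. real (T x) \<partial>std_seq)"
    by (intro tendsto_intros) simp
  moreover have "(\<lambda>n. 2 * real k * (\<Sum>i<n. \<integral>x. alive_ind i x \<partial>std_seq)) \<longlonglongrightarrow> (\<integral>x. (final_dev x)\<^sup>2 \<partial>std_seq)"
    using dc2(2) stopped_sum_moments by simp
  ultimately show "(\<integral>x. (final_dev x)\<^sup>2 \<partial>std_seq) = 2 * real k * (\<integral>x. real (T x) \<partial>std_seq)"
    using LIMSEQ_unique by blast
  show "(\<integral>x. final_dev x \<partial>std_seq) = 0"
    using dc1(2) stopped_sum_moments by (simp add: LIMSEQ_const_iff)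
  show "integrable std_seq final_dev" "integrable std_seq (\<lambda>x. (final_dev x)\<^sup>2)" by fact+
qed

text \<open>A mean value bound: the derivative of x (x + 1)^2 is at most 3 (x + 1)^2.\<close>

lemma boundary_step: "boundary k h (Suc n) - boundary k h n \<le> 3 * real k * (real (k * Suc n) + 1)\<^sup>2 / h\<^sup>2"
proof -
  define x where "x = real (k * n)"
  have x: "real (k * Suc n) = x + real k" "0 \<le> x" by (simp_all add: x_def)
  have "(x + real k) * (x + real k + 1)\<^sup>2 - x * (x + 1)\<^sup>2 \<le> 3 * real k * (x + real k + 1)\<^sup>2"
    using x(2) by (simp add: power2_eq_square algebra_simps)
  then show ?thesis unfolding boundary_def x x_def[symmetric] using h_pos
    by (simp add: divide_right_mono flip: diff_divide_distrib)
qed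

definition overshoot :: "(nat \<Rightarrow> real) \<Rightarrow> real" where
  "overshoot x = boundary k h (T x) - sumsq (k * T x) x"

lemma measurable_overshoot [measurable]: "overshoot \<in> borel_measurable std_seq"
  unfolding overshoot_def[abs_def] by measurable

lemma overshoot_nonneg: "stops x \<Longrightarrow> 0 \<le> overshoot x"
  using tau_stops[of x] by (simp add: overshoot_def)

lemma overshoot_le_boundary: "overshoot x \<le> M x ^ 3 / h\<^sup>2"
  using boundary_tau_le[of x] sumsq_nonneg[of "k * T x" x] unfolding overshoot_def by linarith

text \<open>One block before stopping the sum is still above the boundary, and it can only grow, so
  the overshoot is at most one increment of the boundary. At the pilot block there is no earlier
  check, hence the second assumption.\<close>

lemma overshoot_le_step:
  assumes "stops x" "T x \<noteq> m"
  shows "overshoot x \<le> 3 * real k * (M x)\<^sup>2 / h\<^sup>2"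
proof -
  obtain n where n: "T x = Suc n" "m \<le> n"
    using assms tau_stops(1)[of x] by (cases "T x") auto
  then have "alive k h m n x" using alive_iff[OF assms(1), of n] by simp
  then have "boundary k h n < sumsq (k * n) x" using n by (simp add: alive_def)
  also have "\<dots> \<le> sumsq (k * Suc n) x" by (intro sumsq_mono) simp
  finally show ?thesis using boundary_step[of n] unfolding overshoot_def n by simp
qed

end

section \<open>Moments of the stopping time\<close>

lemma summable_power_mult_geometric:
  fixes b :: real assumes "0 < b" "b < 1"
  shows "summable (\<lambda>n. real n ^ a * b ^ n)"
proof -
  define c where "c = (1 + b) / 2"
  have c: "b < c" "c < 1" using assms by (auto simp: c_def)
  have "(\<lambda>n. (real (Suc n) / real n) ^ a * b) \<longlonglongrightarrow> 1 ^ a * b"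
    by (intro tendsto_intros LIMSEQ_Suc_n_over_n)
  then have "\<forall>\<^sub>F n in sequentially. (real (Suc n) / real n) ^ a * b < c"
    using c by (intro order_tendstoD(2)) auto
  then obtain N where N: "\<And>n. N \<le> n \<Longrightarrow> (real (Suc n) / real n) ^ a * b < c"
    by (auto simp: eventually_sequentially)
  show ?thesis
  proof (rule summable_ratio_test[OF c(2), of "max N 1"])
    fix n assume n: "max N 1 \<le> n"
    have "real (Suc n) ^ a * b ^ Suc n = ((real (Suc n) / real n) ^ a * b) * (real n ^ a * b ^ n)"
      using n by (simp add: power_divide)
    also have "\<dots> \<le> c * (real n ^ a * b ^ n)"
      using N[of n] n assms by (intro mult_right_mono) auto
    finally show "norm (real (Suc n) ^ a * b ^ Suc n) \<le> c * norm (real n ^ a * b ^ n)"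
      using assms by simp
  qed
qed

lemma suminf_tail_ennreal:
  fixes g :: "nat \<Rightarrow> real"
  assumes "summable g" "\<And>n. 0 \<le> g n"
  shows "(\<lambda>m. \<Sum>n. if m \<le> n then ennreal (g n) else 0) \<longlonglongrightarrow> 0"
proof -
  have "(\<Sum>n. if m \<le> n then ennreal (g n) else 0) = ennreal (suminf g - sum g {..<m})" for m
  proof -
    have "(\<lambda>n. if n \<in> {..<m} then g n else 0) sums sum g {..<m}"
      by (rule sums_If_finite_set) simp
    then have "(\<lambda>n. g n - (if n \<in> {..<m} then g n else 0)) sums (suminf g - sum g {..<m})"
      using assms by (intro sums_diff summable_sums)
    moreover have "(\<lambda>n. g n - (if n \<in> {..<m} then g n else 0)) = (\<lambda>n. if m \<le> n then g n else 0)"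
      by auto
    ultimately have s: "(\<lambda>n. if m \<le> n then g n else 0) sums (suminf g - sum g {..<m})" by simp
    have "(\<Sum>n. if m \<le> n then ennreal (g n) else 0) = (\<Sum>n. ennreal (if m \<le> n then g n else 0))"
      by (intro suminf_cong) auto
    also have "\<dots> = ennreal (\<Sum>n. if m \<le> n then g n else 0)"
      using s assms by (intro suminf_ennreal2) (auto simp: sums_iff)
    finally show ?thesis using s by (simp add: sums_iff)
  qed
  moreover have "(\<lambda>m. ennreal (suminf g - sum g {..<m})) \<longlonglongrightarrow> ennreal (suminf g - suminf g)"
    by (intro tendsto_ennrealI tendsto_intros summable_LIMSEQ assms)
  ultimately show ?thesis by simp
qed

text \<open>Young's inequality; for small \<delta> the first square keeps a coefficient near 1, at
  the expense of the second.\<close>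

lemma square_add_le:
  fixes a b \<delta> :: real assumes "0 < \<delta>"
  shows "(a + b)\<^sup>2 \<le> (1 + \<delta>) * a\<^sup>2 + (1 + 1 / \<delta>) * b\<^sup>2"
proof -
  have "0 \<le> (\<delta> * a - b)\<^sup>2 / \<delta>" using assms by simp
  also have "\<dots> = \<delta> * a\<^sup>2 - 2 * a * b + b\<^sup>2 / \<delta>" using assms by (simp add: power2_eq_square field_simps)
  finally show ?thesis by (simp add: power2_eq_square algebra_simps)
qed

text \<open>The pilot size tends to infinity and is negligible against \<open>h\<close>, yet a power
  of it dominates \<open>h\<close>. The last condition makes probabilities exponentially small in
  \<open>m\<close> beat every power of \<open>h\<close>.\<close>

locale regime =
  fixes k p :: nat and B :: real and h :: "nat \<Rightarrow> real" and m :: "nat \<Rightarrow> nat"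
  assumes k_ge1: "1 \<le> k" and h_gt0: "\<And>j. 0 < h j" and m_ge1: "\<And>j. 1 \<le> m j"
    and m_top: "filterlim m at_top sequentially"
    and h_top: "filterlim h at_top sequentially"
    and m_h: "(\<lambda>j. real (m j) / h j) \<longlonglongrightarrow> 0"
    and h_le: "\<forall>\<^sub>F j in sequentially. h j \<le> B * real (m j) ^ p"
begin

sublocale st: stopping k "m j" "h j" for j
  by unfold_locales (use k_ge1 h_gt0 in auto)

definition off :: "real \<Rightarrow> nat \<Rightarrow> (nat \<Rightarrow> real) \<Rightarrow> real" where
  "off \<delta> j x = (if \<delta> * h j < \<bar>st.M j x - h j\<bar> then 1 else 0)"

abbreviation delta :: "nat \<Rightarrow> (nat \<Rightarrow> real) \<Rightarrow> real" where "delta j x \<equiv> st.M j x - h j"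

lemma measurable_off [measurable]: "off \<delta> j \<in> borel_measurable std_seq"
  unfolding off_def[abs_def] by measurable

lemma off_cases: "off \<delta> j x = 0 \<and> \<bar>delta j x\<bar> \<le> \<delta> * h j \<or> off \<delta> j x = 1"
  by (auto simp: off_def)

lemma off_nonneg: "0 \<le> off \<delta> j x" by (simp add: off_def)

lemma h_large: "\<forall>\<^sub>F j in sequentially. c \<le> h j"
  using h_top by (auto simp: filterlim_at_top)

lemma inverse_h: "(\<lambda>j. c / h j) \<longlonglongrightarrow> 0"
  using tendsto_divide_0[OF tendsto_const filterlim_at_top_imp_at_infinity[OF h_top], of c] .

lemma km_small: assumes "0 < \<delta>" shows "\<forall>\<^sub>F j in sequentially. real (k * m j) + 1 < \<delta> * h j"
proof -
  have "(\<lambda>j. real k * (real (m j) / h j) + 1 / h j) \<longlonglongrightarrow> real k * 0 + 0"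
    by (intro tendsto_intros m_h inverse_h)
  then have "\<forall>\<^sub>F j in sequentially. real k * (real (m j) / h j) + 1 / h j < \<delta>"
    using assms by (intro order_tendstoD(2)) auto
  then show ?thesis
  proof eventually_elim
    case (elim j)
    then have "(real k * (real (m j) / h j) + 1 / h j) * h j < \<delta> * h j" using h_gt0 by simp
    then show ?case using h_gt0[of j] by (simp add: algebra_simps)
  qed
qed

text \<open>Stopping at an n far from \<open>h\<close> has probability of order b^n and requires n
  \<ge> m, while \<open>h\<close> is at most a power of m \<le> n. The integral is thus bounded by a
  tail, beyond \<open>m\<close>, of a convergent series with terms of order n^a b^n.\<close>

lemma nn_integral_off:
  assumes \<delta>: "0 < \<delta>" "\<delta> < 1"
  shows "(\<lambda>j. \<integral>\<^sup>+x. ennreal ((st.M j x + h j) ^ q * off \<delta> j x) \<partial>std_seq) \<longlonglongrightarrow> 0"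
proof -
  obtain b :: real where b: "0 < b" "b < 1"
    "\<And>d. measure std_seq {x. (1 + \<delta> / 2) * real d \<le> sumsq d x} \<le> b ^ d"
    "\<And>d. measure std_seq {x. sumsq d x \<le> (1 - \<delta> / 2) * real d} \<le> b ^ d"
    by (rule sumsq_chernoff[of "\<delta> / 2"]) (use \<delta> in auto)
  define D where "D = (real k + 1 + \<bar>B\<bar>) ^ q / b"
  \<comment> \<open>The exponent p + 1 covers both \<open>h\<close>, of order n^p, and the term k n,
    also when p = 0.\<close>
  define a where "a = Suc p * q"
  define g where "g n = D * (real n ^ a * b ^ n)" for n
  have g: "summable g" "\<And>n. 0 \<le> g n"
    using b by (auto simp: g_def[abs_def] D_def intro!: summable_mult summable_power_mult_geometric)
  have ev: "\<forall>\<^sub>F j in sequentially. (\<integral>\<^sup>+x. ennreal ((st.M j x + h j) ^ q * off \<delta> j x) \<partial>std_seq)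
      \<le> (\<Sum>n. if m j \<le> n then ennreal (g n) else 0)"
    using h_le h_large[of "2 * real k / \<delta>"] km_small[of 1, OF zero_less_one]
  proof eventually_elim
    case (elim j)
    have hk: "2 * real k \<le> \<delta> * h j" using elim(2) \<delta> by (simp add: field_simps)
    have km: "real (k * m j) + 1 < h j" using elim(3) by simp
    let ?F = "\<lambda>n. ennreal ((real (k * n) + 1 + h j) ^ q * (if \<delta> * h j < \<bar>real (k * n) + 1 - h j\<bar> then 1 else 0))"
    have "(\<integral>\<^sup>+x. ennreal ((st.M j x + h j) ^ q * off \<delta> j x) \<partial>std_seq)
        = (\<Sum>n. ?F n * emeasure std_seq {x. st.T j x = n})"
      unfolding off_def by (rule st.nn_integral_tau)
    also have "\<dots> \<le> (\<Sum>n. if m j \<le> n then ennreal (g n) else 0)"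
    proof (intro suminf_le summableI)
      fix n
      show "?F n * emeasure std_seq {x. st.T j x = n} \<le> (if m j \<le> n then ennreal (g n) else 0)"
      proof (cases "\<delta> * h j < \<bar>real (k * n) + 1 - h j\<bar>")
        case True
        have pr: "measure std_seq {x. st.T j x = n} \<le> (if m j \<le> n then b ^ n / b else 0)"
          by (rule st.prob_tau_off[OF b(3,4,1,2) \<delta> hk km True])
        have pos: "0 \<le> real (k * n) + 1 + h j" using h_gt0[of j] by (simp add: less_imp_le)
        have "?F n * emeasure std_seq {x. st.T j x = n}
            = ennreal ((real (k * n) + 1 + h j) ^ q * measure std_seq {x. st.T j x = n})"
          using True pos by (simp add: std_seq.emeasure_eq_measure ennreal_mult)
        also have "\<dots> \<le> ennreal ((real (k * n) + 1 + h j) ^ q * (if m j \<le> n then b ^ n / b else 0))"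
          using pr pos by (intro ennreal_leI mult_left_mono) auto
        also have "\<dots> \<le> (if m j \<le> n then ennreal (g n) else 0)"
        proof (cases "m j \<le> n")
          case mn: True
          have n1: "1 \<le> real n" using mn m_ge1[of j] by linarith
          have "real (k * n) \<le> real k * real n ^ Suc p"
            using n1 self_le_power[of "real n" "Suc p"] by (simp add: mult_left_mono)
          moreover have "1 \<le> real n ^ Suc p" using n1 by (rule one_le_power)
          moreover have "h j \<le> \<bar>B\<bar> * real n ^ Suc p"
          proof -
            have "h j \<le> B * real (m j) ^ p" by (rule elim(1))
            also have "\<dots> \<le> \<bar>B\<bar> * real (m j) ^ p" by (intro mult_right_mono) auto
            also have "\<dots> \<le> \<bar>B\<bar> * real n ^ Suc p"
            proof (rule mult_left_mono)
              have "real (m j) ^ p \<le> real n ^ p" using mn by (intro power_mono) auto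
              also have "\<dots> \<le> real n ^ Suc p" using n1 by (intro power_increasing) auto
              finally show "real (m j) ^ p \<le> real n ^ Suc p" .
            qed simp
            finally show ?thesis .
          qed
          ultimately have "real (k * n) + 1 + h j \<le> (real k + 1 + \<bar>B\<bar>) * real n ^ Suc p"
            unfolding distrib_right by linarith
          then have "(real (k * n) + 1 + h j) ^ q \<le> ((real k + 1 + \<bar>B\<bar>) * real n ^ Suc p) ^ q"
            using pos by (intro power_mono)
          also have "\<dots> = (real k + 1 + \<bar>B\<bar>) ^ q * real n ^ a"
            unfolding power_mult_distrib a_def by (simp only: power_mult)
          finally have "(real (k * n) + 1 + h j) ^ q * (b ^ n / b) \<le> (real k + 1 + \<bar>B\<bar>) ^ q * real n ^ a * (b ^ n / b)"
            using b by (intro mult_right_mono) auto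
          also have "\<dots> = g n" by (simp add: g_def D_def)
          finally show ?thesis using mn by (simp add: ennreal_leI)
        qed simp
        finally show ?thesis .
      qed simp
    qed
    finally show ?case .
  qed
  show ?thesis
  proof (rule tendsto_sandwich[OF _ ev tendsto_const])
    show "(\<lambda>j. \<Sum>n. if m j \<le> n then ennreal (g n) else 0) \<longlonglongrightarrow> 0"
      using filterlim_compose[OF suminf_tail_ennreal[OF g] m_top] .
  qed simp
qed

lemma base_ge1: "1 \<le> st.M j x + h j"
  using h_gt0[of j] by simp

lemma base_power_nonneg: "0 \<le> (st.M j x + h j) ^ q"
  using base_ge1[of j x] by (intro zero_le_power) linarith

lemma off_integral:
  assumes \<delta>: "0 < \<delta>" "\<delta> < 1"
  shows "\<forall>\<^sub>F j in sequentially. integrable std_seq (\<lambda>x. (st.M j x + h j) ^ q * off \<delta> j x)"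
    and "(\<lambda>j. \<integral>x. (st.M j x + h j) ^ q * off \<delta> j x \<partial>std_seq) \<longlonglongrightarrow> 0"
proof -
  have nonneg: "0 \<le> (st.M j x + h j) ^ q * off \<delta> j x" for j x
    using base_ge1[of j x] off_nonneg[of \<delta> j x] by (intro mult_nonneg_nonneg zero_le_power) linarith+
  have "\<forall>\<^sub>F j in sequentially. (\<integral>\<^sup>+x. ennreal ((st.M j x + h j) ^ q * off \<delta> j x) \<partial>std_seq) < 1"
    using nn_integral_off[OF \<delta>] by (rule order_tendstoD) simp
  then show "\<forall>\<^sub>F j in sequentially. integrable std_seq (\<lambda>x. (st.M j x + h j) ^ q * off \<delta> j x)"
  proof eventually_elim
    case (elim j)
    show ?case
    proof (rule integrableI_bounded)
      have "(\<integral>\<^sup>+x. ennreal (norm ((st.M j x + h j) ^ q * off \<delta> j x)) \<partial>std_seq) < 1"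
        using elim nonneg by (simp only: real_norm_def abs_of_nonneg)
      also have "(1::ennreal) < \<infinity>" by simp
      finally show "(\<integral>\<^sup>+x. ennreal (norm ((st.M j x + h j) ^ q * off \<delta> j x)) \<partial>std_seq) < \<infinity>" .
    qed measurable
  qed
  have "(\<integral>x. (st.M j x + h j) ^ q * off \<delta> j x \<partial>std_seq)
      = enn2real (\<integral>\<^sup>+x. ennreal ((st.M j x + h j) ^ q * off \<delta> j x) \<partial>std_seq)" for j
    by (rule integral_eq_nn_integral) (use nonneg in auto)
  then show "(\<lambda>j. \<integral>x. (st.M j x + h j) ^ q * off \<delta> j x \<partial>std_seq) \<longlonglongrightarrow> 0"
    using tendsto_enn2real[OF nn_integral_off[OF \<delta>, of q, folded ennreal_0]] by simp
qed

lemma integrable_moments: "\<forall>\<^sub>F j in sequentially. integrable std_seq (\<lambda>x. (st.M j x + h j) ^ q)"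
proof -
  have "\<forall>\<^sub>F j in sequentially. integrable std_seq (\<lambda>x. (st.M j x + h j) ^ q * off (1 / 2) j x)"
    by (rule off_integral) auto
  then show ?thesis
  proof eventually_elim
    case (elim j)
    show ?case
    proof (rule Bochner_Integration.integrable_bound)
      show "integrable std_seq (\<lambda>x. (3 * h j) ^ q + (st.M j x + h j) ^ q * off (1 / 2) j x)"
        using elim by simp
      have "\<bar>(st.M j x + h j) ^ q\<bar> \<le> \<bar>(3 * h j) ^ q + (st.M j x + h j) ^ q * off (1 / 2) j x\<bar>" for x
      proof -
        have pos: "0 \<le> (st.M j x + h j) ^ q" "0 \<le> (3 * h j) ^ q"
          using base_ge1[of j x] h_gt0[of j] by (auto intro!: zero_le_power simp: less_imp_le)
        from off_cases[of "1 / 2" j x] show ?thesis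
        proof
          assume *: "off (1 / 2) j x = 0 \<and> \<bar>delta j x\<bar> \<le> 1 / 2 * h j"
          have "st.M j x + h j \<le> 3 * h j" using * h_gt0[of j] by linarith
          then have "(st.M j x + h j) ^ q \<le> (3 * h j) ^ q"
            using base_ge1[of j x] by (intro power_mono) linarith+
          then show ?thesis using pos * by simp
        next
          assume "off (1 / 2) j x = 1" then show ?thesis using pos by simp
        qed
      qed
      then show "AE x in std_seq. norm ((st.M j x + h j) ^ q) \<le> norm ((3 * h j) ^ q + (st.M j x + h j) ^ q * off (1 / 2) j x)"
        by (simp only: real_norm_def) simp
    qed measurable
  qed
qed

lemma integrable_by_moment:
  assumes "integrable std_seq (\<lambda>x. (st.M j x + h j) ^ q)"
    and [measurable]: "f \<in> borel_measurable std_seq"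
    and le: "AE x in std_seq. \<bar>f x\<bar> \<le> C * (st.M j x + h j) ^ q"
  shows "integrable std_seq f"
proof (rule Bochner_Integration.integrable_bound[of _ "\<lambda>x. C * (st.M j x + h j) ^ q"])
  show "AE x in std_seq. norm (f x) \<le> norm (C * (st.M j x + h j) ^ q)"
    using le by (rule eventually_mono) (metis abs_ge_self order_trans real_norm_def)
qed (use assms(1) in auto)

lemma delta_le: "\<bar>delta j x\<bar> \<le> st.M j x + h j"
  using h_gt0[of j] by (simp add: abs_le_iff)

lemma power_base_mono: "a \<le> b \<Longrightarrow> (st.M j x + h j) ^ a \<le> (st.M j x + h j) ^ b"
  using base_ge1 by (intro power_increasing)

text \<open>The pattern of the moment bounds below: where \<open>off\<close> vanishes the deviation
  is at most \<delta> h, and elsewhere a crude power of M + h is negligible by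
  \<open>off_integral\<close>.\<close>

lemma mean_delta: "(\<lambda>j. (\<integral>x. \<bar>delta j x\<bar> \<partial>std_seq) / h j) \<longlonglongrightarrow> 0"
proof (rule tendstoI)
  fix e :: real assume e: "0 < e"
  define \<delta> where "\<delta> = min (e / 2) (1 / 2)"
  have \<delta>: "0 < \<delta>" "\<delta> < 1" "\<delta> \<le> e / 2" using e by (auto simp: \<delta>_def)
  have "\<forall>\<^sub>F j in sequentially. (\<integral>x. (st.M j x + h j) ^ 1 * off \<delta> j x \<partial>std_seq) < e / 2"
    using off_integral(2)[OF \<delta>(1,2), of 1] e by (intro order_tendstoD(2)) auto
  then show "\<forall>\<^sub>F j in sequentially. dist ((\<integral>x. \<bar>delta j x\<bar> \<partial>std_seq) / h j) 0 < e"
    using off_integral(1)[OF \<delta>(1,2), of 1] integrable_moments[of 1] h_large[of 1]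
  proof eventually_elim
    case (elim j)
    have int: "integrable std_seq (\<lambda>x. \<bar>delta j x\<bar>)"
      by (rule integrable_by_moment[OF elim(3), of _ 1]) (use delta_le in auto)
    have "(\<integral>x. \<bar>delta j x\<bar> \<partial>std_seq) \<le> (\<integral>x. \<delta> * h j + (st.M j x + h j) ^ 1 * off \<delta> j x \<partial>std_seq)"
    proof (rule integral_mono[OF int])
      fix x show "\<bar>delta j x\<bar> \<le> \<delta> * h j + (st.M j x + h j) ^ 1 * off \<delta> j x"
      proof -
        have "0 \<le> \<delta> * h j" using \<delta> h_gt0[of j] by simp
        moreover have "0 \<le> st.M j x + h j" using base_ge1[of j x] by linarith
        ultimately show ?thesis using off_cases[of \<delta> j x] delta_le[of j x] by (elim disjE conjE) simp_all
      qed
    qed (use elim in simp)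
    also have "\<dots> = \<delta> * h j + (\<integral>x. (st.M j x + h j) ^ 1 * off \<delta> j x \<partial>std_seq)"
      using elim by (simp add: std_seq.prob_space[simplified])
    also have "\<dots> < e / 2 * h j + e / 2 * h j"
    proof -
      have "e / 2 \<le> e / 2 * h j" using elim e by simp
      moreover have "\<delta> * h j \<le> e / 2 * h j" using \<delta> h_gt0[of j] by (intro mult_right_mono) auto
      ultimately show ?thesis using elim by linarith
    qed
    finally have "(\<integral>x. \<bar>delta j x\<bar> \<partial>std_seq) / h j < e" using h_gt0[of j] by (simp add: field_simps)
    moreover have "0 \<le> (\<integral>x. \<bar>delta j x\<bar> \<partial>std_seq) / h j" using h_gt0[of j] by simp
    ultimately show ?case by simp
  qed
qed

lemma mean_M: "(\<lambda>j. (\<integral>x. st.M j x \<partial>std_seq) / h j) \<longlonglongrightarrow> 1"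
proof -
  have "(\<lambda>j. (\<integral>x. st.M j x \<partial>std_seq) / h j - 1) \<longlonglongrightarrow> 0"
  proof (rule Lim_null_comparison[OF _ mean_delta])
    show "\<forall>\<^sub>F j in sequentially. norm ((\<integral>x. st.M j x \<partial>std_seq) / h j - 1) \<le> (\<integral>x. \<bar>delta j x\<bar> \<partial>std_seq) / h j"
      using integrable_moments[of 1]
    proof eventually_elim
      case (elim j)
      have i: "integrable std_seq (st.M j)"
        by (rule integrable_by_moment[OF elim, of _ 1]) (use h_gt0[of j] in auto)
      have "(\<integral>x. st.M j x \<partial>std_seq) / h j - 1 = (\<integral>x. delta j x \<partial>std_seq) / h j"
        using i h_gt0[of j] by (simp add: std_seq.prob_space[simplified] field_simps)
      moreover have "\<bar>\<integral>x. delta j x \<partial>std_seq\<bar> \<le> (\<integral>x. \<bar>delta j x\<bar> \<partial>std_seq)"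
        by (rule integral_abs_bound)
      ultimately show ?case using h_gt0[of j] by (simp add: divide_right_mono)
    qed
  qed
  then show ?thesis by (simp add: LIM_zero_iff)
qed

text \<open>Near \<open>h\<close> the increment bound 3 k M^2 / h^2 applies with M \<le> 2 h, which
  gives 12 k; elsewhere the overshoot is at most the whole boundary, of cubic order.\<close>

lemma overshoot_bound:
  assumes "h j \<ge> 1" "real (k * m j) + 1 < 1 / 2 * h j" "0 < \<delta>" "\<delta> \<le> 1 / 2" "st.stops j x"
  shows "0 \<le> st.overshoot j x" "st.overshoot j x \<le> 12 * real k + (st.M j x + h j) ^ 3 * off \<delta> j x"
proof -
  show "0 \<le> st.overshoot j x" using assms st.overshoot_nonneg by blast
  show "st.overshoot j x \<le> 12 * real k + (st.M j x + h j) ^ 3 * off \<delta> j x"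
    using off_cases[of \<delta> j x]
  proof
    assume *: "off \<delta> j x = 0 \<and> \<bar>delta j x\<bar> \<le> \<delta> * h j"
    have dh: "\<delta> * h j \<le> 1 / 2 * h j" using assms h_gt0[of j] by (intro mult_right_mono) auto
    have M: "st.M j x \<le> 2 * h j" "1 / 2 * h j \<le> st.M j x" using * dh by linarith+
    have "st.T j x \<noteq> m j" using M(2) assms(2) by auto
    then have "st.overshoot j x \<le> 3 * real k * (st.M j x)\<^sup>2 / (h j)\<^sup>2"
      using st.overshoot_le_step assms by blast
    also have "\<dots> \<le> 3 * real k * (2 * h j)\<^sup>2 / (h j)\<^sup>2"
      using M by (intro divide_right_mono mult_left_mono power_mono) auto
    also have "\<dots> = 12 * real k" using h_gt0[of j] by (simp add: power2_eq_square field_simps)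
    finally show ?thesis using * by simp
  next
    assume *: "off \<delta> j x = 1"
    have "st.overshoot j x \<le> st.M j x ^ 3 / (h j)\<^sup>2" by (rule st.overshoot_le_boundary)
    also have "\<dots> \<le> (st.M j x + h j) ^ 3 / 1"
      using assms(1) h_gt0[of j] one_le_power[OF assms(1), of 2] by (intro frac_le power_mono) auto
    finally show ?thesis using * by simp
  qed
qed

text \<open>The conditions on \<open>j\<close> under which the estimates below are valid. Sixth
  moments suffice, since the largest quantities integrated are squares of the cubic
  boundary.\<close>

definition good :: "nat \<Rightarrow> bool" where
  "good j \<longleftrightarrow> 1 \<le> h j \<and> real (k * m j) + 1 < 1 / 2 * h j
     \<and> integrable std_seq (\<lambda>x. (st.M j x + h j) ^ 6)"

lemma good_eventually: "\<forall>\<^sub>F j in sequentially. good j"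
proof -
  have "\<forall>\<^sub>F j in sequentially. real (k * m j) + 1 < 1 / 2 * h j" by (rule km_small) simp
  with h_large[of 1] integrable_moments[of 6] show ?thesis unfolding good_def
    by eventually_elim blast
qed

lemma off_eventually: "0 < \<delta> \<Longrightarrow> \<delta> < 1 \<Longrightarrow> q \<le> 6 \<Longrightarrow> 0 < e \<Longrightarrow>
  \<forall>\<^sub>F j in sequentially. (\<integral>x. (st.M j x + h j) ^ q * off \<delta> j x \<partial>std_seq) < e"
  using off_integral(2)[of \<delta> q] by (intro order_tendstoD(2)) auto

lemma good_moment:
  assumes "good j" "q \<le> 6" shows "integrable std_seq (\<lambda>x. (st.M j x + h j) ^ q)"
  by (rule integrable_by_moment[of j 6 _ 1])
     (use assms power_base_mono[OF assms(2)] base_ge1 in \<open>auto simp: good_def abs_of_nonneg\<close>)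

lemma good_integrable:
  assumes "good j" "q \<le> 6" "f \<in> borel_measurable std_seq" "AE x in std_seq. \<bar>f x\<bar> \<le> C * (st.M j x + h j) ^ q"
  shows "integrable std_seq f"
  using integrable_by_moment[OF good_moment[OF assms(1,2)] assms(3,4)] .

lemma good_off: "good j \<Longrightarrow> q \<le> 6 \<Longrightarrow> integrable std_seq (\<lambda>x. (st.M j x + h j) ^ q * off \<delta> j x)"
proof (rule good_integrable[of j q _ 1])
  show "AE x in std_seq. \<bar>(st.M j x + h j) ^ q * off \<delta> j x\<bar> \<le> 1 * (st.M j x + h j) ^ q"
  proof (rule AE_I2)
    fix x show "\<bar>(st.M j x + h j) ^ q * off \<delta> j x\<bar> \<le> 1 * (st.M j x + h j) ^ q"
      using off_cases[of \<delta> j x] base_power_nonneg[of j x q] by (elim disjE conjE) simp_all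
  qed
qed measurable

lemma good_wald:
  assumes "good j"
  shows "integrable std_seq (st.final_dev j)" "integrable std_seq (\<lambda>x. (st.final_dev j x)\<^sup>2)"
    "(\<integral>x. st.final_dev j x \<partial>std_seq) = 0"
    "(\<integral>x. (st.final_dev j x)\<^sup>2 \<partial>std_seq) = 2 * ((\<integral>x. st.M j x \<partial>std_seq) - 1)"
proof -
  have "integrable std_seq (\<lambda>x. st.M j x ^ 6)"
  proof (rule good_integrable[OF assms order_refl, of _ 1])
    show "AE x in std_seq. \<bar>st.M j x ^ 6\<bar> \<le> 1 * (st.M j x + h j) ^ 6"
      using h_gt0[of j] by (intro AE_I2) (simp add: power_mono)
  qed measurable
  note w = st.wald[OF this]
  show "integrable std_seq (st.final_dev j)" "integrable std_seq (\<lambda>x. (st.final_dev j x)\<^sup>2)"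
    "(\<integral>x. st.final_dev j x \<partial>std_seq) = 0" by (fact w)+
  have "integrable std_seq (\<lambda>x. real (st.T j x))"
  proof (rule good_integrable[OF assms, of 1 _ 1])
    show "AE x in std_seq. \<bar>real (st.T j x)\<bar> \<le> 1 * (st.M j x + h j) ^ 1"
    proof (rule AE_I2)
      fix x
      have "real (st.T j x) \<le> real (k * st.T j x)" unfolding of_nat_le_iff using k_ge1 by simp
      then show "\<bar>real (st.T j x)\<bar> \<le> 1 * (st.M j x + h j) ^ 1" using h_gt0[of j] by simp
    qed
  qed auto
  then have "(\<integral>x. st.M j x \<partial>std_seq) - 1 = real k * (\<integral>x. real (st.T j x) \<partial>std_seq)"
    by (simp add: std_seq.prob_space[simplified])
  then show "(\<integral>x. (st.final_dev j x)\<^sup>2 \<partial>std_seq) = 2 * ((\<integral>x. st.M j x \<partial>std_seq) - 1)"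
    using w(4) by simp
qed

lemma good_overshoot:
  assumes "good j" "0 < \<delta>" "\<delta> \<le> 1 / 2"
  shows "AE x in std_seq. 0 \<le> st.overshoot j x \<and> st.overshoot j x \<le> 12 * real k + (st.M j x + h j) ^ 3 * off \<delta> j x"
  using st.AE_stops[of j] overshoot_bound[of j \<delta>] assms unfolding good_def by (auto elim!: eventually_mono)

lemma good_overshoot_square:
  assumes "good j" "0 < \<delta>" "\<delta> \<le> 1 / 2"
  shows "integrable std_seq (\<lambda>x. (st.overshoot j x)\<^sup>2)"
    "(\<integral>x. (st.overshoot j x)\<^sup>2 \<partial>std_seq) \<le> 288 * (real k)\<^sup>2 + 2 * (\<integral>x. (st.M j x + h j) ^ 6 * off \<delta> j x \<partial>std_seq)"
proof -
  have le: "AE x in std_seq. (st.overshoot j x)\<^sup>2 \<le> 288 * (real k)\<^sup>2 + 2 * ((st.M j x + h j) ^ 6 * off \<delta> j x)"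
    using good_overshoot[OF assms]
  proof (rule eventually_mono)
    fix x assume "0 \<le> st.overshoot j x \<and> st.overshoot j x \<le> 12 * real k + (st.M j x + h j) ^ 3 * off \<delta> j x"
    then have "(st.overshoot j x)\<^sup>2 \<le> (12 * real k + (st.M j x + h j) ^ 3 * off \<delta> j x)\<^sup>2"
      by (intro power_mono) auto
    also have "\<dots> \<le> (1 + 1) * (12 * real k)\<^sup>2 + (1 + 1 / 1) * ((st.M j x + h j) ^ 3 * off \<delta> j x)\<^sup>2"
      by (rule square_add_le) simp
    also have "((st.M j x + h j) ^ 3 * off \<delta> j x)\<^sup>2 = (st.M j x + h j) ^ 6 * off \<delta> j x"
      by (auto simp: off_def simp flip: power_mult)
    finally show "(st.overshoot j x)\<^sup>2 \<le> 288 * (real k)\<^sup>2 + 2 * ((st.M j x + h j) ^ 6 * off \<delta> j x)"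
      by (simp add: power_mult_distrib)
  qed
  have i: "integrable std_seq (\<lambda>x. 288 * (real k)\<^sup>2 + 2 * ((st.M j x + h j) ^ 6 * off \<delta> j x))"
    using good_off[OF assms(1) order_refl, of \<delta>] by simp
  show int: "integrable std_seq (\<lambda>x. (st.overshoot j x)\<^sup>2)"
    by (rule Bochner_Integration.integrable_bound[OF i]) (use le in \<open>auto elim!: eventually_mono\<close>)
  have "(\<integral>x. (st.overshoot j x)\<^sup>2 \<partial>std_seq) \<le> (\<integral>x. 288 * (real k)\<^sup>2 + 2 * ((st.M j x + h j) ^ 6 * off \<delta> j x) \<partial>std_seq)"
    by (rule integral_mono_AE[OF int i le])
  also have "\<dots> = 288 * (real k)\<^sup>2 + 2 * (\<integral>x. (st.M j x + h j) ^ 6 * off \<delta> j x \<partial>std_seq)"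
    using good_off[OF assms(1) order_refl, of \<delta>] by (simp add: std_seq.prob_space[simplified])
  finally show "(\<integral>x. (st.overshoot j x)\<^sup>2 \<partial>std_seq) \<le> 288 * (real k)\<^sup>2 + 2 * (\<integral>x. (st.M j x + h j) ^ 6 * off \<delta> j x \<partial>std_seq)" .
qed

section \<open>Moments of the deviation of M from \<open>h\<close>\<close>

lemma overshoot_square_vanish: "(\<lambda>j. (\<integral>x. (st.overshoot j x)\<^sup>2 \<partial>std_seq) / h j) \<longlonglongrightarrow> 0"
proof (rule Lim_null_comparison)
  show "\<forall>\<^sub>F j in sequentially. norm ((\<integral>x. (st.overshoot j x)\<^sup>2 \<partial>std_seq) / h j) \<le> (288 * (real k)\<^sup>2 + 2) / h j"
    using good_eventually off_eventually[of "1 / 2" 6 1, simplified]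
  proof eventually_elim
    case (elim j)
    have "(\<integral>x. (st.overshoot j x)\<^sup>2 \<partial>std_seq) \<le> 288 * (real k)\<^sup>2 + 2"
      using good_overshoot_square(2)[OF elim(1), of "1 / 2"] elim(2) by simp
    then show ?case using h_gt0[of j] by (simp add: divide_right_mono)
  qed
qed (rule inverse_h)

text \<open>The left side is the boundary minus k T at stopping, that is (M - 1) (M^2 - h^2) / h^2;
  the difference of squares brings out \<open>delta\<close>.\<close>

lemma dev_factor: "st.final_dev j x + st.overshoot j x = (st.M j x - 1) * (st.M j x + h j) * delta j x / (h j)\<^sup>2"
  using h_gt0[of j]
  by (simp add: st.final_dev_def st.overshoot_def boundary_def field_simps power2_eq_square)

lemma dev_le: assumes "1 \<le> h j" shows "\<bar>st.final_dev j x + st.overshoot j x\<bar> \<le> (st.M j x + h j) ^ 3"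
proof -
  have "\<bar>st.final_dev j x + st.overshoot j x\<bar> = (st.M j x - 1) * (st.M j x + h j) * \<bar>delta j x\<bar> / (h j)\<^sup>2"
    unfolding dev_factor using base_ge1[of j x] by (simp add: abs_mult)
  also have "\<dots> \<le> (st.M j x + h j) * (st.M j x + h j) * (st.M j x + h j) / 1"
    using assms delta_le[of j x] h_gt0[of j] by (intro frac_le mult_mono) (auto simp: one_le_power)
  finally show ?thesis by (simp add: power3_eq_cube)
qed

text \<open>The cofactor \<theta> of \<open>delta\<close> in \<open>dev_factor\<close> is near 2
  when M is near \<open>h\<close>, which explains the factor 4.\<close>

lemma dev_bounds:
  assumes \<delta>: "0 < \<delta>" "\<delta> \<le> 1 / 6" and h: "1 / \<delta> \<le> h j" and d: "\<bar>delta j x\<bar> \<le> \<delta> * h j"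
  shows "4 * (1 - 3 * \<delta>)\<^sup>2 * (delta j x)\<^sup>2 \<le> (st.final_dev j x + st.overshoot j x)\<^sup>2"
    "(st.final_dev j x + st.overshoot j x)\<^sup>2 \<le> 4 * (1 + 3 * \<delta>)\<^sup>2 * (delta j x)\<^sup>2"
proof -
  let ?M = "st.M j x" and ?h = "h j"
  define \<theta> where "\<theta> = (?M - 1) * (?M + ?h) / ?h\<^sup>2"
  have h0: "0 < ?h" by (rule h_gt0)
  have dh: "1 \<le> \<delta> * ?h" using h \<delta> by (simp add: field_simps)
  have eq: "st.final_dev j x + st.overshoot j x = \<theta> * delta j x" unfolding dev_factor \<theta>_def by simp
  have lo: "(1 - 2 * \<delta>) * ?h \<le> ?M - 1" "(2 - \<delta>) * ?h \<le> ?M + ?h" using d dh by (simp_all add: algebra_simps abs_le_iff)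
  have hi: "?M - 1 \<le> (1 + \<delta>) * ?h" "?M + ?h \<le> (2 + \<delta>) * ?h" using d by (simp_all add: algebra_simps abs_le_iff)
  have "2 * (1 - 3 * \<delta>) * ?h\<^sup>2 \<le> ((1 - 2 * \<delta>) * ?h) * ((2 - \<delta>) * ?h)"
  proof -
    have "2 * (1 - 3 * \<delta>) \<le> (1 - 2 * \<delta>) * (2 - \<delta>)" using \<delta> by (simp add: algebra_simps)
    then have "2 * (1 - 3 * \<delta>) * ?h\<^sup>2 \<le> (1 - 2 * \<delta>) * (2 - \<delta>) * ?h\<^sup>2" by (rule mult_right_mono) simp
    then show ?thesis by (simp add: power2_eq_square mult_ac)
  qed
  also have "\<dots> \<le> (?M - 1) * (?M + ?h)" using lo \<delta> h0 by (intro mult_mono) auto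
  finally have t1: "2 * (1 - 3 * \<delta>) \<le> \<theta>" using h0 by (simp add: \<theta>_def field_simps)
  have "(?M - 1) * (?M + ?h) \<le> ((1 + \<delta>) * ?h) * ((2 + \<delta>) * ?h)" using hi \<delta> h0 by (intro mult_mono) auto
  also have "\<dots> \<le> 2 * (1 + 3 * \<delta>) * ?h\<^sup>2"
  proof -
    have "\<delta> * \<delta> \<le> \<delta> * 1" using \<delta> by (intro mult_left_mono) auto
    then have "(1 + \<delta>) * (2 + \<delta>) \<le> 2 * (1 + 3 * \<delta>)" using \<delta> by (simp add: algebra_simps)
    then have "(1 + \<delta>) * (2 + \<delta>) * ?h\<^sup>2 \<le> 2 * (1 + 3 * \<delta>) * ?h\<^sup>2" by (rule mult_right_mono) simp
    then show ?thesis by (simp add: power2_eq_square mult_ac)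
  qed
  finally have t2: "\<theta> \<le> 2 * (1 + 3 * \<delta>)" using h0 by (simp add: \<theta>_def field_simps)
  have "(2 * (1 - 3 * \<delta>))\<^sup>2 \<le> \<theta>\<^sup>2" using t1 \<delta> by (intro power_mono) auto
  then have "(2 * (1 - 3 * \<delta>))\<^sup>2 * (delta j x)\<^sup>2 \<le> \<theta>\<^sup>2 * (delta j x)\<^sup>2" by (rule mult_right_mono) simp
  then show "4 * (1 - 3 * \<delta>)\<^sup>2 * (delta j x)\<^sup>2 \<le> (st.final_dev j x + st.overshoot j x)\<^sup>2"
    unfolding eq power_mult_distrib by simp
  have "\<theta>\<^sup>2 \<le> (2 * (1 + 3 * \<delta>))\<^sup>2" using t1 t2 \<delta> by (intro power_mono) auto
  then have "\<theta>\<^sup>2 * (delta j x)\<^sup>2 \<le> (2 * (1 + 3 * \<delta>))\<^sup>2 * (delta j x)\<^sup>2" by (rule mult_right_mono) simp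
  then show "(st.final_dev j x + st.overshoot j x)\<^sup>2 \<le> 4 * (1 + 3 * \<delta>)\<^sup>2 * (delta j x)\<^sup>2"
    unfolding eq power_mult_distrib by simp
qed

end

lemma integral_combination:
  fixes f1 f2 f3 f4 :: "'a \<Rightarrow> real"
  assumes "integrable M f1" "integrable M f2" "integrable M f3" "integrable M f4"
  shows "(\<integral>x. a * f1 x + b * f2 x + c * f3 x - f4 x \<partial>M)
    = a * (\<integral>x. f1 x \<partial>M) + b * (\<integral>x. f2 x \<partial>M) + c * (\<integral>x. f3 x \<partial>M) - (\<integral>x. f4 x \<partial>M)"
  using assms by simp

context regime
begin

lemma delta_power_moment: "good j \<Longrightarrow> q \<le> 6 \<Longrightarrow> integrable std_seq (\<lambda>x. delta j x ^ q)"
  by (rule good_integrable[of j q _ 1])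
     (auto simp: power_abs simp del: of_nat_mult intro!: AE_I2 power_mono delta_le)

text \<open>Near \<open>h\<close> the centred sum plus the overshoot is about twice
  \<open>delta\<close>. Young's inequality separates the two summands at the price of a factor 1 +
  \<delta> on the first, and the second moment of the overshoot is negligible against
  \<open>h\<close>.\<close>

lemma delta_square_sandwich:
  assumes \<delta>: "0 < \<delta>" "\<delta> \<le> 1 / 6"
  shows "\<forall>\<^sub>F j in sequentially.
    4 * (1 - 3 * \<delta>)\<^sup>2 * (\<integral>x. (delta j x)\<^sup>2 \<partial>std_seq)
      \<le> (1 + \<delta>) * (\<integral>x. (st.final_dev j x)\<^sup>2 \<partial>std_seq) + (1 + 1 / \<delta>) * (\<integral>x. (st.overshoot j x)\<^sup>2 \<partial>std_seq)
        + 4 * (\<integral>x. (st.M j x + h j) ^ 6 * off \<delta> j x \<partial>std_seq) \<and>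
    (\<integral>x. (st.final_dev j x)\<^sup>2 \<partial>std_seq)
      \<le> (1 + \<delta>) * (4 * (1 + 3 * \<delta>)\<^sup>2 * (\<integral>x. (delta j x)\<^sup>2 \<partial>std_seq) + (\<integral>x. (st.M j x + h j) ^ 6 * off \<delta> j x \<partial>std_seq))
        + (1 + 1 / \<delta>) * (\<integral>x. (st.overshoot j x)\<^sup>2 \<partial>std_seq)"
  using good_eventually h_large[of "1 / \<delta>"]
proof eventually_elim
  case (elim j)
  let ?V = "st.final_dev j" and ?R = "st.overshoot j" and ?O = "\<lambda>x. (st.M j x + h j) ^ 6 * off \<delta> j x"
  have h1: "1 \<le> h j" using elim(1) by (simp add: good_def)
  have iD: "integrable std_seq (\<lambda>x. (delta j x)\<^sup>2)" using delta_power_moment[OF elim(1), of 2] by simp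
  have iV: "integrable std_seq (\<lambda>x. (?V x)\<^sup>2)" using good_wald[OF elim(1)] by simp
  have iR: "integrable std_seq (\<lambda>x. (?R x)\<^sup>2)" using good_overshoot_square[OF elim(1), of "1/2"] by simp
  have iO: "integrable std_seq ?O" using good_off[OF elim(1), of 6] by simp
  have lo: "4 * (1 - 3 * \<delta>)\<^sup>2 * (delta j x)\<^sup>2 \<le> (?V x + ?R x)\<^sup>2 + 4 * ?O x" for x
    using off_cases[of \<delta> j x]
  proof
    assume "off \<delta> j x = 0 \<and> \<bar>delta j x\<bar> \<le> \<delta> * h j"
    then show ?thesis using dev_bounds(1)[OF \<delta> elim(2), of x] by simp
  next
    assume *: "off \<delta> j x = 1"
    have "(1 - 3 * \<delta>)\<^sup>2 \<le> 1" using \<delta> by (intro power_le_one) auto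
    then have "4 * (1 - 3 * \<delta>)\<^sup>2 * (delta j x)\<^sup>2 \<le> 4 * (delta j x)\<^sup>2" by (intro mult_right_mono) auto
    also have "(delta j x)\<^sup>2 \<le> (st.M j x + h j)\<^sup>2"
      using delta_le[of j x] by (metis abs_ge_zero power2_abs power_mono)
    also have "(st.M j x + h j)\<^sup>2 \<le> (st.M j x + h j) ^ 6" by (rule power_base_mono) simp
    finally have "4 * (1 - 3 * \<delta>)\<^sup>2 * (delta j x)\<^sup>2 \<le> 4 * ?O x" using * by simp
    then show ?thesis using zero_le_power2[of "?V x + ?R x"] by linarith
  qed
  have hi: "(?V x + ?R x)\<^sup>2 \<le> 4 * (1 + 3 * \<delta>)\<^sup>2 * (delta j x)\<^sup>2 + ?O x" for x
    using off_cases[of \<delta> j x]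
  proof
    assume "off \<delta> j x = 0 \<and> \<bar>delta j x\<bar> \<le> \<delta> * h j"
    then show ?thesis using dev_bounds(2)[OF \<delta> elim(2), of x] by simp
  next
    assume *: "off \<delta> j x = 1"
    have "(?V x + ?R x)\<^sup>2 \<le> ((st.M j x + h j) ^ 3)\<^sup>2"
      using dev_le[OF h1, of x] by (metis abs_ge_zero power2_abs power_mono)
    also have "\<dots> = ?O x" using * by (simp flip: power_mult)
    finally show ?thesis using zero_le_mult_iff[of "4 * (1 + 3 * \<delta>)\<^sup>2" "(delta j x)\<^sup>2"] by (simp add: add_increasing)
  qed
  have "(\<integral>x. 4 * (1 - 3 * \<delta>)\<^sup>2 * (delta j x)\<^sup>2 \<partial>std_seq)
      \<le> (\<integral>x. (1 + \<delta>) * (?V x)\<^sup>2 + (1 + 1 / \<delta>) * (?R x)\<^sup>2 + 4 * ?O x \<partial>std_seq)"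
  proof (rule integral_mono)
    fix x show "4 * (1 - 3 * \<delta>)\<^sup>2 * (delta j x)\<^sup>2 \<le> (1 + \<delta>) * (?V x)\<^sup>2 + (1 + 1 / \<delta>) * (?R x)\<^sup>2 + 4 * ?O x"
      using lo[of x] square_add_le[OF \<delta>(1), of "?V x" "?R x"] by linarith
  qed (use iD iV iR iO in auto)
  then have 1: "4 * (1 - 3 * \<delta>)\<^sup>2 * (\<integral>x. (delta j x)\<^sup>2 \<partial>std_seq)
      \<le> (1 + \<delta>) * (\<integral>x. (?V x)\<^sup>2 \<partial>std_seq) + (1 + 1 / \<delta>) * (\<integral>x. (?R x)\<^sup>2 \<partial>std_seq) + 4 * (\<integral>x. ?O x \<partial>std_seq)"
    using iD iV iR iO by simp
  have "(\<integral>x. (?V x)\<^sup>2 \<partial>std_seq)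
      \<le> (\<integral>x. (1 + \<delta>) * (4 * (1 + 3 * \<delta>)\<^sup>2 * (delta j x)\<^sup>2 + ?O x) + (1 + 1 / \<delta>) * (?R x)\<^sup>2 \<partial>std_seq)"
  proof (rule integral_mono)
    fix x
    have "(?V x)\<^sup>2 \<le> (1 + \<delta>) * (?V x + ?R x)\<^sup>2 + (1 + 1 / \<delta>) * (?R x)\<^sup>2"
      using square_add_le[OF \<delta>(1), of "?V x + ?R x" "- ?R x"] by simp
    moreover have "(1 + \<delta>) * (?V x + ?R x)\<^sup>2 \<le> (1 + \<delta>) * (4 * (1 + 3 * \<delta>)\<^sup>2 * (delta j x)\<^sup>2 + ?O x)"
      using hi[of x] \<delta> by (intro mult_left_mono) auto
    ultimately show "(?V x)\<^sup>2 \<le> (1 + \<delta>) * (4 * (1 + 3 * \<delta>)\<^sup>2 * (delta j x)\<^sup>2 + ?O x) + (1 + 1 / \<delta>) * (?R x)\<^sup>2"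
      by linarith
  qed (use iD iV iR iO in auto)
  then have 2: "(\<integral>x. (?V x)\<^sup>2 \<partial>std_seq) \<le> (1 + \<delta>) * (4 * (1 + 3 * \<delta>)\<^sup>2 * (\<integral>x. (delta j x)\<^sup>2 \<partial>std_seq) + (\<integral>x. ?O x \<partial>std_seq))
        + (1 + 1 / \<delta>) * (\<integral>x. (?R x)\<^sup>2 \<partial>std_seq)"
    using iD iV iR iO by simp
  show ?case using 1 2 by blast
qed

lemma final_dev_square_limit: "(\<lambda>j. (\<integral>x. (st.final_dev j x)\<^sup>2 \<partial>std_seq) / h j) \<longlonglongrightarrow> 2"
proof -
  have "(\<lambda>j. 2 * ((\<integral>x. st.M j x \<partial>std_seq) / h j - 1 / h j)) \<longlonglongrightarrow> 2 * (1 - 0)"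
    by (intro tendsto_intros mean_M inverse_h)
  then have "(\<lambda>j. 2 * ((\<integral>x. st.M j x \<partial>std_seq) / h j - 1 / h j)) \<longlonglongrightarrow> 2" by simp
  then show ?thesis
  proof (rule Lim_transform_eventually)
    show "\<forall>\<^sub>F j in sequentially. 2 * ((\<integral>x. st.M j x \<partial>std_seq) / h j - 1 / h j) = (\<integral>x. (st.final_dev j x)\<^sup>2 \<partial>std_seq) / h j"
      using good_eventually by eventually_elim (simp add: good_wald diff_divide_distrib)
  qed
qed

lemma delta_square_bounds:
  assumes \<delta>: "0 < \<delta>" "\<delta> \<le> 1 / 6"
  shows "\<forall>\<^sub>F j in sequentially. (\<integral>x. (delta j x)\<^sup>2 \<partial>std_seq) / h j \<le> (2 + 3 * \<delta>) / (4 * (1 - 3 * \<delta>)\<^sup>2)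
    \<and> (2 - \<delta>) / ((1 + \<delta>) * (4 * (1 + 3 * \<delta>)\<^sup>2)) \<le> (\<integral>x. (delta j x)\<^sup>2 \<partial>std_seq) / h j"
proof -
  let ?v = "\<lambda>j. (\<integral>x. (st.final_dev j x)\<^sup>2 \<partial>std_seq) / h j" and ?\<rho> = "\<lambda>j. (\<integral>x. (st.overshoot j x)\<^sup>2 \<partial>std_seq) / h j"
  let ?o = "\<lambda>j. (\<integral>x. (st.M j x + h j) ^ 6 * off \<delta> j x \<partial>std_seq) * (1 / h j)"
  have o: "?o \<longlonglongrightarrow> 0 * 0"
    using \<delta> by (intro tendsto_mult inverse_h off_integral) auto
  have "(\<lambda>j. (1 + \<delta>) * ?v j + (1 + 1 / \<delta>) * ?\<rho> j + 4 * ?o j) \<longlonglongrightarrow> (1 + \<delta>) * 2 + (1 + 1 / \<delta>) * 0 + 4 * (0 * 0)"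
    by (intro tendsto_intros final_dev_square_limit overshoot_square_vanish o)
  then have e1: "\<forall>\<^sub>F j in sequentially. (1 + \<delta>) * ?v j + (1 + 1 / \<delta>) * ?\<rho> j + 4 * ?o j < 2 + 3 * \<delta>"
    by (rule order_tendstoD) (use \<delta> in auto)
  have "(\<lambda>j. ?v j - (1 + \<delta>) * ?o j - (1 + 1 / \<delta>) * ?\<rho> j) \<longlonglongrightarrow> 2 - (1 + \<delta>) * (0 * 0) - (1 + 1 / \<delta>) * 0"
    by (intro tendsto_intros final_dev_square_limit overshoot_square_vanish o)
  then have e2: "\<forall>\<^sub>F j in sequentially. 2 - \<delta> < ?v j - (1 + \<delta>) * ?o j - (1 + 1 / \<delta>) * ?\<rho> j"
    by (rule order_tendstoD) (use \<delta> in auto)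
  show ?thesis
    using e1 e2 delta_square_sandwich[OF \<delta>]
  proof eventually_elim
    case (elim j)
    define D V R O' where "D = (\<integral>x. (delta j x)\<^sup>2 \<partial>std_seq)" "V = (\<integral>x. (st.final_dev j x)\<^sup>2 \<partial>std_seq)"
      "R = (\<integral>x. (st.overshoot j x)\<^sup>2 \<partial>std_seq)" "O' = (\<integral>x. (st.M j x + h j) ^ 6 * off \<delta> j x \<partial>std_seq)"
    note defs = this[symmetric]
    have h0: "0 < h j" by (rule h_gt0)
    have "4 * (1 - 3 * \<delta>)\<^sup>2 * D / h j \<le> ((1 + \<delta>) * V + (1 + 1 / \<delta>) * R + 4 * O') / h j"
      using elim(3) h0 unfolding defs by (intro divide_right_mono) auto
    also have "\<dots> = (1 + \<delta>) * (V / h j) + (1 + 1 / \<delta>) * (R / h j) + 4 * (O' * (1 / h j))"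
      by (simp add: add_divide_distrib)
    also have "\<dots> \<le> 2 + 3 * \<delta>" using elim(1) unfolding defs by simp
    finally have "4 * (1 - 3 * \<delta>)\<^sup>2 * (D / h j) \<le> 2 + 3 * \<delta>" by simp
    then have A: "D / h j \<le> (2 + 3 * \<delta>) / (4 * (1 - 3 * \<delta>)\<^sup>2)"
      using \<delta> by (subst pos_le_divide_eq) (auto simp: mult.commute)
    have "V / h j \<le> ((1 + \<delta>) * (4 * (1 + 3 * \<delta>)\<^sup>2 * D + O') + (1 + 1 / \<delta>) * R) / h j"
      using elim(3) h0 unfolding defs by (intro divide_right_mono) auto
    also have "\<dots> = (1 + \<delta>) * (4 * (1 + 3 * \<delta>)\<^sup>2) * (D / h j) + (1 + \<delta>) * (O' * (1 / h j)) + (1 + 1 / \<delta>) * (R / h j)"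
      by (simp add: add_divide_distrib distrib_left)
    finally have "2 - \<delta> \<le> (1 + \<delta>) * (4 * (1 + 3 * \<delta>)\<^sup>2) * (D / h j)" using elim(2) unfolding defs by linarith
    then have Bd: "(2 - \<delta>) / ((1 + \<delta>) * (4 * (1 + 3 * \<delta>)\<^sup>2)) \<le> D / h j"
      using \<delta> by (subst pos_divide_le_eq) (auto simp: mult.commute intro!: mult_pos_pos)
    show ?case using A Bd unfolding defs by blast
  qed
qed

lemma delta_square_limit: "(\<lambda>j. (\<integral>x. (delta j x)\<^sup>2 \<partial>std_seq) / h j) \<longlonglongrightarrow> 1 / 2"
proof (rule tendstoI)
  fix e :: real assume e: "0 < e"
  \<comment> \<open>The bounds hold for large \<open>j\<close> at fixed \<delta>. Letting \<delta>
    tend to 0 from the right yields one \<delta> for which both lie within \<open>e\<close> of 1 /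
    2.\<close>
  have u: "((\<lambda>\<delta>::real. (2 + 3 * \<delta>) / (4 * (1 - 3 * \<delta>)\<^sup>2)) \<longlongrightarrow> (2 + 3 * 0) / (4 * (1 - 3 * 0)\<^sup>2)) (at_right 0)"
    by (intro tendsto_intros) auto
  have l: "((\<lambda>\<delta>::real. (2 - \<delta>) / ((1 + \<delta>) * (4 * (1 + 3 * \<delta>)\<^sup>2))) \<longlongrightarrow> (2 - 0) / ((1 + 0) * (4 * (1 + 3 * 0)\<^sup>2))) (at_right 0)"
    by (intro tendsto_intros) auto
  have "\<forall>\<^sub>F \<delta> in at_right 0. (2 + 3 * \<delta>) / (4 * (1 - 3 * \<delta>)\<^sup>2) < 1 / 2 + e"
    using order_tendstoD(2)[OF u] e by simp
  moreover have "\<forall>\<^sub>F \<delta> in at_right 0. 1 / 2 - e < (2 - \<delta>) / ((1 + \<delta>) * (4 * (1 + 3 * \<delta>)\<^sup>2))"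
    using order_tendstoD(1)[OF l] e by simp
  moreover have "\<forall>\<^sub>F \<delta> in at_right 0. \<delta> < (1 / 6 :: real)" by (rule order_tendstoD) (auto simp: tendsto_ident_at)
  moreover have "\<forall>\<^sub>F \<delta> in at_right 0. (0 :: real) < \<delta>" by (simp add: eventually_at_right_less)
  ultimately have "\<forall>\<^sub>F \<delta> in at_right 0. (0 :: real) < \<delta> \<and> \<delta> < 1 / 6
      \<and> (2 + 3 * \<delta>) / (4 * (1 - 3 * \<delta>)\<^sup>2) < 1 / 2 + e \<and> 1 / 2 - e < (2 - \<delta>) / ((1 + \<delta>) * (4 * (1 + 3 * \<delta>)\<^sup>2))"
    by eventually_elim auto
  then obtain \<delta> :: real where \<delta>: "0 < \<delta>" "\<delta> < 1 / 6" "(2 + 3 * \<delta>) / (4 * (1 - 3 * \<delta>)\<^sup>2) < 1 / 2 + e"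
    "1 / 2 - e < (2 - \<delta>) / ((1 + \<delta>) * (4 * (1 + 3 * \<delta>)\<^sup>2))"
    using eventually_happens'[OF trivial_limit_at_right_real] by blast
  show "\<forall>\<^sub>F j in sequentially. dist ((\<integral>x. (delta j x)\<^sup>2 \<partial>std_seq) / h j) (1 / 2) < e"
    using delta_square_bounds[OF \<delta>(1) less_imp_le[OF \<delta>(2)]]
    by eventually_elim (use \<delta> in \<open>simp only: dist_real_def abs_less_iff; linarith\<close>)
qed

text \<open>Near \<open>h\<close> one factor of the cube is at most \<delta> h, and the remaining
  square has a mean of order \<open>h\<close>.\<close>

lemma delta_cube_limit: "(\<lambda>j. (\<integral>x. \<bar>delta j x\<bar> ^ 3 \<partial>std_seq) / (h j)\<^sup>2) \<longlonglongrightarrow> 0"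
proof (rule tendstoI)
  fix e :: real assume e: "0 < e"
  define \<delta> where "\<delta> = min (e / 2) (1 / 2)"
  have \<delta>: "0 < \<delta>" "\<delta> < 1" "\<delta> \<le> e / 2" using e by (auto simp: \<delta>_def)
  have a1: "\<forall>\<^sub>F j in sequentially. (\<integral>x. (delta j x)\<^sup>2 \<partial>std_seq) / h j < 1"
    using delta_square_limit by (rule order_tendstoD) simp
  have o: "\<forall>\<^sub>F j in sequentially. (\<integral>x. (st.M j x + h j) ^ 3 * off \<delta> j x \<partial>std_seq) < e / 2"
    using \<delta> e by (intro off_eventually) auto
  show "\<forall>\<^sub>F j in sequentially. dist ((\<integral>x. \<bar>delta j x\<bar> ^ 3 \<partial>std_seq) / (h j)\<^sup>2) 0 < e"
    using good_eventually a1 o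
  proof eventually_elim
    case (elim j)
    have h1: "1 \<le> h j" and h0: "0 < h j" using elim(1) h_gt0 by (auto simp: good_def)
    have i2: "integrable std_seq (\<lambda>x. (delta j x)\<^sup>2)" using delta_power_moment[OF elim(1), of 2] by simp
    have i3: "integrable std_seq (\<lambda>x. \<bar>delta j x\<bar> ^ 3)"
      using integrable_abs[OF delta_power_moment[OF elim(1), of 3]] by (simp add: power_abs)
    have iO: "integrable std_seq (\<lambda>x. (st.M j x + h j) ^ 3 * off \<delta> j x)" using good_off[OF elim(1), of 3] by simp
    have "(\<integral>x. \<bar>delta j x\<bar> ^ 3 \<partial>std_seq) \<le> (\<integral>x. \<delta> * h j * (delta j x)\<^sup>2 + (st.M j x + h j) ^ 3 * off \<delta> j x \<partial>std_seq)"
    proof (rule integral_mono[OF i3])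
      fix x show "\<bar>delta j x\<bar> ^ 3 \<le> \<delta> * h j * (delta j x)\<^sup>2 + (st.M j x + h j) ^ 3 * off \<delta> j x"
        using off_cases[of \<delta> j x]
      proof
        assume *: "off \<delta> j x = 0 \<and> \<bar>delta j x\<bar> \<le> \<delta> * h j"
        have "\<bar>delta j x\<bar> ^ 3 = \<bar>delta j x\<bar> * (delta j x)\<^sup>2" by (simp add: power3_eq_cube power2_eq_square mult.assoc)
        also have "\<dots> \<le> \<delta> * h j * (delta j x)\<^sup>2" using * by (intro mult_right_mono) auto
        finally show ?thesis using * by simp
      next
        assume *: "off \<delta> j x = 1"
        have "\<bar>delta j x\<bar> ^ 3 \<le> (st.M j x + h j) ^ 3" using delta_le[of j x] by (intro power_mono) auto
        moreover have "0 \<le> \<delta> * h j * (delta j x)\<^sup>2" using \<delta> h0 by simp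
        ultimately show ?thesis using * by simp
      qed
    qed (use i2 iO in simp)
    also have "\<dots> = \<delta> * h j * (\<integral>x. (delta j x)\<^sup>2 \<partial>std_seq) + (\<integral>x. (st.M j x + h j) ^ 3 * off \<delta> j x \<partial>std_seq)"
      using i2 iO by simp
    also have "\<dots> < \<delta> * h j * h j + e / 2"
    proof (rule add_less_le_mono)
      have "(\<integral>x. (delta j x)\<^sup>2 \<partial>std_seq) < h j" using elim(2) h0 by (simp add: field_simps)
      then show "\<delta> * h j * (\<integral>x. (delta j x)\<^sup>2 \<partial>std_seq) < \<delta> * h j * h j" using \<delta> h0 by simp
    qed (use elim in simp)
    also have "\<dots> \<le> e / 2 * (h j)\<^sup>2 + e / 2 * (h j)\<^sup>2"
    proof (rule add_mono)
      show "\<delta> * h j * h j \<le> e / 2 * (h j)\<^sup>2" using \<delta> h0 by (simp add: power2_eq_square mult.assoc mult_right_mono)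
      show "e / 2 \<le> e / 2 * (h j)\<^sup>2" using e one_le_power[OF h1, of 2] by simp
    qed
    finally have "(\<integral>x. \<bar>delta j x\<bar> ^ 3 \<partial>std_seq) / (h j)\<^sup>2 < e" using h0 by (simp add: field_simps)
    moreover have "0 \<le> (\<integral>x. \<bar>delta j x\<bar> ^ 3 \<partial>std_seq) / (h j)\<^sup>2" by simp
    ultimately show ?case by simp
  qed
qed

text \<open>Wald's first identity gives \<open>E[(M - 1) (M + h) \<Delta> / h^2] = E[overshoot]\<close> with \<open>\<Delta> = M - h\<close>; expanding in \<open>\<Delta>\<close>
  leaves \<open>2 E \<Delta> + 3 E \<Delta>^2 / h\<close> on the left, where \<open>E \<Delta>^2 / h \<longlonglongrightarrow> 1 / 2\<close>.\<close>

lemma delta_mean_limit: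
  assumes R: "(\<lambda>j. \<integral>x. st.overshoot j x \<partial>std_seq) \<longlonglongrightarrow> e"
  shows "(\<lambda>j. \<integral>x. delta j x \<partial>std_seq) \<longlonglongrightarrow> (e - 3 / 2) / 2"
proof -
  let ?a = "\<lambda>j. (\<integral>x. (delta j x)\<^sup>2 \<partial>std_seq) / h j" and ?d3 = "\<lambda>j. (\<integral>x. delta j x ^ 3 \<partial>std_seq) / (h j)\<^sup>2"
  have d3: "?d3 \<longlonglongrightarrow> 0"
  proof (rule Lim_null_comparison[OF _ delta_cube_limit])
    show "\<forall>\<^sub>F j in sequentially. norm (?d3 j) \<le> (\<integral>x. \<bar>delta j x\<bar> ^ 3 \<partial>std_seq) / (h j)\<^sup>2"
    proof (rule always_eventually, rule allI)
      fix j
      have "\<bar>\<integral>x. delta j x ^ 3 \<partial>std_seq\<bar> \<le> (\<integral>x. \<bar>delta j x ^ 3\<bar> \<partial>std_seq)" by (rule integral_abs_bound)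
      then show "norm (?d3 j) \<le> (\<integral>x. \<bar>delta j x\<bar> ^ 3 \<partial>std_seq) / (h j)\<^sup>2"
        by (simp add: power_abs divide_right_mono)
    qed
  qed
  have "(\<lambda>j. ((\<integral>x. st.overshoot j x \<partial>std_seq) - 3 * ?a j + ?a j * (1 / h j) - ?d3 j) / (2 * (1 - 1 / h j)))
      \<longlonglongrightarrow> (e - 3 * (1 / 2) + 1 / 2 * 0 - 0) / (2 * (1 - 0))"
    by (intro tendsto_intros R delta_square_limit inverse_h d3) auto
  then have "(\<lambda>j. ((\<integral>x. st.overshoot j x \<partial>std_seq) - 3 * ?a j + ?a j * (1 / h j) - ?d3 j) / (2 * (1 - 1 / h j)))
      \<longlonglongrightarrow> (e - 3 / 2) / 2" by simp
  then show ?thesis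
  proof (rule Lim_transform_eventually)
    show "\<forall>\<^sub>F j in sequentially. ((\<integral>x. st.overshoot j x \<partial>std_seq) - 3 * ?a j + ?a j * (1 / h j) - ?d3 j) / (2 * (1 - 1 / h j))
      = (\<integral>x. delta j x \<partial>std_seq)"
      using good_eventually h_large[of 2]
    proof eventually_elim
      case (elim j)
      have h0: "0 < h j" by (rule h_gt0)
      have i1: "integrable std_seq (delta j)" using delta_power_moment[OF elim(1), of 1] by simp
      have i2: "integrable std_seq (\<lambda>x. (delta j x)\<^sup>2)" using delta_power_moment[OF elim(1), of 2] by simp
      have i3: "integrable std_seq (\<lambda>x. delta j x ^ 3)" using delta_power_moment[OF elim(1), of 3] by simp
      have "st.overshoot j x = 2 * (1 - 1 / h j) * delta j x + (3 / h j - 1 / (h j)\<^sup>2) * (delta j x)\<^sup>2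
          + 1 / (h j)\<^sup>2 * delta j x ^ 3 - st.final_dev j x" for x
      proof -
        define d where "d = delta j x"
        have M: "st.M j x = h j + d" by (simp add: d_def)
        have "st.final_dev j x + st.overshoot j x = (h j + d - 1) * (h j + d + h j) * d / (h j)\<^sup>2"
          using dev_factor[of j x] unfolding M by (simp add: d_def)
        also have "\<dots> = 2 * (1 - 1 / h j) * d + (3 / h j - 1 / (h j)\<^sup>2) * d\<^sup>2 + 1 / (h j)\<^sup>2 * d ^ 3"
          using h0 by (simp add: field_simps power2_eq_square power3_eq_cube)
        finally show ?thesis unfolding d_def by simp
      qed
      then have "(\<integral>x. st.overshoot j x \<partial>std_seq) = (\<integral>x. 2 * (1 - 1 / h j) * delta j x + (3 / h j - 1 / (h j)\<^sup>2) * (delta j x)\<^sup>2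
          + 1 / (h j)\<^sup>2 * delta j x ^ 3 - st.final_dev j x \<partial>std_seq)" by simp
      also have "\<dots> = 2 * (1 - 1 / h j) * (\<integral>x. delta j x \<partial>std_seq) + (3 / h j - 1 / (h j)\<^sup>2) * (\<integral>x. (delta j x)\<^sup>2 \<partial>std_seq)
          + 1 / (h j)\<^sup>2 * (\<integral>x. delta j x ^ 3 \<partial>std_seq) - (\<integral>x. st.final_dev j x \<partial>std_seq)"
        by (rule integral_combination[OF i1 i2 i3 good_wald(1)[OF elim(1)]])
      also have "\<dots> = 2 * (1 - 1 / h j) * (\<integral>x. delta j x \<partial>std_seq) + 3 * ?a j - ?a j * (1 / h j) + ?d3 j"
        unfolding good_wald(3)[OF elim(1)] using h0 by (simp add: field_simps power2_eq_square)
      finally have eq: "(\<integral>x. st.overshoot j x \<partial>std_seq) - 3 * ?a j + ?a j * (1 / h j) - ?d3 j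
          = 2 * (1 - 1 / h j) * (\<integral>x. delta j x \<partial>std_seq)" by simp
      have "2 * (1 - 1 / h j) \<noteq> 0" using elim(2) by (simp add: field_simps)
      then show ?case unfolding eq by simp
    qed
  qed
qed

end

section \<open>Local expectations of chi-square walks\<close>

lemma integral_std_split':
  fixes f :: "(nat \<Rightarrow> real) \<Rightarrow> real"
  assumes f: "integrable std_seq f"
  shows "(\<integral>x. f x \<partial>std_seq) = (\<integral>y. \<integral>x. f (comb_seq d x y) \<partial>std_seq \<partial>std_seq)"
    and "integrable std_seq (\<lambda>y. \<integral>x. f (comb_seq d x y) \<partial>std_seq)"
proof -
  have [measurable]: "f \<in> borel_measurable std_seq" using f by auto
  have i: "integrable (std_seq \<Otimes>\<^sub>M std_seq) (\<lambda>(x, y). f (comb_seq d x y))"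
    by (rule integrable_std_split[OF f])
  have "(\<integral>x. f x \<partial>std_seq) = (\<integral>z. f (case z of (x, y) \<Rightarrow> comb_seq d x y) \<partial>(std_seq \<Otimes>\<^sub>M std_seq))"
    by (subst distr_comb_seq_std[of d, symmetric], subst integral_distr) simp_all
  also have "\<dots> = (\<integral>z. (case z of (x, y) \<Rightarrow> f (comb_seq d x y)) \<partial>(std_seq \<Otimes>\<^sub>M std_seq))"
    by (simp add: split_beta')
  also have "\<dots> = (\<integral>y. \<integral>x. f (comb_seq d x y) \<partial>std_seq \<partial>std_seq)"
    by (rule std_pair.integral_snd[symmetric, OF i])
  finally show "(\<integral>x. f x \<partial>std_seq) = (\<integral>y. \<integral>x. f (comb_seq d x y) \<partial>std_seq \<partial>std_seq)" .
  show "integrable std_seq (\<lambda>y. \<integral>x. f (comb_seq d x y) \<partial>std_seq)"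
    by (rule std_pair.integrable_snd[OF i])
qed

text \<open>A triangle area: the overshoot as a function of the starting excess \<open>u\<close>,
  integrated over \<open>u\<close>. It is the source of the half second moment.\<close>

lemma has_bochner_integral_ramp:
  fixes e D :: real
  shows "has_bochner_integral lborel (\<lambda>u. if e < u then max 0 (D - u) else 0) ((max 0 (D - e))\<^sup>2 / 2)"
proof (cases "e < D")
  case True
  have "has_bochner_integral lborel (\<lambda>u. (D - u) * indicator {e..D} u) (- (D - D)\<^sup>2 / 2 - (- (D - e)\<^sup>2 / 2))"
    by (rule has_bochner_integral_FTC_Icc_nonneg[where F = "\<lambda>u. - (D - u)\<^sup>2 / 2"])
       (use True in \<open>auto intro!: derivative_eq_intros simp: field_simps\<close>)
  moreover have "AE u in lborel. (D - u) * indicator {e..D} u = (if e < u then max 0 (D - u) else 0)"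
    using AE_lborel_singleton[of e] by eventually_elim (auto simp: indicator_def max_def)
  ultimately have "has_bochner_integral lborel (\<lambda>u. if e < u then max 0 (D - u) else 0) (- (D - D)\<^sup>2 / 2 - (- (D - e)\<^sup>2 / 2))"
    by (subst (asm) has_bochner_integral_cong_AE) auto
  then show ?thesis using True by simp
next
  case False
  then have "(\<lambda>u. if e < u then max 0 (D - u) else 0) = (\<lambda>u. 0)" "(max 0 (D - e))\<^sup>2 / 2 = 0"
    by (auto simp: max_def fun_eq_iff)
  then show ?thesis by (simp only: has_bochner_integral_zero)
qed

text \<open>With \<open>u\<close> the excess over the boundary at step n and \<open>z\<close> the
  boundary increment minus the next block, this is the drop in the indicator of being above the
  boundary. As a signed indicator of the interval between 0 and \<open>z\<close> it integrates to
  \<open>z\<close>.\<close>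

definition crossing :: "real \<Rightarrow> real \<Rightarrow> real" where
  "crossing z u = (if 0 < u then 1 else 0) - (if z < u then 1 else 0)"

lemma crossing_integral:
  shows "integrable lborel (crossing z)" "(\<integral>u. crossing z u \<partial>lborel) = z"
    "integrable lborel (\<lambda>u. \<bar>u * crossing z u\<bar>)" "(\<integral>u. \<bar>u * crossing z u\<bar> \<partial>lborel) \<le> z\<^sup>2"
proof -
  have eq: "crossing z = (\<lambda>u. indicator {0<..z} u - indicator {z<..0} u)"
    by (auto simp: crossing_def indicator_def fun_eq_iff)
  have ind: "integrable lborel (indicator {0<..z} :: real \<Rightarrow> real)" "integrable lborel (indicator {z<..0} :: real \<Rightarrow> real)"
    by (cases "0 \<le> z"; simp)+
  then show i: "integrable lborel (crossing z)" unfolding eq by simp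
  show "(\<integral>u. crossing z u \<partial>lborel) = z"
    unfolding eq Bochner_Integration.integral_diff[OF ind] by (cases "0 \<le> z") simp_all
  have le: "\<bar>u * crossing z u\<bar> \<le> \<bar>z\<bar> * indicator {min 0 z..max 0 z} u" for u
    by (auto simp: crossing_def indicator_def abs_mult)
  have ii: "integrable lborel (\<lambda>u. \<bar>z\<bar> * indicator {min 0 z..max 0 z} u)" by simp
  have [measurable]: "crossing z \<in> borel_measurable borel" unfolding crossing_def[abs_def] by measurable
  show j: "integrable lborel (\<lambda>u. \<bar>u * crossing z u\<bar>)"
    by (rule Bochner_Integration.integrable_bound[OF ii]) (use le in auto)
  have "(\<integral>u. \<bar>u * crossing z u\<bar> \<partial>lborel) \<le> (\<integral>u. \<bar>z\<bar> * indicator {min 0 z..max 0 z} u \<partial>lborel)"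
    by (rule integral_mono[OF j ii le])
  also have "\<dots> = z\<^sup>2" by (auto simp: min_def max_def power2_eq_square)
  finally show "(\<integral>u. \<bar>u * crossing z u\<bar> \<partial>lborel) \<le> z\<^sup>2" .
qed

text \<open>At least six degrees of freedom make the chi-square density Lipschitz at the origin.\<close>

locale chi_density =
  fixes C :: real and dens :: "nat \<Rightarrow> real \<Rightarrow> real"
  assumes C_pos: "0 < C"
    and dens_measurable: "\<And>d. 6 \<le> d \<Longrightarrow> dens d \<in> borel_measurable borel"
    and dens_nonneg: "\<And>d y. 6 \<le> d \<Longrightarrow> 0 \<le> dens d y"
    and dens_le: "\<And>d y. 6 \<le> d \<Longrightarrow> dens d y \<le> C / sqrt d"
    and dens_lipschitz: "\<And>d y z. 6 \<le> d \<Longrightarrow> \<bar>dens d y - dens d z\<bar> \<le> C / d * \<bar>y - z\<bar>"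
    and dens_eq: "\<And>d f. 6 \<le> d \<Longrightarrow> f \<in> borel_measurable borel \<Longrightarrow>
      (\<integral>\<^sup>+x. f (sumsq d x) \<partial>std_seq) = (\<integral>\<^sup>+y. f y * ennreal (dens d y) \<partial>lborel)"
begin

lemma distr_sumsq:
  assumes d: "6 \<le> d" shows "distr std_seq borel (sumsq d) = density lborel (dens d)"
proof (rule measure_eqI)
  fix A :: "real set" assume "A \<in> sets (distr std_seq borel (sumsq d))"
  then have A: "A \<in> sets borel" by simp
  have "emeasure (distr std_seq borel (sumsq d)) A = (\<integral>\<^sup>+y. indicator A y \<partial>distr std_seq borel (sumsq d))"
    using A by simp
  also have "\<dots> = (\<integral>\<^sup>+x. indicator A (sumsq d x) \<partial>std_seq)"
    using A by (intro nn_integral_distr) auto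
  also have "\<dots> = (\<integral>\<^sup>+y. indicator A y * ennreal (dens d y) \<partial>lborel)"
    using A by (intro dens_eq d) auto
  also have "\<dots> = emeasure (density lborel (dens d)) A"
    using A dens_measurable[OF d] by (subst emeasure_density) (auto simp: mult.commute)
  finally show "emeasure (distr std_seq borel (sumsq d)) A = emeasure (density lborel (dens d)) A" .
qed simp

lemma integral_sumsq_shift:
  fixes f :: "real \<Rightarrow> real"
  assumes d: "6 \<le> d" and f[measurable]: "f \<in> borel_measurable borel"
  shows "(\<integral>x. f (sumsq d x - c) \<partial>std_seq) = (\<integral>u. dens d (c + u) * f u \<partial>lborel)"
proof -
  note dens_measurable[OF d, measurable]
  have "(\<integral>x. f (sumsq d x - c) \<partial>std_seq) = (\<integral>s. f (s - c) \<partial>distr std_seq borel (sumsq d))"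
    by (rule integral_distr[symmetric]) auto
  also have "\<dots> = (\<integral>s. dens d s * f (s - c) \<partial>lborel)"
    unfolding distr_sumsq[OF d] by (subst integral_density) (auto simp: dens_nonneg[OF d])
  also have "\<dots> = (\<integral>u. dens d (c + u) * f u \<partial>lborel)"
    by (subst lborel_integral_real_affine[where c = 1 and t = c]) simp_all
  finally show ?thesis .
qed

text \<open>The density at c + u is replaced by the density at \<open>c\<close>, at a Lipschitz cost
  of C / d times |u|.\<close>

lemma local_integral:
  fixes f :: "real \<Rightarrow> real"
  assumes d: "6 \<le> d" and f: "integrable lborel f" and uf: "integrable lborel (\<lambda>u. \<bar>u * f u\<bar>)"
  shows "\<bar>(\<integral>x. f (sumsq d x - c) \<partial>std_seq) - dens d c * (\<integral>u. f u \<partial>lborel)\<bar> \<le> C / d * (\<integral>u. \<bar>u * f u\<bar> \<partial>lborel)"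
proof -
  note dens_measurable[OF d, measurable]
  have [measurable]: "f \<in> borel_measurable borel" using f by auto
  have i: "integrable lborel (\<lambda>u. dens d (c + u) * f u)"
  proof (rule Bochner_Integration.integrable_bound)
    show "integrable lborel (\<lambda>u. C / sqrt d * f u)" using f by simp
    have "norm (dens d (c + u) * f u) \<le> norm (C / sqrt d * f u)" for u
    proof -
      have "dens d (c + u) * \<bar>f u\<bar> \<le> C / sqrt d * \<bar>f u\<bar>" by (intro mult_right_mono dens_le[OF d]) auto
      then show ?thesis using dens_nonneg[OF d, of "c + u"] C_pos by (simp add: abs_mult)
    qed
    then show "AE u in lborel. norm (dens d (c + u) * f u) \<le> norm (C / sqrt d * f u)" by simp
  qed measurable
  have "(\<integral>x. f (sumsq d x - c) \<partial>std_seq) - dens d c * (\<integral>u. f u \<partial>lborel)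
      = (\<integral>u. dens d (c + u) * f u - dens d c * f u \<partial>lborel)"
    using f i by (subst integral_sumsq_shift[OF d]) auto
  also have "\<bar>\<dots>\<bar> \<le> (\<integral>u. \<bar>dens d (c + u) * f u - dens d c * f u\<bar> \<partial>lborel)"
    by (rule integral_abs_bound)
  also have "\<dots> \<le> (\<integral>u. C / d * \<bar>u * f u\<bar> \<partial>lborel)"
  proof (rule integral_mono)
    show "integrable lborel (\<lambda>u. \<bar>dens d (c + u) * f u - dens d c * f u\<bar>)" using f i by auto
    show "integrable lborel (\<lambda>u. C / d * \<bar>u * f u\<bar>)" using uf by simp
    fix u
    have "\<bar>dens d (c + u) * f u - dens d c * f u\<bar> = \<bar>dens d (c + u) - dens d c\<bar> * \<bar>f u\<bar>"
      by (simp flip: abs_mult left_diff_distrib)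
    also have "\<dots> \<le> (C / d * \<bar>c + u - c\<bar>) * \<bar>f u\<bar>"
      by (intro mult_right_mono dens_lipschitz[OF d]) auto
    finally show "\<bar>dens d (c + u) * f u - dens d c * f u\<bar> \<le> C / d * \<bar>u * f u\<bar>" by (simp add: abs_mult)
  qed
  finally show ?thesis by simp
qed

text \<open>\<open>local_integral\<close> is applied conditionally on the coordinates after
  \<open>d\<close>; \<open>W\<close> dominates the conditional error terms.\<close>

lemma local_expectation:
  fixes F :: "real \<Rightarrow> (nat \<Rightarrow> real) \<Rightarrow> real"
  assumes d: "6 \<le> d" and F: "integrable std_seq (\<lambda>x. F (sumsq d x - c) (\<lambda>i. x (i + d)))"
    and f: "\<And>y. integrable lborel (\<lambda>u. F u y)" and uf: "\<And>y. integrable lborel (\<lambda>u. \<bar>u * F u y\<bar>)"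
    and I: "integrable std_seq (\<lambda>y. \<integral>u. F u y \<partial>lborel)"
    and W: "integrable std_seq W" "\<And>y. (\<integral>u. \<bar>u * F u y\<bar> \<partial>lborel) \<le> W y"
  shows "\<bar>(\<integral>x. F (sumsq d x - c) (\<lambda>i. x (i + d)) \<partial>std_seq) - dens d c * (\<integral>y. \<integral>u. F u y \<partial>lborel \<partial>std_seq)\<bar>
    \<le> C / d * (\<integral>y. W y \<partial>std_seq)"
proof -
  let ?J = "\<lambda>y. \<integral>x. F (sumsq d x - c) y \<partial>std_seq" and ?I = "\<lambda>y. \<integral>u. F u y \<partial>lborel"
  note sp = integral_std_split'[OF F, of d]
  have J: "integrable std_seq ?J" using sp(2) by (simp add: sumsq_comb_seq_le comb_seq_add)
  have "(\<integral>x. F (sumsq d x - c) (\<lambda>i. x (i + d)) \<partial>std_seq) - dens d c * (\<integral>y. ?I y \<partial>std_seq)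
      = (\<integral>y. ?J y - dens d c * ?I y \<partial>std_seq)"
    using J I sp(1) by (simp add: sumsq_comb_seq_le comb_seq_add)
  also have "\<bar>\<dots>\<bar> \<le> (\<integral>y. \<bar>?J y - dens d c * ?I y\<bar> \<partial>std_seq)" by (rule integral_abs_bound)
  also have "\<dots> \<le> (\<integral>y. C / d * W y \<partial>std_seq)"
  proof (rule integral_mono)
    fix y
    have "\<bar>?J y - dens d c * ?I y\<bar> \<le> C / d * (\<integral>u. \<bar>u * F u y\<bar> \<partial>lborel)"
      by (rule local_integral[OF d f uf])
    also have "\<dots> \<le> C / d * W y" using W(2) C_pos by (intro mult_left_mono) auto
    finally show "\<bar>?J y - dens d c * ?I y\<bar> \<le> C / d * W y" .
  qed (use J I W in auto)
  finally show ?thesis by simp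
qed

lemma interval_prob:
  assumes d: "6 \<le> d" and "\<alpha> \<le> \<beta>"
  shows "emeasure std_seq {x. \<alpha> < sumsq d x \<and> sumsq d x \<le> \<beta>} \<le> ennreal (C / sqrt d * (\<beta> - \<alpha>))"
proof -
  have "emeasure std_seq {x. \<alpha> < sumsq d x \<and> sumsq d x \<le> \<beta>} = (\<integral>\<^sup>+x. indicator {x. \<alpha> < sumsq d x \<and> sumsq d x \<le> \<beta>} x \<partial>std_seq)"
    by (rule nn_integral_indicator[symmetric], rule sets_std_Collect) measurable
  also have "\<dots> = (\<integral>\<^sup>+x. indicator {\<alpha><..\<beta>} (sumsq d x) \<partial>std_seq)"
    by (intro nn_integral_cong) (auto simp: indicator_def)
  also have "\<dots> = (\<integral>\<^sup>+y. indicator {\<alpha><..\<beta>} y * ennreal (dens d y) \<partial>lborel)"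
    by (rule dens_eq[OF d]) simp
  also have "\<dots> \<le> (\<integral>\<^sup>+y. ennreal (C / sqrt d) * indicator {\<alpha><..\<beta>} y \<partial>lborel)"
    using dens_le[OF d] by (intro nn_integral_mono) (auto simp: indicator_def intro!: ennreal_leI)
  also have "\<dots> = ennreal (C / sqrt d) * ennreal (\<beta> - \<alpha>)"
    using assms by (subst nn_integral_cmult_indicator) auto
  also have "\<dots> = ennreal (C / sqrt d * (\<beta> - \<alpha>))" by (rule ennreal_mult[symmetric]) (use assms C_pos in auto)
  finally show ?thesis .
qed

text \<open>The event on the left requires the last \<open>e\<close> squares to exceed \<open>a\<close>; conditionally on them the
  partial sum of the first \<open>d\<close> lies in an interval of length \<open>\<beta> - \<alpha>\<close>.\<close>

lemma jump_prob:
  assumes d: "6 \<le> d" and ab: "\<alpha> \<le> \<beta>"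
  shows "measure std_seq {x. sumsq d x \<le> \<alpha> - a \<and> \<alpha> < sumsq (d + e) x \<and> sumsq (d + e) x \<le> \<beta>}
    \<le> C / sqrt d * (\<beta> - \<alpha>) * measure std_seq {y. a \<le> sumsq e y}"
proof -
  let ?E = "{x. sumsq d x \<le> \<alpha> - a \<and> \<alpha> < sumsq (d + e) x \<and> sumsq (d + e) x \<le> \<beta>}"
  let ?c = "C / sqrt d * (\<beta> - \<alpha>)"
  have c: "0 \<le> ?c" using C_pos ab by simp
  have E: "?E \<in> sets std_seq" by (rule sets_std_Collect) measurable
  have Y: "{y. a \<le> sumsq e y} \<in> sets std_seq" by (rule sets_std_Collect) measurable
  have "emeasure std_seq ?E = (\<integral>\<^sup>+x. indicator ?E x \<partial>std_seq)" using E by simp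
  also have "\<dots> = (\<integral>\<^sup>+y. \<integral>\<^sup>+x. indicator ?E (comb_seq d x y) \<partial>std_seq \<partial>std_seq)"
    using E by (intro nn_integral_std_split') simp
  also have "\<dots> \<le> (\<integral>\<^sup>+y. ennreal ?c * indicator {y. a \<le> sumsq e y} y \<partial>std_seq)"
  proof (rule nn_integral_mono)
    fix y
    let ?A = "{x. \<alpha> - sumsq e y < sumsq d x \<and> sumsq d x \<le> \<beta> - sumsq e y}"
    have A: "?A \<in> sets std_seq" by (rule sets_std_Collect) measurable
    have "(\<integral>\<^sup>+x. indicator ?E (comb_seq d x y) \<partial>std_seq) \<le> (\<integral>\<^sup>+x. indicator ?A x * indicator {y. a \<le> sumsq e y} y \<partial>std_seq)"
      by (intro nn_integral_mono) (auto simp: indicator_def sumsq_comb_seq_add sumsq_comb_seq_le)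
    also have "\<dots> = emeasure std_seq ?A * indicator {y. a \<le> sumsq e y} y"
      using A by (simp add: nn_integral_multc)
    also have "\<dots> \<le> ennreal ?c * indicator {y. a \<le> sumsq e y} y"
      using interval_prob[OF d, of "\<alpha> - sumsq e y" "\<beta> - sumsq e y"] ab by (intro mult_right_mono) auto
    finally show "(\<integral>\<^sup>+x. indicator ?E (comb_seq d x y) \<partial>std_seq) \<le> ennreal ?c * indicator {y. a \<le> sumsq e y} y" .
  qed
  also have "\<dots> = ennreal ?c * emeasure std_seq {y. a \<le> sumsq e y}"
    using Y by (rule nn_integral_cmult_indicator)
  also have "\<dots> = ennreal (?c * measure std_seq {y. a \<le> sumsq e y})"
    unfolding std_seq.emeasure_eq_measure by (rule ennreal_mult[symmetric]) (use c in auto)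
  finally have "ennreal (measure std_seq ?E) \<le> ennreal (?c * measure std_seq {y. a \<le> sumsq e y})"
    by (simp only: std_seq.emeasure_eq_measure)
  moreover have "0 \<le> ?c * measure std_seq {y. a \<le> sumsq e y}" using c by (rule mult_nonneg_nonneg) simp
  ultimately show ?thesis by (simp only: ennreal_le_iff)
qed

end

lemma chi_density_exists: obtains C dens where "chi_density C dens"
proof -
  obtain C :: real where C: "0 < C" "\<And>d. 6 \<le> d \<Longrightarrow> \<exists>p. p \<in> borel_measurable borel \<and> (\<forall>y. 0 \<le> p y \<and> p y \<le> C / sqrt d)
      \<and> (\<forall>y z. \<bar>p y - p z\<bar> \<le> C / d * \<bar>y - z\<bar>)
      \<and> (\<forall>f\<in>borel_measurable borel. (\<integral>\<^sup>+x. f (sumsq d x) \<partial>std_seq) = (\<integral>\<^sup>+y. f y * ennreal (p y) \<partial>lborel))"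
    using sumsq_density by blast
  then have "\<forall>d. \<exists>p. 6 \<le> d \<longrightarrow> p \<in> borel_measurable borel \<and> (\<forall>y. 0 \<le> p y \<and> p y \<le> C / sqrt d)
      \<and> (\<forall>y z. \<bar>p y - p z\<bar> \<le> C / d * \<bar>y - z\<bar>)
      \<and> (\<forall>f\<in>borel_measurable borel. (\<integral>\<^sup>+x. f (sumsq d x) \<partial>std_seq) = (\<integral>\<^sup>+y. f y * ennreal (p y) \<partial>lborel))"
    by meson
  then obtain dens where "\<forall>d. 6 \<le> d \<longrightarrow> dens d \<in> borel_measurable borel \<and> (\<forall>y. 0 \<le> dens d y \<and> dens d y \<le> C / sqrt d)
      \<and> (\<forall>y z. \<bar>dens d y - dens d z\<bar> \<le> C / d * \<bar>y - z\<bar>)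
      \<and> (\<forall>f\<in>borel_measurable borel. (\<integral>\<^sup>+x. f (sumsq d x) \<partial>std_seq) = (\<integral>\<^sup>+y. f y * ennreal (dens d y) \<partial>lborel))"
    by (rule choice[THEN exE])
  then have "chi_density C dens" using C(1) by unfold_locales simp_all
  then show thesis by (rule that)
qed

section \<open>The limit of the mean overshoot\<close>

text \<open>The boundary grows at least as fast as its cubic part, and the left side is a difference
  of cubes over h^2.\<close>

lemma boundary_diff_ge:
  assumes "0 < h" "i \<le> n"
  shows "real (k * (n - i)) * ((real (k * n))\<^sup>2 + real (k * n) * real (k * i) + (real (k * i))\<^sup>2) / h\<^sup>2
    \<le> boundary k h n - boundary k h i"
proof -
  define X x where "X = real (k * n)" and "x = real (k * i)"
  have "x \<le> X" unfolding X_def x_def of_nat_le_iff using assms by simp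
  then have x: "0 \<le> x" "x \<le> X" "real (k * (n - i)) = X - x"
    using assms by (auto simp: X_def x_def of_nat_diff algebra_simps)
  have "0 \<le> (X - x) * (2 * (X + x) + 1)"   proof (rule mult_nonneg_nonneg)
    show "0 \<le> X - x" using x(2) by simp
    have "0 \<le> X" using x(1,2) by (rule order_trans)
    with x(1) show "0 \<le> 2 * (X + x) + 1" by simp
  qed
  then have "(X - x) * (X\<^sup>2 + X * x + x\<^sup>2) \<le> X * (X + 1)\<^sup>2 - x * (x + 1)\<^sup>2"
    by (simp add: power2_eq_square algebra_simps)
  then show ?thesis unfolding boundary_def X_def[symmetric] x_def[symmetric] x(3)
    by (simp add: divide_right_mono flip: diff_divide_distrib)
qed

text \<open>Near \<open>h\<close> the slope 3 x^2 / h^2 of the cubic part is close to 3. The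
  remaining terms, collected in \<open>rest\<close>, are at most h (d + 9)^2 and thus small against
  h^2.\<close>

lemma boundary_gap_close:
  assumes h: "0 < h" and \<eta>: "0 < \<eta>" "\<eta> \<le> 1" and n: "\<bar>real (k * n) - h\<bar> \<le> \<eta> * h"
    and big: "(real (k * i) + 9)\<^sup>2 \<le> \<eta> * h"
  shows "\<bar>boundary k h (n + i) - boundary k h n - 3 * real (k * i)\<bar> \<le> 10 * real (k * i) * \<eta>"
proof -
  define x d where "x = real (k * n)" and "d = real (k * i)"
  have xd: "real (k * (n + i)) = x + d" "0 \<le> x" "0 \<le> d" by (auto simp: x_def d_def algebra_simps)
  have h81: "81 \<le> \<eta> * h" using big power_mono[of 9 "real (k * i) + 9" 2] by simp
  have "\<eta> * h \<le> 1 * h" using \<eta> h by (intro mult_right_mono) auto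
  then have h1: "1 \<le> h" using h81 by linarith
  have xh: "x \<le> 2 * h" "(1 - \<eta>) * h \<le> x" "x \<le> (1 + \<eta>) * h"
    using n \<open>\<eta> * h \<le> 1 * h\<close> unfolding x_def[symmetric] by (simp_all add: algebra_simps abs_le_iff)
  define rest where "rest = 3 * x * d + d\<^sup>2 + 4 * x + 2 * d + 1"
  have r0: "0 \<le> rest" using xd by (simp add: rest_def)
  have "3 * x * d \<le> 6 * h * d" using xh xd by (intro mult_right_mono) auto
  moreover have "1 * (d\<^sup>2 + 2 * d + 1) \<le> h * (d\<^sup>2 + 2 * d + 1)" using h1 xd by (intro mult_right_mono) auto
  then have "d\<^sup>2 + 2 * d + 1 \<le> h * (d\<^sup>2 + 2 * d + 1)" by simp
  ultimately have "rest \<le> 6 * h * d + 8 * h + h * (d\<^sup>2 + 2 * d + 1)"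
    using xh(1) unfolding rest_def by linarith
  also have "\<dots> = h * (d\<^sup>2 + 8 * d + 9)" by (simp add: algebra_simps)
  also have "\<dots> \<le> h * (d + 9)\<^sup>2" using h xd by (intro mult_left_mono) (auto simp: power2_eq_square algebra_simps)
  also have "\<dots> \<le> h * (\<eta> * h)" using big h unfolding d_def[symmetric] by (intro mult_left_mono) auto
  finally have r1: "rest / h\<^sup>2 \<le> \<eta>" using h by (simp add: power2_eq_square field_simps)
  have eq: "boundary k h (n + i) - boundary k h n - 3 * real (k * i) = d * (3 * (x\<^sup>2 / h\<^sup>2 - 1) + rest / h\<^sup>2)"
  proof -
    have "(x + d) * (x + d + 1)\<^sup>2 - x * (x + 1)\<^sup>2 = d * (3 * x\<^sup>2 + rest)"
      unfolding rest_def by (simp add: power2_eq_square algebra_simps)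
    then have "boundary k h (n + i) - boundary k h n = d * (3 * x\<^sup>2 + rest) / h\<^sup>2"
      unfolding boundary_def xd(1) x_def[symmetric] by (simp flip: diff_divide_distrib)
    then show ?thesis unfolding d_def[symmetric] by (simp add: add_divide_distrib algebra_simps)
  qed
  have "(x / h)\<^sup>2 \<le> (1 + \<eta>)\<^sup>2" using xh xd h by (intro power_mono) (auto simp: field_simps)
  also have "\<dots> \<le> 1 + 3 * \<eta>" using \<eta> mult_left_mono[of \<eta> 1 \<eta>] by (simp add: power2_eq_square algebra_simps)
  finally have u: "x\<^sup>2 / h\<^sup>2 - 1 \<le> 3 * \<eta>" by (simp add: power_divide)
  have "1 - 2 * \<eta> \<le> (1 - \<eta>)\<^sup>2" by (simp add: power2_eq_square algebra_simps)
  also have "\<dots> \<le> (x / h)\<^sup>2" using xh \<eta> h by (intro power_mono) (auto simp: field_simps)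
  finally have l: "- 2 * \<eta> \<le> x\<^sup>2 / h\<^sup>2 - 1" by (simp add: power_divide)
  have "0 \<le> rest / h\<^sup>2" using r0 by simp
  moreover have "\<bar>3 * (U - 1) + Q\<bar> \<le> 10 * \<eta>"
    if "0 \<le> Q" "U - 1 \<le> 3 * \<eta>" "- 2 * \<eta> \<le> U - 1" "Q \<le> \<eta>" for U Q :: real
    using that \<eta> unfolding abs_le_iff by simp
  ultimately have "\<bar>3 * (x\<^sup>2 / h\<^sup>2 - 1) + rest / h\<^sup>2\<bar> \<le> 10 * \<eta>" using u l r1 by blast
  then have "d * \<bar>3 * (x\<^sup>2 / h\<^sup>2 - 1) + rest / h\<^sup>2\<bar> \<le> d * (10 * \<eta>)" using xd by (intro mult_left_mono) auto
  also have "\<dots> = 10 * real (k * i) * \<eta>" by (simp add: d_def)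
  finally show ?thesis unfolding eq abs_mult using xd(3) by (simp only: abs_of_nonneg)
qed

lemma abs_Max_image_diff:
  fixes f f' :: "'a \<Rightarrow> real"
  assumes "finite I" "I \<noteq> {}" "\<And>i. i \<in> I \<Longrightarrow> \<bar>f i - f' i\<bar> \<le> \<eta>"
  shows "\<bar>Max (f ` I) - Max (f' ` I)\<bar> \<le> \<eta>"
proof -
  have "Max (f ` I) \<le> Max (f' ` I) + \<eta>"
  proof (rule Max.boundedI)
    fix a assume "a \<in> f ` I"
    then obtain i where i: "i \<in> I" "a = f i" by blast
    have "f' i \<le> Max (f' ` I)" using assms(1) i by simp
    then show "a \<le> Max (f' ` I) + \<eta>" using assms(3)[OF i(1)] i by linarith
  qed (use assms in auto)
  moreover have "Max (f' ` I) \<le> Max (f ` I) + \<eta>"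
  proof (rule Max.boundedI)
    fix a assume "a \<in> f' ` I"
    then obtain i where i: "i \<in> I" "a = f' i" by blast
    have "f i \<le> Max (f ` I)" using assms(1) i by simp
    then show "a \<le> Max (f ` I) + \<eta>" using assms(3)[OF i(1)] i by linarith
  qed (use assms in auto)
  ultimately show ?thesis by linarith
qed

lemma boundary_mono: "0 < h \<Longrightarrow> i \<le> n \<Longrightarrow> boundary k h i \<le> boundary k h n"
proof -
  assume "0 < h" "i \<le> n"
  have "0 \<le> real (k * (n - i)) * ((real (k * n))\<^sup>2 + real (k * n) * real (k * i) + (real (k * i))\<^sup>2) / h\<^sup>2"
    by (intro divide_nonneg_nonneg mult_nonneg_nonneg add_nonneg_nonneg) auto
  also have "\<dots> \<le> boundary k h n - boundary k h i" by (rule boundary_diff_ge) fact+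
  finally show ?thesis by simp
qed

lemma sumsq_block_add: "sumsq (k * (n + i)) x = sumsq (k * n) x + sumsq (k * i) (\<lambda>j. x (j + k * n))"
  using sumsq_add[of "k * n" "k * i" x] by (simp add: distrib_left)

text \<open>Two versions of the overshoot at step \<open>n + L + 1\<close>: \<open>survived\<close> asks that the walk has not stopped before,
  \<open>passed\<close> forgets the past before step \<open>n\<close> and is thus a local functional of the partial sum at \<open>n\<close>.\<close>

definition passed :: "nat \<Rightarrow> real \<Rightarrow> nat \<Rightarrow> nat \<Rightarrow> (nat \<Rightarrow> real) \<Rightarrow> real" where
  "passed k h n L x = (if \<forall>i\<le>L. boundary k h (n + i) < sumsq (k * (n + i)) x
     then max 0 (boundary k h (n + Suc L) - sumsq (k * (n + Suc L)) x) else 0)"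

definition survived :: "nat \<Rightarrow> real \<Rightarrow> nat \<Rightarrow> nat \<Rightarrow> nat \<Rightarrow> (nat \<Rightarrow> real) \<Rightarrow> real" where
  "survived k h m n L x = (if alive k h m (n + L) x
     then max 0 (boundary k h (n + Suc L) - sumsq (k * (n + Suc L)) x) else 0)"

lemma measurable_passed [measurable]: "passed k h n L \<in> borel_measurable std_seq"
  unfolding passed_def[abs_def] by measurable

lemma measurable_survived [measurable]: "survived k h m n L \<in> borel_measurable std_seq"
  unfolding survived_def[abs_def] by measurable

lemma integrable_passed: "integrable std_seq (passed k h n L)"
  by (rule std_seq.integrable_const_bound[of _ "boundary k h (n + Suc L)"])
     (auto simp: passed_def boundary_nonneg simp del: add_Suc_right)

lemma integrable_survived: "integrable std_seq (survived k h m n L)"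
  by (rule std_seq.integrable_const_bound[of _ "boundary k h (n + Suc L)"])
     (auto simp: survived_def boundary_nonneg simp del: add_Suc_right)

text \<open>Let \<open>y\<close> be the coordinates after step \<open>n\<close> and u the excess of
  the sum over the boundary at \<open>n\<close>. Staying above the boundary at steps n to n + L
  means u > \<open>barrier\<close>, and \<open>landing\<close> - u is the overshoot at step n + L +
  1; see \<open>passed_eq\<close>.\<close>

definition barrier :: "nat \<Rightarrow> real \<Rightarrow> nat \<Rightarrow> nat \<Rightarrow> (nat \<Rightarrow> real) \<Rightarrow> real" where
  "barrier k h n L y = Max ((\<lambda>i. boundary k h (n + i) - boundary k h n - sumsq (k * i) y) ` {..L})"

definition landing :: "nat \<Rightarrow> real \<Rightarrow> nat \<Rightarrow> nat \<Rightarrow> (nat \<Rightarrow> real) \<Rightarrow> real" where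
  "landing k h n L y = boundary k h (n + Suc L) - boundary k h n - sumsq (k * Suc L) y"

lemma measurable_barrier [measurable]: "barrier k h n L \<in> borel_measurable std_seq"
  unfolding barrier_def[abs_def] by (rule borel_measurable_Max) auto

lemma measurable_landing [measurable]: "landing k h n L \<in> borel_measurable std_seq"
  unfolding landing_def[abs_def] by measurable

lemma barrier_nonneg: "0 \<le> barrier k h n L y"
proof -
  have "boundary k h (n + 0) - boundary k h n - sumsq (k * 0) y \<le> barrier k h n L y"
    unfolding barrier_def by (rule Max_ge) (simp, rule image_eqI[of _ _ 0], simp_all)
  then show ?thesis by simp
qed

lemma passed_eq:
  "passed k h n L x = (let y = (\<lambda>j. x (j + k * n)); u = sumsq (k * n) x - boundary k h n in
     if barrier k h n L y < u then max 0 (landing k h n L y - u) else 0)"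
proof -
  let ?y = "\<lambda>j. x (j + k * n)"
  have A: "barrier k h n L ?y < sumsq (k * n) x - boundary k h n \<longleftrightarrow> (\<forall>i\<le>L. boundary k h (n + i) < sumsq (k * (n + i)) x)"
    unfolding barrier_def sumsq_block_add by (subst Max_less_iff) (auto simp: algebra_simps)
  have B: "boundary k h (n + Suc L) - sumsq (k * (n + Suc L)) x = landing k h n L ?y - (sumsq (k * n) x - boundary k h n)"
    unfolding landing_def sumsq_block_add by simp
  show ?thesis unfolding passed_def Let_def A B ..
qed

text \<open>In the excess u the functional is a ramp between \<open>barrier\<close> and
  \<open>landing\<close>. There |u| is at most the boundary increment \<open>G\<close>, which gives
  the cubic error term.\<close>

lemma (in chi_density) passed_local:
  assumes h: "0 < h" and d: "6 \<le> k * n"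
  shows "\<bar>(\<integral>x. passed k h n L x \<partial>std_seq)
      - dens (k * n) (boundary k h n) * (\<integral>y. (max 0 (landing k h n L y - barrier k h n L y))\<^sup>2 / 2 \<partial>std_seq)\<bar>
    \<le> C / (k * n) * (boundary k h (n + Suc L) - boundary k h n) ^ 3"
proof -
  let ?c = "boundary k h n" and ?e = "barrier k h n L" and ?D = "landing k h n L"
  define G where "G = boundary k h (n + Suc L) - ?c"
  define F where "F u y = (if ?e y < u then max 0 (?D y - u) else 0)" for u y
  have G: "0 \<le> G" unfolding G_def using boundary_mono[OF h, of n "n + Suc L" k] by simp
  have DG: "?D y \<le> G" for y unfolding landing_def G_def by simp
  have ramp: "has_bochner_integral lborel (\<lambda>u. F u y) ((max 0 (?D y - ?e y))\<^sup>2 / 2)" for y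
    unfolding F_def by (rule has_bochner_integral_ramp)
  have f: "integrable lborel (\<lambda>u. F u y)" and If: "(\<integral>u. F u y \<partial>lborel) = (max 0 (?D y - ?e y))\<^sup>2 / 2" for y
    using ramp[of y] by (auto simp: has_bochner_integral_iff)
  have sq: "(max 0 (?D y - ?e y))\<^sup>2 / 2 \<le> G\<^sup>2" for y
  proof -
    have "max 0 (?D y - ?e y) \<le> G" using G DG[of y] barrier_nonneg[of k h n L y] by linarith
    then have "(max 0 (?D y - ?e y))\<^sup>2 \<le> G\<^sup>2" by (intro power_mono) auto
    then show ?thesis using zero_le_power2[of G] by linarith
  qed
  have le: "\<bar>u * F u y\<bar> \<le> G * F u y" for u y
  proof (cases "F u y = 0")
    case False
    then have "?e y < u" "u < ?D y" unfolding F_def by (auto split: if_splits)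
    then have "\<bar>u\<bar> \<le> G" using barrier_nonneg[of k h n L y] DG[of y] by linarith
    moreover have "0 \<le> F u y" unfolding F_def by simp
    ultimately show ?thesis by (simp add: abs_mult mult_right_mono)
  qed simp
  have mF: "(\<lambda>u. F u y) \<in> borel_measurable borel" for y using f[of y] by auto
  have uf: "integrable lborel (\<lambda>u. \<bar>u * F u y\<bar>)" for y
  proof (rule Bochner_Integration.integrable_bound[of _ "\<lambda>u. G * F u y"])
    show "integrable lborel (\<lambda>u. G * F u y)" using f by simp
    show "(\<lambda>u. \<bar>u * F u y\<bar>) \<in> borel_measurable lborel" using mF[of y] by simp
    have "norm \<bar>u * F u y\<bar> \<le> norm (G * F u y)" for u using le[of u y] by simp
    then show "AE u in lborel. norm \<bar>u * F u y\<bar> \<le> norm (G * F u y)" by simp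
  qed
  have W: "(\<integral>u. \<bar>u * F u y\<bar> \<partial>lborel) \<le> G ^ 3" for y
  proof -
    have "(\<integral>u. \<bar>u * F u y\<bar> \<partial>lborel) \<le> (\<integral>u. G * F u y \<partial>lborel)"
      using f uf le by (intro integral_mono) auto
    also have "\<dots> = G * ((max 0 (?D y - ?e y))\<^sup>2 / 2)" by (simp add: If)
    also have "\<dots> \<le> G * G\<^sup>2" using sq G by (intro mult_left_mono) auto
    finally show ?thesis by (simp add: power3_eq_cube power2_eq_square)
  qed
  have pe: "F (sumsq (k * n) x - ?c) (\<lambda>i. x (i + k * n)) = passed k h n L x" for x
    unfolding passed_eq F_def Let_def ..
  have I: "integrable std_seq (\<lambda>y. \<integral>u. F u y \<partial>lborel)"
    unfolding If by (rule std_seq.integrable_const_bound[of _ "G\<^sup>2"]) (use sq in auto)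
  have "\<bar>(\<integral>x. F (sumsq (k * n) x - ?c) (\<lambda>i. x (i + k * n)) \<partial>std_seq) - dens (k * n) ?c * (\<integral>y. \<integral>u. F u y \<partial>lborel \<partial>std_seq)\<bar>
      \<le> C / (k * n) * (\<integral>y. G ^ 3 \<partial>std_seq)"
  proof (rule local_expectation[OF d _ f uf I _ W])
    show "integrable std_seq (\<lambda>x. F (sumsq (k * n) x - ?c) (\<lambda>i. x (i + k * n)))"
      unfolding pe by (rule integrable_passed)
  qed simp
  then show ?thesis unfolding pe If G_def by (simp add: std_seq.prob_space[simplified])
qed

text \<open>For slope exactly 3 per coordinate, \<open>barrier\<close> and \<open>landing\<close>
  become the quantities in \<open>overshoot_moment\<close>. The two positive parts then differ by at
  most 2 \<eta> and are bounded, so their squares are close.\<close>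

lemma landing_moment_close:
  assumes \<eta>: "0 \<le> \<eta>" "\<eta> \<le> 1" and close: "\<And>i. i \<le> Suc L \<Longrightarrow> \<bar>boundary k h (n + i) - boundary k h n - 3 * real (k * i)\<bar> \<le> \<eta>"
  shows "\<bar>(\<integral>y. (max 0 (landing k h n L y - barrier k h n L y))\<^sup>2 / 2 \<partial>std_seq) - overshoot_moment k L / 2\<bar>
    \<le> 2 * \<eta> * (3 * real (k * Suc L) + 1)"
proof -
  define H where "H = 3 * real (k * Suc L) + 1"
  have H: "0 \<le> H" unfolding H_def by simp
  let ?X = "\<lambda>y. max 0 (landing k h n L y - barrier k h n L y)"
  let ?Y = "\<lambda>y. max 0 (- walk k (Suc L) y - Max ((\<lambda>i. - walk k i y) ` {..L}))"
  have [measurable]: "(\<lambda>y. Max ((\<lambda>i. - walk k i y) ` {..L})) \<in> borel_measurable std_seq"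
    by (rule borel_measurable_Max) auto
  have XH: "?X y \<le> H" for y
  proof -
    have "landing k h n L y \<le> H"
      using close[OF order_refl] \<eta> sumsq_nonneg[of "k * Suc L" y] unfolding landing_def H_def by linarith
    then show ?thesis using barrier_nonneg[of k h n L y] H by linarith
  qed
  have M0: "0 \<le> Max ((\<lambda>i. - walk k i y) ` {..L})" for y
  proof -
    have "- walk k 0 y \<le> Max ((\<lambda>i. - walk k i y) ` {..L})"
      by (rule Max_ge) (simp, rule image_eqI[of _ _ 0], simp_all)
    then show ?thesis by simp
  qed
  have YH: "?Y y \<le> H" for y
  proof -
    have "- walk k (Suc L) y \<le> H" using sumsq_nonneg[of "k * Suc L" y] unfolding walk_def H_def by linarith
    then show ?thesis using M0[of y] H by linarith
  qed
  have XY: "\<bar>?X y - ?Y y\<bar> \<le> 2 * \<eta>" for y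
  proof -
    have "\<bar>landing k h n L y - (- walk k (Suc L) y)\<bar> \<le> \<eta>"
      using close[OF order_refl] unfolding landing_def walk_def by linarith
    moreover have "\<bar>barrier k h n L y - Max ((\<lambda>i. - walk k i y) ` {..L})\<bar> \<le> \<eta>"
      unfolding barrier_def
    proof (rule abs_Max_image_diff)
      fix i assume "i \<in> {..L}"
      then have "i \<le> Suc L" by simp
      then show "\<bar>boundary k h (n + i) - boundary k h n - sumsq (k * i) y - - walk k i y\<bar> \<le> \<eta>"
        using close[of i] unfolding walk_def by linarith
    qed auto
    ultimately show ?thesis by linarith
  qed
  have diff: "\<bar>(?X y)\<^sup>2 / 2 - (?Y y)\<^sup>2 / 2\<bar> \<le> 2 * \<eta> * H" for y
  proof -
    have "\<bar>(?X y)\<^sup>2 - (?Y y)\<^sup>2\<bar> = \<bar>?X y - ?Y y\<bar> * (?X y + ?Y y)"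
      unfolding power2_eq_square square_diff_square_factored abs_mult by (simp add: mult.commute)
    also have "\<dots> \<le> (2 * \<eta>) * (2 * H)"
    proof (rule mult_mono)
      show "?X y + ?Y y \<le> 2 * H" using XH[of y] YH[of y] by linarith
    qed (use XY[of y] \<eta> in auto)
    finally show ?thesis by linarith
  qed
  have iX: "integrable std_seq (\<lambda>y. (?X y)\<^sup>2 / 2)"
  proof (rule std_seq.integrable_const_bound[of _ "H\<^sup>2"])
    have "norm ((?X y)\<^sup>2 / 2) \<le> H\<^sup>2" for y
    proof -
      have "(?X y)\<^sup>2 \<le> H\<^sup>2" by (rule power_mono[OF XH]) simp
      moreover have "norm ((?X y)\<^sup>2 / 2) = (?X y)\<^sup>2 / 2" by simp
      ultimately show ?thesis using zero_le_power2[of H] by linarith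
    qed
    then show "AE y in std_seq. norm ((?X y)\<^sup>2 / 2) \<le> H\<^sup>2" by simp
  qed measurable
  have iY: "integrable std_seq (\<lambda>y. (?Y y)\<^sup>2 / 2)"
  proof (rule std_seq.integrable_const_bound[of _ "H\<^sup>2"])
    have "norm ((?Y y)\<^sup>2 / 2) \<le> H\<^sup>2" for y
    proof -
      have "(?Y y)\<^sup>2 \<le> H\<^sup>2" by (rule power_mono[OF YH]) simp
      moreover have "norm ((?Y y)\<^sup>2 / 2) = (?Y y)\<^sup>2 / 2" by simp
      ultimately show ?thesis using zero_le_power2[of H] by linarith
    qed
    then show "AE y in std_seq. norm ((?Y y)\<^sup>2 / 2) \<le> H\<^sup>2" by simp
  qed measurable
  have "\<bar>(\<integral>y. (?X y)\<^sup>2 / 2 \<partial>std_seq) - (\<integral>y. (?Y y)\<^sup>2 / 2 \<partial>std_seq)\<bar> = \<bar>\<integral>y. (?X y)\<^sup>2 / 2 - (?Y y)\<^sup>2 / 2 \<partial>std_seq\<bar>"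
    by (subst Bochner_Integration.integral_diff[OF iX iY]) simp
  also have "\<dots> \<le> (\<integral>y. \<bar>(?X y)\<^sup>2 / 2 - (?Y y)\<^sup>2 / 2\<bar> \<partial>std_seq)" by (rule integral_abs_bound)
  also have "\<dots> \<le> (\<integral>y. 2 * \<eta> * H \<partial>std_seq)"
    using iX iY diff by (intro integral_mono) auto
  also have "\<dots> = 2 * \<eta> * H" by (simp add: std_seq.prob_space[simplified])
  also have "(\<integral>y. (?Y y)\<^sup>2 / 2 \<partial>std_seq) = overshoot_moment k L / 2"
    unfolding overshoot_moment_def by simp
  finally show ?thesis unfolding H_def .
qed

section \<open>Crossing probabilities and the window around \<open>h\<close>\<close>

definition prob_above :: "nat \<Rightarrow> real \<Rightarrow> nat \<Rightarrow> real" where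
  "prob_above k h n = measure std_seq {x. boundary k h n < sumsq (k * n) x}"

text \<open>The signed crossing indicator integrates to \<open>G\<close> minus the next block, whose
  mean is k, so the local expectation is the density times the net drift
  \<open>G - real k\<close>.\<close>

lemma (in chi_density) prob_above_step:
  assumes h: "0 < h" and d: "6 \<le> k * n"
  defines "G \<equiv> boundary k h (Suc n) - boundary k h n"
  shows "\<bar>prob_above k h n - prob_above k h (Suc n) - dens (k * n) (boundary k h n) * (G - real k)\<bar>
    \<le> C / (k * n) * ((G - real k)\<^sup>2 + 2 * real k)"
proof -
  let ?c = "boundary k h n"
  let ?A = "\<lambda>n. {x. boundary k h n < sumsq (k * n) x}"
  let ?F = "\<lambda>u y. crossing (G - sumsq k y) u"
  have A: "?A n \<in> sets std_seq" for n by (rule sets_std_Collect) measurable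
  have eq: "?F (sumsq (k * n) x - ?c) (\<lambda>i. x (i + k * n)) = indicator (?A n) x - indicator (?A (Suc n)) x" for x
    using sumsq_block_add[of k n 1 x] unfolding crossing_def G_def by (auto simp: indicator_def)
  have ind: "integrable std_seq (indicator (?A n) :: _ \<Rightarrow> real)" for n
    using A by (intro integrable_real_indicator) (simp_all add: std_seq.emeasure_eq_measure)
  have sq: "(G - sumsq k y)\<^sup>2 = (G - real k)\<^sup>2 - 2 * (G - real k) * (sumsq k y - real k) + (sumsq k y - real k)\<^sup>2" for y
    by (simp add: power2_eq_square algebra_simps)
  have W: "integrable std_seq (\<lambda>y. (G - sumsq k y)\<^sup>2)" "(\<integral>y. (G - sumsq k y)\<^sup>2 \<partial>std_seq) = (G - real k)\<^sup>2 + 2 * real k"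
    unfolding sq using sumsq_centered[of k] by (auto simp: integral_sumsq std_seq.prob_space[simplified])
  have "\<bar>(\<integral>x. ?F (sumsq (k * n) x - ?c) (\<lambda>i. x (i + k * n)) \<partial>std_seq) - dens (k * n) ?c * (\<integral>y. \<integral>u. ?F u y \<partial>lborel \<partial>std_seq)\<bar>
      \<le> C / (k * n) * (\<integral>y. (G - sumsq k y)\<^sup>2 \<partial>std_seq)"
  proof (rule local_expectation[OF d _ crossing_integral(1) crossing_integral(3) _ W(1) crossing_integral(4)])
    show "integrable std_seq (\<lambda>x. ?F (sumsq (k * n) x - ?c) (\<lambda>i. x (i + k * n)))"
      unfolding eq by (rule Bochner_Integration.integrable_diff[OF ind ind])
    show "integrable std_seq (\<lambda>y. \<integral>u. ?F u y \<partial>lborel)" unfolding crossing_integral(2) by simp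
  qed
  moreover have "(\<integral>x. ?F (sumsq (k * n) x - ?c) (\<lambda>i. x (i + k * n)) \<partial>std_seq) = prob_above k h n - prob_above k h (Suc n)"
    unfolding eq Bochner_Integration.integral_diff[OF ind ind] prob_above_def using A by simp
  moreover have "(\<integral>y. \<integral>u. ?F u y \<partial>lborel \<partial>std_seq) = G - real k"
    unfolding crossing_integral(2) by (simp add: integral_sumsq std_seq.prob_space[simplified])
  ultimately show ?thesis unfolding W(2) by simp
qed

lemma prob_sumsq_chebyshev:
  assumes "0 < t"
  shows "measure std_seq {x. t \<le> \<bar>sumsq d x - real d\<bar>} \<le> 2 * real d / t\<^sup>2"
proof -
  have ae: "t\<^sup>2 \<le> (sumsq d x - real d)\<^sup>2 \<longleftrightarrow> t \<le> \<bar>sumsq d x - real d\<bar>" for x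
    using assms abs_le_square_iff[of t "sumsq d x - real d"] by simp
  have "measure std_seq {x\<in>space std_seq. t\<^sup>2 \<le> (sumsq d x - real d)\<^sup>2} \<le> (\<integral>x. (sumsq d x - real d)\<^sup>2 \<partial>std_seq) / t\<^sup>2"
    by (rule integral_Markov_inequality_measure[where A = "{}"]) (use assms sumsq_centered[of d] in auto)
  then show ?thesis using sumsq_centered[of d] unfolding ae by simp
qed

locale overshoot_regime = regime k p B h m + chi_density C dens
  for k p :: nat and B :: real and h :: "nat \<Rightarrow> real" and m :: "nat \<Rightarrow> nat"
    and C :: real and dens :: "nat \<Rightarrow> real \<Rightarrow> real"
begin

text \<open>The stopping time leaves the window between \<open>lo\<close> and \<open>hi\<close> with probability \<open>O(1 / K^2)\<close> only.\<close>

definition lo :: "real \<Rightarrow> nat \<Rightarrow> nat" where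
  "lo K j = nat \<lfloor>(h j - K * sqrt (h j)) / real k\<rfloor>"

definition hi :: "real \<Rightarrow> nat \<Rightarrow> nat" where
  "hi K j = nat \<lceil>(h j + K * sqrt (h j)) / real k\<rceil>"

text \<open>What stage \<open>j\<close> must satisfy once K, L and \<eta> are fixed. The range up to
  \<open>hi K j + Suc L\<close> leaves room for the L + 1 blocks that follow a step of the
  window.\<close>

definition win :: "real \<Rightarrow> nat \<Rightarrow> real \<Rightarrow> nat \<Rightarrow> bool" where
  "win K L \<eta> j \<longleftrightarrow> good j \<and> real (k * lo K j) \<le> h j - K * sqrt (h j) \<and> h j + K * sqrt (h j) \<le> real (k * hi K j)
     \<and> (\<forall>n. lo K j \<le> n \<longrightarrow> n \<le> hi K j + Suc L \<longrightarrow> \<bar>real (k * n) - h j\<bar> \<le> \<eta> * h j)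
     \<and> real (hi K j - lo K j) \<le> 4 * K * sqrt (h j) \<and> lo K j \<le> hi K j \<and> m j \<le> lo K j
     \<and> real (k * (L + 2)) + 1 \<le> K / 2 * sqrt (h j) \<and> 12 \<le> h j \<and> (real (k * Suc L) + 9)\<^sup>2 \<le> \<eta> * h j"

lemma sqrt_large: "\<forall>\<^sub>F j in sequentially. c \<le> sqrt (h j)"
  using h_large[of "(max 0 c)\<^sup>2"]
proof eventually_elim
  case (elim j)
  then have "max 0 c \<le> sqrt (h j)" by (rule real_le_rsqrt)
  then show ?case by simp
qed

text \<open>The width of the window is of order sqrt h, so the window and any fixed number of
  further blocks are negligible against \<open>h\<close>; the rest is rounding.\<close>

lemma win_eventually:
  assumes K: "1 \<le> K" and \<eta>: "0 < \<eta>" "\<eta> \<le> 1 / 10"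
  shows "\<forall>\<^sub>F j in sequentially. win K L \<eta> j"
  using good_eventually sqrt_large[of "2 * (real (k * (L + 2)) + 1)"] sqrt_large[of "2 * K / \<eta>"]
    h_large[of 12] h_large[of "4 * real k"] h_large[of "(real (k * Suc L) + 9)\<^sup>2 / \<eta>"]
proof eventually_elim
  case (elim j)
  define s where "s = sqrt (h j)"
  have h0: "0 < h j" by (rule h_gt0)
  have hs: "h j = s * s" using h0 by (simp add: s_def)
  have s0: "0 < s" using h0 by (simp add: s_def)
  have k1: "1 \<le> real k" and kn: "k \<noteq> 0" using k_ge1 by simp_all
  have Ks: "s \<le> K * s" using K s0 by simp
  have half: "K / 2 * s = (K * s) / 2" by simp
  have half_le: "a \<le> b / 2" if "2 * a \<le> b" for a b :: real using that by simp
  have kL: "real (k * (L + 2)) + 1 \<le> K / 2 * s"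
    unfolding half by (rule half_le[OF order_trans[OF elim(2)[folded s_def] Ks]])
  have kL2: "real (k * (L + 2)) = real k * real L + 2 * real k" by (simp add: algebra_simps)
  have kKs: "real k * real L + 2 * real k \<le> K * s" "1 \<le> K * s"
  proof -
    have gen: "a \<le> P \<and> 1 \<le> P" if "a + 1 \<le> P / 2" "0 \<le> a" for a P :: real using that by simp
    have "real k * real L + 2 * real k \<le> K * s \<and> 1 \<le> K * s"
      by (rule gen) (use kL[unfolded kL2 half] in auto)
    then show "real k * real L + 2 * real k \<le> K * s" "1 \<le> K * s" by auto
  qed
  have eh: "2 * K * s \<le> \<eta> * h j"
  proof -
    have "2 * K \<le> \<eta> * s" using elim(3) \<eta> unfolding s_def[symmetric] by (simp add: field_simps)
    then have "2 * K * s \<le> \<eta> * s * s" using s0 by (intro mult_right_mono) auto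
    then show ?thesis by (simp add: hs mult.assoc)
  qed
  have eh': "\<eta> * h j \<le> 1 / 10 * h j" using \<eta> h0 by (intro mult_right_mono) auto
  have Ksh: "K * s \<le> 1 / 20 * h j" using eh eh' by linarith
  have q0: "0 \<le> (h j - K * s) / real k" using Ksh h0 k1 by (intro divide_nonneg_nonneg) linarith+
  have lo_r: "real (lo K j) = of_int \<lfloor>(h j - K * s) / real k\<rfloor>"
    unfolding lo_def s_def[symmetric] using q0 by (simp add: of_nat_nat)
  have hi_r: "real (hi K j) = of_int \<lceil>(h j + K * s) / real k\<rceil>"
    unfolding hi_def s_def[symmetric] using h0 K s0 k1 by (simp add: of_nat_nat)
  have lo1: "real k * real (lo K j) \<le> h j - K * s"
  proof -
    have "real (lo K j) * real k \<le> (h j - K * s) / real k * real k"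
      unfolding lo_r by (rule mult_right_mono[OF of_int_floor_le]) simp
    then show ?thesis using k1 by (simp add: mult.commute)
  qed
  have lo2: "h j - K * s - real k \<le> real k * real (lo K j)"
  proof -
    have "(h j - K * s) / real k - 1 \<le> real (lo K j)" unfolding lo_r by linarith
    then have "((h j - K * s) / real k - 1) * real k \<le> real (lo K j) * real k" using k1 by (intro mult_right_mono) auto
    moreover have "((h j - K * s) / real k - 1) * real k = h j - K * s - real k"
      using kn by (simp add: left_diff_distrib diff_divide_distrib)
    ultimately show ?thesis by (simp only: mult.commute[of "real k"])
  qed
  have hi1: "h j + K * s \<le> real k * real (hi K j)"
  proof -
    have "(h j + K * s) / real k * real k \<le> real (hi K j) * real k"
      unfolding hi_r by (rule mult_right_mono[OF le_of_int_ceiling]) simp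
    then show ?thesis using k1 by (simp add: mult.commute)
  qed
  have hi2: "real k * real (hi K j) \<le> h j + K * s + real k"
  proof -
    have "real (hi K j) \<le> (h j + K * s) / real k + 1" unfolding hi_r by linarith
    then have "real (hi K j) * real k \<le> ((h j + K * s) / real k + 1) * real k" using k1 by (intro mult_right_mono) auto
    moreover have "((h j + K * s) / real k + 1) * real k = h j + K * s + real k" using kn by (simp add: distrib_right add_divide_distrib)
    ultimately show ?thesis by (simp only: mult.commute[of "real k"])
  qed
  have le: "lo K j \<le> hi K j"
  proof -
    have "real k * real (lo K j) \<le> real k * real (hi K j)" using lo1 hi1 Ks s0 by linarith
    then show ?thesis using k1 by simp
  qed
  have range: "\<bar>real (k * n) - h j\<bar> \<le> \<eta> * h j" if n: "lo K j \<le> n" "n \<le> hi K j + Suc L" for n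
  proof -
    have "real k * real (lo K j) \<le> real k * real n" using n by (intro mult_left_mono) auto
    moreover have "real n \<le> real (hi K j) + real L + 1" using n by simp
    then have "real k * real n \<le> real k * (real (hi K j) + real L + 1)" by (intro mult_left_mono) auto
    then have "real k * real n \<le> real k * real (hi K j) + real k * real L + real k" by (simp add: algebra_simps)
    moreover have "real (k * n) = real k * real n" by simp
    moreover have "0 \<le> real k * real L" by simp
    ultimately show ?thesis using lo2 hi2 kKs eh unfolding abs_le_iff by linarith
  qed
  have width: "real (hi K j - lo K j) \<le> 4 * K * s"
  proof -
    have "real k * real (hi K j - lo K j) = real k * real (hi K j) - real k * real (lo K j)"
      using le by (simp add: of_nat_diff right_diff_distrib)
    also have "\<dots> \<le> 2 * (K * s) + 2 * real k" using lo2 hi2 by linarith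
    also have "\<dots> \<le> real k * (2 * (K * s)) + real k * 2"
      using k1 Ks s0 mult_right_mono[of 1 "real k" "2 * (K * s)"] by simp
    finally have "real k * real (hi K j - lo K j) \<le> real k * (2 * (K * s) + 2)" by (simp add: distrib_left)
    then have "real (hi K j - lo K j) \<le> 2 * (K * s) + 2" using k1 by simp
    then show ?thesis using kKs by linarith
  qed
  have mlo: "m j \<le> lo K j"
  proof -
    have "real k * real (m j) + 1 < 1 / 2 * h j" using elim(1) by (simp add: good_def)
    then have "real k * real (m j) \<le> real k * real (lo K j)" using lo2 Ksh elim(5) by linarith
    then show ?thesis using k1 by simp
  qed
  have big: "(real (k * Suc L) + 9)\<^sup>2 \<le> \<eta> * h j" using elim(6) \<eta> by (simp add: field_simps)
  show ?case unfolding win_def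
    using elim(1,4) lo1 hi1 range width le mlo kL big unfolding s_def by simp
qed

text \<open>If the walk stops later, it is above the boundary at step n + L + 1 and the positive
  part vanishes. Each \<open>n\<close> therefore picks out one stopping time, and summing over
  \<open>n\<close> recovers the overshoot.\<close>

lemma survived_eq:
  assumes "st.stops j x" "m j \<le> n"
  shows "survived k (h j) (m j) n L x = (if st.T j x = n + Suc L then st.overshoot j x else 0)"
proof -
  have al: "alive k (h j) (m j) (n + L) x \<longleftrightarrow> n + L < st.T j x"
    using st.alive_iff[OF assms(1), of "n + L"] .
  consider "st.T j x \<le> n + L" | "st.T j x = n + Suc L" | "n + Suc L < st.T j x" by linarith
  then show ?thesis
  proof cases
    case 2
    then show ?thesis using al st.overshoot_nonneg[OF assms(1)] unfolding survived_def st.overshoot_def by auto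
  next
    case 3
    then have "alive k (h j) (m j) (n + Suc L) x" using st.alive_iff[OF assms(1), of "n + Suc L"] by simp
    then have "boundary k (h j) (n + Suc L) < sumsq (k * (n + Suc L)) x"
      using assms(2) unfolding alive_def by (auto dest!: bspec[of _ _ "n + Suc L"])
    then show ?thesis using 3 unfolding survived_def by simp
  qed (use al in \<open>auto simp: survived_def\<close>)
qed

text \<open>The sum misses only stopping times outside the window, where |M - h| is at least K sqrt
  h / 2. Chebyshev's inequality on the bound 12 k for the overshoot gives 4 * 12 k / K^2 times the
  normalised second moment; the last term covers large overshoots.\<close>

lemma survived_sum:
  assumes w: "win K L \<eta> j" and K: "1 \<le> K"
  shows "\<bar>(\<integral>x. st.overshoot j x \<partial>std_seq) - (\<Sum>n\<in>{lo K j..<hi K j}. \<integral>x. survived k (h j) (m j) n L x \<partial>std_seq)\<bar>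
    \<le> 48 * real k / K\<^sup>2 * ((\<integral>x. (delta j x)\<^sup>2 \<partial>std_seq) / h j) + (\<integral>x. (st.M j x + h j) ^ 3 * off (1 / 2) j x \<partial>std_seq)"
proof -
  let ?s = "sqrt (h j)" and ?R = "st.overshoot j"
  let ?S = "\<lambda>x. \<Sum>n\<in>{lo K j..<hi K j}. survived k (h j) (m j) n L x"
  let ?O = "\<lambda>x. (st.M j x + h j) ^ 3 * off (1 / 2) j x"
  let ?c = "48 * real k / (K\<^sup>2 * h j)"
  have g: "good j" and lo1: "real (k * lo K j) \<le> h j - K * ?s" and hi1: "h j + K * ?s \<le> real (k * hi K j)"
    and mlo: "m j \<le> lo K j" and kL: "real (k * (L + 2)) + 1 \<le> K / 2 * ?s"
    using w unfolding win_def by auto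
  have h0: "0 < h j" by (rule h_gt0)
  have O0: "0 \<le> ?O x" for x using base_power_nonneg[of j x 3] off_nonneg[of "1/2" j x] by (rule mult_nonneg_nonneg)
  have R: "AE x in std_seq. 0 \<le> ?R x \<and> ?R x \<le> 12 * real k + ?O x"
    using good_overshoot[OF g, of "1 / 2"] by simp
  have iO: "integrable std_seq ?O" using good_off[OF g, of 3] by simp
  have iR: "integrable std_seq ?R"
  proof (rule Bochner_Integration.integrable_bound[of _ "\<lambda>x. 12 * real k + ?O x"])
    show "AE x in std_seq. norm (?R x) \<le> norm (12 * real k + ?O x)"
      using R by eventually_elim simp
  qed (use iO in auto)
  have iD: "integrable std_seq (\<lambda>x. (delta j x)\<^sup>2)" using delta_power_moment[OF g, of 2] by simp
  have iS: "integrable std_seq ?S" using integrable_survived by simp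
  have far: "K\<^sup>2 * h j \<le> 4 * (delta j x)\<^sup>2" if "st.T j x \<le> lo K j + L \<or> hi K j + Suc L \<le> st.T j x" for x
  proof -
    have "K / 2 * ?s \<le> \<bar>delta j x\<bar>"
      using that
    proof
      assume "st.T j x \<le> lo K j + L"
      then have "k * st.T j x \<le> k * (lo K j + L)" by (rule mult_le_mono2)
      then have "real (k * st.T j x) \<le> real (k * lo K j) + real (k * L)" by (simp only: distrib_left of_nat_add[symmetric] of_nat_le_iff)
      moreover have "real (k * L) \<le> real (k * (L + 2))" unfolding of_nat_le_iff by simp
      ultimately show ?thesis using lo1 kL by linarith
    next
      assume "hi K j + Suc L \<le> st.T j x"
      then have "k * hi K j \<le> k * st.T j x" by (intro mult_le_mono2) simp
      then have "real (k * hi K j) \<le> real (k * st.T j x)" by (simp only: of_nat_le_iff)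
      moreover have "0 \<le> K * ?s" using K h0 by simp
      ultimately show ?thesis using hi1 by linarith
    qed
    then have "(K / 2 * ?s)\<^sup>2 \<le> \<bar>delta j x\<bar>\<^sup>2" using K h0 by (intro power_mono) auto
    then show ?thesis using h0 by (simp add: power_mult_distrib power_divide)
  qed
  have pw: "AE x in std_seq. 0 \<le> ?R x - ?S x \<and> ?R x - ?S x \<le> ?c * (delta j x)\<^sup>2 + ?O x"
    using R st.AE_stops[of j]
  proof eventually_elim
    case (elim x)
    have S: "?S x = (if st.T j x \<in> {lo K j + Suc L..<hi K j + Suc L} then ?R x else 0)"
    proof -
      have "?S x = (\<Sum>n\<in>{lo K j..<hi K j}. if st.T j x = n + Suc L then ?R x else 0)"
        using mlo elim(2) by (intro sum.cong refl survived_eq) auto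
      also have "\<dots> = (\<Sum>n\<in>{lo K j..<hi K j}. if n = st.T j x - Suc L \<and> Suc L \<le> st.T j x then ?R x else 0)"
        by (intro sum.cong refl) auto
      also have "\<dots> = (if st.T j x \<in> {lo K j + Suc L..<hi K j + Suc L} then ?R x else 0)"
        by (cases "Suc L \<le> st.T j x") (auto simp: sum.delta)
      finally show ?thesis .
    qed
    have c0: "0 \<le> ?c * (delta j x)\<^sup>2" using h0 by simp
    show ?case
    proof (cases "st.T j x \<in> {lo K j + Suc L..<hi K j + Suc L}")
      case True
      then show ?thesis unfolding S using c0 O0[of x] by simp
    next
      case False
      then have "K\<^sup>2 * h j \<le> 4 * (delta j x)\<^sup>2" by (intro far) auto
      then have "12 * real k * (K\<^sup>2 * h j) \<le> 12 * real k * (4 * (delta j x)\<^sup>2)" by (intro mult_left_mono) auto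
      then have "12 * real k \<le> 12 * real k * (4 * (delta j x)\<^sup>2) / (K\<^sup>2 * h j)"
        using h0 K by (subst pos_le_divide_eq) auto
      also have "\<dots> = ?c * (delta j x)\<^sup>2" by simp
      finally show ?thesis unfolding S using False elim(1) by auto
    qed
  qed
  have "(\<integral>x. ?R x \<partial>std_seq) - (\<Sum>n\<in>{lo K j..<hi K j}. \<integral>x. survived k (h j) (m j) n L x \<partial>std_seq) = (\<integral>x. ?R x - ?S x \<partial>std_seq)"
    using iR iS integrable_survived by simp
  moreover have "0 \<le> (\<integral>x. ?R x - ?S x \<partial>std_seq)"
    by (rule integral_nonneg_AE) (use pw in \<open>auto elim: eventually_mono\<close>)
  moreover have "(\<integral>x. ?R x - ?S x \<partial>std_seq) \<le> (\<integral>x. ?c * (delta j x)\<^sup>2 + ?O x \<partial>std_seq)"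
    by (rule integral_mono_AE) (use pw iR iS iD iO in \<open>auto elim: eventually_mono\<close>)
  moreover have "(\<integral>x. ?c * (delta j x)\<^sup>2 + ?O x \<partial>std_seq) = ?c * (\<integral>x. (delta j x)\<^sup>2 \<partial>std_seq) + (\<integral>x. ?O x \<partial>std_seq)"
    using iD iO by simp
  moreover have "?c * (\<integral>x. (delta j x)\<^sup>2 \<partial>std_seq) = 48 * real k / K\<^sup>2 * ((\<integral>x. (delta j x)\<^sup>2 \<partial>std_seq) / h j)" by simp
  ultimately show ?thesis by linarith
qed

text \<open>The difference comes from paths at or below the boundary at some block i < n that are
  nevertheless above it, by at most 12 k, at block N = n + L. Early i are improbable by themselves.
  For later i the sum must grow from i to N at a rate of at least 5/4 per coordinate instead of 1
  and then land in a bounded interval, which costs b^(N - i) times a density of order 1 / sqrt h.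
  The factor 1 / sqrt h pays for the order of sqrt h blocks in the window.\<close>

lemma passed_survived:
  assumes w: "win K L \<eta> j" and \<eta>: "0 < \<eta>" "\<eta> \<le> 1 / 10" and n: "lo K j \<le> n" "n < hi K j"
    and b: "\<And>d. measure std_seq {x. (1 + 1 / 4) * real d \<le> sumsq d x} \<le> b ^ d"
    "\<And>d. measure std_seq {x. sumsq d x \<le> (1 - 1 / 4) * real d} \<le> b ^ d" "0 < b" "b < 1"
  shows "\<bar>(\<integral>x. passed k (h j) n L x \<partial>std_seq) - (\<integral>x. survived k (h j) (m j) n L x \<partial>std_seq)\<bar>
    \<le> 12 * real k * (b ^ m j / (1 - b) + 24 * real k * C * b ^ L / ((1 - b) * sqrt (h j)))"
proof -
  let ?g = "boundary k (h j)" and ?N = "n + L"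
  have h0: "0 < h j" by (rule h_gt0)
  have h12: "12 \<le> h j" and mlo: "m j \<le> lo K j"
    and near: "\<And>i. lo K j \<le> i \<Longrightarrow> i \<le> hi K j + Suc L \<Longrightarrow> \<bar>real (k * i) - h j\<bar> \<le> \<eta> * h j"
    using w unfolding win_def by auto
  have eh: "\<eta> * h j \<le> 1 / 10 * h j" using \<eta> h0 by (intro mult_right_mono) auto
  have kN: "9 / 10 * h j \<le> real (k * ?N)" "real (k * Suc ?N) + 1 \<le> 2 * h j"
  proof -
    have "\<bar>real (k * ?N) - h j\<bar> \<le> 1 / 10 * h j" by (rule order_trans[OF near eh]) (use n in auto)
    then show "9 / 10 * h j \<le> real (k * ?N)" by linarith
    have "\<bar>real (k * Suc ?N) - h j\<bar> \<le> 1 / 10 * h j" by (rule order_trans[OF near eh]) (use n in auto)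
    then show "real (k * Suc ?N) + 1 \<le> 2 * h j" using h12 by linarith
  qed
  have step: "?g (n + Suc L) - ?g ?N \<le> 12 * real k"
  proof -
    have "?g (Suc ?N) - ?g ?N \<le> 3 * real k * (real (k * Suc ?N) + 1)\<^sup>2 / (h j)\<^sup>2" by (rule st.boundary_step)
    also have "\<dots> \<le> 3 * real k * (2 * h j)\<^sup>2 / (h j)\<^sup>2"
      using kN by (intro divide_right_mono mult_left_mono power_mono) auto
    also have "\<dots> = 12 * real k" using h0 by (simp add: power_mult_distrib)
    finally show ?thesis by simp
  qed
  let ?E = "\<lambda>i. {x. sumsq (k * i) x \<le> ?g i \<and> ?g ?N < sumsq (k * ?N) x \<and> sumsq (k * ?N) x \<le> ?g ?N + 12 * real k}"
  have E: "?E i \<in> sets std_seq" for i by (rule sets_std_Collect) measurable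
  have pw: "0 \<le> passed k (h j) n L x - survived k (h j) (m j) n L x \<and>
      passed k (h j) n L x - survived k (h j) (m j) n L x \<le> (\<Sum>i\<in>{m j..<n}. 12 * real k * indicator (?E i) x)" for x
  proof -
    have sum0: "0 \<le> (\<Sum>i\<in>{m j..<n}. 12 * real k * indicator (?E i) x)" by (intro sum_nonneg) auto
    let ?V = "max 0 (?g (n + Suc L) - sumsq (k * (n + Suc L)) x)"
    show ?thesis
    proof (cases "\<forall>i\<le>L. ?g (n + i) < sumsq (k * (n + i)) x")
      case P: True
      show ?thesis
      proof (cases "alive k (h j) (m j) ?N x")
        case True
        then show ?thesis using P sum0 by (simp add: passed_def survived_def)
      next
        case False
        then obtain i where i: "m j \<le> i" "i \<le> ?N" "sumsq (k * i) x \<le> ?g i" unfolding alive_def by (auto simp: not_less)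
        have "i < n"
        proof (rule ccontr)
          assume "\<not> i < n"
          then have e: "n + (i - n) = i" and "i - n \<le> L" using i(2) by auto
          from P this(2) have "?g (n + (i - n)) < sumsq (k * (n + (i - n))) x" by blast
          then show False using i(3) unfolding e by simp
        qed
        have PV: "passed k (h j) n L x - survived k (h j) (m j) n L x = ?V"
          using P False by (simp add: passed_def survived_def)
        have "?V \<le> (\<Sum>i\<in>{m j..<n}. 12 * real k * indicator (?E i) x)"
        proof (cases "?V = 0")
          case True
          show ?thesis unfolding True by (rule sum0)
        next
          case V: False
          have gN: "?g ?N < sumsq (k * ?N) x" using P by simp
          have mono: "sumsq (k * ?N) x \<le> sumsq (k * (n + Suc L)) x" by (intro sumsq_mono) simp
          have pos: "0 < ?g (n + Suc L) - sumsq (k * (n + Suc L)) x" using V by (auto simp: max_def split: if_splits)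
          \<comment> \<open>The sum does not decrease, so ending below the next boundary value
            confines it to within one boundary increment above the boundary at
            \<open>?N\<close>.\<close>
          then have "sumsq (k * ?N) x \<le> ?g ?N + 12 * real k" using step mono by linarith
          then have "x \<in> ?E i" using i gN by simp
          then have "12 * real k = 12 * real k * indicator (?E i) x" by simp
          also have "\<dots> \<le> (\<Sum>i\<in>{m j..<n}. 12 * real k * indicator (?E i) x)"
            by (rule member_le_sum) (use i \<open>i < n\<close> in auto)
          finally have "12 * real k \<le> (\<Sum>i\<in>{m j..<n}. 12 * real k * indicator (?E i) x)" .
          moreover have "?V \<le> 12 * real k" using pos gN mono step by linarith
          ultimately show ?thesis by linarith
        qed
        then show ?thesis unfolding PV by simp
      qed
    next
      case False
      have "\<not> alive k (h j) (m j) ?N x"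
      proof
        assume al: "alive k (h j) (m j) ?N x"
        have "?g (n + i) < sumsq (k * (n + i)) x" if "i \<le> L" for i
          using al that n mlo unfolding alive_def by auto
        then show False using False by blast
      qed
      then show ?thesis using False sum0 by (auto simp: passed_def survived_def)
    qed
  qed
  have prE: "measure std_seq (?E i) \<le> b ^ i + 24 * real k * C / sqrt (h j) * b ^ (?N - i)" if i: "m j \<le> i" "i < n" for i
  proof (cases "real (k * i) + 1 \<le> (1 - 1 / 4) * h j")
    case True
    have "measure std_seq (?E i) \<le> measure std_seq {x. sumsq (k * i) x \<le> ?g i}"
      by (intro std_seq.finite_measure_mono sets_std_Collect) auto
    also have "\<dots> \<le> b ^ i" by (rule st.prob_stop_early[OF b(2-4) _ _ True]) auto
    also have "\<dots> \<le> b ^ i + 24 * real k * C / sqrt (h j) * b ^ (?N - i)" using b C_pos h0 by simp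
    finally show ?thesis .
  next
    case False
    define d where "d = k * (?N - i)"
    have ki: "1 / 2 * h j \<le> real (k * i)" using False h12 by (simp add: not_le)
    then have k6: "6 \<le> k * i" using h12 by linarith
    have Nd: "k * ?N = k * i + d" using i by (simp add: d_def flip: distrib_left)
    \<comment> \<open>With k N at least 9 h / 10 and k i at least h / 2, the chord of the boundary
      has slope at least 81/100 + 45/100, which exceeds 5/4.\<close>
    have slope: "(1 + 1 / 4) * real d \<le> ?g ?N - ?g i"
    proof -
      have "(9 / 10 * h j)\<^sup>2 \<le> (real (k * ?N))\<^sup>2" using kN h0 by (intro power_mono) auto
      then have X: "81 / 100 * (h j)\<^sup>2 \<le> (real (k * ?N))\<^sup>2" by (simp only: power_mult_distrib power_divide) simp
      have "(9 / 10 * h j) * (1 / 2 * h j) \<le> real (k * ?N) * real (k * i)"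
        using kN ki h0 by (intro mult_mono) auto
      moreover have "(9 / 10 * h j) * (1 / 2 * h j) = 45 / 100 * (h j)\<^sup>2" by (simp add: power2_eq_square)
      ultimately have Y: "45 / 100 * (h j)\<^sup>2 \<le> real (k * ?N) * real (k * i)" by simp
      have lin: "(1 + 1 / 4) * H \<le> X + Y + Z" if "81 / 100 * H \<le> X" "45 / 100 * H \<le> Y" "0 \<le> Z" "0 \<le> H" for H X Y Z :: real
      proof -
        have "(1 + 1 / 4) * H = 5 / 4 * H" by simp
        then show ?thesis using that by linarith
      qed
      have "(1 + 1 / 4) * (h j)\<^sup>2 \<le> (real (k * ?N))\<^sup>2 + real (k * ?N) * real (k * i) + (real (k * i))\<^sup>2"
        by (rule lin[OF X Y zero_le_power2 zero_le_power2])
      then have "real d * ((1 + 1 / 4) * (h j)\<^sup>2) \<le> real d * ((real (k * ?N))\<^sup>2 + real (k * ?N) * real (k * i) + (real (k * i))\<^sup>2)"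
        by (rule mult_left_mono) simp
      then have "real d * ((1 + 1 / 4) * (h j)\<^sup>2) / (h j)\<^sup>2 \<le> real d * ((real (k * ?N))\<^sup>2 + real (k * ?N) * real (k * i) + (real (k * i))\<^sup>2) / (h j)\<^sup>2"
        by (rule divide_right_mono) simp
      also have "\<dots> \<le> ?g ?N - ?g i" unfolding d_def using i by (intro boundary_diff_ge h0) simp
      finally show ?thesis using h0 by simp
    qed
    have "measure std_seq (?E i) \<le> measure std_seq {x. sumsq (k * i) x \<le> ?g ?N - (1 + 1 / 4) * real d
        \<and> ?g ?N < sumsq (k * i + d) x \<and> sumsq (k * i + d) x \<le> ?g ?N + 12 * real k}"
      unfolding Nd using slope by (intro std_seq.finite_measure_mono sets_std_Collect) auto
    also have "\<dots> \<le> C / sqrt (real (k * i)) * (?g ?N + 12 * real k - ?g ?N) * measure std_seq {y. (1 + 1 / 4) * real d \<le> sumsq d y}"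
      by (rule jump_prob[OF k6]) simp
    also have "\<dots> \<le> (C * 2 / sqrt (h j)) * (12 * real k) * b ^ (?N - i)"
    proof (intro mult_mono)
      show "C / sqrt (real (k * i)) \<le> C * 2 / sqrt (h j)"
      proof -
        have "sqrt (h j) \<le> sqrt (4 * real (k * i))" using ki h0 by (intro real_sqrt_le_mono) linarith
        also have "\<dots> = 2 * sqrt (real (k * i))" by (simp only: real_sqrt_mult real_sqrt_four)
        finally have sq: "sqrt (h j) \<le> 2 * sqrt (real (k * i))" .
        have p: "0 < sqrt (real (k * i))" "0 < sqrt (h j)" using ki h0 by auto
        have "C * sqrt (h j) \<le> C * (2 * sqrt (real (k * i)))" using sq C_pos by (intro mult_left_mono) auto
        then show ?thesis using p by (simp only: divide_le_eq pos_le_divide_eq) (simp add: field_simps)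
      qed
      have "measure std_seq {y. (1 + 1 / 4) * real d \<le> sumsq d y} \<le> b ^ d" by (rule b)
      also have "\<dots> \<le> b ^ (?N - i)" unfolding d_def using b k_ge1 by (intro power_decreasing) auto
      finally show "measure std_seq {y. (1 + 1 / 4) * real d \<le> sumsq d y} \<le> b ^ (?N - i)" .
    qed (use C_pos h0 b in auto)
    also have "\<dots> \<le> b ^ i + 24 * real k * C / sqrt (h j) * b ^ (?N - i)" using b by (simp add: mult_ac)
    finally show ?thesis .
  qed
  have geo: "(\<Sum>i\<in>I. b ^ i) \<le> b ^ a / (1 - b)" if "finite I" "\<And>i. i \<in> I \<Longrightarrow> a \<le> i" for I :: "nat set" and a
  proof -
    have "(\<Sum>i\<in>I. b ^ i) = (\<Sum>i\<in>(\<lambda>i. i - a) ` I. b ^ (i + a))"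
    proof (subst sum.reindex)
      show "inj_on (\<lambda>i. i - a) I"
      proof (rule inj_onI)
        fix x y assume "x \<in> I" "y \<in> I" "x - a = y - a"
        then show "x = y" using that(2)[of x] that(2)[of y] by simp
      qed
      show "(\<Sum>i\<in>I. b ^ i) = sum ((\<lambda>i. b ^ (i + a)) \<circ> (\<lambda>i. i - a)) I"
        using that(2) by (intro sum.cong refl) simp
    qed
    also have "\<dots> \<le> (\<Sum>i. b ^ (i + a))"
      using that(1) b by (intro sum_le_suminf) (auto intro!: summable_ignore_initial_segment summable_geometric)
    also have "\<dots> = b ^ a * (\<Sum>i. b ^ i)"
      using b by (simp add: power_add mult.commute suminf_mult[symmetric] summable_geometric)
    also have "\<dots> = b ^ a / (1 - b)" using b by (subst suminf_geometric) auto
    finally show ?thesis .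
  qed
  have ip: "integrable std_seq (\<lambda>x. passed k (h j) n L x - survived k (h j) (m j) n L x)"
    using integrable_passed integrable_survived by simp
  have iE: "integrable std_seq (\<lambda>x. \<Sum>i\<in>{m j..<n}. 12 * real k * indicator (?E i) x)"
    using E by (intro Bochner_Integration.integrable_sum integrable_mult_right integrable_real_indicator) (auto simp: std_seq.emeasure_eq_measure)
  have "(\<integral>x. passed k (h j) n L x - survived k (h j) (m j) n L x \<partial>std_seq) \<le> (\<integral>x. (\<Sum>i\<in>{m j..<n}. 12 * real k * indicator (?E i) x) \<partial>std_seq)"
    using pw by (intro integral_mono ip iE) auto
  also have "\<dots> = 12 * real k * (\<Sum>i\<in>{m j..<n}. measure std_seq (?E i))"
    using E by (subst Bochner_Integration.integral_sum)
      (auto simp: sum_distrib_left std_seq.emeasure_eq_measure intro!: integrable_mult_right integrable_real_indicator)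
  also have "\<dots> \<le> 12 * real k * (\<Sum>i\<in>{m j..<n}. b ^ i + 24 * real k * C / sqrt (h j) * b ^ (?N - i))"
    using prE by (intro mult_left_mono sum_mono) auto
  also have "\<dots> = 12 * real k * ((\<Sum>i\<in>{m j..<n}. b ^ i) + 24 * real k * C / sqrt (h j) * (\<Sum>i\<in>{m j..<n}. b ^ (?N - i)))"
    by (simp add: sum.distrib sum_distrib_left)
  also have "\<dots> \<le> 12 * real k * (b ^ m j / (1 - b) + 24 * real k * C / sqrt (h j) * (b ^ L / (1 - b)))"
  proof (intro mult_left_mono add_mono)
    show "(\<Sum>i\<in>{m j..<n}. b ^ i) \<le> b ^ m j / (1 - b)" by (rule geo) auto
    have "(\<Sum>i\<in>{m j..<n}. b ^ (?N - i)) = (\<Sum>i\<in>(\<lambda>i. ?N - i) ` {m j..<n}. b ^ i)"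
      by (subst sum.reindex) (auto simp: inj_on_def)
    also have "\<dots> \<le> b ^ L / (1 - b)" by (rule geo) auto
    finally show "(\<Sum>i\<in>{m j..<n}. b ^ (?N - i)) \<le> b ^ L / (1 - b)" .
  qed (use C_pos h0 in auto)
  finally have "(\<integral>x. passed k (h j) n L x - survived k (h j) (m j) n L x \<partial>std_seq)
      \<le> 12 * real k * (b ^ m j / (1 - b) + 24 * real k * C / sqrt (h j) * (b ^ L / (1 - b)))" .
  moreover have "0 \<le> (\<integral>x. passed k (h j) n L x - survived k (h j) (m j) n L x \<partial>std_seq)"
    using pw by (intro integral_nonneg_AE) auto
  moreover have "(\<integral>x. passed k (h j) n L x - survived k (h j) (m j) n L x \<partial>std_seq)
      = (\<integral>x. passed k (h j) n L x \<partial>std_seq) - (\<integral>x. survived k (h j) (m j) n L x \<partial>std_seq)"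
    using integrable_passed integrable_survived by simp
  moreover have "24 * real k * C / sqrt (h j) * (b ^ L / (1 - b)) = 24 * real k * C * b ^ L / ((1 - b) * sqrt (h j))"
    by (simp add: mult.commute)
  ultimately show ?thesis by (simp add: mult.commute)
qed

end

section \<open>The sum of boundary densities and the limit of the overshoot\<close>

context overshoot_regime
begin

definition dens_sum :: "real \<Rightarrow> nat \<Rightarrow> real" where
  "dens_sum K j = (\<Sum>n\<in>{lo K j..<hi K j}. dens (k * n) (boundary k (h j) n))"

lemma win_near:
  assumes "win K L \<eta> j" "\<eta> \<le> 1 / 10" "lo K j \<le> n" "n \<le> hi K j + Suc L"
  shows "\<bar>real (k * n) - h j\<bar> \<le> 1 / 10 * h j" "1 / 2 * h j \<le> real (k * n)" "6 \<le> k * n"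
proof -
  have "\<bar>real (k * n) - h j\<bar> \<le> \<eta> * h j" using assms unfolding win_def by blast
  also have "\<dots> \<le> 1 / 10 * h j" using assms h_gt0[of j] by (intro mult_right_mono) auto
  finally show *: "\<bar>real (k * n) - h j\<bar> \<le> 1 / 10 * h j" .
  then show half: "1 / 2 * h j \<le> real (k * n)" using h_gt0[of j] unfolding abs_le_iff by linarith
  have "12 \<le> h j" using assms unfolding win_def by blast
  then show "6 \<le> k * n" using half by linarith
qed

lemma win_gap:
  assumes "win K L \<eta> j" "0 < \<eta>" "\<eta> \<le> 1 / 10" "lo K j \<le> n" "n < hi K j" "i \<le> Suc L"
  shows "\<bar>boundary k (h j) (n + i) - boundary k (h j) n - 3 * real (k * i)\<bar> \<le> 10 * real (k * i) * \<eta>"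
proof (rule boundary_gap_close)
  show "\<bar>real (k * n) - h j\<bar> \<le> \<eta> * h j" using assms unfolding win_def by simp
  have "real (k * i) \<le> real (k * Suc L)" unfolding of_nat_le_iff using assms(6) by (intro mult_le_mono2)
  then have "(real (k * i) + 9)\<^sup>2 \<le> (real (k * Suc L) + 9)\<^sup>2" by (intro power_mono) auto
  also have "\<dots> \<le> \<eta> * h j" using assms(1) unfolding win_def by blast
  finally show "(real (k * i) + 9)\<^sup>2 \<le> \<eta> * h j" .
qed (use assms h_gt0 in auto)

text \<open>At \<open>lo\<close> the boundary is at least K sqrt h / 4 below the mean: its relative
  deficit is at least K / (2 sqrt h), on a mean of at least h / 2. Chebyshev's inequality with
  variance at most 2 h gives 32 / K^2.\<close>

lemma prob_above_lo:
  assumes w: "win K L \<eta> j" and \<eta>: "\<eta> \<le> 1 / 10" and K: "1 \<le> K"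
  shows "1 - 32 / K\<^sup>2 \<le> prob_above k (h j) (lo K j)"
proof -
  define s where "s = sqrt (h j)"
  have h0: "0 < h j" by (rule h_gt0)
  then have s: "0 < s" "h j = s * s" by (auto simp: s_def)
  let ?a = "real (k * lo K j)" and ?g = "boundary k (h j) (lo K j)"
  have le: "lo K j \<le> hi K j" using w unfolding win_def by blast
  have near: "\<bar>?a - h j\<bar> \<le> 1 / 10 * h j" using win_near(1)[OF w \<eta> order_refl] le by simp
  have a1: "?a \<le> h j - K * s" using w unfolding win_def s_def by blast
  have "real (k * (L + 2)) + 1 \<le> K / 2 * s" using w unfolding win_def s_def by blast
  then have one: "1 \<le> K / 2 * s" using of_nat_0_le_iff[of "k * (L + 2)", where 'a = real] by linarith
  define q where "q = (?a + 1) / h j"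
  have "?a + 1 \<le> h j - K / 2 * s"
  proof -
    have "K * s = K / 2 * s + K / 2 * s" by simp
    then show ?thesis using a1 one by linarith
  qed
  then have "q \<le> (h j - K / 2 * s) / h j" unfolding q_def using h0 by (intro divide_right_mono) auto
  also have "\<dots> = 1 - K / (2 * s)" using s by (simp add: diff_divide_distrib)
  finally have q1: "q \<le> 1 - K / (2 * s)" .
  have q0: "0 \<le> q" unfolding q_def using h0 by simp
  have "0 \<le> K / (2 * s)" using K s by simp
  then have "q \<le> 1" using q1 by linarith
  then have "q * q \<le> q * 1" using q0 by (intro mult_left_mono) auto
  then have "q\<^sup>2 \<le> 1 - K / (2 * s)" using q1 by (simp add: power2_eq_square)
  then have "?a * q\<^sup>2 \<le> ?a * (1 - K / (2 * s))" by (intro mult_left_mono) auto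
  moreover have "?g = ?a * q\<^sup>2" unfolding boundary_def q_def by (simp add: power_divide)
  moreover have "1 / 4 * (K * s) \<le> ?a * (K / (2 * s))"
  proof -
    have "1 / 2 * h j \<le> ?a" using near h0 unfolding abs_le_iff by linarith
    then have "1 / 2 * h j * (K / (2 * s)) \<le> ?a * (K / (2 * s))" using K s by (intro mult_right_mono) auto
    moreover have "1 / 2 * h j * (K / (2 * s)) = 1 / 4 * (K * s)" using s by simp
    ultimately show ?thesis by (simp only:)
  qed
  moreover have "?a * (1 - K / (2 * s)) = ?a - ?a * (K / (2 * s))" by (simp add: right_diff_distrib)
  ultimately have g: "?g \<le> ?a - 1 / 4 * (K * s)" by linarith
  have A: "{x. ?g < sumsq (k * lo K j) x} \<in> sets std_seq" by (rule sets_std_Collect) measurable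
  have "1 - prob_above k (h j) (lo K j) = measure std_seq (UNIV - {x. ?g < sumsq (k * lo K j) x})"
    using std_seq.prob_compl[OF A] unfolding prob_above_def by simp
  also have "\<dots> \<le> measure std_seq {x. 1 / 4 * (K * s) \<le> \<bar>sumsq (k * lo K j) x - ?a\<bar>}"
  proof (intro std_seq.finite_measure_mono sets_std_Collect subsetI)
    fix x assume "x \<in> UNIV - {x. ?g < sumsq (k * lo K j) x}"
    then have "\<not> ?g < sumsq (k * lo K j) x" by simp
    then have "1 / 4 * (K * s) \<le> \<bar>sumsq (k * lo K j) x - ?a\<bar>" using g by linarith
    then show "x \<in> {x. 1 / 4 * (K * s) \<le> \<bar>sumsq (k * lo K j) x - ?a\<bar>}" by simp
  qed measurable
  also have "\<dots> \<le> 2 * ?a / (1 / 4 * (K * s))\<^sup>2" using K s by (intro prob_sumsq_chebyshev) auto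
  also have "\<dots> \<le> 2 * h j / (1 / 4 * (K * s))\<^sup>2"
  proof (intro divide_right_mono mult_left_mono)
    have "0 \<le> K * s" using K s by simp
    then show "?a \<le> h j" using a1 by linarith
  qed auto
  also have "\<dots> = 32 / K\<^sup>2" using s K by (simp add: power_mult_distrib power2_eq_square)
  finally show ?thesis by linarith
qed

text \<open>At \<open>hi\<close> the boundary exceeds the mean by at least K sqrt h, and the
  variance is at most 4 h.\<close>

lemma prob_above_hi:
  assumes w: "win K L \<eta> j" and \<eta>: "\<eta> \<le> 1 / 10" and K: "1 \<le> K"
  shows "prob_above k (h j) (hi K j) \<le> 4 / K\<^sup>2"
proof -
  define s where "s = sqrt (h j)"
  have h0: "0 < h j" by (rule h_gt0)
  then have s: "0 < s" "h j = s * s" by (auto simp: s_def)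
  let ?b = "real (k * hi K j)" and ?g = "boundary k (h j) (hi K j)"
  have le: "lo K j \<le> hi K j" using w unfolding win_def by blast
  have near: "\<bar>?b - h j\<bar> \<le> 1 / 10 * h j" using win_near(1)[OF w \<eta> le] by simp
  have b1: "h j + K * s \<le> ?b" using w unfolding win_def s_def by blast
  have Ks: "0 \<le> K * s" "0 \<le> K / s" using K s by auto
  define q where "q = (?b + 1) / h j"
  have "(h j + K * s) / h j \<le> q" unfolding q_def using b1 h0 by (intro divide_right_mono) auto
  moreover have "(h j + K * s) / h j = 1 + K / s" using s by (simp add: add_divide_distrib)
  ultimately have q1: "1 + K / s \<le> q" by simp
  then have "1 \<le> q" using Ks by linarith
  then have "q * 1 \<le> q * q" by (intro mult_left_mono) auto
  then have "1 + K / s \<le> q\<^sup>2" using q1 by (simp add: power2_eq_square)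
  then have "?b * (1 + K / s) \<le> ?b * q\<^sup>2" by (intro mult_left_mono) auto
  moreover have "?g = ?b * q\<^sup>2" unfolding boundary_def q_def by (simp add: power_divide)
  moreover have "K * s \<le> ?b * (K / s)"
  proof -
    have "h j * (K / s) \<le> ?b * (K / s)" using b1 Ks by (intro mult_right_mono) auto
    moreover have "h j * (K / s) = K * s" using s by simp
    ultimately show ?thesis by (simp only:)
  qed
  moreover have "?b * (1 + K / s) = ?b + ?b * (K / s)" by (simp add: distrib_left)
  ultimately have g: "?b + K * s \<le> ?g" by linarith
  have "prob_above k (h j) (hi K j) \<le> measure std_seq {x. K * s \<le> \<bar>sumsq (k * hi K j) x - ?b\<bar>}"
    unfolding prob_above_def using g by (intro std_seq.finite_measure_mono sets_std_Collect) auto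
  also have "\<dots> \<le> 2 * ?b / (K * s)\<^sup>2" using K s by (intro prob_sumsq_chebyshev) auto
  also have "\<dots> \<le> 4 * h j / (K * s)\<^sup>2"
  proof (intro divide_right_mono)
    show "2 * ?b \<le> 4 * h j" using near h0 unfolding abs_le_iff by linarith
  qed auto
  also have "\<dots> = 4 / K\<^sup>2" using s K by (simp add: power_mult_distrib power2_eq_square)
  finally show ?thesis .
qed

text \<open>The probabilities \<open>P(S n > g n)\<close> telescope over the window from nearly 1 to nearly 0, and each step is
  \<open>2 k\<close> times the density of \<open>S n\<close> at \<open>g n\<close> up to \<open>O(1 / h)\<close>. This evaluates the sum of the densities
  without a local limit theorem.\<close>

lemma dens_sum_bound:
  assumes w: "win K L \<eta> j" and \<eta>: "0 < \<eta>" "\<eta> \<le> 1 / 10" and K: "1 \<le> K"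
    and small: "8 * K * C * (9 * (real k)\<^sup>2 + 2 * real k) / sqrt (h j) \<le> \<epsilon>" "\<epsilon> \<le> 1"
  shows "dens_sum K j \<le> 2" "\<bar>2 * real k * dens_sum K j - 1\<bar> \<le> 36 / K\<^sup>2 + \<epsilon> + 20 * real k * \<eta>"
proof -
  define W where "W = {lo K j..<hi K j}"
  define s where "s = sqrt (h j)"
  have h0: "0 < h j" by (rule h_gt0)
  then have s: "0 < s" "h j = s * s" by (auto simp: s_def)
  have k1: "1 \<le> real k" using k_ge1 by simp
  let ?g = "boundary k (h j)" and ?P = "prob_above k (h j)"
  let ?p = "\<lambda>n. dens (k * n) (?g n)" and ?G = "\<lambda>n. ?g (Suc n) - ?g n"
  define E where "E = 2 * C * (9 * (real k)\<^sup>2 + 2 * real k)"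
  have le: "lo K j \<le> hi K j" and width: "real (hi K j - lo K j) \<le> 4 * K * s" using w unfolding win_def s_def by blast+
  have p0: "0 \<le> ?p n" if "n \<in> W" for n
    using win_near(3)[OF w \<eta>(2), of n] that unfolding W_def by (intro dens_nonneg) auto
  have G: "\<bar>?G n - 3 * real k\<bar> \<le> 10 * real k * \<eta>" if "n \<in> W" for n
    using win_gap[OF w \<eta>, of n 1] that unfolding W_def by simp
  have e10: "10 * real k * \<eta> \<le> real k" using \<eta> k1 mult_left_mono[of \<eta> "1/10" "10 * real k"] by simp
  have step: "\<bar>?P n - ?P (Suc n) - ?p n * (?G n - real k)\<bar> \<le> E / h j" if n: "n \<in> W" for n
  proof -
    have nn: "1 / 2 * h j \<le> real (k * n)" "6 \<le> k * n" using win_near(2,3)[OF w \<eta>(2), of n] n unfolding W_def by auto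
    have "\<bar>?P n - ?P (Suc n) - ?p n * (?G n - real k)\<bar> \<le> C / (k * n) * ((?G n - real k)\<^sup>2 + 2 * real k)"
      by (rule prob_above_step[OF h0 nn(2)])
    also have "\<dots> \<le> (2 * C / h j) * ((3 * real k)\<^sup>2 + 2 * real k)"
    proof (intro mult_mono add_mono power_mono)
      have "C / real (k * n) \<le> C / (1 / 2 * h j)" using nn h0 C_pos by (intro divide_left_mono) auto
      then show "C / real (k * n) \<le> 2 * C / h j" by (simp add: mult.commute)
      show "?G n - real k \<le> 3 * real k" using G[OF n] e10 by linarith
      show "0 \<le> ?G n - real k" using G[OF n] e10 k1 by linarith
    qed (use C_pos h0 in auto)
    also have "\<dots> = E / h j" unfolding E_def by (simp add: power_mult_distrib)
    finally show ?thesis .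
  qed
  have tele: "(\<Sum>n\<in>W. ?P n - ?P (Suc n)) = ?P (lo K j) - ?P (hi K j)"
    unfolding W_def using sum_Suc_diff'[OF le, of "\<lambda>n. - ?P n"] by simp
  have "\<bar>(?P (lo K j) - ?P (hi K j)) - (\<Sum>n\<in>W. ?p n * (?G n - real k))\<bar> = \<bar>\<Sum>n\<in>W. ?P n - ?P (Suc n) - ?p n * (?G n - real k)\<bar>"
    by (simp only: tele[symmetric] sum_subtractf)
  also have "\<dots> \<le> (\<Sum>n\<in>W. \<bar>?P n - ?P (Suc n) - ?p n * (?G n - real k)\<bar>)" by (rule sum_abs)
  also have "\<dots> \<le> (\<Sum>n\<in>W. E / h j)" by (intro sum_mono step)
  also have "\<dots> = real (hi K j - lo K j) * (E / h j)" unfolding W_def by simp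
  also have "\<dots> \<le> (4 * K * s) * (E / h j)"
    using width C_pos h0 unfolding E_def by (intro mult_right_mono) auto
  also have "\<dots> = 8 * K * C * (9 * (real k)\<^sup>2 + 2 * real k) / s" unfolding E_def using s by simp
  also have "\<dots> \<le> \<epsilon>" using small unfolding s_def by blast
  finally have A: "\<bar>(?P (lo K j) - ?P (hi K j)) - (\<Sum>n\<in>W. ?p n * (?G n - real k))\<bar> \<le> \<epsilon>" .
  have Pd: "dens_sum K j = (\<Sum>n\<in>W. ?p n)" unfolding dens_sum_def W_def ..
  have Pd0: "0 \<le> dens_sum K j" unfolding Pd by (intro sum_nonneg p0)
  have "\<bar>(\<Sum>n\<in>W. ?p n * (?G n - real k)) - 2 * real k * dens_sum K j\<bar> = \<bar>\<Sum>n\<in>W. ?p n * (?G n - 3 * real k)\<bar>"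
    unfolding Pd sum_distrib_left sum_subtractf[symmetric] by (rule arg_cong[where f = abs], intro sum.cong refl) (simp add: algebra_simps)
  also have "\<dots> \<le> (\<Sum>n\<in>W. \<bar>?p n * (?G n - 3 * real k)\<bar>)" by (rule sum_abs)
  also have "\<dots> \<le> (\<Sum>n\<in>W. ?p n * (10 * real k * \<eta>))"
  proof (intro sum_mono)
    fix n assume n: "n \<in> W"
    have "\<bar>?p n * (?G n - 3 * real k)\<bar> = ?p n * \<bar>?G n - 3 * real k\<bar>" using p0[OF n] by (simp add: abs_mult)
    also have "\<dots> \<le> ?p n * (10 * real k * \<eta>)" using G[OF n] p0[OF n] by (intro mult_left_mono)
    finally show "\<bar>?p n * (?G n - 3 * real k)\<bar> \<le> ?p n * (10 * real k * \<eta>)" .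
  qed
  also have "\<dots> = 10 * real k * \<eta> * dens_sum K j" unfolding Pd sum_distrib_right[symmetric] by (rule mult.commute)
  finally have Bd: "\<bar>(\<Sum>n\<in>W. ?p n * (?G n - real k)) - 2 * real k * dens_sum K j\<bar> \<le> 10 * real k * \<eta> * dens_sum K j" .
  have P1: "?P (lo K j) \<le> 1" "0 \<le> ?P (hi K j)" unfolding prob_above_def by simp_all
  \<comment> \<open>The sum occurs in its own error term. As 10 k \<eta> \<le> k, that term is first
    absorbed to bound the sum by 2, and this bound is then inserted for the sharp estimate.\<close>
  have "2 * real k * dens_sum K j \<le> 1 + \<epsilon> + 10 * real k * \<eta> * dens_sum K j" using A Bd P1 unfolding abs_le_iff by linarith
  also have "10 * real k * \<eta> * dens_sum K j \<le> real k * dens_sum K j" using e10 Pd0 by (rule mult_right_mono)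
  finally have "real k * dens_sum K j \<le> 1 + \<epsilon>" by linarith
  moreover have "1 * dens_sum K j \<le> real k * dens_sum K j" using k1 Pd0 by (rule mult_right_mono)
  ultimately show two: "dens_sum K j \<le> 2" using small by linarith
  have "10 * real k * \<eta> * dens_sum K j \<le> 10 * real k * \<eta> * 2" using two \<eta> by (intro mult_left_mono) auto
  then have "10 * real k * \<eta> * dens_sum K j \<le> 20 * real k * \<eta>" by simp
  then show "\<bar>2 * real k * dens_sum K j - 1\<bar> \<le> 36 / K\<^sup>2 + \<epsilon> + 20 * real k * \<eta>"
    using A Bd P1 prob_above_lo[OF w \<eta>(2) K] prob_above_hi[OF w \<eta>(2) K] zero_le_divide_iff[of 36 "K\<^sup>2"]
    unfolding abs_le_iff by linarith
qed

text \<open>The window has of order sqrt h steps and each local approximation errs by order 1 / h,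
  so these errors add up to order 1 / sqrt h. The error from the curvature of the boundary is
  weighted by the densities, whose sum is bounded.\<close>

lemma passed_sum:
  assumes w: "win K L \<eta> j" and \<eta>: "0 < \<eta>" "\<eta> \<le> 1 / 10" and K: "1 \<le> K"
    and \<eta>L: "10 * real (k * Suc L) * \<eta> \<le> 1"
  defines "H \<equiv> 3 * real (k * Suc L) + 1"
  shows "\<bar>(\<Sum>n\<in>{lo K j..<hi K j}. \<integral>x. passed k (h j) n L x \<partial>std_seq) - dens_sum K j * (overshoot_moment k L / 2)\<bar>
    \<le> dens_sum K j * (20 * real (k * Suc L) * \<eta> * H) + 8 * K * C * H ^ 3 / sqrt (h j)"
proof -
  define W where "W = {lo K j..<hi K j}"
  define s where "s = sqrt (h j)"
  have h0: "0 < h j" by (rule h_gt0)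
  then have s: "0 < s" "h j = s * s" by (auto simp: s_def)
  have H0: "0 \<le> H" unfolding H_def by simp
  let ?g = "boundary k (h j)" and ?p = "\<lambda>n. dens (k * n) (boundary k (h j) n)"
  let ?I = "\<lambda>n. \<integral>y. (max 0 (landing k (h j) n L y - barrier k (h j) n L y))\<^sup>2 / 2 \<partial>std_seq"
  have width: "real (hi K j - lo K j) \<le> 4 * K * s" using w unfolding win_def s_def by blast
  have one: "\<bar>(\<integral>x. passed k (h j) n L x \<partial>std_seq) - ?p n * (overshoot_moment k L / 2)\<bar>
      \<le> ?p n * (20 * real (k * Suc L) * \<eta> * H) + 2 * C / h j * H ^ 3" if n: "n \<in> W" for n
  proof -
    have nn: "1 / 2 * h j \<le> real (k * n)" "6 \<le> k * n" using win_near(2,3)[OF w \<eta>(2), of n] n unfolding W_def by auto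
    have p0: "0 \<le> ?p n" using nn by (intro dens_nonneg)
    have gap: "\<bar>?g (n + i) - ?g n - 3 * real (k * i)\<bar> \<le> 10 * real (k * Suc L) * \<eta>" if i: "i \<le> Suc L" for i
    proof -
      have "\<bar>?g (n + i) - ?g n - 3 * real (k * i)\<bar> \<le> 10 * real (k * i) * \<eta>"
        using win_gap[OF w \<eta> _ _ i, of n] n unfolding W_def by simp
      also have "\<dots> \<le> 10 * real (k * Suc L) * \<eta>"
      proof (intro mult_right_mono mult_left_mono)
        show "real (k * i) \<le> real (k * Suc L)" unfolding of_nat_le_iff using i by (intro mult_le_mono2)
      qed (use \<eta> in auto)
      finally show ?thesis .
    qed
    have g0: "0 \<le> ?g (n + Suc L) - ?g n" using boundary_mono[OF h0, of n "n + Suc L" k] by simp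
    have gH: "?g (n + Suc L) - ?g n \<le> H" using gap[of "Suc L"] \<eta>L unfolding H_def abs_le_iff by linarith
    have "\<bar>(\<integral>x. passed k (h j) n L x \<partial>std_seq) - ?p n * ?I n\<bar> \<le> C / (k * n) * (?g (n + Suc L) - ?g n) ^ 3"
      by (rule passed_local[OF h0 nn(2)])
    also have "\<dots> \<le> 2 * C / h j * H ^ 3"
    proof (intro mult_mono power_mono gH g0)
      have "C / real (k * n) \<le> C / (1 / 2 * h j)" using nn h0 C_pos by (intro divide_left_mono) auto
      then show "C / real (k * n) \<le> 2 * C / h j" by (simp add: mult.commute)
    qed (use C_pos h0 g0 in auto)
    finally have a: "\<bar>(\<integral>x. passed k (h j) n L x \<partial>std_seq) - ?p n * ?I n\<bar> \<le> 2 * C / h j * H ^ 3" .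
    have eq: "2 * (10 * real (k * Suc L) * \<eta>) * H = 20 * real (k * Suc L) * \<eta> * H" by simp
    have "\<bar>?I n - overshoot_moment k L / 2\<bar> \<le> 2 * (10 * real (k * Suc L) * \<eta>) * (3 * real (k * Suc L) + 1)"
      by (rule landing_moment_close[OF _ \<eta>L gap]) (use \<eta> in simp)
    then have "\<bar>?I n - overshoot_moment k L / 2\<bar> \<le> 20 * real (k * Suc L) * \<eta> * H" by (fold H_def) (simp only: eq)
    then have "?p n * \<bar>?I n - overshoot_moment k L / 2\<bar> \<le> ?p n * (20 * real (k * Suc L) * \<eta> * H)"
      using p0 by (rule mult_left_mono)
    moreover have "\<bar>?p n * ?I n - ?p n * (overshoot_moment k L / 2)\<bar> = ?p n * \<bar>?I n - overshoot_moment k L / 2\<bar>"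
      using p0 by (simp only: right_diff_distrib[symmetric] abs_mult abs_of_nonneg)
    ultimately show ?thesis using a by linarith
  qed
  have "\<bar>(\<Sum>n\<in>W. \<integral>x. passed k (h j) n L x \<partial>std_seq) - dens_sum K j * (overshoot_moment k L / 2)\<bar>
      = \<bar>\<Sum>n\<in>W. (\<integral>x. passed k (h j) n L x \<partial>std_seq) - ?p n * (overshoot_moment k L / 2)\<bar>"
    unfolding dens_sum_def W_def[symmetric] by (simp only: sum_subtractf sum_distrib_right)
  also have "\<dots> \<le> (\<Sum>n\<in>W. \<bar>(\<integral>x. passed k (h j) n L x \<partial>std_seq) - ?p n * (overshoot_moment k L / 2)\<bar>)" by (rule sum_abs)
  also have "\<dots> \<le> (\<Sum>n\<in>W. ?p n * (20 * real (k * Suc L) * \<eta> * H) + 2 * C / h j * H ^ 3)" by (intro sum_mono one)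
  also have "\<dots> = dens_sum K j * (20 * real (k * Suc L) * \<eta> * H) + real (hi K j - lo K j) * (2 * C / h j * H ^ 3)"
    unfolding dens_sum_def W_def[symmetric] sum.distrib sum_distrib_right[symmetric] by (simp add: W_def)
  also have "real (hi K j - lo K j) * (2 * C / h j * H ^ 3) \<le> (4 * K * s) * (2 * C / h j * H ^ 3)"
    using width C_pos h0 H0 by (intro mult_right_mono) auto
  also have "(4 * K * s) * (2 * C / h j * H ^ 3) = 8 * K * C * H ^ 3 / s" using s by simp
  finally show ?thesis unfolding W_def s_def by simp
qed

text \<open>Four successive replacements: the overshoot by the sum of \<open>survived\<close>, this
  by the sum of \<open>passed\<close>, this by \<open>dens_sum\<close> times half the overshoot
  moment, and \<open>dens_sum\<close> by 1 / (2 k). \<open>K\<close> and \<open>L\<close> stay fixed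
  while \<open>j\<close> grows.\<close>

lemma overshoot_window:
  assumes K: "1 \<le> K" and \<epsilon>: "0 < \<epsilon>" "\<epsilon> \<le> 1"
    and b: "\<And>d. measure std_seq {x. (1 + 1 / 4) * real d \<le> sumsq d x} \<le> b ^ d"
    "\<And>d. measure std_seq {x. sumsq d x \<le> (1 - 1 / 4) * real d} \<le> b ^ d" "0 < b" "b < 1"
  shows "\<forall>\<^sub>F j in sequentially. \<bar>(\<integral>x. st.overshoot j x \<partial>std_seq) - overshoot_moment k L / (4 * real k)\<bar>
    \<le> 48 * real k / K\<^sup>2 + 4 * \<epsilon> + 1152 * (real k)\<^sup>2 * C / (1 - b) * K * b ^ L
      + overshoot_moment k L / (4 * real k) * (36 / K\<^sup>2 + 2 * \<epsilon>)"
proof -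
  define H where "H = 3 * real (k * Suc L) + 1"
  define D where "D = real (k * Suc L)"
  have k1: "1 \<le> real k" using k_ge1 by simp
  have "1 * 1 \<le> k * Suc L" using k_ge1 by (intro mult_le_mono) auto
  then have D1: "1 \<le> D" unfolding D_def by (simp only: mult_1 of_nat_le_iff[symmetric, where 'a = real] of_nat_1)
  have kD: "real k \<le> D" unfolding D_def of_nat_le_iff by simp
  have H1: "1 \<le> H" unfolding H_def by simp
  \<comment> \<open>Chosen so that the curvature error in \<open>passed_sum\<close>, with
    \<open>dens_sum\<close> bounded by 2, equals \<epsilon>.\<close>
  define \<eta> where "\<eta> = \<epsilon> / (40 * D * H)"
  have DH: "0 < 40 * D * H" using D1 H1 by simp
  have \<eta>0: "0 < \<eta>" unfolding \<eta>_def using \<epsilon> DH by simp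
  have \<eta>e: "40 * D * \<eta> * H = \<epsilon>" unfolding \<eta>_def using D1 H1 by simp
  have \<eta>D: "40 * D * \<eta> \<le> \<epsilon>"
  proof -
    have "40 * D * \<eta> * 1 \<le> 40 * D * \<eta> * H" using H1 D1 \<eta>0 by (intro mult_left_mono) auto
    then show ?thesis using \<eta>e by simp
  qed
  have \<eta>k: "20 * real k * \<eta> \<le> \<epsilon>"
  proof -
    have "20 * real k * \<eta> \<le> 40 * D * \<eta>" using kD \<eta>0 D1 by (intro mult_right_mono) auto
    then show ?thesis using \<eta>D by (rule order_trans)
  qed
  have \<eta>1: "\<eta> \<le> 1 / 10" "10 * D * \<eta> \<le> 1"
  proof -
    have "1 * \<eta> \<le> D * \<eta>" using D1 \<eta>0 by (intro mult_right_mono) auto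
    then show "\<eta> \<le> 1 / 10" using \<eta>D \<epsilon> by linarith
    show "10 * D * \<eta> \<le> 1" using \<eta>D \<epsilon> \<eta>0 D1 mult_pos_pos[of D \<eta>] by linarith
  qed
  have om0: "0 \<le> overshoot_moment k L" unfolding overshoot_moment_def by (intro integral_nonneg_AE) simp
  have e1: "\<forall>\<^sub>F j in sequentially. c / sqrt (h j) \<le> \<epsilon>" for c
    using sqrt_large[of "\<bar>c\<bar> / \<epsilon>"]
  proof eventually_elim
    case (elim j)
    have "\<bar>c\<bar> \<le> \<epsilon> * sqrt (h j)" using elim \<epsilon> by (simp add: field_simps)
    then have "c \<le> \<epsilon> * sqrt (h j)" by linarith
    then show ?case using h_gt0[of j] by (simp add: field_simps)
  qed
  have e2: "\<forall>\<^sub>F j in sequentially. (\<integral>x. (delta j x)\<^sup>2 \<partial>std_seq) / h j < 1"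
    using delta_square_limit by (rule order_tendstoD) simp
  have e3: "\<forall>\<^sub>F j in sequentially. (\<integral>x. (st.M j x + h j) ^ 3 * off (1 / 2) j x \<partial>std_seq) < \<epsilon>"
    using \<epsilon> by (intro off_eventually) auto
  \<comment> \<open>The contribution b^m of early stopping is multiplied by the order of sqrt h
    blocks in the window; it vanishes because \<open>h\<close> is at most a power of the pilot
    size.\<close>
  have e4: "\<forall>\<^sub>F j in sequentially. 48 * real k * K / (1 - b) * (sqrt (h j) * b ^ m j) < \<epsilon>"
  proof -
    have "(\<lambda>n. real n ^ p * b ^ n) \<longlonglongrightarrow> 0"
      by (rule summable_LIMSEQ_zero) (rule summable_power_mult_geometric[OF b(3,4)])
    then have "(\<lambda>j. \<bar>B\<bar> * (real (m j) ^ p * b ^ m j)) \<longlonglongrightarrow> \<bar>B\<bar> * 0"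
      by (intro tendsto_mult tendsto_const) (rule filterlim_compose[OF _ m_top])
    then have z: "(\<lambda>j. \<bar>B\<bar> * (real (m j) ^ p * b ^ m j)) \<longlonglongrightarrow> 0" by simp
    have "(\<lambda>j. sqrt (h j) * b ^ m j) \<longlonglongrightarrow> 0"
    proof (rule Lim_null_comparison[OF _ z])
      show "\<forall>\<^sub>F j in sequentially. norm (sqrt (h j) * b ^ m j) \<le> \<bar>B\<bar> * (real (m j) ^ p * b ^ m j)"
        using h_le h_large[of 1]
      proof eventually_elim
        case (elim j)
        have "h j \<le> (h j)\<^sup>2" using elim(2) by (simp add: power2_eq_square)
        then have "sqrt (h j) \<le> h j" using elim(2) by (intro real_le_lsqrt) auto
        also have "\<dots> \<le> B * real (m j) ^ p" by (rule elim(1))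
        also have "\<dots> \<le> \<bar>B\<bar> * real (m j) ^ p" by (intro mult_right_mono) auto
        finally have "sqrt (h j) * b ^ m j \<le> \<bar>B\<bar> * real (m j) ^ p * b ^ m j" using b by (intro mult_right_mono) auto
        then show ?case using b elim(2) by (simp add: abs_mult mult.assoc)
      qed
    qed
    then have "(\<lambda>j. 48 * real k * K / (1 - b) * (sqrt (h j) * b ^ m j)) \<longlonglongrightarrow> 48 * real k * K / (1 - b) * 0"
      by (intro tendsto_mult tendsto_const)
    then show ?thesis using \<epsilon> by (intro order_tendstoD(2)) auto
  qed
  show ?thesis
    using win_eventually[OF K \<eta>0 \<eta>1(1), of L] e1[of "8 * K * C * (9 * (real k)\<^sup>2 + 2 * real k)"] e1[of "8 * K * C * H ^ 3"] e2 e3 e4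
  proof eventually_elim
    case (elim j)
    note w = elim(1)
    define s where "s = sqrt (h j)"
    have s: "0 < s" unfolding s_def using h_gt0[of j] by simp
    let ?R = "\<integral>x. st.overshoot j x \<partial>std_seq" and ?om = "overshoot_moment k L"
    let ?S = "\<Sum>n\<in>{lo K j..<hi K j}. \<integral>x. survived k (h j) (m j) n L x \<partial>std_seq"
    let ?P = "\<Sum>n\<in>{lo K j..<hi K j}. \<integral>x. passed k (h j) n L x \<partial>std_seq"
    note ds = dens_sum_bound[OF w \<eta>0 \<eta>1(1) K elim(2) \<epsilon>(2)]
    have "48 * real k / K\<^sup>2 * ((\<integral>x. (delta j x)\<^sup>2 \<partial>std_seq) / h j) \<le> 48 * real k / K\<^sup>2 * 1"
      using elim(4) by (intro mult_left_mono) auto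
    then have 1: "\<bar>?R - ?S\<bar> \<le> 48 * real k / K\<^sup>2 + \<epsilon>" using survived_sum[OF w K] elim(5) by linarith
    let ?c = "12 * real k * (b ^ m j / (1 - b) + 24 * real k * C * b ^ L / ((1 - b) * s))"
    have c0: "0 \<le> ?c" using b C_pos s by (intro mult_nonneg_nonneg add_nonneg_nonneg divide_nonneg_nonneg) auto
    have "\<bar>?P - ?S\<bar> \<le> (\<Sum>n\<in>{lo K j..<hi K j}. \<bar>(\<integral>x. passed k (h j) n L x \<partial>std_seq) - (\<integral>x. survived k (h j) (m j) n L x \<partial>std_seq)\<bar>)"
      unfolding sum_subtractf[symmetric] by (rule sum_abs)
    also have "\<dots> \<le> (\<Sum>n\<in>{lo K j..<hi K j}. ?c)"
      unfolding s_def by (intro sum_mono passed_survived[OF w \<eta>0 \<eta>1(1) _ _ b]) auto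
    also have "\<dots> = real (hi K j - lo K j) * ?c" by simp
    also have "\<dots> \<le> (4 * K * s) * ?c"
      using w c0 unfolding win_def s_def by (intro mult_right_mono) blast+
    also have "\<dots> = 48 * real k * K / (1 - b) * (s * b ^ m j) + 1152 * (real k)\<^sup>2 * C / (1 - b) * K * b ^ L"
    proof -
      have "(4 * K * s) * (12 * real k * (x / u + 24 * real k * C * y / (u * s)))
          = 48 * real k * K / u * (s * x) + 1152 * (real k)\<^sup>2 * C / u * K * y" for x y u
        using s by (simp add: distrib_left power2_eq_square mult_ac)
      then show ?thesis .
    qed
    also have "\<dots> \<le> \<epsilon> + 1152 * (real k)\<^sup>2 * C / (1 - b) * K * b ^ L" using elim(6) unfolding s_def by linarith
    finally have 2: "\<bar>?P - ?S\<bar> \<le> \<epsilon> + 1152 * (real k)\<^sup>2 * C / (1 - b) * K * b ^ L" .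
    have "dens_sum K j * (20 * D * \<eta> * H) \<le> 2 * (20 * D * \<eta> * H)"
      using ds(1) D1 \<eta>0 H1 by (intro mult_right_mono) auto
    also have "\<dots> = \<epsilon>" using \<eta>e by simp
    finally have "dens_sum K j * (20 * D * \<eta> * H) \<le> \<epsilon>" .
    then have 3: "\<bar>?P - dens_sum K j * (?om / 2)\<bar> \<le> 2 * \<epsilon>"
      using passed_sum[OF w \<eta>0 \<eta>1(1) K \<eta>1(2)[unfolded D_def]] elim(3) unfolding H_def D_def by linarith
    have "dens_sum K j * (?om / 2) - ?om / (4 * real k) = ?om / (4 * real k) * (2 * real k * dens_sum K j - 1)"
      using k1 by (simp add: field_simps)
    then have "\<bar>dens_sum K j * (?om / 2) - ?om / (4 * real k)\<bar> = ?om / (4 * real k) * \<bar>2 * real k * dens_sum K j - 1\<bar>"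
      using om0 by (simp add: abs_mult)
    also have "\<dots> \<le> ?om / (4 * real k) * (36 / K\<^sup>2 + 2 * \<epsilon>)"
      using ds(2) \<eta>k om0 by (intro mult_left_mono) auto
    finally have 4: "\<bar>dens_sum K j * (?om / 2) - ?om / (4 * real k)\<bar> \<le> ?om / (4 * real k) * (36 / K\<^sup>2 + 2 * \<epsilon>)" .
    show ?case using 1 2 3 4 by linarith
  qed
qed

text \<open>The bound \<open>Q\<close> on the moments is uniform in L, so \<open>K\<close> and
  \<epsilon> can be fixed first. L comes next, because the error of forgetting the past is of order
  K b^L, and \<open>j\<close> last.\<close>

lemma overshoot_limit:
  "(\<lambda>j. \<integral>x. st.overshoot j x \<partial>std_seq)
    \<longlonglongrightarrow> real k + 1 / 2 - (\<Sum>n. chi_sq_excess (k * Suc n) / real (Suc n))" (is "_ \<longlonglongrightarrow> ?e")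
proof (rule tendstoI)
  fix e :: real assume e: "0 < e"
  have k1: "1 \<le> real k" using k_ge1 by simp
  obtain b :: real where b: "0 < b" "b < 1"
    "\<And>d. measure std_seq {x. (1 + 1 / 4) * real d \<le> sumsq d x} \<le> b ^ d"
    "\<And>d. measure std_seq {x. sumsq d x \<le> (1 - 1 / 4) * real d} \<le> b ^ d"
    by (rule sumsq_chernoff[of "1 / 4"]) auto
  let ?om = "\<lambda>L. overshoot_moment k L / (4 * real k)"
  have "(\<lambda>L. ?om L) \<longlonglongrightarrow> (4 * (real k)\<^sup>2 + 2 * real k - 4 * real k * (\<Sum>n. chi_sq_excess (k * Suc n) / real (Suc n))) / (4 * real k)"
    by (intro tendsto_intros overshoot_moment_limit k_ge1) (use k1 in auto)
  moreover have "(4 * (real k)\<^sup>2 + 2 * real k - 4 * real k * S) / (4 * real k) = real k + 1 / 2 - S" for S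
    using k1 by (simp add: field_simps power2_eq_square)
  ultimately have om: "?om \<longlonglongrightarrow> ?e" by simp
  then have "Bseq ?om" by (rule convergent_imp_Bseq[OF convergentI])
  then obtain Q where Q: "0 < Q" "\<And>L. \<bar>?om L\<bar> \<le> Q" by (auto simp: Bseq_def)
  define D where "D = 48 * real k + 36 * Q"
  have D0: "0 < D" unfolding D_def using Q k1 by simp
  define K where "K = 1 + 5 * D / e"
  have K1: "1 \<le> K" unfolding K_def using D0 e by simp
  have DK: "D / K\<^sup>2 \<le> e / 5"
  proof -
    have "K * 1 \<le> K * K" using K1 by (intro mult_left_mono) auto
    then have "K \<le> K\<^sup>2" by (simp add: power2_eq_square)
    moreover have "D / (e / 5) \<le> K"
    proof -
      have q: "D / (e / 5) = 5 * D / e" by (simp add: mult.commute)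
      show ?thesis unfolding q K_def by simp
    qed
    ultimately have "D / (e / 5) \<le> K\<^sup>2" by linarith
    then show ?thesis using e K1 by (simp add: field_simps)
  qed
  define \<epsilon> where "\<epsilon> = min 1 (e / (5 * (4 + 2 * Q)))"
  have \<epsilon>: "0 < \<epsilon>" "\<epsilon> \<le> 1" unfolding \<epsilon>_def using e Q by auto
  have \<epsilon>Q: "\<epsilon> * (4 + 2 * Q) \<le> e / 5"
  proof -
    have "\<epsilon> * (4 + 2 * Q) \<le> e / (5 * (4 + 2 * Q)) * (4 + 2 * Q)" unfolding \<epsilon>_def using Q by (intro mult_right_mono) auto
    also have "\<dots> = e / 5"
    proof -
      have "e / (5 * t) * t = e / 5" if "t \<noteq> 0" for t using that by simp
      then show ?thesis using Q by (metis add_pos_pos less_irrefl mult_pos_pos zero_less_numeral)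
    qed
    finally show ?thesis .
  qed
  let ?c = "1152 * (real k)\<^sup>2 * C / (1 - b) * K"
  have "(\<lambda>L. ?c * b ^ L) \<longlonglongrightarrow> ?c * 0" using b by (intro tendsto_mult tendsto_const LIMSEQ_power_zero) auto
  then have "\<forall>\<^sub>F L in sequentially. ?c * b ^ L < e / 5" using e by (intro order_tendstoD(2)) auto
  moreover have "\<forall>\<^sub>F L in sequentially. dist (?om L) ?e < e / 5" using om e by (intro tendstoD) auto
  ultimately have "\<forall>\<^sub>F L in sequentially. ?c * b ^ L < e / 5 \<and> dist (?om L) ?e < e / 5" by (rule eventually_conj)
  then obtain L where L: "?c * b ^ L < e / 5" "dist (?om L) ?e < e / 5"
    using eventually_happens'[OF sequentially_bot] by blast
  show "\<forall>\<^sub>F j in sequentially. dist (\<integral>x. st.overshoot j x \<partial>std_seq) ?e < e"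
    using overshoot_window[OF K1 \<epsilon> b(3,4,1,2), of L]
  proof eventually_elim
    case (elim j)
    have "?om L * (36 / K\<^sup>2 + 2 * \<epsilon>) \<le> Q * (36 / K\<^sup>2 + 2 * \<epsilon>)"
      by (rule mult_right_mono[OF order_trans[OF abs_ge_self Q(2)]]) (use \<epsilon> in simp)
    moreover have "48 * real k / K\<^sup>2 + 4 * \<epsilon> + Q * (36 / K\<^sup>2 + 2 * \<epsilon>) = D / K\<^sup>2 + \<epsilon> * (4 + 2 * Q)"
      unfolding D_def by (simp add: add_divide_distrib distrib_left distrib_right)
    ultimately show ?case using elim DK \<epsilon>Q L e unfolding dist_real_def by linarith
  qed
qed

end

section \<open>The final sample size and the loss\<close>

text \<open>One more than the largest integer strictly below u is the ceiling of u.\<close>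

definition final_size :: "nat \<Rightarrow> real \<Rightarrow> nat \<Rightarrow> nat" where
  "final_size k \<rho> t = nat \<lceil>(real (k * t) + 1) / \<rho>\<rceil>"

lemma final_size_bounds:
  assumes "0 < \<rho>"
  shows "(real (k * t) + 1) / \<rho> \<le> real (final_size k \<rho> t)" "real (final_size k \<rho> t) \<le> (real (k * t) + 1) / \<rho> + 1"
proof -
  have "0 < real (k * t) + 1" using of_nat_0_le_iff[of "k * t", where 'a = real] by linarith
  then have "0 < (real (k * t) + 1) / \<rho>" using assms by (rule divide_pos_pos)
  then have "real (final_size k \<rho> t) = of_int \<lceil>(real (k * t) + 1) / \<rho>\<rceil>"
    unfolding final_size_def by (simp add: of_nat_nat)
  then show "(real (k * t) + 1) / \<rho> \<le> real (final_size k \<rho> t)" "real (final_size k \<rho> t) \<le> (real (k * t) + 1) / \<rho> + 1"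
    by linarith+
qed

text \<open>Since \<rho> < 1, the final size exceeds the k t coordinates that decide stopping, so
  the Helmert coordinate of the final mean is not among them.\<close>

lemma final_size_ge: "0 < \<rho> \<Longrightarrow> \<rho> < 1 \<Longrightarrow> Suc (k * t) \<le> final_size k \<rho> t"
proof -
  assume \<rho>: "0 < \<rho>" "\<rho> < 1"
  have "(real (k * t) + 1) * \<rho> \<le> (real (k * t) + 1) * 1" using \<rho> by (intro mult_left_mono) auto
  then have "real (k * t) + 1 \<le> (real (k * t) + 1) / \<rho>" using \<rho> by (simp only: pos_le_divide_eq) simp
  also have "\<dots> \<le> real (final_size k \<rho> t)" by (rule final_size_bounds[OF \<rho>(1)])
  finally show ?thesis by linarith
qed

locale regime_final = overshoot_regime k p B h m C dens
  for k p :: nat and B :: real and h :: "nat \<Rightarrow> real" and m :: "nat \<Rightarrow> nat"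
    and C :: real and dens :: "nat \<Rightarrow> real \<Rightarrow> real" +
  fixes \<rho> :: real
  assumes \<rho>: "0 < \<rho>" "\<rho> < 1"
begin

abbreviation N :: "nat \<Rightarrow> (nat \<Rightarrow> real) \<Rightarrow> real" where
  "N j x \<equiv> real (final_size k \<rho> (st.T j x))"

lemma N_bounds: "st.M j x / \<rho> \<le> N j x" "N j x \<le> st.M j x / \<rho> + 1"
  using final_size_bounds[OF \<rho>(1)] by auto

lemma N_ge1: "1 \<le> N j x"
  using final_size_ge[OF \<rho>, of k "st.T j x"] by simp

text \<open>Here \<open>h j / \<rho>\<close> is n^*. Rounding up adds between 0 and 1, which is the
  gap between the two bounds on the mean sample size.\<close>

lemma N_delta: "delta j x / \<rho> \<le> N j x - h j / \<rho>" "N j x - h j / \<rho> \<le> delta j x / \<rho> + 1"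
  using N_bounds[of j x] by (simp_all add: diff_divide_distrib)

lemma measurable_N [measurable]: "N j \<in> borel_measurable std_seq"
  by measurable

lemma N_dev_le: "\<bar>N j x - h j / \<rho>\<bar> \<le> (1 / \<rho> + 1) * (st.M j x + h j)"
proof -
  have "\<bar>delta j x / \<rho>\<bar> \<le> (st.M j x + h j) / \<rho>" using delta_le[of j x] \<rho> by (simp add: divide_right_mono)
  then have "\<bar>N j x - h j / \<rho>\<bar> \<le> (st.M j x + h j) / \<rho> + (st.M j x + h j)"
    using N_delta[of j x] base_ge1[of j x] unfolding abs_le_iff by linarith
  also have "\<dots> = (1 / \<rho> + 1) * (st.M j x + h j)" by (simp add: distrib_right)
  finally show ?thesis .
qed

lemma good_N: assumes "good j" shows "integrable std_seq (N j)"
proof (rule good_integrable[OF assms, of 1 _ "2 * (1 / \<rho> + 1)"])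
  have "\<bar>N j x\<bar> \<le> 2 * (1 / \<rho> + 1) * (st.M j x + h j) ^ 1" for x
  proof -
    have "h j / \<rho> \<le> (1 / \<rho> + 1) * (st.M j x + h j)"
    proof -
      have "h j \<le> st.M j x + h j" by simp
      then have "h j / \<rho> \<le> (st.M j x + h j) / \<rho>" using \<rho> by (intro divide_right_mono) auto
      then show ?thesis using base_ge1[of j x] by (simp add: distrib_right)
    qed
    moreover have "\<bar>n\<bar> \<le> 2 * P" if "a \<le> P" "\<bar>n - a\<bar> \<le> P" "1 \<le> n" for n a P :: real using that by linarith
    ultimately show ?thesis using N_dev_le[of j x] N_ge1[of j x] unfolding power_one_right mult.assoc[of 2] by blast
  qed
  then show "AE x in std_seq. \<bar>N j x\<bar> \<le> 2 * (1 / \<rho> + 1) * (st.M j x + h j) ^ 1" by simp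
qed auto

lemma N_ratio_limit: "(\<lambda>j. \<integral>x. N j x / (h j / \<rho>) \<partial>std_seq) \<longlonglongrightarrow> 1"
proof -
  have "(\<lambda>j. (\<integral>x. st.M j x \<partial>std_seq) / h j + \<rho> / h j) \<longlonglongrightarrow> 1 + 0"
    by (intro tendsto_add mean_M inverse_h)
  then have u: "(\<lambda>j. (\<integral>x. st.M j x \<partial>std_seq) / h j + \<rho> / h j) \<longlonglongrightarrow> 1" by simp
  have ev: "\<forall>\<^sub>F j in sequentially. (\<integral>x. st.M j x \<partial>std_seq) / h j \<le> (\<integral>x. N j x / (h j / \<rho>) \<partial>std_seq)
      \<and> (\<integral>x. N j x / (h j / \<rho>) \<partial>std_seq) \<le> (\<integral>x. st.M j x \<partial>std_seq) / h j + \<rho> / h j"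
    using good_eventually
  proof eventually_elim
    case (elim j)
    have h0: "0 < h j" by (rule h_gt0)
    have iN: "integrable std_seq (N j)" by (rule good_N[OF elim])
    have iM: "integrable std_seq (st.M j)"
      by (rule good_integrable[OF elim, of 1 _ 1]) (use h0 in auto)
    have le: "st.M j x / h j \<le> N j x / (h j / \<rho>)" "N j x / (h j / \<rho>) \<le> st.M j x / h j + \<rho> / h j" for x
    proof -
      have "st.M j x / \<rho> / (h j / \<rho>) \<le> N j x / (h j / \<rho>)" using N_bounds[of j x] h0 \<rho> by (intro divide_right_mono) auto
      then show "st.M j x / h j \<le> N j x / (h j / \<rho>)" using \<rho> by simp
      have "N j x / (h j / \<rho>) \<le> (st.M j x / \<rho> + 1) / (h j / \<rho>)" using N_bounds[of j x] h0 \<rho> by (intro divide_right_mono) auto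
      moreover have "(a / \<rho> + 1) / (h j / \<rho>) = a / h j + \<rho> / h j" for a
        using \<rho> by (simp add: add_divide_distrib distrib_right)
      ultimately show "N j x / (h j / \<rho>) \<le> st.M j x / h j + \<rho> / h j" by (simp only:)
    qed
    have "(\<integral>x. st.M j x / h j \<partial>std_seq) \<le> (\<integral>x. N j x / (h j / \<rho>) \<partial>std_seq)"
      by (rule integral_mono) (use iM iN le in auto)
    moreover have "(\<integral>x. N j x / (h j / \<rho>) \<partial>std_seq) \<le> (\<integral>x. st.M j x / h j + \<rho> / h j \<partial>std_seq)"
      by (rule integral_mono) (use iM iN le in auto)
    moreover have "(\<integral>x. st.M j x / h j + \<rho> / h j \<partial>std_seq) = (\<integral>x. st.M j x / h j \<partial>std_seq) + \<rho> / h j"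
      using iM by (subst Bochner_Integration.integral_add) (auto simp: std_seq.prob_space[simplified])
    moreover have "(\<integral>x. st.M j x / h j \<partial>std_seq) = (\<integral>x. st.M j x \<partial>std_seq) / h j" by (rule integral_divide_zero)
    ultimately show ?case by simp
  qed
  show ?thesis
    by (rule tendsto_sandwich[OF _ _ mean_M u]) (use ev in \<open>auto elim: eventually_mono\<close>)
qed

text \<open>Inserting the overshoot limit k + 1/2 - S for e into (e - 3/2) / 2 gives (k - 1) / 2 - S
  / 2.\<close>

lemma eta1_limit: "(\<lambda>j. \<integral>x. delta j x \<partial>std_seq) \<longlonglongrightarrow> eta1 k"
proof -
  have eq: "(real k + 1 / 2 - S - 3 / 2) / 2 = (real k - 1) / 2 - 1 / 2 * S" for S by (simp add: field_simps)
  show ?thesis using delta_mean_limit[OF overshoot_limit] unfolding eta1_def eq .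
qed

lemma N_mean_bounds:
  "\<forall>\<^sub>F j in sequentially. (\<integral>x. delta j x \<partial>std_seq) / \<rho> \<le> (\<integral>x. N j x - h j / \<rho> \<partial>std_seq)
    \<and> (\<integral>x. N j x - h j / \<rho> \<partial>std_seq) \<le> (\<integral>x. delta j x \<partial>std_seq) / \<rho> + 1"
  using good_eventually
proof eventually_elim
  case (elim j)
  have iN: "integrable std_seq (\<lambda>x. N j x - h j / \<rho>)" using good_N[OF elim] by simp
  have iD: "integrable std_seq (delta j)" using delta_power_moment[OF elim, of 1] by simp
  have "(\<integral>x. delta j x / \<rho> \<partial>std_seq) \<le> (\<integral>x. N j x - h j / \<rho> \<partial>std_seq)"
    by (rule integral_mono[OF integrable_divide[OF iD] iN N_delta(1)])
  moreover have "(\<integral>x. N j x - h j / \<rho> \<partial>std_seq) \<le> (\<integral>x. delta j x / \<rho> + 1 \<partial>std_seq)"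
    by (rule integral_mono[OF iN _ N_delta(2)]) (use integrable_divide[OF iD, of \<rho>] in simp)
  moreover have "(\<integral>x. delta j x / \<rho> + 1 \<partial>std_seq) = (\<integral>x. delta j x / \<rho> \<partial>std_seq) + 1"
    using integrable_divide[OF iD, of \<rho>] by (subst Bochner_Integration.integral_add) (auto simp: std_seq.prob_space[simplified])
  moreover have "(\<integral>x. delta j x / \<rho> \<partial>std_seq) = (\<integral>x. delta j x \<partial>std_seq) / \<rho>" by (rule integral_divide_zero)
  ultimately show ?case by simp
qed

section \<open>The loss caused by the random sample size\<close>

definition loss :: "nat \<Rightarrow> (nat \<Rightarrow> real) \<Rightarrow> real" where
  "loss j x = (N j x - h j / \<rho>)\<^sup>2 / N j x"

lemma measurable_loss [measurable]: "loss j \<in> borel_measurable std_seq"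
  unfolding loss_def[abs_def] by measurable

lemma loss_nonneg: "0 \<le> loss j x" unfolding loss_def by simp

lemma loss_le: "loss j x \<le> (1 / \<rho> + 1)\<^sup>2 * (st.M j x + h j)\<^sup>2"
proof -
  have "loss j x \<le> (N j x - h j / \<rho>)\<^sup>2 / 1" unfolding loss_def using N_ge1[of j x] by (intro divide_left_mono) auto
  also have "\<dots> = \<bar>N j x - h j / \<rho>\<bar>\<^sup>2" by simp
  also have "\<dots> \<le> ((1 / \<rho> + 1) * (st.M j x + h j))\<^sup>2" by (rule power_mono[OF N_dev_le]) simp
  finally show ?thesis by (simp only: power_mult_distrib)
qed

lemma good_loss: "good j \<Longrightarrow> integrable std_seq (loss j)"
  by (rule good_integrable[of j 2 _ "(1 / \<rho> + 1)\<^sup>2"]) (use loss_le loss_nonneg in \<open>auto simp: abs_of_nonneg\<close>)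

text \<open>Write N - n^* = \<open>delta\<close> / \<rho> + \<theta> with \<theta> between 0 and 1.
  Near \<open>h\<close> the denominator N is close to h / \<rho>, so the loss is about the square of
  \<open>delta\<close> over \<rho> h; the rounding \<theta> disappears after division by
  \<open>h\<close>.\<close>

lemma loss_sandwich:
  assumes \<delta>: "0 < \<delta>" "\<delta> \<le> 1 / 6"
  shows "\<forall>\<^sub>F j in sequentially.
    (\<integral>x. loss j x \<partial>std_seq) \<le> ((1 + \<delta>) * (\<integral>x. (delta j x)\<^sup>2 \<partial>std_seq) / \<rho>\<^sup>2 + (1 + 1 / \<delta>)) / ((1 - 2 * \<delta>) * (h j / \<rho>))
        + (1 / \<rho> + 1)\<^sup>2 * (\<integral>x. (st.M j x + h j) ^ 2 * off \<delta> j x \<partial>std_seq) \<and>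
    (\<integral>x. (delta j x)\<^sup>2 \<partial>std_seq) / \<rho>\<^sup>2
      \<le> (1 + \<delta>) * ((1 + 2 * \<delta>) * (h j / \<rho>)) * (\<integral>x. loss j x \<partial>std_seq) + (1 + 1 / \<delta>)
        + (\<integral>x. (st.M j x + h j) ^ 2 * off \<delta> j x \<partial>std_seq) / \<rho>\<^sup>2"
  using good_eventually h_large[of "1 / \<delta>"]
proof eventually_elim
  case (elim j)
  let ?O = "\<lambda>x. (st.M j x + h j) ^ 2 * off \<delta> j x" and ?n = "h j / \<rho>"
  have h0: "0 < h j" by (rule h_gt0)
  have n0: "0 < ?n" using h0 \<rho> by simp
  have d1: "1 \<le> \<delta> * ?n"
  proof -
    have "1 \<le> \<delta> * h j" using elim(2) \<delta> by (simp add: field_simps)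
    also have "\<delta> * h j * \<rho> \<le> \<delta> * h j * 1" using \<delta> h0 \<rho> by (intro mult_left_mono) auto
    then have "\<delta> * h j \<le> \<delta> * h j / \<rho>" using \<rho> by (simp only: pos_le_divide_eq mult_1_right)
    finally show ?thesis by simp
  qed
  have iD: "integrable std_seq (\<lambda>x. (delta j x)\<^sup>2)" using delta_power_moment[OF elim(1), of 2] by simp
  have iO: "integrable std_seq ?O" using good_off[OF elim(1), of 2] by simp
  have iL: "integrable std_seq (loss j)" by (rule good_loss[OF elim(1)])
  have theta: "\<exists>\<theta>. 0 \<le> \<theta> \<and> \<theta> \<le> 1 \<and> N j x - ?n = delta j x / \<rho> + \<theta>" for x
    using N_delta[of j x] by (intro exI[of _ "N j x - ?n - delta j x / \<rho>"]) auto
  have sq: "(N j x - ?n)\<^sup>2 \<le> (1 + \<delta>) * (delta j x)\<^sup>2 / \<rho>\<^sup>2 + (1 + 1 / \<delta>)"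
    "(delta j x)\<^sup>2 / \<rho>\<^sup>2 \<le> (1 + \<delta>) * (N j x - ?n)\<^sup>2 + (1 + 1 / \<delta>)" for x
  proof -
    obtain \<theta> where \<theta>: "0 \<le> \<theta>" "\<theta> \<le> 1" "N j x - ?n = delta j x / \<rho> + \<theta>" using theta by blast
    have "\<theta>\<^sup>2 \<le> 1" using \<theta> by (intro power_le_one)
    then have t: "(1 + 1 / \<delta>) * \<theta>\<^sup>2 \<le> (1 + 1 / \<delta>) * 1" using \<delta> by (intro mult_left_mono) auto
    have "(N j x - ?n)\<^sup>2 \<le> (1 + \<delta>) * (delta j x / \<rho>)\<^sup>2 + (1 + 1 / \<delta>) * \<theta>\<^sup>2"
      unfolding \<theta>(3) by (rule square_add_le[OF \<delta>(1)])
    then show "(N j x - ?n)\<^sup>2 \<le> (1 + \<delta>) * (delta j x)\<^sup>2 / \<rho>\<^sup>2 + (1 + 1 / \<delta>)"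
      using t by (simp add: power_divide)
    have "(delta j x / \<rho>)\<^sup>2 = ((N j x - ?n) + - \<theta>)\<^sup>2" unfolding \<theta>(3) by simp
    also have "\<dots> \<le> (1 + \<delta>) * (N j x - ?n)\<^sup>2 + (1 + 1 / \<delta>) * (- \<theta>)\<^sup>2"
      by (rule square_add_le[OF \<delta>(1)])
    finally show "(delta j x)\<^sup>2 / \<rho>\<^sup>2 \<le> (1 + \<delta>) * (N j x - ?n)\<^sup>2 + (1 + 1 / \<delta>)"
      using t by (simp add: power_divide)
  qed
  have Nn: "(1 - 2 * \<delta>) * ?n \<le> N j x" "N j x \<le> (1 + 2 * \<delta>) * ?n" if "\<bar>delta j x\<bar> \<le> \<delta> * h j" for x
  proof -
    have "\<bar>delta j x / \<rho>\<bar> \<le> \<delta> * h j / \<rho>" using that \<rho> by (simp add: divide_right_mono)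
    then have a: "\<bar>delta j x / \<rho>\<bar> \<le> \<delta> * ?n" by simp
    have b: "0 \<le> \<delta> * ?n" by (rule less_imp_le[OF mult_pos_pos[OF \<delta>(1) n0]])
    have l: "(1 - 2 * \<delta>) * ?n = ?n - 2 * (\<delta> * ?n)" "(1 + 2 * \<delta>) * ?n = ?n + 2 * (\<delta> * ?n)" by (simp_all add: algebra_simps)
    show "(1 - 2 * \<delta>) * ?n \<le> N j x" "N j x \<le> (1 + 2 * \<delta>) * ?n"
      unfolding l using a b d1 N_delta[of j x] unfolding abs_le_iff by linarith+
  qed
  let ?u = "\<lambda>x. ((1 + \<delta>) * (delta j x)\<^sup>2 / \<rho>\<^sup>2 + (1 + 1 / \<delta>)) / ((1 - 2 * \<delta>) * ?n)"
  have u0: "0 \<le> ?u x" for x using \<delta> h0 \<rho> by (intro divide_nonneg_nonneg add_nonneg_nonneg mult_nonneg_nonneg) auto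
  have up: "loss j x \<le> ?u x + (1 / \<rho> + 1)\<^sup>2 * ?O x" for x
    using off_cases[of \<delta> j x]
  proof
    assume *: "off \<delta> j x = 0 \<and> \<bar>delta j x\<bar> \<le> \<delta> * h j"
    have "loss j x \<le> ((1 + \<delta>) * (delta j x)\<^sup>2 / \<rho>\<^sup>2 + (1 + 1 / \<delta>)) / ((1 - 2 * \<delta>) * ?n)"
      unfolding loss_def
    proof (rule frac_le[OF _ sq(1)])
      show "0 \<le> (1 + \<delta>) * (delta j x)\<^sup>2 / \<rho>\<^sup>2 + (1 + 1 / \<delta>)"
        using \<delta> by (intro add_nonneg_nonneg divide_nonneg_nonneg mult_nonneg_nonneg) auto
      show "0 < (1 - 2 * \<delta>) * ?n" by (rule mult_pos_pos[OF _ n0]) (use \<delta> in simp)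
      show "(1 - 2 * \<delta>) * ?n \<le> N j x" using Nn(1) * by blast
    qed
    then show ?thesis using * by simp
  next
    assume "off \<delta> j x = 1"
    then show ?thesis using loss_le[of j x] u0[of x] by simp
  qed
  have lw: "(delta j x)\<^sup>2 / \<rho>\<^sup>2 \<le> (1 + \<delta>) * ((1 + 2 * \<delta>) * ?n) * loss j x + (1 + 1 / \<delta>) + ?O x / \<rho>\<^sup>2" for x
    using off_cases[of \<delta> j x]
  proof
    assume *: "off \<delta> j x = 0 \<and> \<bar>delta j x\<bar> \<le> \<delta> * h j"
    have "(N j x - ?n)\<^sup>2 = N j x * loss j x" unfolding loss_def using N_ge1[of j x] by simp
    also have "\<dots> \<le> (1 + 2 * \<delta>) * ?n * loss j x" using Nn(2) * loss_nonneg by (intro mult_right_mono) auto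
    finally have "(1 + \<delta>) * (N j x - ?n)\<^sup>2 \<le> (1 + \<delta>) * ((1 + 2 * \<delta>) * ?n * loss j x)" using \<delta> by (intro mult_left_mono) auto
    then show ?thesis using sq(2)[of x] * by (simp add: mult.assoc)
  next
    assume *: "off \<delta> j x = 1"
    have "(delta j x)\<^sup>2 \<le> ?O x" using * power_mono[OF delta_le[of j x], of 2] by simp
    then have "(delta j x)\<^sup>2 / \<rho>\<^sup>2 \<le> ?O x / \<rho>\<^sup>2" by (intro divide_right_mono) auto
    moreover have "0 \<le> (1 + \<delta>) * ((1 + 2 * \<delta>) * ?n) * loss j x" using \<delta> n0 loss_nonneg[of j x] by (intro mult_nonneg_nonneg) auto
    moreover have "0 \<le> 1 + 1 / \<delta>" using \<delta> by simp
    ultimately show ?thesis by linarith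
  qed
  have iu: "integrable std_seq ?u" using iD by simp
  have "(\<integral>x. loss j x \<partial>std_seq) \<le> (\<integral>x. ?u x + (1 / \<rho> + 1)\<^sup>2 * ?O x \<partial>std_seq)"
    by (rule integral_mono[OF iL _ up]) (use iu iO in auto)
  also have "\<dots> = (\<integral>x. ?u x \<partial>std_seq) + (1 / \<rho> + 1)\<^sup>2 * (\<integral>x. ?O x \<partial>std_seq)"
    using iu iO by (subst Bochner_Integration.integral_add) auto
  also have "(\<integral>x. ?u x \<partial>std_seq) = ((1 + \<delta>) * (\<integral>x. (delta j x)\<^sup>2 \<partial>std_seq) / \<rho>\<^sup>2 + (1 + 1 / \<delta>)) / ((1 - 2 * \<delta>) * ?n)"
    using iD by (simp add: std_seq.prob_space[simplified])
  finally have 1: "(\<integral>x. loss j x \<partial>std_seq) \<le> ((1 + \<delta>) * (\<integral>x. (delta j x)\<^sup>2 \<partial>std_seq) / \<rho>\<^sup>2 + (1 + 1 / \<delta>)) / ((1 - 2 * \<delta>) * ?n)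
    + (1 / \<rho> + 1)\<^sup>2 * (\<integral>x. ?O x \<partial>std_seq)" .
  have "(\<integral>x. (delta j x)\<^sup>2 / \<rho>\<^sup>2 \<partial>std_seq) \<le> (\<integral>x. (1 + \<delta>) * ((1 + 2 * \<delta>) * ?n) * loss j x + (1 + 1 / \<delta>) + ?O x / \<rho>\<^sup>2 \<partial>std_seq)"
    by (rule integral_mono[OF _ _ lw]) (use iD iL iO in auto)
  also have "\<dots> = (1 + \<delta>) * ((1 + 2 * \<delta>) * ?n) * (\<integral>x. loss j x \<partial>std_seq) + (1 + 1 / \<delta>) + (\<integral>x. ?O x \<partial>std_seq) / \<rho>\<^sup>2"
    using iL iO by (simp add: std_seq.prob_space[simplified])
  finally have 2: "(\<integral>x. (delta j x)\<^sup>2 \<partial>std_seq) / \<rho>\<^sup>2 \<le> (1 + \<delta>) * ((1 + 2 * \<delta>) * ?n) * (\<integral>x. loss j x \<partial>std_seq) + (1 + 1 / \<delta>) + (\<integral>x. ?O x \<partial>std_seq) / \<rho>\<^sup>2"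
    by simp
  show ?case using 1 2 by blast
qed

lemma loss_bounds:
  assumes \<delta>: "0 < \<delta>" "\<delta> \<le> 1 / 6"
  shows "\<forall>\<^sub>F j in sequentially. (\<integral>x. loss j x \<partial>std_seq) \<le> (1 + \<delta>) / (1 - 2 * \<delta>) * (1 / (2 * \<rho>)) + \<delta>
    \<and> (1 / (2 * \<rho>) - \<delta>) / ((1 + \<delta>) * (1 + 2 * \<delta>)) \<le> (\<integral>x. loss j x \<partial>std_seq)"
proof -
  let ?a = "\<lambda>j. (\<integral>x. (delta j x)\<^sup>2 \<partial>std_seq) / h j" and ?o = "\<lambda>j. \<integral>x. (st.M j x + h j) ^ 2 * off \<delta> j x \<partial>std_seq"
  have o: "?o \<longlonglongrightarrow> 0" using \<delta> by (intro off_integral) auto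
  have "(\<lambda>j. (1 + \<delta>) / (1 - 2 * \<delta>) * (?a j / \<rho>) + (1 + 1 / \<delta>) * \<rho> / (1 - 2 * \<delta>) / h j + (1 / \<rho> + 1)\<^sup>2 * ?o j)
      \<longlonglongrightarrow> (1 + \<delta>) / (1 - 2 * \<delta>) * (1 / 2 / \<rho>) + 0 + (1 / \<rho> + 1)\<^sup>2 * 0"
    using \<rho> by (intro tendsto_add tendsto_mult tendsto_const tendsto_divide delta_square_limit inverse_h o) auto
  then have e1: "\<forall>\<^sub>F j in sequentially. (1 + \<delta>) / (1 - 2 * \<delta>) * (?a j / \<rho>) + (1 + 1 / \<delta>) * \<rho> / (1 - 2 * \<delta>) / h j + (1 / \<rho> + 1)\<^sup>2 * ?o j
      < (1 + \<delta>) / (1 - 2 * \<delta>) * (1 / (2 * \<rho>)) + \<delta>"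
    by (rule order_tendstoD) (use \<delta> in simp)
  have "(\<lambda>j. ?a j / \<rho> - (1 + 1 / \<delta>) * \<rho> / h j - 1 / \<rho> / h j * ?o j) \<longlonglongrightarrow> 1 / 2 / \<rho> - 0 - 0 * 0"
    using \<rho> by (intro tendsto_diff tendsto_mult tendsto_const tendsto_divide delta_square_limit inverse_h o) auto
  then have e2: "\<forall>\<^sub>F j in sequentially. 1 / (2 * \<rho>) - \<delta> < ?a j / \<rho> - (1 + 1 / \<delta>) * \<rho> / h j - 1 / \<rho> / h j * ?o j"
    by (rule order_tendstoD) (use \<delta> in simp)
  show ?thesis
    using e1 e2 loss_sandwich[OF \<delta>]
  proof eventually_elim
    case (elim j)
    define D X O' where "D = (\<integral>x. (delta j x)\<^sup>2 \<partial>std_seq)" "X = (\<integral>x. loss j x \<partial>std_seq)" "O' = ?o j"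
    note defs = this[symmetric]
    have h0: "0 < h j" by (rule h_gt0)
    have eq1: "((1 + \<delta>) * D / \<rho>\<^sup>2 + (1 + 1 / \<delta>)) / ((1 - 2 * \<delta>) * (h j / \<rho>))
        = (1 + \<delta>) / (1 - 2 * \<delta>) * (D / h j / \<rho>) + (1 + 1 / \<delta>) * \<rho> / (1 - 2 * \<delta>) / h j"
    proof -
      have "(a * D / \<rho>\<^sup>2 + c) / (q * (h j / \<rho>)) = a / q * (D / h j / \<rho>) + c * \<rho> / q / h j" for a c q
        using \<rho> h0 by (simp add: add_divide_distrib distrib_right power2_eq_square)
      then show ?thesis .
    qed
    have A: "X \<le> (1 + \<delta>) / (1 - 2 * \<delta>) * (1 / (2 * \<rho>)) + \<delta>"
      using elim(1,3) unfolding defs eq1 by linarith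
    have pos: "0 < (1 + \<delta>) * (1 + 2 * \<delta>)" using \<delta> by (intro mult_pos_pos) auto
    have "D / \<rho>\<^sup>2 * (\<rho> / h j) \<le> ((1 + \<delta>) * ((1 + 2 * \<delta>) * (h j / \<rho>)) * X + (1 + 1 / \<delta>) + O' / \<rho>\<^sup>2) * (\<rho> / h j)"
      using elim(3) \<rho> h0 unfolding defs by (intro mult_right_mono) auto
    also have "\<dots> = (1 + \<delta>) * (1 + 2 * \<delta>) * X + (1 + 1 / \<delta>) * \<rho> / h j + 1 / \<rho> / h j * O'"
    proof -
      have "(a * (b * (h j / \<rho>)) * X + c + O' / \<rho>\<^sup>2) * (\<rho> / h j) = a * b * X + c * \<rho> / h j + 1 / \<rho> / h j * O'" for a b c
        using \<rho> h0 by (simp add: distrib_right add_divide_distrib power2_eq_square)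
      then show ?thesis .
    qed
    finally have "D / \<rho>\<^sup>2 * (\<rho> / h j) \<le> (1 + \<delta>) * (1 + 2 * \<delta>) * X + (1 + 1 / \<delta>) * \<rho> / h j + 1 / \<rho> / h j * O'" .
    moreover have "D / \<rho>\<^sup>2 * (\<rho> / h j) = D / h j / \<rho>" using \<rho> by (simp add: power2_eq_square)
    ultimately have "1 / (2 * \<rho>) - \<delta> \<le> (1 + \<delta>) * (1 + 2 * \<delta>) * X" using elim(2) unfolding defs by linarith
    then have Bd: "(1 / (2 * \<rho>) - \<delta>) / ((1 + \<delta>) * (1 + 2 * \<delta>)) \<le> X"
      using pos by (subst pos_divide_le_eq) (auto simp: mult.commute)
    show ?case using A Bd unfolding defs by blast
  qed
qed

lemma loss_limit: "(\<lambda>j. \<integral>x. loss j x \<partial>std_seq) \<longlonglongrightarrow> 1 / (2 * \<rho>)"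
proof (rule tendstoI)
  fix e :: real assume e: "0 < e"
  have u: "((\<lambda>\<delta>::real. (1 + \<delta>) / (1 - 2 * \<delta>) * (1 / (2 * \<rho>)) + \<delta>) \<longlongrightarrow> (1 + 0) / (1 - 2 * 0) * (1 / (2 * \<rho>)) + 0) (at_right 0)"
    by (intro tendsto_intros) auto
  have l: "((\<lambda>\<delta>::real. (1 / (2 * \<rho>) - \<delta>) / ((1 + \<delta>) * (1 + 2 * \<delta>))) \<longlongrightarrow> (1 / (2 * \<rho>) - 0) / ((1 + 0) * (1 + 2 * 0))) (at_right 0)"
    by (intro tendsto_intros) auto
  have "\<forall>\<^sub>F \<delta> in at_right 0. (1 + \<delta>) / (1 - 2 * \<delta>) * (1 / (2 * \<rho>)) + \<delta> < 1 / (2 * \<rho>) + e"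
    using order_tendstoD(2)[OF u, of "1 / (2 * \<rho>) + e"] e by simp
  moreover have "\<forall>\<^sub>F \<delta> in at_right 0. 1 / (2 * \<rho>) - e < (1 / (2 * \<rho>) - \<delta>) / ((1 + \<delta>) * (1 + 2 * \<delta>))"
    using order_tendstoD(1)[OF l, of "1 / (2 * \<rho>) - e"] e by simp
  moreover have "\<forall>\<^sub>F \<delta> in at_right 0. \<delta> < (1 / 6 :: real)" by (rule order_tendstoD) (auto simp: tendsto_ident_at)
  moreover have "\<forall>\<^sub>F \<delta> in at_right 0. (0 :: real) < \<delta>" by (simp add: eventually_at_right_less)
  ultimately have "\<forall>\<^sub>F \<delta> in at_right 0. (0 :: real) < \<delta> \<and> \<delta> < 1 / 6
      \<and> (1 + \<delta>) / (1 - 2 * \<delta>) * (1 / (2 * \<rho>)) + \<delta> < 1 / (2 * \<rho>) + e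
      \<and> 1 / (2 * \<rho>) - e < (1 / (2 * \<rho>) - \<delta>) / ((1 + \<delta>) * (1 + 2 * \<delta>))"
    by eventually_elim auto
  then obtain \<delta> :: real where \<delta>: "0 < \<delta>" "\<delta> < 1 / 6" "(1 + \<delta>) / (1 - 2 * \<delta>) * (1 / (2 * \<rho>)) + \<delta> < 1 / (2 * \<rho>) + e"
    "1 / (2 * \<rho>) - e < (1 / (2 * \<rho>) - \<delta>) / ((1 + \<delta>) * (1 + 2 * \<delta>))"
    using eventually_happens'[OF trivial_limit_at_right_real] by blast
  show "\<forall>\<^sub>F j in sequentially. dist (\<integral>x. loss j x \<partial>std_seq) (1 / (2 * \<rho>)) < e"
    using loss_bounds[OF \<delta>(1) less_imp_le[OF \<delta>(2)]]
    by eventually_elim (use \<delta> in \<open>simp only: dist_real_def abs_less_iff; linarith\<close>)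
qed

end

section \<open>Reduction of the sequential procedure\<close>

text \<open>Unlike \<open>tau\<close>, this event involves finitely many coordinates only, so it can
  be evaluated on Helmert transforms of any sufficient length.\<close>

definition stops_at :: "nat \<Rightarrow> real \<Rightarrow> nat \<Rightarrow> nat \<Rightarrow> (nat \<Rightarrow> real) \<Rightarrow> bool" where
  "stops_at k h m t z \<longleftrightarrow> m \<le> t \<and> sumsq (k * t) z \<le> boundary k h t
     \<and> (\<forall>i\<in>{m..<t}. boundary k h i < sumsq (k * i) z)"

lemma measurable_stops_at [measurable]: "Measurable.pred std_seq (stops_at k h m t)"
  unfolding stops_at_def[abs_def] by measurable

lemma stops_at_cong:
  assumes "\<And>i. i \<le> t \<Longrightarrow> sumsq (k * i) z = sumsq (k * i) z'"
  shows "stops_at k h m t z \<longleftrightarrow> stops_at k h m t z'"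
  unfolding stops_at_def using assms by auto

lemma suminf_eq_single:
  fixes f :: "nat \<Rightarrow> ennreal"
  assumes "\<And>s. s \<noteq> t \<Longrightarrow> f s = 0" shows "(\<Sum>s. f s) = f t"
  using suminf_finite[of "{t}" f] assms by auto

context stopping
begin

lemma stops_at_imp: "stops_at k h m t z \<Longrightarrow> T z = t"
  unfolding tau_def by (rule Least_equality) (auto simp: stops_at_def not_less[symmetric])

lemma stops_at_tau: "stops z \<Longrightarrow> stops_at k h m (T z) z"
proof -
  assume z: "stops z"
  have "boundary k h i < sumsq (k * i) z" if i: "m \<le> i" "i < T z" for i
    using alive_iff[OF z, of i] i by (auto simp: alive_def)
  then show ?thesis using tau_stops[OF z] by (auto simp: stops_at_def)
qed

text \<open>Slicing by the value of the stopping time; almost surely exactly one slice contains the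
  point.\<close>

lemma nn_integral_stops_at:
  assumes "\<And>t. \<phi> t \<in> borel_measurable std_seq"
  shows "(\<integral>\<^sup>+z. \<phi> (T z) z \<partial>std_seq) = (\<Sum>t. \<integral>\<^sup>+z. \<phi> t z * indicator {z. stops_at k h m t z} z \<partial>std_seq)"
proof -
  note assms[measurable]
  have "(\<integral>\<^sup>+z. \<phi> (T z) z \<partial>std_seq) = (\<integral>\<^sup>+z. (\<Sum>t. \<phi> t z * indicator {z. stops_at k h m t z} z) \<partial>std_seq)"
  proof (rule nn_integral_cong_AE)
    show "AE z in std_seq. \<phi> (T z) z = (\<Sum>t. \<phi> t z * indicator {z. stops_at k h m t z} z)"
      using AE_stops
    proof (rule eventually_mono)
      fix z assume z: "stops z"
      show "\<phi> (T z) z = (\<Sum>t. \<phi> t z * indicator {z. stops_at k h m t z} z)"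
      proof (subst suminf_eq_single[of "T z"])
        show "\<phi> s z * indicator {z. stops_at k h m s z} z = 0" if "s \<noteq> T z" for s
          using stops_at_imp[of s z] that by (simp add: indicator_def) blast
        show "\<phi> (T z) z = \<phi> (T z) z * indicator {y. stops_at k h m (T z) y} z"
          using stops_at_tau[OF z] by simp
      qed
    qed
  qed
  also have "\<dots> = (\<Sum>t. \<integral>\<^sup>+z. \<phi> t z * indicator {z. stops_at k h m t z} z \<partial>std_seq)"
    by (rule nn_integral_suminf) (auto intro!: borel_measurable_times_ennreal borel_measurable_indicator sets_std_Collect)
  finally show ?thesis .
qed

end

section \<open>The procedure in Helmert coordinates\<close>

locale sequential_procedure =
  fixes \<mu> \<sigma> A c \<rho> :: real and k m :: nat
  assumes \<sigma>: "0 < \<sigma>" and A: "0 < A" and c: "0 < c" and \<rho>: "0 < \<rho>" "\<rho> < 1" and k: "1 \<le> k" and m: "1 \<le> m"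
begin

abbreviation h :: real where "h \<equiv> \<rho> * n_star \<sigma> A c"

lemma n_star_pos: "0 < n_star \<sigma> A c"
  using \<sigma> A c by (simp add: n_star_def)

sublocale stopping k m h
  by unfold_locales (use k n_star_pos \<rho> in auto)

abbreviation X :: "(nat \<Rightarrow> real) measure" where "X \<equiv> normal_seq_space \<mu> \<sigma>"

sublocale X: prob_space X
  by (rule prob_space_normal_seq[OF \<sigma>])

text \<open>The length \<open>d\<close> is a parameter because coordinate \<open>d\<close> holds the
  normalised sum after exactly \<open>d\<close> steps; every \<open>Z d\<close> has the law of
  \<open>std_seq\<close>.\<close>

definition Z :: "nat \<Rightarrow> (nat \<Rightarrow> real) \<Rightarrow> nat \<Rightarrow> real" where
  "Z d x = helmert d (standardize \<mu> \<sigma> x)"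

lemma measurable_Z: "Z d \<in> X \<rightarrow>\<^sub>M std_seq"
  unfolding Z_def[abs_def] by (rule measurable_compose[OF measurable_standardize measurable_helmert])

abbreviation stopped :: "nat \<Rightarrow> (nat \<Rightarrow> real) \<Rightarrow> bool" where
  "stopped t x \<equiv> stops_at k h m t (Z (k * t) x)"

text \<open>Coordinates below k t no longer change after k t steps, so any longer transform decides
  the event alike.\<close>

lemma stopped_iff: "k * t \<le> d \<Longrightarrow> stopped t x \<longleftrightarrow> stops_at k h m t (Z d x)"
  unfolding Z_def
  by (rule stops_at_cong) (rule sumsq_helmert_stable[symmetric], auto)

lemma stopped_unique:
  assumes "stopped t x" "stopped t' x" shows "t = t'"
proof -
  let ?d = "k * max t t'"
  have "stops_at k h m t (Z ?d x)" "stops_at k h m t' (Z ?d x)"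
    using assms stopped_iff[of t ?d x] stopped_iff[of t' ?d x] by auto
  then show ?thesis using stops_at_imp by metis
qed

lemma criterion:
  assumes "1 \<le> t"
  shows "\<rho> * sample_sd (Suc (k * t)) x * sqrt (A / c) \<le> real (Suc (k * t))
    \<longleftrightarrow> sumsq (k * t) (Z (k * t) x) \<le> boundary k h t"
proof -
  define n where "n = real (k * t)"
  have n: "0 < n" unfolding n_def using assms k by simp
  let ?S = "sumsq (k * t) (Z (k * t) x)"
  have h0: "0 < h" by (rule h_pos)
  have "\<rho> * sample_sd (Suc (k * t)) x * sqrt (A / c) = h * sqrt (?S / n)"
    unfolding sample_sd_standardize[OF \<sigma>, of "k * t" x \<mu>] n_star_def Z_def n_def by simp
  moreover have "h * sqrt (?S / n) \<le> n + 1 \<longleftrightarrow> ?S \<le> n * (n + 1)\<^sup>2 / h\<^sup>2"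
  proof -
    have "h * sqrt (?S / n) \<le> n + 1 \<longleftrightarrow> sqrt (?S / n) \<le> (n + 1) / h" using h0 by (simp add: pos_le_divide_eq mult.commute)
    also have "\<dots> \<longleftrightarrow> sqrt (?S / n) \<le> sqrt (((n + 1) / h)\<^sup>2)" using h0 n by (simp only: real_sqrt_abs) simp
    also have "\<dots> \<longleftrightarrow> ?S / n \<le> ((n + 1) / h)\<^sup>2" by (rule real_sqrt_le_iff)
    also have "\<dots> \<longleftrightarrow> ?S \<le> ((n + 1) / h)\<^sup>2 * n" using n by (simp only: pos_divide_le_eq)
    also have "((n + 1) / h)\<^sup>2 * n = n * (n + 1)\<^sup>2 / h\<^sup>2" by (simp add: power_divide)
    finally show ?thesis .
  qed
  moreover have "real (Suc (k * t)) = n + 1" by (simp add: n_def)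
  ultimately show ?thesis unfolding boundary_def n_def[symmetric] by (simp only:)
qed

lemma stop_T_eq:
  assumes "stopped t x" shows "stop_T (m * k + 1) k \<rho> A c x = t - m"
proof -
  have mt: "m \<le> t" using assms by (simp add: stops_at_def)
  have idx: "m * k + 1 + k * n = Suc (k * (m + n))" for n by (simp add: algebra_simps)
  have crit: "\<rho> * sample_sd (m * k + 1 + k * n) x * sqrt (A / c) \<le> real (m * k + 1 + k * n)
      \<longleftrightarrow> sumsq (k * (m + n)) (Z (k * (m + n)) x) \<le> boundary k h (m + n)" for n
    unfolding idx by (rule criterion) (use m in simp)
  show ?thesis unfolding stop_T_def crit
  proof (rule Least_equality)
    show "sumsq (k * (m + (t - m))) (Z (k * (m + (t - m))) x) \<le> boundary k h (m + (t - m))"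
      using assms mt by (simp add: stops_at_def)
    fix n assume n: "sumsq (k * (m + n)) (Z (k * (m + n)) x) \<le> boundary k h (m + n)"
    show "t - m \<le> n"
    proof (rule ccontr)
      assume "\<not> t - m \<le> n"
      then have i: "m \<le> m + n" "m + n < t" by auto
      then have "boundary k h (m + n) < sumsq (k * (m + n)) (Z (k * t) x)"
        using assms unfolding stops_at_def by auto
      also have "\<dots> = sumsq (k * (m + n)) (Z (k * (m + n)) x)"
        unfolding Z_def using i by (intro sumsq_helmert_stable mult_le_mono2) auto
      finally show False using n by simp
    qed
  qed
qed

lemma final_N_eq:
  assumes "stopped t x" shows "final_N (m * k + 1) k \<rho> A c x = final_size k \<rho> t"
proof -
  have mt: "m \<le> t" using assms by (simp add: stops_at_def)
  have "m * k + 1 + k * (t - m) = k * t + 1" using mt by (simp add: diff_mult_distrib2 mult.commute)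
  then show ?thesis unfolding final_N_def stop_T_eq[OF assms] strict_floor_def final_size_def by (simp add: add.commute)
qed

lemma sets_stopped: "{x. stopped t x} \<in> sets X"
proof -
  have "Z (k * t) -` {z. stops_at k h m t z} \<inter> space X \<in> sets X"
    by (rule measurable_sets[OF measurable_Z sets_std_Collect[OF measurable_stops_at]])
  then show ?thesis by (simp add: vimage_def)
qed

lemma nn_integral_Z:
  assumes "f \<in> borel_measurable std_seq"
  shows "(\<integral>\<^sup>+x. f (Z d x) \<partial>X) = (\<integral>\<^sup>+z. f z \<partial>std_seq)"
  unfolding Z_def by (rule nn_integral_helmert_standardize[OF \<sigma> assms])

lemma nn_integral_stopped:
  assumes "k * t \<le> d" "f \<in> borel_measurable std_seq"
  shows "(\<integral>\<^sup>+x. f (Z d x) * indicator {x. stopped t x} x \<partial>X)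
    = (\<integral>\<^sup>+z. f z * indicator {z. stops_at k h m t z} z \<partial>std_seq)"
proof -
  have "(\<lambda>z. f z * indicator {z. stops_at k h m t z} z) \<in> borel_measurable std_seq"
    using assms(2) by (intro borel_measurable_times_ennreal borel_measurable_indicator sets_std_Collect measurable_stops_at)
  from nn_integral_Z[OF this, of d] show ?thesis
    by (simp add: indicator_def stopped_iff[OF assms(1)])
qed

text \<open>The slices are disjoint and have the same probabilities as under \<open>std_seq\<close>,
  where they add up to 1.\<close>

lemma AE_stopped: "AE x in X. \<exists>t. stopped t x"
proof -
  have E: "emeasure X {x. stopped t x} = (\<integral>\<^sup>+z. indicator {z. stops_at k h m t z} z \<partial>std_seq)" for t
    using nn_integral_stopped[of t "k * t" "\<lambda>_. 1"] nn_integral_indicator[OF sets_stopped[of t]] by simp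
  have "emeasure X (\<Union>t. {x. stopped t x}) = (\<Sum>t. emeasure X {x. stopped t x})"
    by (rule suminf_emeasure[symmetric]) (use sets_stopped stopped_unique in \<open>auto simp: disjoint_family_on_def\<close>)
  also have "\<dots> = (\<integral>\<^sup>+z. 1 \<partial>std_seq)"
    unfolding E using nn_integral_stops_at[of "\<lambda>_ _. 1"] by simp
  also have "\<dots> = 1" using std_seq.emeasure_space_1 by simp
  finally have "X.prob (\<Union>t. {x. stopped t x}) = 1" by (simp add: X.emeasure_eq_measure)
  then have "AE x in X. x \<in> (\<Union>t. {x. stopped t x})"
    by (rule X.AE_prob_1)
  then show ?thesis by simp
qed

text \<open>Every slice may be read off a transform of its own length \<open>d t\<close>. This is
  what makes the error of the mean at the random N accessible, as it sits in a coordinate that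
  varies with the slice.\<close>

lemma nn_integral_procedure:
  assumes F: "\<And>t x. stopped t x \<Longrightarrow> F x = \<phi> t (Z (d t) x)" and d: "\<And>t. k * t \<le> d t"
    and \<phi>: "\<And>t. \<phi> t \<in> borel_measurable std_seq"
  shows "(\<integral>\<^sup>+x. F x \<partial>X) = (\<Sum>t. \<integral>\<^sup>+z. \<phi> t z * indicator {z. stops_at k h m t z} z \<partial>std_seq)"
proof -
  have "(\<integral>\<^sup>+x. F x \<partial>X) = (\<integral>\<^sup>+x. (\<Sum>t. \<phi> t (Z (d t) x) * indicator {x. stopped t x} x) \<partial>X)"
  proof (rule nn_integral_cong_AE)
    show "AE x in X. F x = (\<Sum>t. \<phi> t (Z (d t) x) * indicator {x. stopped t x} x)"
      using AE_stopped
    proof (rule eventually_mono)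
      fix x assume "\<exists>t. stopped t x"
      then obtain t where t: "stopped t x" by blast
      show "F x = (\<Sum>t. \<phi> t (Z (d t) x) * indicator {x. stopped t x} x)"
      proof (subst suminf_eq_single[of t])
        show "\<phi> s (Z (d s) x) * indicator {x. stopped s x} x = 0" if "s \<noteq> t" for s
          using stopped_unique[OF _ t, of s] that by (simp add: indicator_def) blast
        show "F x = \<phi> t (Z (d t) x) * indicator {y. stopped t y} x"
          using F[OF t] t by simp
      qed
    qed
  qed
  also have "\<dots> = (\<Sum>t. \<integral>\<^sup>+x. \<phi> t (Z (d t) x) * indicator {x. stopped t x} x \<partial>X)"
    by (rule nn_integral_suminf)
       (intro borel_measurable_times_ennreal borel_measurable_indicator sets_stopped measurable_compose[OF measurable_Z \<phi>])
  also have "\<dots> = (\<Sum>t. \<integral>\<^sup>+z. \<phi> t z * indicator {z. stops_at k h m t z} z \<partial>std_seq)"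
    by (intro suminf_cong nn_integral_stopped d \<phi>)
  finally show ?thesis .
qed

abbreviation N :: "(nat \<Rightarrow> real) \<Rightarrow> nat" where "N x \<equiv> final_N (m * k + 1) k \<rho> A c x"

abbreviation N' :: "(nat \<Rightarrow> real) \<Rightarrow> nat" where "N' z \<equiv> final_size k \<rho> (T z)"

lemma measurable_sample_mean [measurable]: "sample_mean n \<in> borel_measurable X"
  unfolding sample_mean_def[abs_def] by measurable

lemma measurable_sample_sd [measurable]: "sample_sd n \<in> borel_measurable X"
  unfolding sample_sd_def[abs_def] by measurable

lemma measurable_N [measurable]: "N \<in> X \<rightarrow>\<^sub>M count_space UNIV"
proof -
  have "stop_T (m * k + 1) k \<rho> A c \<in> X \<rightarrow>\<^sub>M count_space UNIV"
    unfolding stop_T_def[abs_def] by (rule measurable_Least) measurable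
  then show ?thesis unfolding final_N_def[abs_def] by (rule measurable_compose) simp
qed

lemma distr_N: "distr X (count_space UNIV) N = distr std_seq (count_space UNIV) N'"
proof (rule measure_eqI)
  fix E :: "nat set" assume "E \<in> sets (distr X (count_space UNIV) N)"
  have "emeasure (distr X (count_space UNIV) N) E = (\<integral>\<^sup>+x. indicator E (N x) \<partial>X)"
    using nn_integral_distr[OF measurable_N, of "indicator E"] by simp
  also have "\<dots> = (\<Sum>t. \<integral>\<^sup>+z. indicator E (final_size k \<rho> t) * indicator {z. stops_at k h m t z} z \<partial>std_seq)"
    by (rule nn_integral_procedure[of "\<lambda>x. indicator E (N x)" "\<lambda>t z. indicator E (final_size k \<rho> t)" "\<lambda>t. k * t"])
       (simp only: final_N_eq, simp_all)
  also have "\<dots> = (\<integral>\<^sup>+z. indicator E (N' z) \<partial>std_seq)"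
    by (rule nn_integral_stops_at[of "\<lambda>t z. indicator E (final_size k \<rho> t)", symmetric]) simp
  also have "\<dots> = emeasure (distr std_seq (count_space UNIV) N') E"
    using nn_integral_distr[of N' std_seq "count_space UNIV" "indicator E"] by simp
  finally show "emeasure (distr X (count_space UNIV) N) E = emeasure (distr std_seq (count_space UNIV) N') E" .
qed simp

lemma integral_N: "(\<integral>x. f (N x) \<partial>X) = (\<integral>z. f (N' z) \<partial>std_seq)" for f :: "nat \<Rightarrow> real"
proof -
  have "(\<integral>x. f (N x) \<partial>X) = (\<integral>n. f n \<partial>distr X (count_space UNIV) N)"
    by (rule integral_distr[symmetric, OF measurable_N]) simp
  also have "\<dots> = (\<integral>z. f (N' z) \<partial>std_seq)"
    unfolding distr_N by (rule integral_distr) auto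
  finally show ?thesis .
qed

text \<open>Coordinate \<open>d\<close> comes after those deciding the event, hence is independent
  of it, and its second moment is 1.\<close>

lemma nn_integral_square_split:
  assumes "k * t \<le> d" and a: "0 \<le> a"
  shows "(\<integral>\<^sup>+z. ennreal (a * (z d)\<^sup>2) * indicator {z. stops_at k h m t z} z \<partial>std_seq)
    = (\<integral>\<^sup>+z. ennreal a * indicator {z. stops_at k h m t z} z \<partial>std_seq)"
proof -
  let ?I = "indicator {z. stops_at k h m t z} :: (nat \<Rightarrow> real) \<Rightarrow> ennreal"
  have I: "?I \<in> borel_measurable std_seq"
    by (intro borel_measurable_indicator sets_std_Collect measurable_stops_at)
  have st: "?I (comb_seq d z y) = ?I z" for z y
  proof -
    have "stops_at k h m t (comb_seq d z y) \<longleftrightarrow> stops_at k h m t z"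
    proof (rule stops_at_cong)
      fix i assume "i \<le> t"
      then have "k * i \<le> d" using assms(1) mult_le_mono2[of i t k] by linarith
      then show "sumsq (k * i) (comb_seq d z y) = sumsq (k * i) z" by (rule sumsq_comb_seq_le)
    qed
    then show ?thesis by (simp add: indicator_def)
  qed
  have one: "(\<integral>\<^sup>+y. ennreal ((y 0)\<^sup>2) \<partial>std_seq) = 1"
    using nn_integral_eq_integral[OF integrable_std_power[of 0 2]] integral_std_square[of 0] by simp
  have "(\<integral>\<^sup>+z. ennreal (a * (z d)\<^sup>2) * ?I z \<partial>std_seq)
      = (\<integral>\<^sup>+z. \<integral>\<^sup>+y. ennreal (a * (comb_seq d z y d)\<^sup>2) * ?I (comb_seq d z y) \<partial>std_seq \<partial>std_seq)"
    by (rule nn_integral_std_split) (rule borel_measurable_times_ennreal[OF _ I], measurable)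
  also have "\<dots> = (\<integral>\<^sup>+z. \<integral>\<^sup>+y. (ennreal a * ?I z) * ennreal ((y 0)\<^sup>2) \<partial>std_seq \<partial>std_seq)"
    unfolding st by (intro nn_integral_cong) (simp add: comb_seq_def ennreal_mult[OF a] mult_ac)
  also have "\<dots> = (\<integral>\<^sup>+z. ennreal a * ?I z \<partial>std_seq)"
  proof (rule nn_integral_cong)
    fix z
    have "(\<integral>\<^sup>+y. (ennreal a * ?I z) * ennreal ((y 0)\<^sup>2) \<partial>std_seq) = (ennreal a * ?I z) * (\<integral>\<^sup>+y. ennreal ((y 0)\<^sup>2) \<partial>std_seq)"
      by (rule nn_integral_cmult) measurable
    then show "(\<integral>\<^sup>+y. (ennreal a * ?I z) * ennreal ((y 0)\<^sup>2) \<partial>std_seq) = ennreal a * ?I z" by (simp add: one)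
  qed
  finally show ?thesis .
qed

text \<open>The sample mean at \<open>n\<close> is the \<open>n\<close>-th Helmert coordinate, whereas stopping at block \<open>t\<close> only involves
  the first \<open>k t < N\<close> coordinates; hence the mean squared error is \<open>\<sigma>^2 E[1/N]\<close>.\<close>

lemma integral_squared_error:
  "(\<integral>x. (sample_mean (N x) x - \<mu>)\<^sup>2 \<partial>X) = (\<integral>z. \<sigma>\<^sup>2 / real (N' z) \<partial>std_seq)"
proof -
  let ?d = "\<lambda>t. final_size k \<rho> t - 1"
  have d: "k * t \<le> ?d t" "Suc (?d t) = final_size k \<rho> t" for t using final_size_ge[OF \<rho>, of k t] by auto
  have F: "ennreal ((sample_mean (N x) x - \<mu>)\<^sup>2) = ennreal (\<sigma>\<^sup>2 / real (final_size k \<rho> t) * (Z (?d t) x (?d t))\<^sup>2)"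
    if "stopped t x" for t x
  proof -
    have "sample_mean (N x) x - \<mu> = \<sigma> * Z (?d t) x (?d t) / sqrt (real (final_size k \<rho> t))"
      unfolding final_N_eq[OF that] using sample_mean_standardize[OF \<sigma>, of "?d t" x \<mu>] unfolding d(2) Z_def .
    then show ?thesis by (simp add: power_divide power_mult_distrib)
  qed
  have "(\<integral>\<^sup>+x. ennreal ((sample_mean (N x) x - \<mu>)\<^sup>2) \<partial>X)
      = (\<Sum>t. \<integral>\<^sup>+z. ennreal (\<sigma>\<^sup>2 / real (final_size k \<rho> t) * (z (?d t))\<^sup>2) * indicator {z. stops_at k h m t z} z \<partial>std_seq)"
    by (rule nn_integral_procedure[of "\<lambda>x. ennreal ((sample_mean (N x) x - \<mu>)\<^sup>2)"
        "\<lambda>t z. ennreal (\<sigma>\<^sup>2 / real (final_size k \<rho> t) * (z (?d t))\<^sup>2)" ?d, OF F d(1)]) measurable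
  also have "\<dots> = (\<Sum>t. \<integral>\<^sup>+z. ennreal (\<sigma>\<^sup>2 / real (final_size k \<rho> t)) * indicator {z. stops_at k h m t z} z \<partial>std_seq)"
    by (intro suminf_cong nn_integral_square_split d(1)) simp
  also have "\<dots> = (\<integral>\<^sup>+z. ennreal (\<sigma>\<^sup>2 / real (N' z)) \<partial>std_seq)"
    by (rule nn_integral_stops_at[of "\<lambda>t z. ennreal (\<sigma>\<^sup>2 / real (final_size k \<rho> t))", symmetric]) simp
  finally have nn: "(\<integral>\<^sup>+x. ennreal ((sample_mean (N x) x - \<mu>)\<^sup>2) \<partial>X) = (\<integral>\<^sup>+z. ennreal (\<sigma>\<^sup>2 / real (N' z)) \<partial>std_seq)" .
  have meas: "(\<lambda>x. sample_mean (N x) x) \<in> borel_measurable X"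
    by (rule measurable_compose_countable[of "\<lambda>n x. sample_mean n x"]) measurable
  have "(\<integral>x. (sample_mean (N x) x - \<mu>)\<^sup>2 \<partial>X) = enn2real (\<integral>\<^sup>+x. ennreal ((sample_mean (N x) x - \<mu>)\<^sup>2) \<partial>X)"
    using meas by (intro integral_eq_nn_integral) auto
  moreover have "(\<integral>z. \<sigma>\<^sup>2 / real (N' z) \<partial>std_seq) = enn2real (\<integral>\<^sup>+z. ennreal (\<sigma>\<^sup>2 / real (N' z)) \<partial>std_seq)"
    by (intro integral_eq_nn_integral) auto
  ultimately show ?thesis unfolding nn by simp
qed

text \<open>As A \<sigma>^2 equals c times the square of n^*, the expression A \<sigma>^2 / N + c N
  - 2 c n^* is a complete square over N.\<close>

lemma regret_eq:
  assumes int: "integrable std_seq (\<lambda>z. real (N' z))"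
  shows "regret \<mu> \<sigma> (m * k + 1) k \<rho> A c = c * (\<integral>z. (real (N' z) - n_star \<sigma> A c)\<^sup>2 / real (N' z) \<partial>std_seq)"
proof -
  let ?n = "n_star \<sigma> A c"
  have N1: "1 \<le> real (N' z)" for z using final_size_ge[OF \<rho>, of k "T z"] by simp
  have n2: "A * \<sigma>\<^sup>2 = c * ?n\<^sup>2"
    using A c by (simp add: n_star_def power_mult_distrib)
  have inv: "integrable std_seq (\<lambda>z. 1 / real (N' z))"
    by (rule std_seq.integrable_const_bound[of _ 1]) (use N1 in \<open>auto simp: divide_le_eq\<close>)
  have "(real (N' z) - ?n)\<^sup>2 / real (N' z) = ?n\<^sup>2 * (1 / real (N' z)) + real (N' z) - 2 * ?n" for z
    using N1[of z] by (simp add: power2_eq_square field_simps)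
  moreover have "(\<integral>z. a * f z + g z - b \<partial>std_seq) = a * (\<integral>z. f z \<partial>std_seq) + (\<integral>z. g z \<partial>std_seq) - b"
    if "integrable std_seq f" "integrable std_seq g" for a b :: real and f g
    using that by (simp add: std_seq.prob_space[simplified])
  ultimately have "(\<integral>z. (real (N' z) - ?n)\<^sup>2 / real (N' z) \<partial>std_seq)
      = ?n\<^sup>2 * (\<integral>z. 1 / real (N' z) \<partial>std_seq) + (\<integral>z. real (N' z) \<partial>std_seq) - 2 * ?n"
    using int inv by (simp only:)
  moreover have "(\<integral>z. \<sigma>\<^sup>2 / real (N' z) \<partial>std_seq) = \<sigma>\<^sup>2 * (\<integral>z. 1 / real (N' z) \<partial>std_seq)"
    by (subst integral_mult_right_zero[symmetric]) simp
  moreover have "A * (\<sigma>\<^sup>2 * J) + c * K - 2 * c * ?n = c * (?n\<^sup>2 * J + K - 2 * ?n)" for J K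
    unfolding mult.assoc[symmetric] n2 by (simp add: algebra_simps)
  ultimately show ?thesis
    unfolding regret_def risk_N_def risk_opt_def integral_squared_error integral_N by (simp only:)
qed

end

theorem theorem3p2:
  fixes \<mu> \<sigma> A \<rho> r :: real and k :: nat
    and m0 :: "nat \<Rightarrow> nat" and c :: "nat \<Rightarrow> real"
  assumes "\<sigma> > 0" and "A > 0" and "k \<ge> 1" and "0 < \<rho>" and "\<rho> < 1" and "r > 1"
    and "\<And>j. m0 j \<ge> 1"
    and "filterlim m0 at_top sequentially"
    and "\<And>j. c j > 0"
    and "c \<in> O(\<lambda>j. real (m0 j * k + 1) powr (- 2 * r))"
    and "(\<lambda>j. n_star \<sigma> A (c j)) \<in> O(\<lambda>j. real (m0 j * k + 1) powr r)"
    and "limsup (\<lambda>j. ereal (real (m0 j * k + 1) / n_star \<sigma> A (c j))) < ereal \<rho>"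
  shows
    "((\<lambda>j. \<integral>x. real (final_N (m0 j * k + 1) k \<rho> A (c j) x) / n_star \<sigma> A (c j)
              \<partial>normal_seq_space \<mu> \<sigma>) \<longlongrightarrow> 1) sequentially
   \<and> (\<exists>e1 e2 :: nat \<Rightarrow> real. (e1 \<longlongrightarrow> 0) sequentially \<and> (e2 \<longlongrightarrow> 0) sequentially \<and>
        (\<forall>j. eta1 k / \<rho> + e1 j
               \<le> (\<integral>x. real (final_N (m0 j * k + 1) k \<rho> A (c j) x) - n_star \<sigma> A (c j)
                     \<partial>normal_seq_space \<mu> \<sigma>)
           \<and> (\<integral>x. real (final_N (m0 j * k + 1) k \<rho> A (c j) x) - n_star \<sigma> A (c j)
                     \<partial>normal_seq_space \<mu> \<sigma>)
               \<le> eta1 k / \<rho> + 1 + e2 j))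
   \<and> ((\<lambda>j. risk_eff \<mu> \<sigma> (m0 j * k + 1) k \<rho> A (c j)) \<longlongrightarrow> 1) sequentially
   \<and> (\<lambda>j. regret \<mu> \<sigma> (m0 j * k + 1) k \<rho> A (c j) - c j / (2 * \<rho>)) \<in> o(c)"
proof -
  define x where "x j = real (m0 j * k + 1)" for j
  define n where "n j = n_star \<sigma> A (c j)" for j
  have x1: "1 \<le> x j" for j by (simp add: x_def)
  have n0: "0 < n j" for j using assms(1,2) assms(9)[of j] by (simp add: n_def n_star_def)
  have m0_top: "filterlim (\<lambda>j. real (m0 j)) at_top sequentially"
    by (rule filterlim_compose[OF filterlim_real_sequentially assms(8)])
  have m_le_x: "real (m0 j) \<le> x j" for j
    using mult_left_mono[of 1 "real k" "real (m0 j)"] assms(3) by (simp add: x_def)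
  have x_top: "filterlim x at_top sequentially"
    by (rule filterlim_at_top_mono[OF m0_top]) (simp add: m_le_x)
  obtain C where C: "0 < C" "\<forall>\<^sub>F j in sequentially. norm (c j) \<le> C * norm (x j powr (- 2 * r))"
    using assms(10) unfolding x_def by (elim landau_o.bigE) auto
  \<comment> \<open>From c = O(x^(-2r)) it follows that n^* is at least of order x^r, so the pilot
    fraction x / n^* is O(x^(1 - r)), and r > 1 makes it vanish.\<close>
  have "(\<lambda>j. sqrt C / (\<sigma> * sqrt A) * x j powr (1 - r)) \<longlonglongrightarrow> sqrt C / (\<sigma> * sqrt A) * 0"
    using assms(6) x_top by (intro tendsto_mult tendsto_const tendsto_neg_powr) auto
  then have z: "(\<lambda>j. sqrt C / (\<sigma> * sqrt A) * x j powr (1 - r)) \<longlonglongrightarrow> 0" by simp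
  have "\<forall>\<^sub>F j in sequentially. x j / n j \<le> sqrt C / (\<sigma> * sqrt A) * x j powr (1 - r)"
    using C(2)
  proof eventually_elim
    case (elim j)
    have "x j powr (- 2 * r) = (x j powr - r)\<^sup>2" using powr_add[of "x j" "- r" "- r"] by (simp add: power2_eq_square)
    then have "c j \<le> C * (x j powr - r)\<^sup>2" using elim assms(9)[of j] by simp
    then have "sqrt (c j) \<le> sqrt C * x j powr - r"
      using real_sqrt_le_mono[of "c j" "C * (x j powr - r)\<^sup>2"] by (simp add: real_sqrt_mult)
    then have "x j * sqrt (c j) / (\<sigma> * sqrt A) \<le> x j * (sqrt C * x j powr - r) / (\<sigma> * sqrt A)"
      using x1[of j] assms(1,2) by (intro divide_right_mono mult_left_mono) auto
    moreover have "x j / n j = x j * sqrt (c j) / (\<sigma> * sqrt A)" by (simp add: n_def n_star_def real_sqrt_divide)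
    moreover have "x j * x j powr - r = x j powr (1 - r)"
      using powr_add[of "x j" 1 "- r"] x1[of j] by simp
    ultimately show ?case by (simp add: mult_ac)
  qed
  then have xn: "(\<lambda>j. x j / n j) \<longlonglongrightarrow> 0"
    by (rule tendsto_sandwich[OF _ _ tendsto_const z, rotated])
       (use divide_nonneg_pos[OF order_trans[OF zero_le_one x1] n0] in simp)
  have "(\<lambda>j. inverse (n j)) \<longlonglongrightarrow> 0"
  proof (rule tendsto_sandwich[OF _ _ tendsto_const xn])
    have "inverse (n j) \<le> x j / n j" for j
      using divide_right_mono[OF x1[of j] less_imp_le[OF n0[of j]]] by (simp add: inverse_eq_divide)
    then show "\<forall>\<^sub>F j in sequentially. inverse (n j) \<le> x j / n j" by simp
    show "\<forall>\<^sub>F j in sequentially. 0 \<le> inverse (n j)" using n0 by (simp add: less_imp_le)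
  qed
  then have "filterlim (\<lambda>j. inverse (inverse (n j))) at_top sequentially"
    by (rule filterlim_inverse_at_top) (simp add: n0)
  then have n_top: "filterlim n at_top sequentially" by simp
  obtain K where K: "0 < K" "\<forall>\<^sub>F j in sequentially. norm (n j) \<le> K * norm (x j powr r)"
    using assms(11) unfolding x_def n_def by (elim landau_o.bigE) auto
  \<comment> \<open>An integer exponent at least r, since \<open>regime\<close> bounds
    \<open>h\<close> by a natural power of the pilot size.\<close>
  define p where "p = nat \<lceil>r\<rceil>"
  obtain D dens where dens: "chi_density D dens" by (rule chi_density_exists)
  \<comment> \<open>The factor (k + 1)^p passes from the pilot sample size m0 k + 1 to the number m0
    of pilot blocks.\<close>
  interpret regime_final k p "K * (real k + 1) ^ p" "\<lambda>j. \<rho> * n j" m0 D dens \<rho>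
  proof (intro regime_final.intro overshoot_regime.intro regime.intro dens regime_final_axioms.intro assms(3,4,5,7))
    show "0 < \<rho> * n j" for j using n0 assms(4) by simp
    show "filterlim m0 at_top sequentially" by (rule assms(8))
    show "filterlim (\<lambda>j. \<rho> * n j) at_top sequentially"
      by (rule filterlim_tendsto_pos_mult_at_top[OF tendsto_const assms(4) n_top])
    show "(\<lambda>j. real (m0 j) / (\<rho> * n j)) \<longlonglongrightarrow> 0"
    proof (rule tendsto_sandwich[OF _ _ tendsto_const])
      show "(\<lambda>j. 1 / \<rho> * (x j / n j)) \<longlonglongrightarrow> 0" using tendsto_mult_right_zero[OF xn] .
      have "real (m0 j) / (\<rho> * n j) \<le> x j / (\<rho> * n j)" for j
        using m_le_x[of j] n0[of j] assms(4) by (intro divide_right_mono) auto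
      then show "\<forall>\<^sub>F j in sequentially. real (m0 j) / (\<rho> * n j) \<le> 1 / \<rho> * (x j / n j)" by simp
      show "\<forall>\<^sub>F j in sequentially. 0 \<le> real (m0 j) / (\<rho> * n j)"
        using n0 assms(4) by (simp add: less_imp_le)
    qed
    show "\<forall>\<^sub>F j in sequentially. \<rho> * n j \<le> K * (real k + 1) ^ p * real (m0 j) ^ p"
      using K(2)
    proof eventually_elim
      case (elim j)
      have "\<rho> * n j \<le> 1 * n j" using assms(5) n0[of j] by (intro mult_right_mono) auto
      also have "\<dots> \<le> K * x j powr r" using elim n0[of j] by simp
      also have "\<dots> \<le> K * x j powr real p"
        using x1[of j] K(1) unfolding p_def by (intro mult_left_mono powr_mono) (auto intro: real_nat_ceiling_ge)
      also have "\<dots> = K * x j ^ p" using x1[of j] by (simp add: powr_realpow)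
      also have "\<dots> \<le> K * ((real k + 1) * real (m0 j)) ^ p"
        using x1[of j] K(1) assms(7)[of j] by (intro mult_left_mono power_mono) (auto simp: x_def algebra_simps)
      finally show ?case by (simp add: power_mult_distrib)
    qed
  qed
  have proc: "sequential_procedure \<sigma> A (c j) \<rho> k (m0 j)" for j
    by unfold_locales (rule assms)+
  have hn: "\<rho> * n j / \<rho> = n j" for j using assms(4) by simp
  let ?X = "normal_seq_space \<mu> \<sigma>"
  let ?N = "\<lambda>j x. final_N (m0 j * k + 1) k \<rho> A (c j) x"
  have int: "(\<integral>x. f (?N j x) \<partial>?X) = (\<integral>z. f (final_size k \<rho> (st.T j z)) \<partial>std_seq)" for f :: "nat \<Rightarrow> real" and j
    unfolding n_def by (rule sequential_procedure.integral_N[OF proc])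
  define E where "E j = (\<integral>x. real (?N j x) - n j \<partial>?X)" for j
  define a where "a j = (\<integral>x. delta j x \<partial>std_seq) / \<rho> - eta1 k / \<rho>" for j
  have a: "a \<longlonglongrightarrow> 0"
    unfolding a_def[abs_def] using tendsto_diff[OF tendsto_divide[OF eta1_limit tendsto_const[of \<rho>]] tendsto_const[of "eta1 k / \<rho>"]] assms(4) by simp
  have mean: "\<forall>\<^sub>F j in sequentially. a j \<le> E j - eta1 k / \<rho> \<and> E j - eta1 k / \<rho> - 1 \<le> a j"
    using N_mean_bounds
  proof eventually_elim
    case (elim j)
    have "E j = (\<integral>x. N j x - \<rho> * n j / \<rho> \<partial>std_seq)" unfolding E_def hn by (rule int)
    then show ?case using elim unfolding a_def by linarith
  qed
  define L where "L j = (\<integral>x. loss j x \<partial>std_seq)" for j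
  have L: "L \<longlonglongrightarrow> 1 / (2 * \<rho>)" unfolding L_def[abs_def] by (rule loss_limit)
  have reg: "\<forall>\<^sub>F j in sequentially. regret \<mu> \<sigma> (m0 j * k + 1) k \<rho> A (c j) = c j * L j"
    using good_eventually
  proof eventually_elim
    case (elim j)
    show ?case
      unfolding L_def loss_def[abs_def] hn
      unfolding n_def by (rule sequential_procedure.regret_eq[OF proc good_N[OF elim, unfolded n_def]])
  qed
  have "(\<lambda>j. \<integral>x. real (?N j x) / n j \<partial>?X) \<longlonglongrightarrow> 1"
    using N_ratio_limit unfolding hn int[of "\<lambda>N. real N / n _"] .
  moreover have "\<exists>e1 e2 :: nat \<Rightarrow> real. e1 \<longlonglongrightarrow> 0 \<and> e2 \<longlonglongrightarrow> 0 \<and>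
      (\<forall>j. eta1 k / \<rho> + e1 j \<le> E j \<and> E j \<le> eta1 k / \<rho> + 1 + e2 j)"
  proof (intro exI conjI allI)
    \<comment> \<open>The mean bounds hold for large \<open>j\<close> only, whereas the error
      sequences must serve every \<open>j\<close>. Taking the minimum and the maximum makes the
      inequalities true everywhere, and both sequences eventually coincide with
      \<open>a\<close>.\<close>
    let ?e1 = "\<lambda>j. min (a j) (E j - eta1 k / \<rho>)" and ?e2 = "\<lambda>j. max (a j) (E j - eta1 k / \<rho> - 1)"
    show "?e1 \<longlonglongrightarrow> 0"
      by (rule Lim_transform_eventually[OF a]) (use mean in eventually_elim, auto simp: min_def)
    show "?e2 \<longlonglongrightarrow> 0"
      by (rule Lim_transform_eventually[OF a]) (use mean in eventually_elim, auto simp: max_def)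
    show "eta1 k / \<rho> + ?e1 j \<le> E j" "E j \<le> eta1 k / \<rho> + 1 + ?e2 j" for j by linarith+
  qed
  moreover have "(\<lambda>j. risk_eff \<mu> \<sigma> (m0 j * k + 1) k \<rho> A (c j)) \<longlonglongrightarrow> 1"
  proof (rule Lim_transform_eventually)
    have "(\<lambda>j. 1 + L j * inverse (n j) / 2) \<longlonglongrightarrow> 1 + 1 / (2 * \<rho>) * 0 / 2"
      by (intro tendsto_intros L \<open>(\<lambda>j. inverse (n j)) \<longlonglongrightarrow> 0\<close>) simp
    then show "(\<lambda>j. 1 + L j * inverse (n j) / 2) \<longlonglongrightarrow> 1" by simp
    show "\<forall>\<^sub>F j in sequentially. 1 + L j * inverse (n j) / 2 = risk_eff \<mu> \<sigma> (m0 j * k + 1) k \<rho> A (c j)"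
      using reg
    proof eventually_elim
      case (elim j)
      have "risk_N \<mu> \<sigma> (m0 j * k + 1) k \<rho> A (c j) = 2 * c j * n j + c j * L j"
        using elim unfolding regret_def risk_opt_def n_def by simp
      then show ?case unfolding risk_eff_def risk_opt_def n_def[symmetric]
        using n0[of j] assms(9)[of j] by (simp add: field_simps)
    qed
  qed
  moreover have "(\<lambda>j. regret \<mu> \<sigma> (m0 j * k + 1) k \<rho> A (c j) - c j / (2 * \<rho>)) \<in> o(c)"
  proof (rule smalloI_tendsto)
    have "(\<lambda>j. L j - 1 / (2 * \<rho>)) \<longlonglongrightarrow> 0"
      using tendsto_diff[OF L tendsto_const[of "1 / (2 * \<rho>)"]] by simp
    then show "(\<lambda>j. (regret \<mu> \<sigma> (m0 j * k + 1) k \<rho> A (c j) - c j / (2 * \<rho>)) / c j) \<longlonglongrightarrow> 0"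
    proof (rule Lim_transform_eventually)
      show "\<forall>\<^sub>F j in sequentially. L j - 1 / (2 * \<rho>) = (regret \<mu> \<sigma> (m0 j * k + 1) k \<rho> A (c j) - c j / (2 * \<rho>)) / c j"
        using reg
      proof eventually_elim
        case (elim j)
        then show ?case using assms(9)[of j] by (simp add: diff_divide_distrib)
      qed
    qed
    show "\<forall>\<^sub>F j in sequentially. c j \<noteq> 0" using assms(9) by (simp add: less_imp_neq[symmetric])
  qed
  ultimately show ?thesis unfolding n_def E_def by blast
qed

end
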